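(* Let $(\sigma^k:E^k\to M,\kappa^k)$ be an almost Lie higher algebroid of order $k$ and let $(A,\kappa)$, $A=E^1$, $\kappa=\kappa^1$, be its order-one reduction. Let $\Theta^k\subset A^{[k]}\times E^k$ be the canonical relation defined in the context. Then (a) $\Theta^k$ is (the graph of) a morphism of graded bundles of order $k$, $\Theta^k:A^{[k]}\to E^k$; (b) $\Theta^k$ intertwines the anchor morphisms: $\sharp^k\circ\Theta^k=\sharp^{[k]}$.
   Context: **Graded bundles.** A graded bundle of order $k$ is a smooth fibre bundle $\sigma^k:E^k\to M$ with an atlas of coordinates $(x^a,y^i_w)$, where $x^a$ (weight $0$) are coordinates on $M$ and each fibre coordinate $y^i_w$ (ranging over $\mathbb R$) has a weight $w\in\{1,\dots,k\}$, such that fibre coordinates of weight $w$ transform by polynomials homogeneous of weight $w$ in the fibre coordinates with coefficients smooth on $M$. The weight vector field is $\Delta=\sum w\,y^i_w\partial_{y^i_w}$; it corresponds to the action $h_t$ ($t\in\mathbb R$) multiplying $y^i_w$ by $t^w$. Morphisms are smooth maps commuting with $h_t$. Removing coordinates of weight $>j$ gives the order-$j$ reduction $E^j$ and a projection $E^k\to E^j$; $E^0=M$, and $\sigma^1:E^1\to M$ is a vector bundle. **Higher tangent bundles and comorphisms.** $[\gamma]_k\in\mathrm T^kM$ is the $k$-th order tangency class at $0$ of a curve $\gamma$; $\mathrm T^kM$ is a graded bundle of order $k$, $h_s[\gamma]_k=[t\mapsto\gamma(st)]_k$. For a vector bundle $\sigma:E\to M$, $\mathrm T^k\sigma:\mathrm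 T^kE\to\mathrm T^kM$ is a vector bundle and $\mathrm T^kE$ is a graded bundle over $E$; $\mathrm TE^k$ is a vector bundle $\tau_{E^k}$ over $E^k$ and a graded bundle with action $\mathrm Th_t$. $\kappa^k_M:\mathrm T^k\mathrm TM\to\mathrm T\mathrm T^kM$ is the canonical flip, $[t\mapsto[s\mapsto\gamma(s,t)]_1]_k\mapsto[s\mapsto[t\mapsto\gamma(s,t)]_k]_1$. A VB comorphism from $\sigma_1:E_1\to M_1$ to $\sigma_2:E_2\to M_2$ covering $\underline r:M_2\to M_1$ is a relation $r\subset E_1\times E_2$ that is the union of graphs of linear maps $r_y:(E_1)_{\underline r(y)}\to(E_2)_y$, $y\in M_2$, depending smoothly on $y$. **Higher algebroids.** A higher algebroid (HA) of order $k$ is a graded bundle $E^k$ of order $k$ with a VB comorphism $\kappa^k\subset\mathrm T^kE^1\times\mathrm TE^k$ from $\mathrm T^k\sigma^1$ to $\tau_{E^k}$ that is a graded subbundle of the product, covering a graded bundle morphism $\sharp^k:E^k\to\mathrm T^kM$ over $\mathrm{id}_M$ (the anchor), whose order-one reduction $\kappa^1\subset\mathrm TE^1\times\mathrm TE^1$ is an algebroid structure on $E^1$ (it is the identity between the cores $\cong E^1$). It is skew if $\kappa^1$ is a symmetric relation (equivalently $\kappa^1$ encodes a skew algebroid on $A=E^1$, with anchor $\sharp=\sharp^1:A\to\mathrm TM$). It is almost Lie if it is skew and $(\kappa^k_M\circ\mathrm T^k\sharp)(X)=\mathrm T\sharp^k(Y)$ for all $(X,Y)\in\kappa^k$. **Prolongations.**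 Let $\sigma:A\to M$ be a vector bundle with anchor $\sharp:A\to\mathrm TM$. A curve $a$ in $A$ is admissible if $\frac{d}{dt}(\sigma\circ a)=\sharp\circ a$. $A^{[k]}=\{[a]_{k-1}: a\text{ admissible}\}\subset\mathrm T^{k-1}A$ is a graded bundle of order $k$ over $M$ with coordinates $(x^a,y^{i,(\alpha)})_{0\le\alpha\le k-1}$, $y^{i,(\alpha)}$ (the $\alpha$-th derivative of the linear coordinate $y^i$) of weight $\alpha+1$. The anchor $\sharp^{[k]}:A^{[k]}\to\mathrm T^kM$ is $[a]_{k-1}\mapsto[\sigma\circ a]_k$ for admissible $a$ (it is the restriction of $\mathrm T^{k-1}\sharp$, where $\mathrm T^kM\subset\mathrm T^{k-1}\mathrm TM$ canonically). **The relation $\Theta^k$.** For $U\in A^{[k]}$ and $V\in E^k$ one has $(U,V)\in\Theta^k$ iff $\mathrm T^{k-1}\sigma(U)$ equals the image of $\sharp^k(V)$ in $\mathrm T^{k-1}M$ and $\kappa^k_V(\widetilde U)=\Delta(V)$, where $\widetilde U=[t\mapsto t\,b(t)]_k\in\mathrm T^kA$ for any curve $b$ in $A$ with $[b]_{k-1}=U$ and $[\sigma\circ b]_k=\sharp^k(V)$, and $\kappa^k_V:(\mathrm T^kA)_{\sharp^k(V)}\to\mathrm T_VE^k$ is the linear map defined by $\kappa^k$. (This is the unwound form of the paper's definition of $\Theta^k$ as the intersection of $A^{[k]}\times E^k$ with the relation $\Lambda(\kappa^k)\subset\mathrm T^{k-1}A\times\ell(E^k)$, obtained from $\kappa^k$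 by setting to zero coordinates of bi-weight $(0,1)$ and removing those of bi-weight $(k,0)$, where $E^k$ embeds in its linearisation $\ell(E^k)$ by the weight vector field.) *)

theory Defs
  imports "HOL-Analysis.Analysis"
begin

section \<open>Smooth manifolds\<close>

text \<open>
  Coordinate spaces are the spaces of real families over a finite index set \<open>I\<close> (extensional
  functions) with the product topology. Index sets are ordinary sets, so that dimension and rank 0
  are allowed and the coordinates of jet bundles of variable order can be indexed by pairs.
\<close>

abbreviation Rn :: "'i set \<Rightarrow> ('i \<Rightarrow> real) topology" where
  "Rn I \<equiv> product_topology (\<lambda>_. euclideanreal) I"

definition pdiff :: "'i \<Rightarrow> (('i \<Rightarrow> real) \<Rightarrow> real) \<Rightarrow> ('i \<Rightarrow> real) \<Rightarrow> real" where
  "pdiff i f x = deriv (\<lambda>t. f (x(i := t))) (x i)"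

primrec pdiffs :: "'i list \<Rightarrow> (('i \<Rightarrow> real) \<Rightarrow> real) \<Rightarrow> ('i \<Rightarrow> real) \<Rightarrow> real" where
  "pdiffs [] f = f"
| "pdiffs (i # is) f = pdiff i (pdiffs is f)"

text \<open>To be used for open \<open>S\<close>: all iterated partial derivatives exist and are continuous on \<open>S\<close>.\<close>

definition smooth_on :: "'i set \<Rightarrow> ('i \<Rightarrow> real) set \<Rightarrow> (('i \<Rightarrow> real) \<Rightarrow> real) \<Rightarrow> bool" where
  "smooth_on I S f \<longleftrightarrow>
     (\<forall>is \<in> lists I.
        continuous_map (subtopology (Rn I) S) euclideanreal (pdiffs is f) \<and>
        (\<forall>x\<in>S. \<forall>i\<in>I. (\<lambda>t. pdiffs is f (x(i := t))) differentiable (at (x i))))"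

text \<open>A manifold is given by an atlas; a chart is a pair of its domain and its coordinate map.\<close>

type_synonym ('m, 'i) chart = "'m set \<times> ('m \<Rightarrow> 'i \<Rightarrow> real)"

record ('m, 'i) mfd =
  idx :: "'i set"
  atlas :: "('m, 'i) chart set"

definition pts :: "('m, 'i) mfd \<Rightarrow> 'm set" where
  "pts M = \<Union> (fst ` atlas M)"

definition mtop :: "('m, 'i) mfd \<Rightarrow> 'm topology" where
  "mtop M = topology (\<lambda>W. W \<subseteq> pts M \<and>
     (\<forall>(U, \<phi>) \<in> atlas M. openin (Rn (idx M)) (\<phi> ` (W \<inter> U))))"

definition is_chart :: "'i set \<Rightarrow> ('m, 'i) chart \<Rightarrow> bool" where
  "is_chart I = (\<lambda>(U, \<phi>). inj_on \<phi> U \<and> openin (Rn I) (\<phi> ` U))"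

definition smooth_transition :: "'i set \<Rightarrow> ('m, 'i) chart \<Rightarrow> ('m, 'i) chart \<Rightarrow> bool" where
  "smooth_transition I = (\<lambda>(U, \<phi>) (V, \<psi>).
     openin (Rn I) (\<phi> ` (U \<inter> V)) \<and>
     (\<forall>j\<in>I. smooth_on I (\<phi> ` (U \<inter> V)) (\<lambda>x. \<psi> (inv_into U \<phi> x) j)))"

definition manifold :: "('m, 'i) mfd \<Rightarrow> bool" where
  "manifold M \<longleftrightarrow>
     finite (idx M) \<and>
     (\<forall>c \<in> atlas M. is_chart (idx M) c) \<and>
     (\<forall>c \<in> atlas M. \<forall>c' \<in> atlas M. smooth_transition (idx M) c c') \<and>
     Hausdorff_space (mtop M) \<and> second_countable (mtop M)"

text \<open>Membership in the maximal atlas.\<close>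

definition smooth_chart :: "('m, 'i) mfd \<Rightarrow> ('m, 'i) chart \<Rightarrow> bool" where
  "smooth_chart M c \<longleftrightarrow> fst c \<subseteq> pts M \<and> is_chart (idx M) c \<and>
     (\<forall>c' \<in> atlas M. smooth_transition (idx M) c c' \<and> smooth_transition (idx M) c' c)"

text \<open>The openness condition expresses continuity.\<close>

definition smooth_map :: "('m, 'i) mfd \<Rightarrow> ('n, 'j) mfd \<Rightarrow> ('m \<Rightarrow> 'n) \<Rightarrow> bool" where
  "smooth_map M N f \<longleftrightarrow>
     f ` pts M \<subseteq> pts N \<and>
     (\<forall>(U, \<phi>) \<in> atlas M. \<forall>(V, \<psi>) \<in> atlas N.
        openin (Rn (idx M)) (\<phi> ` (U \<inter> f -` V)) \<and>
        (\<forall>j \<in> idx N. smooth_on (idx M) (\<phi> ` (U \<inter> f -` V)) (\<lambda>x. \<psi> (f (inv_into U \<phi> x)) j)))"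

definition smooth_fun :: "('m, 'i) mfd \<Rightarrow> 'm set \<Rightarrow> ('m \<Rightarrow> real) \<Rightarrow> bool" where
  "smooth_fun M W c \<longleftrightarrow>
     W \<subseteq> pts M \<and>
     (\<forall>(U, \<phi>) \<in> atlas M.
        openin (Rn (idx M)) (\<phi> ` (U \<inter> W)) \<and>
        smooth_on (idx M) (\<phi> ` (U \<inter> W)) (\<lambda>x. c (inv_into U \<phi> x)))"

definition open_mfd :: "'i set \<Rightarrow> ('i \<Rightarrow> real) set \<Rightarrow> ('i \<Rightarrow> real, 'i) mfd" where
  "open_mfd I S = \<lparr>idx = I, atlas = {(S, id)}\<rparr>"

definition prod_mfd :: "('m, 'i) mfd \<Rightarrow> ('n, 'j) mfd \<Rightarrow> ('m \<times> 'n, 'i + 'j) mfd" where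
  "prod_mfd M N = \<lparr>idx = idx M <+> idx N,
     atlas = {(U \<times> V, \<lambda>(p, q). \<lambda>l \<in> idx M <+> idx N. case l of Inl i \<Rightarrow> \<phi> p i | Inr j \<Rightarrow> \<psi> q j) |
                U \<phi> V \<psi>. (U, \<phi>) \<in> atlas M \<and> (V, \<psi>) \<in> atlas N}\<rparr>"

text \<open>Embedded submanifolds, by slice charts; \<open>K\<close> indexes the coordinates along the submanifold.\<close>

definition embedded_submanifold :: "('m, 'i) mfd \<Rightarrow> 'm set \<Rightarrow> bool" where
  "embedded_submanifold M S \<longleftrightarrow>
     S \<subseteq> pts M \<and>
     (\<exists>K \<subseteq> idx M. \<forall>p\<in>S. \<exists>U \<phi>. smooth_chart M (U, \<phi>) \<and> p \<in> U \<and>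
        \<phi> ` (U \<inter> S) = {z \<in> \<phi> ` U. \<forall>i \<in> idx M - K. z i = 0})"


section \<open>Jets of curves\<close>

text \<open>
  Curves matter only near 0: they are total functions that are smooth on some neighbourhood of 0.
  A point of \<open>T\<^sup>kM\<close> is an equivalence class of such curves.
\<close>

definition curve :: "('m, 'i) mfd \<Rightarrow> (real \<Rightarrow> 'm) \<Rightarrow> bool" where
  "curve M \<gamma> \<longleftrightarrow>
     (\<exists>S. openin (Rn (UNIV :: unit set)) S \<and> (\<lambda>_. 0) \<in> S \<and>
          smooth_map (open_mfd UNIV S) M (\<lambda>z. \<gamma> (z ())))"

definition surface :: "('m, 'i) mfd \<Rightarrow> (real \<Rightarrow> real \<Rightarrow> 'm) \<Rightarrow> bool" where
  "surface M \<Gamma> \<longleftrightarrow>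
     (\<exists>S. openin (Rn (UNIV :: bool set)) S \<and> (\<lambda>_. 0) \<in> S \<and>
          smooth_map (open_mfd UNIV S) M (\<lambda>z. \<Gamma> (z False) (z True)))"

definition jet :: "('m, 'i) mfd \<Rightarrow> nat \<Rightarrow> (real \<Rightarrow> 'm) \<Rightarrow> (real \<Rightarrow> 'm) set" where
  "jet M k \<gamma> = {\<delta>. curve M \<delta> \<and> \<delta> 0 = \<gamma> 0 \<and>
     (\<forall>(U, \<phi>) \<in> atlas M. \<gamma> 0 \<in> U \<longrightarrow>
        (\<forall>i \<in> idx M. \<forall>\<alpha>\<le>k.
           (deriv ^^ \<alpha>) (\<lambda>t. \<phi> (\<delta> t) i) 0 = (deriv ^^ \<alpha>) (\<lambda>t. \<phi> (\<gamma> t) i) 0))}"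

definition jets :: "('m, 'i) mfd \<Rightarrow> nat \<Rightarrow> (real \<Rightarrow> 'm) set set" where
  "jets M k = {jet M k \<gamma> | \<gamma>. curve M \<gamma>}"

definition rep :: "'a set \<Rightarrow> 'a" where
  "rep X = (SOME x. x \<in> X)"

definition base_pt :: "(real \<Rightarrow> 'm) set \<Rightarrow> 'm" where
  "base_pt X = rep X 0"

definition jet_coords ::
  "nat \<Rightarrow> 'i set \<Rightarrow> ('m \<Rightarrow> 'i \<Rightarrow> real) \<Rightarrow> (real \<Rightarrow> 'm) set \<Rightarrow> nat \<times> 'i \<Rightarrow> real" where
  "jet_coords k I \<phi> X =
     (\<lambda>(\<alpha>, i) \<in> {..k} \<times> I. (deriv ^^ \<alpha>) (\<lambda>t. \<phi> (rep X t) i) 0)"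

text \<open>\<open>T\<^sup>kM\<close> as a manifold; \<open>TM\<close> is the case \<open>k = 1\<close>.\<close>

definition Tk :: "nat \<Rightarrow> ('m, 'i) mfd \<Rightarrow> ((real \<Rightarrow> 'm) set, nat \<times> 'i) mfd" where
  "Tk k M = \<lparr>idx = {..k} \<times> idx M,
     atlas = (\<lambda>(U, \<phi>). ({X \<in> jets M k. base_pt X \<in> U}, jet_coords k (idx M) \<phi>)) ` atlas M\<rparr>"

text \<open>\<open>T\<^sup>kf\<close> for a smooth map \<open>f\<close> into \<open>N\<close>.\<close>

definition Tk_map ::
  "('n, 'j) mfd \<Rightarrow> nat \<Rightarrow> ('m \<Rightarrow> 'n) \<Rightarrow> (real \<Rightarrow> 'm) set \<Rightarrow> (real \<Rightarrow> 'n) set" where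
  "Tk_map N k f X = jet N k (f \<circ> rep X)"

definition jet_trunc :: "('m, 'i) mfd \<Rightarrow> nat \<Rightarrow> (real \<Rightarrow> 'm) set \<Rightarrow> (real \<Rightarrow> 'm) set" where
  "jet_trunc M j X = jet M j (rep X)"

definition jet_act :: "('m, 'i) mfd \<Rightarrow> nat \<Rightarrow> real \<Rightarrow> (real \<Rightarrow> 'm) set \<Rightarrow> (real \<Rightarrow> 'm) set" where
  "jet_act M k s X = jet M k (\<lambda>t. rep X (s * t))"

text \<open>The graph of the canonical flip \<open>T\<^sup>kTM \<rightarrow> TT\<^sup>kM\<close>.\<close>

definition flip_graph ::
  "nat \<Rightarrow> ('m, 'i) mfd \<Rightarrow> ((real \<Rightarrow> (real \<Rightarrow> 'm) set) set \<times> (real \<Rightarrow> (real \<Rightarrow> 'm) set) set) set" where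
  "flip_graph k M =
     {(jet (Tk 1 M) k (\<lambda>t. jet M 1 (\<lambda>s. \<Gamma> s t)), jet (Tk k M) 1 (\<lambda>s. jet M k (\<lambda>t. \<Gamma> s t))) |
        \<Gamma>. surface M \<Gamma>}"


section \<open>Graded bundles\<close>

text \<open>
  The base coordinates are exactly the coordinates of weight 0, so base and total space share the
  index type.
\<close>

record ('e, 'm, 'i) gbundle =
  tot :: "('e, 'i) mfd"
  base :: "('m, 'i) mfd"
  proj :: "'e \<Rightarrow> 'm"
  wt :: "'i \<Rightarrow> nat"

definition fib_idx :: "('e, 'm, 'i) gbundle \<Rightarrow> 'i set" where
  "fib_idx E = {i \<in> idx (tot E). 0 < wt E i}"

text \<open>Exponents of the monomials of weight \<open>w\<close> in the fibre coordinates.\<close>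

definition monomials :: "('e, 'm, 'i) gbundle \<Rightarrow> nat \<Rightarrow> ('i \<Rightarrow> nat) set" where
  "monomials E w = {m \<in> fib_idx E \<rightarrow>\<^sub>E UNIV. (\<Sum>i\<in>fib_idx E. m i * wt E i) = w}"

definition graded_bundle :: "nat \<Rightarrow> ('e, 'm, 'i) gbundle \<Rightarrow> bool" where
  "graded_bundle k E \<longleftrightarrow>
     manifold (tot E) \<and> manifold (base E) \<and>
     (\<forall>i \<in> idx (tot E). wt E i \<le> k) \<and>
     idx (base E) = {i \<in> idx (tot E). wt E i = 0} \<and>
     proj E ` pts (tot E) = pts (base E) \<and>
     (\<forall>(W, \<psi>) \<in> atlas (tot E). \<exists>U \<phi>. smooth_chart (base E) (U, \<phi>) \<and>
        W = {e \<in> pts (tot E). proj E e \<in> U} \<and>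
        (\<forall>e\<in>W. restrict (\<psi> e) (idx (base E)) = \<phi> (proj E e)) \<and>
        \<psi> ` W = {z \<in> topspace (Rn (idx (tot E))). restrict z (idx (base E)) \<in> \<phi> ` U}) \<and>
     (\<forall>(W, \<psi>) \<in> atlas (tot E). \<forall>(W', \<psi>') \<in> atlas (tot E). \<forall>j \<in> fib_idx E. \<exists>c.
        (\<forall>m \<in> monomials E (wt E j). smooth_fun (base E) (proj E ` (W \<inter> W')) (c m)) \<and>
        (\<forall>e \<in> W \<inter> W'. \<psi>' e j =
           (\<Sum>m \<in> monomials E (wt E j). c m (proj E e) * (\<Prod>i \<in> fib_idx E. \<psi> e i ^ m i))))"

text \<open>The homotheties and the weight vector field determined by weights \<open>w\<close> of the coordinates.\<close>

definition act :: "('e, 'i) mfd \<Rightarrow> ('i \<Rightarrow> nat) \<Rightarrow> real \<Rightarrow> 'e \<Rightarrow> 'e" where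
  "act M w t e = (THE e'. e' \<in> pts M \<and>
     (\<forall>(W, \<psi>) \<in> atlas M. e \<in> W \<longrightarrow> e' \<in> W \<and> (\<forall>i \<in> idx M. \<psi> e' i = t ^ w i * \<psi> e i)))"

definition weight_field :: "('e, 'i) mfd \<Rightarrow> ('i \<Rightarrow> nat) \<Rightarrow> 'e \<Rightarrow> (real \<Rightarrow> 'e) set" where
  "weight_field M w e = (THE Y. Y \<in> jets M 1 \<and> base_pt Y = e \<and>
     (\<forall>(W, \<psi>) \<in> atlas M. e \<in> W \<longrightarrow>
        (\<forall>i \<in> idx M. jet_coords 1 (idx M) \<psi> Y (1, i) = real (w i) * \<psi> e i)))"

abbreviation gact :: "('e, 'm, 'i) gbundle \<Rightarrow> real \<Rightarrow> 'e \<Rightarrow> 'e" where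
  "gact E \<equiv> act (tot E) (wt E)"

text \<open>Morphisms and subbundles refer to the total spaces and the homotheties only.\<close>

definition graded_morphism ::
  "('e, 'i) mfd \<Rightarrow> (real \<Rightarrow> 'e \<Rightarrow> 'e) \<Rightarrow> ('f, 'j) mfd \<Rightarrow> (real \<Rightarrow> 'f \<Rightarrow> 'f) \<Rightarrow> ('e \<Rightarrow> 'f) \<Rightarrow> bool" where
  "graded_morphism M h N g f \<longleftrightarrow>
     smooth_map M N f \<and> (\<forall>t. \<forall>e \<in> pts M. f (h t e) = g t (f e))"

definition graded_subbundle ::
  "('e, 'i) mfd \<Rightarrow> (real \<Rightarrow> 'e \<Rightarrow> 'e) \<Rightarrow> 'e set \<Rightarrow> bool" where
  "graded_subbundle M h S \<longleftrightarrow> embedded_submanifold M S \<and> (\<forall>t. \<forall>e\<in>S. h t e \<in> S)"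

text \<open>
  The reduction \<open>E\<^sup>j\<close>: its points are the classes of points of \<open>E\<^sup>k\<close> that share all
  coordinates of weight at most \<open>j\<close>; \<open>red E j\<close> is the projection \<open>E\<^sup>k \<rightarrow> E\<^sup>j\<close>.
\<close>

definition red :: "('e, 'm, 'i) gbundle \<Rightarrow> nat \<Rightarrow> 'e \<Rightarrow> 'e set" where
  "red E j e = {e' \<in> pts (tot E). proj E e' = proj E e \<and>
     (\<forall>(W, \<psi>) \<in> atlas (tot E). e \<in> W \<longrightarrow> (\<forall>i \<in> idx (tot E). wt E i \<le> j \<longrightarrow> \<psi> e' i = \<psi> e i))}"

definition reduction :: "nat \<Rightarrow> ('e, 'm, 'i) gbundle \<Rightarrow> ('e set, 'm, 'i) gbundle" where
  "reduction j E =
     \<lparr>tot = \<lparr>idx = {i \<in> idx (tot E). wt E i \<le> j},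
              atlas = (\<lambda>(W, \<psi>). (red E j ` W,
                 \<lambda>C. restrict (\<psi> (rep C)) {i \<in> idx (tot E). wt E i \<le> j})) ` atlas (tot E)\<rparr>,
      base = base E, proj = (\<lambda>C. proj E (rep C)), wt = wt E\<rparr>"


section \<open>Vector bundles and comorphisms\<close>

text \<open>
  The charts of the total space are linear bundle charts and \<open>vfib\<close> indexes their linear
  coordinates.
\<close>

record ('e, 'i, 'm, 'j) vbundle =
  vtot :: "('e, 'i) mfd"
  vbase :: "('m, 'j) mfd"
  vproj :: "'e \<Rightarrow> 'm"
  vfib :: "'i set"

text \<open>\<open>T\<^sup>k\<sigma>: T\<^sup>kA \<rightarrow> T\<^sup>kM\<close> for a graded bundle \<open>\<sigma>: A \<rightarrow> M\<close> of order 1.\<close>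

definition Tk_vb ::
  "nat \<Rightarrow> ('a, 'm, 'i) gbundle \<Rightarrow> ((real \<Rightarrow> 'a) set, nat \<times> 'i, (real \<Rightarrow> 'm) set, nat \<times> 'i) vbundle" where
  "Tk_vb k A = \<lparr>vtot = Tk k (tot A), vbase = Tk k (base A), vproj = Tk_map (base A) k (proj A),
     vfib = {..k} \<times> fib_idx A\<rparr>"

definition tangent_vb :: "('e, 'i) mfd \<Rightarrow> ((real \<Rightarrow> 'e) set, nat \<times> 'i, 'e, 'i) vbundle" where
  "tangent_vb M = \<lparr>vtot = Tk 1 M, vbase = M, vproj = base_pt, vfib = {1} \<times> idx M\<rparr>"

text \<open>
  The last condition states in linear charts that the maps \<open>r\<^sub>y\<close> are linear and depend smoothly
  on \<open>y\<close>.
\<close>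

definition vb_comorphism ::
  "('e, 'i, 'm, 'j) vbundle \<Rightarrow> ('f, 'p, 'n, 'q) vbundle \<Rightarrow> ('e \<times> 'f) set \<Rightarrow> ('n \<Rightarrow> 'm) \<Rightarrow> bool" where
  "vb_comorphism E F r \<rho> \<longleftrightarrow>
     r \<subseteq> pts (vtot E) \<times> pts (vtot F) \<and>
     smooth_map (vbase F) (vbase E) \<rho> \<and>
     (\<forall>(X, Y) \<in> r. vproj E X = \<rho> (vproj F Y)) \<and>
     (\<forall>y \<in> pts (vbase F). \<forall>X \<in> pts (vtot E). vproj E X = \<rho> y \<longrightarrow>
        (\<exists>!Y. (X, Y) \<in> r \<and> vproj F Y = y)) \<and>
     (\<forall>(W, \<psi>) \<in> atlas (vtot E). \<forall>(W', \<psi>') \<in> atlas (vtot F). \<exists>Q.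
        (\<forall>j \<in> vfib F. \<forall>i \<in> vfib E.
           smooth_fun (vbase F) (vproj F ` W' \<inter> \<rho> -` vproj E ` W) (Q j i)) \<and>
        (\<forall>(X, Y) \<in> r. X \<in> W \<longrightarrow> Y \<in> W' \<longrightarrow>
           (\<forall>j \<in> vfib F. \<psi>' Y j = (\<Sum>i \<in> vfib E. Q j i (vproj F Y) * \<psi> X i))))"


section \<open>Higher algebroids\<close>

text \<open>
  The part of the structure that is common to all orders: a comorphism from \<open>T\<^sup>kA\<close> to \<open>TE\<close>
  that is a graded subbundle, covering a morphism of graded bundles (the anchor) over the identity.
\<close>

definition graded_comorphism ::
  "nat \<Rightarrow> ('a, 'm, 'i) gbundle \<Rightarrow> ('e, 'm, 'i) gbundle \<Rightarrow>
   ((real \<Rightarrow> 'a) set \<times> (real \<Rightarrow> 'e) set) set \<Rightarrow> ('e \<Rightarrow> (real \<Rightarrow> 'm) set) \<Rightarrow> bool" where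
  "graded_comorphism k A E \<kappa> anc \<longleftrightarrow>
     vb_comorphism (Tk_vb k A) (tangent_vb (tot E)) \<kappa> anc \<and>
     graded_subbundle (prod_mfd (Tk k (tot A)) (Tk 1 (tot E)))
       (\<lambda>t (X, Y). (jet_act (tot A) k t X, Tk_map (tot E) 1 (gact E t) Y)) \<kappa> \<and>
     graded_morphism (tot E) (gact E) (Tk k (base E)) (jet_act (base E) k) anc \<and>
     (\<forall>V \<in> pts (tot E). base_pt (anc V) = proj E V)"

text \<open>The last condition is the identity between the cores.\<close>

definition algebroid ::
  "('a, 'm, 'i) gbundle \<Rightarrow> ((real \<Rightarrow> 'a) set \<times> (real \<Rightarrow> 'a) set) set \<Rightarrow>
   ('a \<Rightarrow> (real \<Rightarrow> 'm) set) \<Rightarrow> bool" where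
  "algebroid A \<kappa> anc \<longleftrightarrow>
     graded_bundle 1 A \<and> graded_comorphism 1 A A \<kappa> anc \<and>
     (\<forall>a \<in> pts (tot A).
        (jet (tot A) 1 (\<lambda>t. gact A t a), jet (tot A) 1 (\<lambda>t. gact A t a)) \<in> \<kappa>)"

text \<open>
  Order-one reductions: \<open>kappa1\<close> is the image of \<open>\<kappa>\<close> under \<open>T\<^sup>kE\<^sup>1 \<times> TE\<^sup>k \<rightarrow> TE\<^sup>1 \<times> TE\<^sup>1\<close>.
\<close>

definition kappa1 ::
  "('e, 'm, 'i) gbundle \<Rightarrow> ((real \<Rightarrow> 'e set) set \<times> (real \<Rightarrow> 'e) set) set \<Rightarrow>
   ((real \<Rightarrow> 'e set) set \<times> (real \<Rightarrow> 'e set) set) set" where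
  "kappa1 E \<kappa> =
     (\<lambda>(X, Y). (jet_trunc (tot (reduction 1 E)) 1 X,
                Tk_map (tot (reduction 1 E)) 1 (red E 1) Y)) ` \<kappa>"

definition anchor1 ::
  "('e, 'm, 'i) gbundle \<Rightarrow> ('e \<Rightarrow> (real \<Rightarrow> 'm) set) \<Rightarrow> 'e set \<Rightarrow> (real \<Rightarrow> 'm) set" where
  "anchor1 E anc a = jet_trunc (base E) 1 (anc (rep a))"

definition higher_algebroid ::
  "nat \<Rightarrow> ('e, 'm, 'i) gbundle \<Rightarrow> ((real \<Rightarrow> 'e set) set \<times> (real \<Rightarrow> 'e) set) set \<Rightarrow>
   ('e \<Rightarrow> (real \<Rightarrow> 'm) set) \<Rightarrow> bool" where
  "higher_algebroid k E \<kappa> anc \<longleftrightarrow>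
     1 \<le> k \<and> graded_bundle k E \<and>
     graded_comorphism k (reduction 1 E) E \<kappa> anc \<and>
     algebroid (reduction 1 E) (kappa1 E \<kappa>) (anchor1 E anc)"

definition skew_higher_algebroid ::
  "nat \<Rightarrow> ('e, 'm, 'i) gbundle \<Rightarrow> ((real \<Rightarrow> 'e set) set \<times> (real \<Rightarrow> 'e) set) set \<Rightarrow>
   ('e \<Rightarrow> (real \<Rightarrow> 'm) set) \<Rightarrow> bool" where
  "skew_higher_algebroid k E \<kappa> anc \<longleftrightarrow> higher_algebroid k E \<kappa> anc \<and> sym (kappa1 E \<kappa>)"

definition almost_Lie_higher_algebroid ::
  "nat \<Rightarrow> ('e, 'm, 'i) gbundle \<Rightarrow> ((real \<Rightarrow> 'e set) set \<times> (real \<Rightarrow> 'e) set) set \<Rightarrow>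
   ('e \<Rightarrow> (real \<Rightarrow> 'm) set) \<Rightarrow> bool" where
  "almost_Lie_higher_algebroid k E \<kappa> anc \<longleftrightarrow>
     skew_higher_algebroid k E \<kappa> anc \<and>
     (\<forall>(X, Y) \<in> \<kappa>.
        (Tk_map (Tk 1 (base E)) k (anchor1 E anc) X, Tk_map (Tk k (base E)) 1 anc Y)
          \<in> flip_graph k (base E))"


section \<open>Prolongations\<close>

text \<open>Admissibility is required near 0, in accordance with the convention on curves.\<close>

definition admissible ::
  "('a, 'm, 'i) gbundle \<Rightarrow> ('a \<Rightarrow> (real \<Rightarrow> 'm) set) \<Rightarrow> (real \<Rightarrow> 'a) \<Rightarrow> bool" where
  "admissible A anc a \<longleftrightarrow> curve (tot A) a \<and>
     (\<forall>\<^sub>F t in nhds 0. jet (base A) 1 (\<lambda>s. proj A (a (t + s))) = anc (a t))"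

definition prolongation ::
  "nat \<Rightarrow> ('a, 'm, 'i) gbundle \<Rightarrow> ('a \<Rightarrow> (real \<Rightarrow> 'm) set) \<Rightarrow> (real \<Rightarrow> 'a) set set" where
  "prolongation k A anc = {jet (tot A) (k - 1) a | a. admissible A anc a}"

definition prolongation_idx :: "nat \<Rightarrow> ('a, 'm, 'i) gbundle \<Rightarrow> (nat \<times> 'i) set" where
  "prolongation_idx k A = {0} \<times> idx (base A) \<union> {..<k} \<times> fib_idx A"

definition prolongation_mfd ::
  "nat \<Rightarrow> ('a, 'm, 'i) gbundle \<Rightarrow> ('a \<Rightarrow> (real \<Rightarrow> 'm) set) \<Rightarrow>
   ((real \<Rightarrow> 'a) set, nat \<times> 'i) mfd" where
  "prolongation_mfd k A anc = \<lparr>idx = prolongation_idx k A,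
     atlas = (\<lambda>(W, \<psi>). ({U \<in> prolongation k A anc. base_pt U \<in> W},
       \<lambda>U. restrict (jet_coords (k - 1) (idx (tot A)) \<psi> U) (prolongation_idx k A))) ` atlas (tot A)\<rparr>"

definition prolongation_wt :: "('a, 'm, 'i) gbundle \<Rightarrow> nat \<times> 'i \<Rightarrow> nat" where
  "prolongation_wt A = (\<lambda>(\<alpha>, i). if wt A i = 0 then 0 else \<alpha> + 1)"

definition prolongation_anchor ::
  "nat \<Rightarrow> ('a, 'm, 'i) gbundle \<Rightarrow> ('a \<Rightarrow> (real \<Rightarrow> 'm) set) \<Rightarrow> (real \<Rightarrow> 'a) set \<Rightarrow>
   (real \<Rightarrow> 'm) set" where
  "prolongation_anchor k A anc U =
     jet (base A) k (proj A \<circ> (SOME a. admissible A anc a \<and> jet (tot A) (k - 1) a = U))"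


section \<open>The canonical relation\<close>

definition kappa_at :: "('x \<times> (real \<Rightarrow> 'e) set) set \<Rightarrow> 'e \<Rightarrow> 'x \<Rightarrow> (real \<Rightarrow> 'e) set" where
  "kappa_at \<kappa> V X = (THE Y. (X, Y) \<in> \<kappa> \<and> base_pt Y = V)"

text \<open>
  The lift of \<open>U\<close> does not depend on the choice of \<open>b\<close>, and suitable \<open>b\<close> exist by the condition
  on \<open>T\<^bsup>k-1\<^esup>\<sigma>(U)\<close>.
\<close>

definition Theta ::
  "nat \<Rightarrow> ('e, 'm, 'i) gbundle \<Rightarrow> ((real \<Rightarrow> 'e set) set \<times> (real \<Rightarrow> 'e) set) set \<Rightarrow>
   ('e \<Rightarrow> (real \<Rightarrow> 'm) set) \<Rightarrow> ((real \<Rightarrow> 'e set) set \<times> 'e) set" where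
  "Theta k E \<kappa> anc =
     {(U, V). U \<in> prolongation k (reduction 1 E) (anchor1 E anc) \<and> V \<in> pts (tot E) \<and>
        Tk_map (base E) (k - 1) (proj (reduction 1 E)) U = jet_trunc (base E) (k - 1) (anc V) \<and>
        (\<exists>b. curve (tot (reduction 1 E)) b \<and>
           jet (tot (reduction 1 E)) (k - 1) b = U \<and>
           jet (base E) k (proj (reduction 1 E) \<circ> b) = anc V \<and>
           kappa_at \<kappa> V (jet (tot (reduction 1 E)) k (\<lambda>t. gact (reduction 1 E) t (b t)))
             = weight_field (tot E) (wt E) V)}"

end

theory Submission
  imports Defs
begin

text \<open>
  Why the theorem holds. In charts of \<open>A\<close> and of \<open>E\<close> the comorphism is a matrix: the tangent coordinate with index \<open>j\<close>
  of \<open>\<kappa>\<^sub>V(X)\<close> is the sum of the products \<open>Q\<^sub>j\<^sub>\<alpha>\<^sub>i(V) X\<^sub>\<alpha>\<^sub>i\<close> over the orders \<open>\<alpha> \<le> k\<close> and the linear coordinates \<open>i\<close>. As \<open>\<kappa>\<close> is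
  invariant under the homotheties, \<open>Q\<^sub>j\<^sub>\<alpha>\<^sub>i\<close> is homogeneous of degree \<open>w - \<alpha>\<close>, where \<open>w\<close> is the weight of \<open>j\<close>
  (\<open>Q_homogeneous\<close>), and a smooth homogeneous function depends only on the coordinates of weight at most its degree
  (\<open>Q_depends\<close>). The lift of a jet \<open>U\<close> with coordinates \<open>u\<close> is the jet of \<open>t b(t)\<close>; its coordinate of order \<open>\<alpha>\<close> is \<open>\<alpha>\<close>
  times the coordinate of \<open>u\<close> of order \<open>\<alpha> - 1\<close>. Thus the equation that relates \<open>U\<close> and \<open>V\<close> expresses \<open>w\<close> times the
  coordinate \<open>j\<close> of \<open>V\<close> by \<open>u\<close> and by coordinates of \<open>V\<close> of smaller weight (\<open>theta_eqn\<close>). This triangular system has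
  exactly one solution over the base point of \<open>U\<close> (\<open>theta_eqn_unique\<close>, \<open>approx_solution\<close>). The solution is smooth, being
  obtained by \<open>k\<close> iterations of a smooth map, and it is equivariant by the homogeneity of \<open>Q\<close> (\<open>theta_eqn_gact\<close>).

  A solution of the coordinate equation is related to \<open>U\<close> only if its anchor is the \<open>k\<close>-jet of the base curve of an
  admissible curve \<open>a\<close> that represents \<open>U\<close>. Here the almost Lie condition enters. Let \<open>b\<close> be a curve over the anchor of \<open>V\<close>
  with the fibre coordinates of \<open>a\<close>, and apply the condition to the pair formed by the jet of \<open>t b(t)\<close> and the weight
  vector at \<open>V\<close>. It says that the derivatives at \<open>0\<close> of the base curve of \<open>b\<close> are those that admissibility would
  prescribe, up to order \<open>k\<close> (\<open>weight_field_velocity_jet\<close>). But the fibre coordinates determine the base jet of a curve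
  that is admissible to order \<open>k\<close> (\<open>velocity_jet_unique\<close>). Hence \<open>a\<close> and \<open>b\<close> have the same base jet
  (\<open>theta_eqn_imp_rel\<close>), which also is the compatibility with the anchors.

  Smoothness of the map on the prolongation presupposes that its charts have open images, that is, that arbitrary
  coordinates are realised by the jet of an admissible curve. Such a curve is the solution of an ordinary differential
  equation (\<open>admissible_realization\<close>).

  Smooth functions are given by their iterated partial derivatives on spaces of families of reals. The first sections
  derive the calculus of this notion: the chain rule, composition, the symmetry of second derivatives, jets of
  composites, and the local existence of smooth solutions of differential equations.
\<close>


section \<open>Smooth functions on coordinate spaces\<close>

lemma PiE_UNIV_extensional [simp]: "(\<Pi>\<^sub>E i\<in>I. UNIV) = extensional I"
  by (auto simp: PiE_def)

lemma openin_Rn_iff: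
  assumes "finite I"
  shows "openin (Rn I) S \<longleftrightarrow> S \<subseteq> extensional I \<and>
    (\<forall>x\<in>S. \<exists>e>0. \<forall>y\<in>extensional I. (\<forall>i\<in>I. \<bar>y i - x i\<bar> < e) \<longrightarrow> y \<in> S)"
proof (intro iffI conjI ballI)
  assume S: "openin (Rn I) S"
  show "S \<subseteq> extensional I" using openin_subset[OF S] by simp
  fix x assume x: "x \<in> S"
  obtain U where "\<forall>i\<in>I. openin euclideanreal (U i)" "x \<in> Pi\<^sub>E I U" "Pi\<^sub>E I U \<subseteq> S"
    using bspec[OF S[unfolded openin_product_topology_alt] x] by auto
  then have U: "\<And>i. i \<in> I \<Longrightarrow> open (U i)" "x \<in> Pi\<^sub>E I U" "Pi\<^sub>E I U \<subseteq> S"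
    by auto
  have "\<exists>e>0. \<forall>t. \<bar>t - x i\<bar> < e \<longrightarrow> t \<in> U i" if "i \<in> I" for i
  proof -
    have "x i \<in> U i" using U(2) that by auto
    then show ?thesis using U(1)[OF that] unfolding open_dist dist_real_def by auto
  qed
  then obtain e where e: "\<And>i. i \<in> I \<Longrightarrow> 0 < e i" "\<And>i t. i \<in> I \<Longrightarrow> \<bar>t - x i\<bar> < e i \<Longrightarrow> t \<in> U i"
    by metis
  let ?d = "Min (insert 1 (e ` I))"
  have d: "?d > 0" "\<And>i. i \<in> I \<Longrightarrow> ?d \<le> e i" using assms e by auto
  have "y \<in> S" if "y \<in> extensional I" "\<forall>i\<in>I. \<bar>y i - x i\<bar> < ?d" for y
  proof -
    have "y i \<in> U i" if "i \<in> I" for i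
      by (rule e(2)[OF that]) (use \<open>\<forall>i\<in>I. \<bar>y i - x i\<bar> < ?d\<close> d(2)[OF that] that in fastforce)
    then have "y \<in> Pi\<^sub>E I U" using that(1) by (auto simp: PiE_def)
    then show ?thesis using U(3) by auto
  qed
  then show "\<exists>e>0. \<forall>y\<in>extensional I. (\<forall>i\<in>I. \<bar>y i - x i\<bar> < e) \<longrightarrow> y \<in> S"
    using d(1) by blast
next
  assume *: "S \<subseteq> extensional I \<and>
    (\<forall>x\<in>S. \<exists>e>0. \<forall>y\<in>extensional I. (\<forall>i\<in>I. \<bar>y i - x i\<bar> < e) \<longrightarrow> y \<in> S)"
  show "openin (Rn I) S"
    unfolding openin_product_topology_alt
  proof (intro ballI)
    fix x assume x: "x \<in> S"
    then obtain e where e: "e > 0" "\<And>y. y \<in> extensional I \<Longrightarrow> (\<forall>i\<in>I. \<bar>y i - x i\<bar> < e) \<Longrightarrow> y \<in> S"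
      using * by blast
    show "\<exists>U. finite {i \<in> I. U i \<noteq> topspace euclideanreal} \<and> (\<forall>i\<in>I. openin euclideanreal (U i)) \<and>
        x \<in> Pi\<^sub>E I U \<and> Pi\<^sub>E I U \<subseteq> S"
    proof (intro exI[of _ "\<lambda>i. ball (x i) e"] conjI)
      show "x \<in> (\<Pi>\<^sub>E i\<in>I. ball (x i) e)" using x * e(1) by (auto simp: PiE_def)
      show "(\<Pi>\<^sub>E i\<in>I. ball (x i) e) \<subseteq> S"
        by (intro subsetI e(2)) (auto simp: PiE_def Pi_def dist_real_def abs_minus_commute)
    qed (use assms in auto)
  qed
qed

lemma openin_RnE:
  assumes "openin (Rn I) S" "finite I" "x \<in> S"
  obtains e where "e > 0" "\<And>y. y \<in> extensional I \<Longrightarrow> (\<And>i. i \<in> I \<Longrightarrow> \<bar>y i - x i\<bar> < e) \<Longrightarrow> y \<in> S"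
proof -
  have "\<exists>e>0. \<forall>y\<in>extensional I. (\<forall>i\<in>I. \<bar>y i - x i\<bar> < e) \<longrightarrow> y \<in> S"
    using assms(1,3) openin_Rn_iff[OF assms(2)] by simp
  then obtain e where "e > 0" "\<forall>y\<in>extensional I. (\<forall>i\<in>I. \<bar>y i - x i\<bar> < e) \<longrightarrow> y \<in> S"
    by (elim exE conjE)
  then show thesis using that[of e] by simp
qed

lemma openin_Rn_ext: "openin (Rn I) S \<Longrightarrow> x \<in> S \<Longrightarrow> x \<in> extensional I"
  using openin_subset by fastforce

lemma extensional_fun_upd: "i \<in> I \<Longrightarrow> x \<in> extensional I \<Longrightarrow> x(i := t) \<in> extensional I"
  by (auto simp: extensional_def)

lemma eventually_upd_in_open:
  assumes "openin (Rn I) S" "finite I" "x \<in> S" "i \<in> I"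
  shows "\<forall>\<^sub>F t in nhds (x i). x(i := t) \<in> S"
proof -
  obtain e where e: "e > 0" "\<And>y. y \<in> extensional I \<Longrightarrow> (\<And>i. i \<in> I \<Longrightarrow> \<bar>y i - x i\<bar> < e) \<Longrightarrow> y \<in> S"
    using openin_RnE[OF assms(1-3)] by blast
  have "x(i := t) \<in> S" if "dist t (x i) < e" for t
    by (rule e(2)) (use that e(1) assms openin_Rn_ext[OF assms(1,3)] in
        \<open>auto simp: dist_real_def extensional_fun_upd\<close>)
  then show ?thesis using e(1) unfolding eventually_nhds_metric by auto
qed

lemma continuous_map_RnD:
  assumes "continuous_map (subtopology (Rn I) S) euclideanreal f" "finite I" "openin (Rn I) S" "x \<in> S" "e > 0"
  shows "\<exists>d>0. \<forall>y\<in>extensional I. (\<forall>i\<in>I. \<bar>y i - x i\<bar> < d) \<longrightarrow> y \<in> S \<and> \<bar>f y - f x\<bar> < e"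
proof -
  have "openin (subtopology (Rn I) S) {y \<in> topspace (subtopology (Rn I) S). f y \<in> ball (f x) e}"
    by (rule openin_continuous_map_preimage[OF assms(1)]) auto
  then have "openin (Rn I) {y \<in> topspace (subtopology (Rn I) S). f y \<in> ball (f x) e}"
    using assms(3) openin_trans_full by blast
  moreover have "x \<in> {y \<in> topspace (subtopology (Rn I) S). f y \<in> ball (f x) e}"
    using assms openin_Rn_ext[OF assms(3,4)] by auto
  ultimately obtain d where "d > 0" "\<And>y. y \<in> extensional I \<Longrightarrow> (\<And>i. i \<in> I \<Longrightarrow> \<bar>y i - x i\<bar> < d) \<Longrightarrow>
     y \<in> {y \<in> topspace (subtopology (Rn I) S). f y \<in> ball (f x) e}"
    using openin_RnE[OF _ assms(2)] by blast
  then show ?thesis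
    by (intro exI[of _ d]) (auto simp: dist_real_def abs_minus_commute)
qed

lemma smooth_onD:
  assumes "smooth_on I S f"
  shows "continuous_map (subtopology (Rn I) S) euclideanreal f"
    and "\<And>x i. x \<in> S \<Longrightarrow> i \<in> I \<Longrightarrow> (\<lambda>t. f (x(i := t))) differentiable (at (x i))"
    and "\<And>i. i \<in> I \<Longrightarrow> smooth_on I S (pdiff i f)"
proof -
  show "continuous_map (subtopology (Rn I) S) euclideanreal f"
    "\<And>x i. x \<in> S \<Longrightarrow> i \<in> I \<Longrightarrow> (\<lambda>t. f (x(i := t))) differentiable (at (x i))"
    using assms unfolding smooth_on_def by (auto dest: bspec[of _ _ "[]"])
  fix i assume i: "i \<in> I"
  have "pdiffs is (pdiff i f) = pdiffs (is @ [i]) f" for "is" by (induction "is") auto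
  then show "smooth_on I S (pdiff i f)"
    using assms i unfolding smooth_on_def by auto
qed

lemma smooth_on_mono:
  assumes "smooth_on I S f" "S' \<subseteq> S"
  shows "smooth_on I S' f"
  using assms unfolding smooth_on_def
  by (metis continuous_map_from_subtopology_mono subsetD)

lemma smooth_on_has_deriv:
  assumes "smooth_on I S f" "x \<in> S" "i \<in> I"
  shows "((\<lambda>t. f (x(i := t))) has_real_derivative pdiff i f x) (at (x i))"
  using smooth_onD(2)[OF assms] unfolding pdiff_def
  by (simp add: DERIV_deriv_iff_real_differentiable)

lemma pdiff_cong:
  assumes "openin (Rn I) S" "finite I" "x \<in> S" "i \<in> I" "\<And>y. y \<in> S \<Longrightarrow> f y = g y"
  shows "pdiff i f x = pdiff i g x"
  unfolding pdiff_def
  by (rule deriv_cong_ev[OF eventually_mono[OF eventually_upd_in_open[OF assms(1-4)]]]) (use assms in auto)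

lemma differentiable_cong_ev:
  fixes f g :: "real \<Rightarrow> real"
  assumes "\<forall>\<^sub>F t in nhds x. f t = g t" "g differentiable (at x)"
  shows "f differentiable (at x)"
  using assms by (metis DERIV_cong_ev DERIV_deriv_iff_real_differentiable real_differentiable_def)

text \<open>
  Coinduction for smoothness: it is enough that a class of functions consists of continuous functions
  with partial derivatives that belong, up to equality on the open set \<open>S\<close>, to the class again.
\<close>

lemma smooth_on_coinduct:
  assumes S: "openin (Rn I) S" "finite I" and "P f"
    and cont: "\<And>f. P f \<Longrightarrow> continuous_map (subtopology (Rn I) S) euclideanreal f"
    and diff: "\<And>f i. P f \<Longrightarrow> i \<in> I \<Longrightarrow> \<exists>g. P g \<and> (\<forall>x\<in>S. ((\<lambda>t. f (x(i := t))) has_real_derivative g x) (at (x i)))"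
  shows "smooth_on I S f"
proof -
  have *: "\<exists>g. P g \<and> (\<forall>x\<in>S. pdiffs is f x = g x)" if "is \<in> lists I" for "is"
    using that
  proof (induction "is")
    case Nil
    then show ?case using \<open>P f\<close> by auto
  next
    case (Cons i "is")
    then obtain g where g: "P g" "\<forall>x\<in>S. pdiffs is f x = g x" by auto
    have i: "i \<in> I" using Cons by simp
    obtain h where h: "P h" "\<forall>x\<in>S. ((\<lambda>t. g (x(i := t))) has_real_derivative h x) (at (x i))"
      using diff[OF g(1) i] by blast
    have "pdiffs (i # is) f x = h x" if "x \<in> S" for x
    proof -
      have "pdiff i (pdiffs is f) x = pdiff i g x"
        by (rule pdiff_cong[OF S that]) (use g Cons in auto)
      also have "\<dots> = h x" unfolding pdiff_def using h that DERIV_imp_deriv by blast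
      finally show ?thesis by simp
    qed
    then show ?case using h by blast
  qed
  show ?thesis unfolding smooth_on_def
  proof (intro ballI conjI)
    fix "is" assume "is \<in> lists I"
    then obtain g where g: "P g" "\<forall>x\<in>S. pdiffs is f x = g x" using * by blast
    show "continuous_map (subtopology (Rn I) S) euclideanreal (pdiffs is f)"
      by (rule continuous_map_eq[OF cont[OF g(1)]]) (use g in auto)
    fix x i assume x: "x \<in> S" "i \<in> I"
    obtain h where h: "\<forall>x\<in>S. ((\<lambda>t. g (x(i := t))) has_real_derivative h x) (at (x i))"
      using diff[OF g(1) x(2)] by auto
    have "\<forall>\<^sub>F t in nhds (x i). pdiffs is f (x(i := t)) = g (x(i := t))"
      by (rule eventually_mono[OF eventually_upd_in_open[OF S x]]) (use g in auto)
    then show "(\<lambda>t. pdiffs is f (x(i := t))) differentiable at (x i)"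
      by (rule differentiable_cong_ev) (use h x real_differentiable_def in blast)
  qed
qed

lemma smooth_on_cong:
  assumes "openin (Rn I) S" "finite I" "smooth_on I S f" "\<And>x. x \<in> S \<Longrightarrow> g x = f x"
  shows "smooth_on I S g"
proof (rule smooth_on_coinduct[where P = "\<lambda>g. \<exists>f. smooth_on I S f \<and> (\<forall>x\<in>S. g x = f x)"])
  fix g assume "\<exists>f. smooth_on I S f \<and> (\<forall>x\<in>S. g x = f x)"
  then obtain f where f: "smooth_on I S f" "\<forall>x\<in>S. g x = f x" by blast
  show "continuous_map (subtopology (Rn I) S) euclideanreal g"
    by (rule continuous_map_eq[OF smooth_onD(1)[OF f(1)]]) (use f in auto)
  fix i assume i: "i \<in> I"
  have "((\<lambda>t. g (x(i := t))) has_real_derivative pdiff i f x) (at (x i))" if x: "x \<in> S" for x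
  proof -
    have "\<forall>\<^sub>F t in nhds (x i). g (x(i := t)) = f (x(i := t))"
      by (rule eventually_mono[OF eventually_upd_in_open[OF assms(1,2) x i]]) (use f in auto)
    then show ?thesis using smooth_on_has_deriv[OF f(1) x i] DERIV_cong_ev by fast
  qed
  then show "\<exists>h. (\<exists>f. smooth_on I S f \<and> (\<forall>x\<in>S. h x = f x)) \<and>
      (\<forall>x\<in>S. ((\<lambda>t. g (x(i := t))) has_real_derivative h x) (at (x i)))"
    using smooth_onD(3)[OF f(1) i] by blast
qed (use assms in auto)

lemma smooth_on_const: 
  assumes "openin (Rn I) S" "finite I" shows "smooth_on I S (\<lambda>_. c)"
proof (rule smooth_on_coinduct[where P = "\<lambda>g. \<exists>c. g = (\<lambda>_. c)", OF assms])
  show "\<exists>g. (\<exists>c. g = (\<lambda>_. c)) \<and> (\<forall>x\<in>S. ((\<lambda>t. f (x(i := t))) has_real_derivative g x) (at (x i)))"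
    if "\<exists>c. f = (\<lambda>_. c)" for f :: "('a \<Rightarrow> real) \<Rightarrow> real" and i :: 'a
    using that by (intro exI[of _ "\<lambda>_. 0"]) auto
qed auto

lemma smooth_on_coord:
  assumes S: "openin (Rn I) S" "finite I" and "j \<in> I"
  shows "smooth_on I S (\<lambda>x. x j)"
proof (rule smooth_on_coinduct[where P = "\<lambda>f. f = (\<lambda>x. x j) \<or> (\<exists>c. f = (\<lambda>_. c))", OF S])
  fix f :: "('a \<Rightarrow> real) \<Rightarrow> real" assume f: "f = (\<lambda>x. x j) \<or> (\<exists>c. f = (\<lambda>_. c))"
  then show "continuous_map (subtopology (Rn I) S) euclideanreal f"
    using \<open>j \<in> I\<close> by (auto intro!: continuous_map_from_subtopology continuous_map_product_projection)
  fix i assume "i \<in> I"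
  show "\<exists>g. (g = (\<lambda>x. x j) \<or> (\<exists>c. g = (\<lambda>_. c))) \<and>
      (\<forall>x\<in>S. ((\<lambda>t. f (x(i := t))) has_real_derivative g x) (at (x i)))"
  proof (cases "f = (\<lambda>x. x j) \<and> i = j")
    case True
    then show ?thesis by (intro exI[of _ "\<lambda>_. 1"]) auto
  next
    case False
    then show ?thesis using f by (intro exI[of _ "\<lambda>_. 0"]) auto
  qed
qed auto

text \<open>
  Sums of elements of \<open>B\<close>. The Leibniz rule and the chain rule turn one product or composite into a sum of such, so
  the classes to which coinduction is applied are sums over a set of generators.
\<close>

inductive_set sums_of :: "('a \<Rightarrow> real) set \<Rightarrow> ('a \<Rightarrow> real) set" for B where
  base: "f \<in> B \<Longrightarrow> f \<in> sums_of B"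
| zero: "(\<lambda>_. 0) \<in> sums_of B"
| add: "f \<in> sums_of B \<Longrightarrow> g \<in> sums_of B \<Longrightarrow> (\<lambda>x. f x + g x) \<in> sums_of B"

lemma sums_of_sum: "finite J \<Longrightarrow> (\<And>j. j \<in> J \<Longrightarrow> h j \<in> sums_of B) \<Longrightarrow> (\<lambda>x. \<Sum>j\<in>J. h j x) \<in> sums_of B"
  by (induction J rule: finite_induct) (auto intro: sums_of.intros)

lemma smooth_on_sums_of:
  assumes S: "openin (Rn I) S" "finite I" and "f \<in> sums_of B"
    and cont: "\<And>f. f \<in> B \<Longrightarrow> continuous_map (subtopology (Rn I) S) euclideanreal f"
    and diff: "\<And>f i. f \<in> B \<Longrightarrow> i \<in> I \<Longrightarrow> \<exists>g \<in> sums_of B. \<forall>x\<in>S. ((\<lambda>t. f (x(i := t))) has_real_derivative g x) (at (x i))"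
  shows "smooth_on I S f"
proof (rule smooth_on_coinduct[where P = "\<lambda>h. h \<in> sums_of B", OF S assms(3)])
  fix f assume f: "f \<in> sums_of B"
  then show "continuous_map (subtopology (Rn I) S) euclideanreal f"
    by induction (auto intro: cont continuous_map_add)
  fix i assume i: "i \<in> I"
  show "\<exists>g. g \<in> sums_of B \<and> (\<forall>x\<in>S. ((\<lambda>t. f (x(i := t))) has_real_derivative g x) (at (x i)))"
    using f
  proof induction
    case (base f)
    then show ?case using diff[OF _ i] by blast
  next
    case zero
    then show ?case by (intro exI[of _ "\<lambda>_. 0"]) (auto intro: sums_of.zero)
  next
    case (add f g)
    obtain f' where "f' \<in> sums_of B" "\<forall>x\<in>S. ((\<lambda>t. f (x(i := t))) has_real_derivative f' x) (at (x i))"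
      using add.IH(1) by blast
    moreover obtain g' where "g' \<in> sums_of B" "\<forall>x\<in>S. ((\<lambda>t. g (x(i := t))) has_real_derivative g' x) (at (x i))"
      using add.IH(2) by blast
    ultimately show ?case
      by (intro exI[of _ "\<lambda>x. f' x + g' x"] conjI ballI sums_of.add DERIV_add) blast+
  qed
qed

lemma smooth_on_add:
  assumes S: "openin (Rn I) S" "finite I" and f: "smooth_on I S f" "smooth_on I S g"
  shows "smooth_on I S (\<lambda>x. f x + g x)"
proof (rule smooth_on_sums_of[where B = "{f. smooth_on I S f}", OF S])
  show "(\<lambda>x. f x + g x) \<in> sums_of {f. smooth_on I S f}"
    by (rule sums_of.add) (use f in \<open>simp_all add: sums_of.base\<close>)
  fix h i assume h: "h \<in> {f. smooth_on I S f}" and i: "i \<in> I"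
  show "\<exists>g\<in>sums_of {f. smooth_on I S f}. \<forall>x\<in>S. ((\<lambda>t. h (x(i := t))) has_real_derivative g x) (at (x i))"
  proof (intro bexI[of _ "pdiff i h"] ballI)
    show "pdiff i h \<in> sums_of {f. smooth_on I S f}"
      using smooth_onD(3)[of I S h] h i by (simp add: sums_of.base)
    show "((\<lambda>t. h (x(i := t))) has_real_derivative pdiff i h x) (at (x i))" if "x \<in> S" for x
      by (rule smooth_on_has_deriv[OF _ that i]) (use h in simp)
  qed
qed (simp add: smooth_onD(1))

lemma smooth_on_mult:
  assumes S: "openin (Rn I) S" "finite I" and f: "smooth_on I S f" "smooth_on I S g"
  shows "smooth_on I S (\<lambda>x. f x * g x)"
proof -
  let ?B = "{\<lambda>x. f x * g x | f g. smooth_on I S f \<and> smooth_on I S g}"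
  have B: "(\<lambda>x. f x * g x) \<in> sums_of ?B" if "smooth_on I S f" "smooth_on I S g" for f g
    by (rule sums_of.base, rule CollectI, rule exI[of _ f], rule exI[of _ g]) (use that in auto)
  show ?thesis
  proof (rule smooth_on_sums_of[where B = ?B, OF S])
    show "(\<lambda>x. f x * g x) \<in> sums_of ?B" by (rule B[OF f])
    fix h assume "h \<in> ?B"
    then obtain f g where fg: "smooth_on I S f" "smooth_on I S g" "h = (\<lambda>x. f x * g x)" by blast
    show "continuous_map (subtopology (Rn I) S) euclideanreal h"
      unfolding fg(3) by (intro continuous_map_real_mult smooth_onD(1) fg)
    fix i assume i: "i \<in> I"
    show "\<exists>k \<in> sums_of ?B. \<forall>x\<in>S. ((\<lambda>t. h (x(i := t))) has_real_derivative k x) (at (x i))"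
    proof (intro bexI[of _ "\<lambda>x. pdiff i f x * g x + f x * pdiff i g x"] ballI)
      show "(\<lambda>x. pdiff i f x * g x + f x * pdiff i g x) \<in> sums_of ?B"
        by (intro sums_of.add B smooth_onD(3) fg i)
      fix x assume x: "x \<in> S"
      show "((\<lambda>t. h (x(i := t))) has_real_derivative pdiff i f x * g x + f x * pdiff i g x) (at (x i))"
        unfolding fg(3)
        by (rule DERIV_cong[OF DERIV_mult[OF smooth_on_has_deriv[OF fg(1) x i] smooth_on_has_deriv[OF fg(2) x i]]])
          (simp only: fun_upd_triv mult.commute)
    qed
  qed
qed

lemma smooth_on_sum:
  assumes S: "openin (Rn I) S" "finite I" and f: "\<And>j. j \<in> J \<Longrightarrow> smooth_on I S (f j)"
  shows "smooth_on I S (\<lambda>x. \<Sum>j\<in>J. f j x)"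
  using f
proof (induction J rule: infinite_finite_induct)
  case (insert j J)
  have "smooth_on I S (\<lambda>x. f j x + (\<Sum>j\<in>J. f j x))"
    by (rule smooth_on_add[OF S]) (use insert in auto)
  then show ?case using insert.hyps by simp
qed (simp_all add: smooth_on_const[OF S])

text \<open>
  The mean value theorem, one coordinate at a time: on a box the deviation of \<open>f\<close> from a linear
  function is controlled by the deviation of its partial derivatives. For \<open>c = 0\<close> this is a Lipschitz
  estimate; for the gradient \<open>c\<close> at the centre it gives total differentiability.
\<close>

lemma smooth_on_box_estimate:
  assumes I: "finite I" and f: "smooth_on I S f" and x: "x \<in> extensional I"
    and box: "\<And>z. z \<in> extensional I \<Longrightarrow> (\<And>i. i \<in> I \<Longrightarrow> \<bar>z i - x i\<bar> < d) \<Longrightarrow>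
        z \<in> S \<and> (\<forall>i\<in>I. \<bar>pdiff i f z - c i\<bar> \<le> e)"
    and y: "y \<in> extensional I" "\<And>i. i \<in> I \<Longrightarrow> \<bar>y i - x i\<bar> < d"
    and y': "y' \<in> extensional I" "\<And>i. i \<in> I \<Longrightarrow> \<bar>y' i - x i\<bar> < d"
  shows "\<bar>f y - f y' - (\<Sum>i\<in>I. c i * (y i - y' i))\<bar> \<le> e * (\<Sum>i\<in>I. \<bar>y i - y' i\<bar>)"
proof -
  have step: "\<bar>f z - f (z(i := s)) - c i * (z i - s)\<bar> \<le> e * \<bar>z i - s\<bar>"
    if z: "z \<in> extensional I" "\<And>i. i \<in> I \<Longrightarrow> \<bar>z i - x i\<bar> < d" and i: "i \<in> I" and s: "\<bar>s - x i\<bar> < d" for z i s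
  proof -
    let ?g = "\<lambda>t. f (z(i := t)) - c i * t"
    have in_box: "z(i := t) \<in> S \<and> (\<forall>l\<in>I. \<bar>pdiff l f (z(i := t)) - c l\<bar> \<le> e)" if "\<bar>t - x i\<bar> < d" for t
      by (rule box) (use z i that in \<open>auto simp: extensional_fun_upd\<close>)
    have D: "(?g has_real_derivative (pdiff i f (z(i := t)) - c i)) (at t)" if "\<bar>t - x i\<bar> < d" for t
      using smooth_on_has_deriv[OF f _ i, of "z(i := t)"] in_box[OF that]
      by (auto intro!: derivative_eq_intros)
    have "\<bar>?g (z i) - ?g s\<bar> \<le> e * \<bar>z i - s\<bar>"
    proof (rule field_differentiable_bound[where S = "{x i - d<..<x i + d}" and f' = "\<lambda>t. pdiff i f (z(i := t)) - c i", unfolded real_norm_def])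
      show "(?g has_real_derivative (pdiff i f (z(i := t)) - c i)) (at t within {x i - d<..<x i + d})"
        if "t \<in> {x i - d<..<x i + d}" for t
        by (rule has_field_derivative_at_within[OF D]) (use that in auto)
      show "\<bar>pdiff i f (z(i := t)) - c i\<bar> \<le> e" if "t \<in> {x i - d<..<x i + d}" for t
        using in_box[of t] that i by auto
      show "z i \<in> {x i - d<..<x i + d}" using z(2)[OF i] by auto
    qed (use s in auto)
    then show ?thesis by (simp add: algebra_simps)
  qed
  have "\<bar>f y - f (override_on y y' K) - (\<Sum>i\<in>K. c i * (y i - y' i))\<bar> \<le> e * (\<Sum>i\<in>K. \<bar>y i - y' i\<bar>)"
    if "K \<subseteq> I" for K
    using finite_subset[OF that I] that
  proof (induction K rule: finite_induct)
    case empty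
    then show ?case by simp
  next
    case (insert i K)
    let ?z = "override_on y y' K"
    have z: "?z \<in> extensional I" "\<And>i. i \<in> I \<Longrightarrow> \<bar>?z i - x i\<bar> < d"
      using y y' insert.prems by (auto simp: override_on_def extensional_def)
    have "\<bar>f ?z - f (?z(i := y' i)) - c i * (?z i - y' i)\<bar> \<le> e * \<bar>?z i - y' i\<bar>"
      by (rule step[OF z]) (use insert y' in auto)
    moreover have "?z i = y i" using insert by auto
    moreover have "?z(i := y' i) = override_on y y' (insert i K)" by (auto simp: override_on_def)
    ultimately have "\<bar>f ?z - f (override_on y y' (insert i K)) - c i * (y i - y' i)\<bar> \<le> e * \<bar>y i - y' i\<bar>"
      by simp
    then show ?case using insert by (simp add: algebra_simps)
  qed
  from this[of I] have "\<bar>f y - f (override_on y y' I) - (\<Sum>i\<in>I. c i * (y i - y' i))\<bar> \<le> e * (\<Sum>i\<in>I. \<bar>y i - y' i\<bar>)"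
    by simp
  moreover have "override_on y y' I = y'"
    using y y' by (auto simp: override_on_def extensional_def)
  ultimately show ?thesis by simp
qed

lemma smooth_on_total_differential:
  assumes I: "finite I" and S: "openin (Rn I) S" and f: "smooth_on I S f" and x: "x \<in> S" and e: "e > 0"
  shows "\<exists>d>0. \<forall>y\<in>extensional I. (\<forall>i\<in>I. \<bar>y i - x i\<bar> < d) \<longrightarrow>
    \<bar>f y - f x - (\<Sum>i\<in>I. pdiff i f x * (y i - x i))\<bar> \<le> e * (\<Sum>i\<in>I. \<bar>y i - x i\<bar>)"
proof -
  have "\<exists>d>0. \<forall>y\<in>extensional I. (\<forall>i\<in>I. \<bar>y i - x i\<bar> < d) \<longrightarrow> y \<in> S \<and> \<bar>pdiff j f y - pdiff j f x\<bar> < e"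
    if "j \<in> I" for j
    by (rule continuous_map_RnD[OF smooth_onD(1)[OF smooth_onD(3)[OF f that]] I S x e])
  then obtain D where D: "\<And>j. j \<in> I \<Longrightarrow> D j > 0" "\<And>j y. j \<in> I \<Longrightarrow> y \<in> extensional I \<Longrightarrow>
      (\<forall>i\<in>I. \<bar>y i - x i\<bar> < D j) \<Longrightarrow> \<bar>pdiff j f y - pdiff j f x\<bar> < e"
    by metis
  obtain d0 where d0: "d0 > 0" "\<And>y. y \<in> extensional I \<Longrightarrow> (\<And>i. i \<in> I \<Longrightarrow> \<bar>y i - x i\<bar> < d0) \<Longrightarrow> y \<in> S"
    using openin_RnE[OF S I x] by blast
  let ?d = "Min (insert d0 (D ` I))"
  have d: "?d > 0" "?d \<le> d0" "\<And>j. j \<in> I \<Longrightarrow> ?d \<le> D j" using I D d0 by auto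
  have x_ext: "x \<in> extensional I" using openin_Rn_ext S x by blast
  have box: "z \<in> S \<and> (\<forall>i\<in>I. \<bar>pdiff i f z - pdiff i f x\<bar> \<le> e)"
    if z: "z \<in> extensional I" "\<And>i. i \<in> I \<Longrightarrow> \<bar>z i - x i\<bar> < ?d" for z
  proof (intro conjI ballI)
    show "z \<in> S" by (rule d0(2)) (use z d in fastforce)+
    fix j assume j: "j \<in> I"
    have "\<bar>pdiff j f z - pdiff j f x\<bar> < e" by (rule D(2)[OF j]) (use z d(3)[OF j] in fastforce)+
    then show "\<bar>pdiff j f z - pdiff j f x\<bar> \<le> e" by simp
  qed
  show ?thesis
    by (intro exI[of _ ?d] conjI ballI impI d(1)
        smooth_on_box_estimate[OF I f x_ext box, where y' = x]) (use x_ext d(1) in auto)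
qed

lemma smooth_on_locally_Lipschitz:
  assumes I: "finite I" and S: "openin (Rn I) S" and f: "smooth_on I S f" and x: "x \<in> S"
  obtains d L where "d > 0" "L \<ge> 0"
    "\<And>y. y \<in> extensional I \<Longrightarrow> (\<forall>i\<in>I. \<bar>y i - x i\<bar> < d) \<Longrightarrow> y \<in> S"
    "\<And>y y'. y \<in> extensional I \<Longrightarrow> (\<forall>i\<in>I. \<bar>y i - x i\<bar> < d) \<Longrightarrow>
       y' \<in> extensional I \<Longrightarrow> (\<forall>i\<in>I. \<bar>y' i - x i\<bar> < d) \<Longrightarrow>
       \<bar>f y - f y'\<bar> \<le> L * (\<Sum>i\<in>I. \<bar>y i - y' i\<bar>)"
proof -
  have "\<exists>d>0. \<forall>y\<in>extensional I. (\<forall>i\<in>I. \<bar>y i - x i\<bar> < d) \<longrightarrow> y \<in> S \<and> \<bar>pdiff j f y - pdiff j f x\<bar> < 1"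
    if "j \<in> I" for j
    by (rule continuous_map_RnD[OF smooth_onD(1)[OF smooth_onD(3)[OF f that]] I S x]) simp
  then obtain D where D: "\<And>j. j \<in> I \<Longrightarrow> D j > 0" "\<And>j y. j \<in> I \<Longrightarrow> y \<in> extensional I \<Longrightarrow>
      (\<forall>i\<in>I. \<bar>y i - x i\<bar> < D j) \<Longrightarrow> \<bar>pdiff j f y - pdiff j f x\<bar> < 1"
    by metis
  obtain d0 where d0: "d0 > 0" "\<And>y. y \<in> extensional I \<Longrightarrow> (\<And>i. i \<in> I \<Longrightarrow> \<bar>y i - x i\<bar> < d0) \<Longrightarrow> y \<in> S"
    using openin_RnE[OF S I x] by blast
  let ?d = "Min (insert d0 (D ` I))"
  let ?L = "1 + (\<Sum>j\<in>I. \<bar>pdiff j f x\<bar>)"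
  have d: "?d > 0" "?d \<le> d0" "\<And>j. j \<in> I \<Longrightarrow> ?d \<le> D j" using I D d0 by auto
  have x_ext: "x \<in> extensional I" using openin_Rn_ext S x by blast
  have box: "z \<in> S \<and> (\<forall>i\<in>I. \<bar>pdiff i f z - 0\<bar> \<le> ?L)"
    if z: "z \<in> extensional I" "\<And>i. i \<in> I \<Longrightarrow> \<bar>z i - x i\<bar> < ?d" for z
  proof (intro conjI ballI)
    show "z \<in> S" by (rule d0(2)) (use z d in fastforce)+
    fix j assume j: "j \<in> I"
    have "\<bar>pdiff j f z - pdiff j f x\<bar> < 1" by (rule D(2)[OF j]) (use z d(3)[OF j] in fastforce)+
    moreover have "\<bar>pdiff j f x\<bar> \<le> (\<Sum>j\<in>I. \<bar>pdiff j f x\<bar>)"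
      by (rule member_le_sum) (use I j in auto)
    ultimately show "\<bar>pdiff j f z - 0\<bar> \<le> ?L" by simp
  qed
  have est: "\<bar>f y - f y'\<bar> \<le> ?L * (\<Sum>i\<in>I. \<bar>y i - y' i\<bar>)"
    if "y \<in> extensional I" "\<And>i. i \<in> I \<Longrightarrow> \<bar>y i - x i\<bar> < ?d"
      "y' \<in> extensional I" "\<And>i. i \<in> I \<Longrightarrow> \<bar>y' i - x i\<bar> < ?d" for y y'
  proof -
    have "\<bar>f y - f y' - (\<Sum>i\<in>I. 0 * (y i - y' i))\<bar> \<le> ?L * (\<Sum>i\<in>I. \<bar>y i - y' i\<bar>)"
      by (rule smooth_on_box_estimate[OF I f x_ext _ that]) (rule box)
    then show ?thesis by simp
  qed
  have "?L \<ge> 0" by (intro add_nonneg_nonneg sum_nonneg) auto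
  then show thesis
    by (rule that[OF d(1)]) (use box est in blast)+
qed

text \<open>
  The total differential turns continuous partial derivatives into the chain rule along a differentiable curve of
  coordinates: the remainder is small against the increments of the coordinates, which are bounded by a multiple of the
  increment of the parameter.
\<close>

lemma smooth_on_chain_rule:
  assumes J: "finite J" and T: "openin (Rn J) T" and f: "smooth_on J T f"
    and w0: "w t0 \<in> T" and w: "\<And>t. w t \<in> extensional J"
    and D: "\<And>j. j \<in> J \<Longrightarrow> ((\<lambda>t. w t j) has_real_derivative d j) (at t0)"
  shows "((\<lambda>t. f (w t)) has_real_derivative (\<Sum>j\<in>J. pdiff j f (w t0) * d j)) (at t0)"
proof -
  define c where "c j = pdiff j f (w t0)" for j
  define r where "r t = f (w t) - f (w t0) - (\<Sum>j\<in>J. c j * (w t j - w t0 j))" for t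
  define C where "C = (\<Sum>j\<in>J. \<bar>d j\<bar> + 1)"
  have C: "C \<ge> 0" unfolding C_def by (rule sum_nonneg) auto
  have slope: "\<forall>\<^sub>F t in at t0. (\<Sum>j\<in>J. \<bar>w t j - w t0 j\<bar>) \<le> C * \<bar>t - t0\<bar>"
  proof -
    have "\<forall>\<^sub>F t in at t0. \<bar>w t j - w t0 j\<bar> \<le> (\<bar>d j\<bar> + 1) * \<bar>t - t0\<bar>" if "j \<in> J" for j
    proof -
      have lim: "((\<lambda>t. (w t j - w t0 j) / (t - t0)) \<longlongrightarrow> d j) (at t0)"
        using D[OF that] by (simp add: has_field_derivative_iff)
      have "\<forall>\<^sub>F t in at t0. dist ((w t j - w t0 j) / (t - t0)) (d j) < 1"
        by (rule tendstoD[OF lim]) simp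
      moreover have "\<forall>\<^sub>F t in at t0. t \<noteq> t0" by (simp add: eventually_at_filter)
      ultimately show ?thesis
      proof eventually_elim
        case (elim t)
        have "\<bar>(w t j - w t0 j) / (t - t0)\<bar> \<le> \<bar>d j\<bar> + 1" using elim(1) unfolding dist_real_def by linarith
        then show ?case using elim by (simp add: abs_divide field_simps)
      qed
    qed
    then have "\<forall>\<^sub>F t in at t0. \<forall>j\<in>J. \<bar>w t j - w t0 j\<bar> \<le> (\<bar>d j\<bar> + 1) * \<bar>t - t0\<bar>"
      by (simp add: eventually_ball_finite[OF J])
    then show ?thesis
      by eventually_elim (auto simp: C_def sum_distrib_right intro: sum_mono)
  qed
  have near: "\<forall>\<^sub>F t in at t0. \<forall>j\<in>J. \<bar>w t j - w t0 j\<bar> < \<delta>" if "\<delta> > 0" for \<delta>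
  proof (rule eventually_ball_finite[OF J], rule ballI)
    fix j assume "j \<in> J"
    have "isCont (\<lambda>t. w t j) t0" using D[OF \<open>j \<in> J\<close>] DERIV_isCont by blast
    then show "\<forall>\<^sub>F t in at t0. \<bar>w t j - w t0 j\<bar> < \<delta>"
      using that unfolding isCont_def tendsto_iff dist_real_def by blast
  qed
  have "((\<lambda>t. r t / (t - t0)) \<longlongrightarrow> 0) (at t0)"
  proof (rule tendstoI)
    fix e :: real assume e: "e > 0"
    \<comment> \<open>\<open>C\<close> bounds the slopes of the coordinates and may vanish.\<close>
    let ?e = "e / (C + 1)"
    have e': "?e > 0" using e C by auto
    obtain \<delta> where \<delta>: "\<delta> > 0" "\<And>y. y \<in> extensional J \<Longrightarrow> (\<forall>i\<in>J. \<bar>y i - w t0 i\<bar> < \<delta>) \<Longrightarrow>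
      \<bar>f y - f (w t0) - (\<Sum>i\<in>J. c i * (y i - w t0 i))\<bar> \<le> ?e * (\<Sum>i\<in>J. \<bar>y i - w t0 i\<bar>)"
      using smooth_on_total_differential[OF J T f w0 e'] unfolding c_def by blast
    have "\<forall>\<^sub>F t in at t0. t \<noteq> t0" by (simp add: eventually_at_filter)
    with slope near[OF \<delta>(1)] show "\<forall>\<^sub>F t in at t0. dist (r t / (t - t0)) 0 < e"
    proof eventually_elim
      case (elim t)
      have "\<bar>r t\<bar> \<le> ?e * (\<Sum>i\<in>J. \<bar>w t i - w t0 i\<bar>)" unfolding r_def by (rule \<delta>(2)[OF w]) (use elim in auto)
      also have "\<dots> \<le> ?e * (C * \<bar>t - t0\<bar>)" using elim e' by (intro mult_left_mono) auto
      also have "\<dots> < e * \<bar>t - t0\<bar>"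
      proof -
        have "?e * C < e" using e C by (simp add: field_simps)
        then show ?thesis using elim(3) by (metis mult.assoc mult_strict_right_mono zero_less_abs_iff right_minus_eq)
      qed
      finally show ?case using elim(3) by (simp add: abs_divide field_simps)
    qed
  qed
  then have "(r has_real_derivative 0) (at t0)"
    by (simp add: has_field_derivative_iff r_def)
  moreover have "((\<lambda>t. \<Sum>j\<in>J. c j * (w t j - w t0 j)) has_real_derivative (\<Sum>j\<in>J. c j * d j)) (at t0)"
    by (auto intro!: derivative_eq_intros D sum.cong)
  ultimately have "((\<lambda>t. r t + (\<Sum>j\<in>J. c j * (w t j - w t0 j)) + f (w t0)) has_real_derivative 0 + (\<Sum>j\<in>J. c j * d j) + 0) (at t0)"
    by (intro DERIV_add DERIV_const)
  then show ?thesis by (simp add: r_def c_def)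
qed

lemma continuous_map_Rn_comp:
  assumes "continuous_map (subtopology (Rn J) T) euclideanreal f"
    and "\<And>j. j \<in> J \<Longrightarrow> continuous_map (subtopology (Rn I) S) euclideanreal (\<lambda>x. u x j)"
    and "\<And>x. x \<in> S \<Longrightarrow> u x \<in> T" "\<And>x. u x \<in> extensional J"
  shows "continuous_map (subtopology (Rn I) S) euclideanreal (\<lambda>x. f (u x))"
proof -
  have "continuous_map (subtopology (Rn I) S) (Rn J) u"
    unfolding continuous_map_componentwise using assms by auto
  then have "continuous_map (subtopology (Rn I) S) (subtopology (Rn J) T) u"
    unfolding continuous_map_in_subtopology using assms by auto
  from continuous_map_compose[OF this assms(1)] show ?thesis by (simp add: o_def)
qed

text \<open>
  Composition: the products \<open>(f \<circ> u) g\<close>, with \<open>f\<close> and \<open>g\<close> ranging over all smooth functions, span a class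
  that the chain rule keeps closed under partial derivatives.
\<close>

lemma smooth_on_compose:
  assumes S: "openin (Rn I) S" "finite I" and T: "openin (Rn J) T" "finite J"
    and f: "smooth_on J T f" and u: "\<And>j. j \<in> J \<Longrightarrow> smooth_on I S (\<lambda>x. u x j)"
    and uT: "\<And>x. x \<in> S \<Longrightarrow> u x \<in> T"
  shows "smooth_on I S (\<lambda>x. f (u x))"
proof -
  define v where "v x = restrict (u x) J" for x
  have v: "\<And>j. j \<in> J \<Longrightarrow> smooth_on I S (\<lambda>x. v x j)" unfolding v_def using u by simp
  have v_ext: "v x \<in> extensional J" for x by (simp add: v_def)
  have vT: "v x = u x" if "x \<in> S" for x
    using openin_Rn_ext[OF T(1) uT[OF that]] by (simp add: v_def extensional_restrict)
  let ?B = "{\<lambda>x. f (v x) * g x | f g. smooth_on J T f \<and> smooth_on I S g}"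
  have B: "(\<lambda>x. f (v x) * g x) \<in> sums_of ?B" if "smooth_on J T f" "smooth_on I S g" for f g
    by (rule sums_of.base, rule CollectI, rule exI[of _ f], rule exI[of _ g]) (use that in auto)
  have A: "smooth_on I S (\<lambda>x. f (v x) * 1)"
  proof (rule smooth_on_sums_of[where B = ?B, OF S])
    show "(\<lambda>x. f (v x) * 1) \<in> sums_of ?B"
      by (rule B[OF f smooth_on_const[OF S]])
    fix h assume "h \<in> ?B"
    then obtain f g where fg: "smooth_on J T f" "smooth_on I S g" "h = (\<lambda>x. f (v x) * g x)" by blast
    have "continuous_map (subtopology (Rn I) S) euclideanreal (\<lambda>x. f (v x))"
      by (rule continuous_map_Rn_comp[OF smooth_onD(1)[OF fg(1)]])
        (use smooth_onD(1) v v_ext vT uT in auto)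
    then show "continuous_map (subtopology (Rn I) S) euclideanreal h"
      unfolding fg(3) by (rule continuous_map_real_mult[OF _ smooth_onD(1)[OF fg(2)]])
    fix i assume i: "i \<in> I"
    let ?k = "\<lambda>x. (\<Sum>j\<in>J. pdiff j f (v x) * (pdiff i (\<lambda>x. v x j) x * g x)) + f (v x) * pdiff i g x"
    show "\<exists>k \<in> sums_of ?B. \<forall>x\<in>S. ((\<lambda>t. h (x(i := t))) has_real_derivative k x) (at (x i))"
    proof (intro bexI[of _ ?k] ballI)
      have "smooth_on I S (\<lambda>x. pdiff i (\<lambda>x. v x j) x * g x)" if "j \<in> J" for j
        by (intro smooth_on_mult[OF S] smooth_onD(3)[OF v] fg i that)
      then show "?k \<in> sums_of ?B"
        by (intro sums_of.add sums_of_sum T(2) B smooth_onD(3) fg i)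
      fix x assume x: "x \<in> S"
      have "((\<lambda>t. f (v (x(i := t)))) has_real_derivative (\<Sum>j\<in>J. pdiff j f (v (x(i := x i))) * pdiff i (\<lambda>x. v x j) x)) (at (x i))"
        by (rule smooth_on_chain_rule[OF T(2,1) fg(1)])
          (use x vT uT v_ext smooth_on_has_deriv[OF v x i] in auto)
      note D = DERIV_mult[OF this smooth_on_has_deriv[OF fg(2) x i]]
      have eq: "(\<Sum>j\<in>J. pdiff j f (v (x(i := x i))) * pdiff i (\<lambda>x. v x j) x) * g (x(i := x i)) +
          pdiff i g x * f (v (x(i := x i))) = ?k x"
        by (simp add: sum_distrib_right sum_distrib_left mult_ac)
      show "((\<lambda>t. h (x(i := t))) has_real_derivative ?k x) (at (x i))"
        unfolding fg(3) by (rule DERIV_cong[OF D eq])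
    qed
  qed
  show ?thesis by (rule smooth_on_cong[OF S A]) (simp add: vT)
qed

text \<open>Symmetry of second derivatives, from two evaluations of the same double difference.\<close>

lemma double_difference:
  assumes f: "smooth_on I S f" and ij: "i \<in> I" "j \<in> I" "i \<noteq> j" and h: "h > 0" and x: "x \<in> extensional I"
    and box: "\<And>z. z \<in> extensional I \<Longrightarrow> (\<And>l. l \<in> I \<Longrightarrow> \<bar>z l - x l\<bar> \<le> h) \<Longrightarrow> z \<in> S"
  obtains z where "z \<in> extensional I" "\<And>l. l \<in> I \<Longrightarrow> \<bar>z l - x l\<bar> \<le> h"
    "f (x(i := x i + h, j := x j + h)) - f (x(i := x i + h)) - (f (x(j := x j + h)) - f x)
       = h * h * pdiff j (pdiff i f) z"
proof -
  have inS: "x(i := s, j := t) \<in> S" if "\<bar>s - x i\<bar> \<le> h" "\<bar>t - x j\<bar> \<le> h" for s t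
    by (rule box) (use that x ij h in \<open>auto simp: extensional_def\<close>)
  have D: "((\<lambda>s. g (x(i := s, j := t))) has_real_derivative pdiff i g (x(i := s, j := t))) (at s)"
    if "smooth_on I S g" "\<bar>s - x i\<bar> \<le> h" "\<bar>t - x j\<bar> \<le> h" for g s t
    using smooth_on_has_deriv[OF that(1) inS[OF that(2,3)] ij(1)] ij(3)
    by (simp add: fun_upd_twist)
  have D2: "((\<lambda>t. g (x(i := s, j := t))) has_real_derivative pdiff j g (x(i := s, j := t))) (at t)"
    if "smooth_on I S g" "\<bar>s - x i\<bar> \<le> h" "\<bar>t - x j\<bar> \<le> h" for g s t
    using smooth_on_has_deriv[OF that(1) inS[OF that(2,3)] ij(2)] by simp
  have "\<exists>s. x i < s \<and> s < x i + h \<and>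
      (f (x(i := x i + h, j := x j + h)) - f (x(i := x i + h, j := x j))) - (f (x(i := x i, j := x j + h)) - f (x(i := x i, j := x j)))
      = (x i + h - x i) * (pdiff i f (x(i := s, j := x j + h)) - pdiff i f (x(i := s, j := x j)))"
    by (rule MVT2[where f = "\<lambda>s. f (x(i := s, j := x j + h)) - f (x(i := s, j := x j))"])
      (use h in \<open>auto intro!: DERIV_diff D[OF f]\<close>)
  then obtain s where s: "x i < s" "s < x i + h"
    "(f (x(i := x i + h, j := x j + h)) - f (x(i := x i + h, j := x j))) - (f (x(i := x i, j := x j + h)) - f (x(i := x i, j := x j)))
      = h * (pdiff i f (x(i := s, j := x j + h)) - pdiff i f (x(i := s, j := x j)))"
    by auto
  have "\<exists>t. x j < t \<and> t < x j + h \<and>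
      pdiff i f (x(i := s, j := x j + h)) - pdiff i f (x(i := s, j := x j))
      = (x j + h - x j) * pdiff j (pdiff i f) (x(i := s, j := t))"
    by (rule MVT2[where f = "\<lambda>t. pdiff i f (x(i := s, j := t))"])
      (use h s in \<open>auto intro!: D2 smooth_onD(3)[OF f ij(1)]\<close>)
  then obtain t where t: "x j < t" "t < x j + h"
      "pdiff i f (x(i := s, j := x j + h)) - pdiff i f (x(i := s, j := x j)) = h * pdiff j (pdiff i f) (x(i := s, j := t))"
    by auto
  have e: "x(i := c, j := x j) = x(i := c)" for c using ij(3) by auto
  show thesis
  proof (rule that)
    show "x(i := s, j := t) \<in> extensional I" using x ij by (auto simp: extensional_def)
    show "\<bar>(x(i := s, j := t)) l - x l\<bar> \<le> h" for l using s t h by auto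
    show "f (x(i := x i + h, j := x j + h)) - f (x(i := x i + h)) - (f (x(j := x j + h)) - f x)
       = h * h * pdiff j (pdiff i f) (x(i := s, j := t))"
      using s(3) t(3) e by simp
  qed
qed

lemma pdiff_commute:
  assumes I: "finite I" and S: "openin (Rn I) S" and f: "smooth_on I S f" and x: "x \<in> S"
    and ij: "i \<in> I" "j \<in> I"
  shows "pdiff i (pdiff j f) x = pdiff j (pdiff i f) x"
proof (cases "i = j")
  case False
  let ?a = "pdiff j (pdiff i f)" and ?b = "pdiff i (pdiff j f)"
  have ext: "x \<in> extensional I" using openin_Rn_ext[OF S x] .
  have "\<bar>?a x - ?b x\<bar> \<le> 2 * e" if e: "e > 0" for e
  proof -
    have sm: "smooth_on I S ?a" "smooth_on I S ?b" by (intro smooth_onD(3) f ij)+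
    obtain d1 where d1: "d1 > 0" "\<forall>y\<in>extensional I. (\<forall>i\<in>I. \<bar>y i - x i\<bar> < d1) \<longrightarrow> y \<in> S \<and> \<bar>?a y - ?a x\<bar> < e"
      using continuous_map_RnD[OF smooth_onD(1)[OF sm(1)] I S x e] by blast
    obtain d2 where d2: "d2 > 0" "\<forall>y\<in>extensional I. (\<forall>i\<in>I. \<bar>y i - x i\<bar> < d2) \<longrightarrow> y \<in> S \<and> \<bar>?b y - ?b x\<bar> < e"
      using continuous_map_RnD[OF smooth_onD(1)[OF sm(2)] I S x e] by blast
    define h where "h = min d1 d2 / 2"
    have h: "h > 0" "h < d1" "h < d2" using d1(1) d2(1) by (auto simp: h_def)
    have box: "z \<in> S" "\<bar>?a z - ?a x\<bar> < e" "\<bar>?b z - ?b x\<bar> < e"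
      if "z \<in> extensional I" "\<And>l. l \<in> I \<Longrightarrow> \<bar>z l - x l\<bar> \<le> h" for z
    proof -
      have "\<forall>l\<in>I. \<bar>z l - x l\<bar> < d1" "\<forall>l\<in>I. \<bar>z l - x l\<bar> < d2" using that(2) h by fastforce+
      then show "z \<in> S" "\<bar>?a z - ?a x\<bar> < e" "\<bar>?b z - ?b x\<bar> < e" using d1(2) d2(2) that(1) by auto
    qed
    obtain z where z: "z \<in> extensional I" "\<And>l. l \<in> I \<Longrightarrow> \<bar>z l - x l\<bar> \<le> h"
      "f (x(i := x i + h, j := x j + h)) - f (x(i := x i + h)) - (f (x(j := x j + h)) - f x) = h * h * ?a z"
      using double_difference[OF f ij False h(1) ext box(1)] by metis
    obtain w where w: "w \<in> extensional I" "\<And>l. l \<in> I \<Longrightarrow> \<bar>w l - x l\<bar> \<le> h"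
      "f (x(j := x j + h, i := x i + h)) - f (x(j := x j + h)) - (f (x(i := x i + h)) - f x) = h * h * ?b w"
      using double_difference[OF f ij(2,1) not_sym[OF False] h(1) ext box(1)] by metis
    have "x(j := x j + h, i := x i + h) = x(i := x i + h, j := x j + h)" using False by (auto simp: fun_upd_twist)
    then have "f (x(j := x j + h, i := x i + h)) = f (x(i := x i + h, j := x j + h))" by simp
    then have "h * h * ?a z = h * h * ?b w" using z(3) w(3) by linarith
    then have "?a z = ?b w" using h(1) by simp
    then show ?thesis using box(2)[OF z(1,2)] box(3)[OF w(1,2)] by linarith
  qed
  \<comment> \<open>A quarter of the difference contradicts the bound by \<open>2 e\<close>, unless it is zero.\<close>
  from this[of "\<bar>?a x - ?b x\<bar> / 4"] show ?thesis by (cases "?a x = ?b x") auto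
qed simp

lemma smooth_on_pdiffs: "smooth_on I S f \<Longrightarrow> is \<in> lists I \<Longrightarrow> smooth_on I S (pdiffs is f)"
  by (induction "is") (simp_all add: smooth_onD(3))

lemma pdiff_pdiffs_commute:
  assumes I: "finite I" and S: "openin (Rn I) S" and f: "smooth_on I S f" and x: "x \<in> S"
    and i: "i \<in> I" and "is": "is \<in> lists I"
  shows "pdiff i (pdiffs is f) x = pdiffs is (pdiff i f) x"
  using "is" x
proof (induction "is" arbitrary: x)
  case (Cons j "is")
  have j: "j \<in> I" using Cons by simp
  have sm: "smooth_on I S (pdiffs is f)"
    using smooth_on_pdiffs[OF f] Cons by simp
  have "pdiff i (pdiffs (j # is) f) x = pdiff j (pdiff i (pdiffs is f)) x"
    using pdiff_commute[OF I S sm \<open>x \<in> S\<close> i j] by simp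
  also have "\<dots> = pdiffs (j # is) (pdiff i f) x"
    using pdiff_cong[OF S I \<open>x \<in> S\<close> j Cons.IH] by simp
  finally show ?case .
qed simp


section \<open>Smooth functions of one real variable and their jets\<close>

definition smooth_real_on :: "real set \<Rightarrow> (real \<Rightarrow> real) \<Rightarrow> bool" where
  "smooth_real_on S f \<longleftrightarrow> (\<forall>n. \<forall>t\<in>S. (deriv ^^ n) f differentiable (at t))"

text \<open>The bridge to the coordinate space of dimension one, through which the closure properties are inherited.\<close>

lemma pdiffs_unit: "pdiffs is (\<lambda>z. f (z ())) = (\<lambda>z. (deriv ^^ length is) f (z ()))"
  by (induction "is") (auto simp: pdiff_def)

lemma openin_Rn_unit: "openin (Rn (UNIV :: unit set)) {z. z () \<in> S} \<longleftrightarrow> open S"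
proof
  assume *: "openin (Rn (UNIV :: unit set)) {z. z () \<in> S}"
  show "open S" unfolding open_dist
  proof
    fix t assume "t \<in> S"
    then obtain e where e: "e > 0" "\<And>y. y \<in> extensional UNIV \<Longrightarrow> (\<And>i. i \<in> UNIV \<Longrightarrow> \<bar>y i - t\<bar> < e) \<Longrightarrow> y \<in> {z. z () \<in> S}"
      using openin_RnE[OF *, of "\<lambda>_. t"] by auto
    have "s \<in> S" if "dist s t < e" for s
      using e(2)[of "\<lambda>_. s"] that by (auto simp: dist_real_def extensional_def)
    then show "\<exists>e>0. \<forall>y. dist y t < e \<longrightarrow> y \<in> S" using e(1) by blast
  qed
next
  assume S: "open S"
  have "\<exists>e>0. \<forall>y\<in>extensional UNIV. (\<forall>i\<in>UNIV. \<bar>y i - x i\<bar> < e) \<longrightarrow> y \<in> {z. z () \<in> S}"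
    if x: "x () \<in> S" for x :: "unit \<Rightarrow> real"
  proof -
    obtain e where "e > 0" "\<And>t. dist t (x ()) < e \<Longrightarrow> t \<in> S" using bspec[OF S[unfolded open_dist] x] by blast
    then show ?thesis by (intro exI[of _ e]) (auto simp: dist_real_def)
  qed
  then show "openin (Rn (UNIV :: unit set)) {z. z () \<in> S}"
    unfolding openin_Rn_iff[OF finite] by (auto simp: extensional_def)
qed

lemma smooth_on_unit_iff: "smooth_on (UNIV :: unit set) {z. z () \<in> S} (\<lambda>z. f (z ())) \<longleftrightarrow> smooth_real_on S f"
proof
  assume *: "smooth_on (UNIV :: unit set) {z. z () \<in> S} (\<lambda>z. f (z ()))"
  show "smooth_real_on S f" unfolding smooth_real_on_def
  proof (intro allI ballI)
    fix n t assume "t \<in> S"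
    then show "(deriv ^^ n) f differentiable (at t)"
      using bspec[OF *[unfolded smooth_on_def], of "replicate n ()"] pdiffs_unit[of "replicate n ()" f]
      by (auto dest!: spec[of _ "\<lambda>_. t"])
  qed
next
  assume *: "smooth_real_on S f"
  show "smooth_on (UNIV :: unit set) {z. z () \<in> S} (\<lambda>z. f (z ()))"
    unfolding smooth_on_def
  proof (intro ballI conjI)
    fix "is" :: "unit list"
    let ?g = "(deriv ^^ length is) f"
    have "continuous_on S ?g"
      using * unfolding smooth_real_on_def
      by (meson continuous_at_imp_continuous_on differentiable_imp_continuous_within)
    then have "continuous_map (subtopology euclideanreal S) euclideanreal ?g" by simp
    moreover have "continuous_map (subtopology (Rn (UNIV :: unit set)) {z. z () \<in> S}) (subtopology euclideanreal S) (\<lambda>z. z ())"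
      unfolding continuous_map_in_subtopology
      by (auto intro: continuous_map_from_subtopology continuous_map_product_projection)
    ultimately have "continuous_map (subtopology (Rn (UNIV :: unit set)) {z. z () \<in> S}) euclideanreal (?g \<circ> (\<lambda>z. z ()))"
      using continuous_map_compose by blast
    then show "continuous_map (subtopology (Rn (UNIV :: unit set)) {z. z () \<in> S}) euclideanreal (pdiffs is (\<lambda>z. f (z ())))"
      unfolding pdiffs_unit by (simp add: o_def)
    fix x i assume "x \<in> {z. z () \<in> S}"
    then show "(\<lambda>t. pdiffs is (\<lambda>z. f (z ())) (x(i := t))) differentiable at (x i)"
      unfolding pdiffs_unit using * by (auto simp: smooth_real_on_def)
  qed
qed

lemma smooth_real_on_compose_Rn:
  assumes S: "open S" and T: "openin (Rn J) T" "finite J" and f: "smooth_on J T f"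
    and u: "\<And>j. j \<in> J \<Longrightarrow> smooth_real_on S (\<lambda>t. u t j)" and uT: "\<And>t. t \<in> S \<Longrightarrow> u t \<in> T"
  shows "smooth_real_on S (\<lambda>t. f (u t))"
proof -
  have "smooth_on (UNIV :: unit set) {z. z () \<in> S} (\<lambda>z. f ((\<lambda>z. u (z ())) z))"
    by (rule smooth_on_compose[OF _ _ T f])
      (use S u uT in \<open>auto simp: openin_Rn_unit smooth_on_unit_iff[where f = "\<lambda>t. u t _"]\<close>)
  then show ?thesis using smooth_on_unit_iff[of S "\<lambda>t. f (u t)"] by simp
qed

lemma smooth_real_on_compose:
  assumes "open S" "open T" "smooth_real_on T f" "smooth_real_on S u" "\<And>t. t \<in> S \<Longrightarrow> u t \<in> T"
  shows "smooth_real_on S (\<lambda>t. f (u t))"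
  using smooth_real_on_compose_Rn[of S "UNIV :: unit set" "{z. z () \<in> T}" "\<lambda>z. f (z ())" "\<lambda>t _. u t"] assms
  by (simp add: openin_Rn_unit smooth_on_unit_iff)

lemma smooth_real_on_add:
  assumes "open S" "smooth_real_on S f" "smooth_real_on S g"
  shows "smooth_real_on S (\<lambda>t. f t + g t)"
  using smooth_on_add[of "UNIV :: unit set" "{z. z () \<in> S}" "\<lambda>z. f (z ())" "\<lambda>z. g (z ())"] assms
    smooth_on_unit_iff[of S "\<lambda>t. f t + g t"]
  by (simp add: openin_Rn_unit smooth_on_unit_iff)

lemma smooth_real_on_mult:
  assumes "open S" "smooth_real_on S f" "smooth_real_on S g"
  shows "smooth_real_on S (\<lambda>t. f t * g t)"
  using smooth_on_mult[of "UNIV :: unit set" "{z. z () \<in> S}" "\<lambda>z. f (z ())" "\<lambda>z. g (z ())"] assms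
    smooth_on_unit_iff[of S "\<lambda>t. f t * g t"]
  by (simp add: openin_Rn_unit smooth_on_unit_iff)

lemma smooth_real_on_const: "open S \<Longrightarrow> smooth_real_on S (\<lambda>_. c)"
  using smooth_on_const[of "UNIV :: unit set" "{z. z () \<in> S}" c] smooth_on_unit_iff[of S "\<lambda>_. c"]
  by (simp add: openin_Rn_unit)

lemma smooth_real_on_ident: "open S \<Longrightarrow> smooth_real_on S (\<lambda>t. t)"
  using smooth_on_coord[of "UNIV :: unit set" "{z. z () \<in> S}" "()"] smooth_on_unit_iff[of S "\<lambda>t. t"]
  by (simp add: openin_Rn_unit)

lemma smooth_real_on_sum:
  assumes "open S" "\<And>j. j \<in> J \<Longrightarrow> smooth_real_on S (f j)"
  shows "smooth_real_on S (\<lambda>t. \<Sum>j\<in>J. f j t)"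
  using smooth_on_sum[of "UNIV :: unit set" "{z. z () \<in> S}" J "\<lambda>j z. f j (z ())"] assms
    smooth_on_unit_iff[of S "\<lambda>t. \<Sum>j\<in>J. f j t"]
  by (simp add: openin_Rn_unit smooth_on_unit_iff)

lemma smooth_real_on_power: "open S \<Longrightarrow> smooth_real_on S f \<Longrightarrow> smooth_real_on S (\<lambda>t. f t ^ n)"
  by (induction n) (auto intro: smooth_real_on_const smooth_real_on_mult)

lemma smooth_real_on_mono: "smooth_real_on S f \<Longrightarrow> S' \<subseteq> S \<Longrightarrow> smooth_real_on S' f"
  by (auto simp: smooth_real_on_def)

lemma smooth_real_on_deriv: "smooth_real_on S f \<Longrightarrow> smooth_real_on S (deriv f)"
  unfolding smooth_real_on_def by (metis funpow_Suc_right o_apply)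

lemma smooth_real_on_derivs: "smooth_real_on S f \<Longrightarrow> smooth_real_on S ((deriv ^^ n) f)"
  by (induction n) (auto intro: smooth_real_on_deriv)

lemma smooth_real_on_has_deriv: "smooth_real_on S f \<Longrightarrow> t \<in> S \<Longrightarrow> (f has_real_derivative deriv f t) (at t)"
  unfolding smooth_real_on_def DERIV_deriv_iff_real_differentiable by (metis funpow_0)

lemma eventually_nhds_open: "open S \<Longrightarrow> t \<in> S \<Longrightarrow> \<forall>\<^sub>F s in nhds t. s \<in> S"
  by (auto simp: eventually_nhds)

lemma derivs_cong:
  fixes f g :: "real \<Rightarrow> real"
  assumes "open S" "t \<in> S" "\<And>s. s \<in> S \<Longrightarrow> f s = g s"
  shows "(deriv ^^ n) f t = (deriv ^^ n) g t"
  by (rule higher_deriv_cong_ev[OF eventually_mono[OF eventually_nhds_open[OF assms(1,2)]]]) (use assms in auto)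

lemma smooth_real_on_cong:
  assumes "open S" "smooth_real_on S f" "\<And>s. s \<in> S \<Longrightarrow> g s = f s"
  shows "smooth_real_on S g"
  unfolding smooth_real_on_def
proof (intro allI ballI)
  fix n t assume t: "t \<in> S"
  have "\<forall>\<^sub>F s in nhds t. (deriv ^^ n) g s = (deriv ^^ n) f s"
    by (rule eventually_mono[OF eventually_nhds_open[OF assms(1) t]]) (use derivs_cong[OF assms(1)] assms(3) in blast)
  then show "(deriv ^^ n) g differentiable at t"
    by (rule differentiable_cong_ev) (use assms(2) t in \<open>auto simp: smooth_real_on_def\<close>)
qed

lemma funpow_deriv_Suc: "(deriv ^^ Suc n) f = (deriv ^^ n) (deriv f)"
  by (simp only: funpow_Suc_right o_apply)

lemma derivs_scale:
  assumes "smooth_real_on S f" "open S" "c * t \<in> S"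
  shows "(deriv ^^ n) (\<lambda>t. f (c * t)) t = c ^ n * (deriv ^^ n) f (c * t)"
  using assms(3)
proof (induction n arbitrary: t)
  case (Suc n)
  have o: "open {t. c * t \<in> S}" using open_vimage[OF assms(2), of "\<lambda>t. c * t"] by (simp add: vimage_def continuous_intros)
  have "(deriv ^^ Suc n) (\<lambda>t. f (c * t)) t = deriv ((deriv ^^ n) (\<lambda>t. f (c * t))) t" by simp
  also have "\<dots> = deriv (\<lambda>t. c ^ n * (deriv ^^ n) f (c * t)) t"
    by (rule deriv_cong_ev[OF eventually_mono[OF eventually_nhds_open[OF o]]]) (use Suc in auto)
  also have "\<dots> = c ^ n * ((deriv ((deriv ^^ n) f) (c * t)) * c)"
  proof (rule DERIV_imp_deriv, rule DERIV_cmult, rule DERIV_chain2[where g = "\<lambda>t. c * t"])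
    show "((deriv ^^ n) f has_real_derivative deriv ((deriv ^^ n) f) (c * t)) (at (c * t))"
      by (rule smooth_real_on_has_deriv[OF smooth_real_on_derivs[OF assms(1)] Suc.prems])
  qed (auto intro!: derivative_eq_intros)
  finally show ?case by (simp add: algebra_simps)
qed simp

lemma derivs_cmult:
  assumes "smooth_real_on S f" "open S" "t \<in> S"
  shows "(deriv ^^ n) (\<lambda>t. c * f t) t = c * (deriv ^^ n) f t"
  using assms(3)
proof (induction n arbitrary: t)
  case (Suc n)
  have "(deriv ^^ Suc n) (\<lambda>t. c * f t) t = deriv (\<lambda>t. c * (deriv ^^ n) f t) t"
    unfolding funpow.simps o_apply
    by (rule deriv_cong_ev[OF eventually_mono[OF eventually_nhds_open[OF assms(2) Suc.prems]]]) (use Suc.IH in auto)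
  also have "\<dots> = c * (deriv ^^ Suc n) f t"
    using DERIV_imp_deriv[OF DERIV_cmult[OF smooth_real_on_has_deriv[OF smooth_real_on_derivs[OF assms(1)] Suc.prems]]] by simp
  finally show ?case .
qed simp

text \<open>
  The factor \<open>n\<close> at \<open>t = 0\<close> is the one by which the coordinates of the jet of \<open>t b(t)\<close> differ from those of \<open>b\<close>.
\<close>

lemma derivs_times_ident:
  assumes "smooth_real_on S f" "open S" "t \<in> S"
  shows "(deriv ^^ n) (\<lambda>t. t * f t) t = t * (deriv ^^ n) f t + real n * (deriv ^^ (n - 1)) f t"
  using assms(3)
proof (induction n arbitrary: t)
  case (Suc n)
  have "(deriv ^^ Suc n) (\<lambda>t. t * f t) t = deriv (\<lambda>t. t * (deriv ^^ n) f t + real n * (deriv ^^ (n - 1)) f t) t"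
    unfolding funpow.simps o_apply
    by (rule deriv_cong_ev[OF eventually_mono[OF eventually_nhds_open[OF assms(2) Suc.prems]]]) (use Suc.IH in auto)
  also have "\<dots> = t * (deriv ^^ Suc n) f t + real (Suc n) * (deriv ^^ n) f t"
  proof (rule DERIV_imp_deriv)
    have 1: "((deriv ^^ m) f has_real_derivative (deriv ^^ Suc m) f t) (at t)" for m
      using smooth_real_on_has_deriv[OF smooth_real_on_derivs[OF assms(1)] Suc.prems] by simp
    have 2: "real n * (deriv ^^ Suc (n - 1)) f t = real n * (deriv ^^ n) f t" by (cases n) auto
    have "((\<lambda>t. t * (deriv ^^ n) f t + real n * (deriv ^^ (n - 1)) f t) has_real_derivative
        (1 * (deriv ^^ n) f t + (deriv ^^ Suc n) f t * t) + real n * (deriv ^^ Suc (n - 1)) f t) (at t)"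
      by (intro DERIV_add DERIV_mult DERIV_cmult DERIV_ident 1)
    then show "((\<lambda>t. t * (deriv ^^ n) f t + real n * (deriv ^^ (n - 1)) f t) has_real_derivative
        t * (deriv ^^ Suc n) f t + real (Suc n) * (deriv ^^ n) f t) (at t)"
      unfolding 2 by (simp add: algebra_simps del: funpow.simps)
  qed
  finally show ?case by simp
qed simp

text \<open>
  Monomials provide jets with a single nonzero coordinate.
\<close>

lemma derivs_monomial: "(deriv ^^ \<beta>) (\<lambda>t. t ^ n) (0 :: real) = (if \<beta> = n then fact n else 0)"
proof (induction n arbitrary: \<beta>)
  case 0
  have "(deriv ^^ Suc m) (\<lambda>t :: real. 1 :: real) = (\<lambda>_. 0)" for m by (induction m) auto
  then show ?case by (cases \<beta>) (auto simp del: funpow.simps(2))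
next
  case (Suc n)
  have "(deriv ^^ \<beta>) (\<lambda>t. t * t ^ n) (0 :: real) = real \<beta> * (deriv ^^ (\<beta> - 1)) (\<lambda>t. t ^ n) 0"
    using derivs_times_ident[of UNIV "\<lambda>t. t ^ n" 0 \<beta>] by (simp add: smooth_real_on_power smooth_real_on_ident)
  also have "\<dots> = (if \<beta> = Suc n then fact (Suc n) else 0)" unfolding Suc.IH by (cases \<beta>) auto
  finally show ?case by simp
qed

definition eqjet :: "nat \<Rightarrow> (real \<Rightarrow> real) \<Rightarrow> (real \<Rightarrow> real) \<Rightarrow> bool" where
  "eqjet k f g \<longleftrightarrow> (\<forall>\<alpha>\<le>k. (deriv ^^ \<alpha>) f 0 = (deriv ^^ \<alpha>) g 0)"

lemma eqjet_Suc: "eqjet (Suc k) f g \<longleftrightarrow> f 0 = g 0 \<and> eqjet k (deriv f) (deriv g)"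
proof -
  have "(\<forall>\<alpha>\<le>Suc k. P \<alpha>) \<longleftrightarrow> P 0 \<and> (\<forall>\<alpha>\<le>k. P (Suc \<alpha>))" for P
    by (metis Suc_le_mono le0 not0_implies_Suc)
  from this[of "\<lambda>\<alpha>. (deriv ^^ \<alpha>) f 0 = (deriv ^^ \<alpha>) g 0"] show ?thesis
    by (simp only: eqjet_def funpow_deriv_Suc funpow_0)
qed

lemma eqjet_0: "eqjet 0 f g \<longleftrightarrow> f 0 = g 0" by (simp add: eqjet_def)

lemma eqjet_mono: "eqjet k f g \<Longrightarrow> j \<le> k \<Longrightarrow> eqjet j f g" by (simp add: eqjet_def)

lemma eqjet_refl: "eqjet k f f" by (simp add: eqjet_def)

lemma eqjet_cong:
  assumes "open S" "0 \<in> S" "\<And>t. t \<in> S \<Longrightarrow> f t = f' t" "\<And>t. t \<in> S \<Longrightarrow> g t = g' t"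
  shows "eqjet k f g \<longleftrightarrow> eqjet k f' g'"
  unfolding eqjet_def using derivs_cong[OF assms(1,2), of f f'] derivs_cong[OF assms(1,2), of g g'] assms(3,4) by simp

lemma eqjet_add:
  assumes S: "open S" "0 \<in> S"
  shows "smooth_real_on S f \<Longrightarrow> smooth_real_on S g \<Longrightarrow> smooth_real_on S f' \<Longrightarrow> smooth_real_on S g' \<Longrightarrow>
    eqjet k f f' \<Longrightarrow> eqjet k g g' \<Longrightarrow> eqjet k (\<lambda>t. f t + g t) (\<lambda>t. f' t + g' t)"
proof (induction k arbitrary: f g f' g')
  case (Suc k)
  have d: "deriv (\<lambda>t. f t + g t) t = deriv f t + deriv g t"
    if "t \<in> S" "smooth_real_on S f" "smooth_real_on S g" for f g t
    by (intro DERIV_imp_deriv DERIV_add smooth_real_on_has_deriv[OF that(2,1)] smooth_real_on_has_deriv[OF that(3,1)])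
  have "eqjet k (\<lambda>t. deriv f t + deriv g t) (\<lambda>t. deriv f' t + deriv g' t)"
    by (rule Suc.IH) (use Suc.prems in \<open>auto intro: smooth_real_on_deriv simp: eqjet_Suc\<close>)
  then show ?case
    unfolding eqjet_Suc using eqjet_cong[OF S, of "deriv (\<lambda>t. f t + g t)" _ "deriv (\<lambda>t. f' t + g' t)"] d Suc.prems
    by (auto simp: eqjet_Suc)
qed (auto simp: eqjet_0)

lemma eqjet_mult:
  assumes S: "open S" "0 \<in> S"
  shows "smooth_real_on S f \<Longrightarrow> smooth_real_on S g \<Longrightarrow> smooth_real_on S f' \<Longrightarrow> smooth_real_on S g' \<Longrightarrow>
    eqjet k f f' \<Longrightarrow> eqjet k g g' \<Longrightarrow> eqjet k (\<lambda>t. f t * g t) (\<lambda>t. f' t * g' t)"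
proof (induction k arbitrary: f g f' g')
  case (Suc k)
  have d: "deriv (\<lambda>t. f t * g t) t = deriv f t * g t + deriv g t * f t"
    if "t \<in> S" "smooth_real_on S f" "smooth_real_on S g" for f g t
    by (intro DERIV_imp_deriv DERIV_mult smooth_real_on_has_deriv[OF that(2,1)] smooth_real_on_has_deriv[OF that(3,1)])
  have 1: "eqjet k f f'" "eqjet k g g'" "eqjet k (deriv f) (deriv f')" "eqjet k (deriv g) (deriv g')"
    using Suc.prems(5,6) eqjet_mono[of "Suc k"] by (auto simp: eqjet_Suc[symmetric]) (auto simp: eqjet_Suc)
  have "eqjet k (\<lambda>t. deriv f t * g t + deriv g t * f t) (\<lambda>t. deriv f' t * g' t + deriv g' t * f' t)"
    by (intro eqjet_add[OF S] Suc.IH smooth_real_on_mult smooth_real_on_deriv S Suc.prems 1)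
  then show ?case
    unfolding eqjet_Suc using eqjet_cong[OF S, of "deriv (\<lambda>t. f t * g t)" _ "deriv (\<lambda>t. f' t * g' t)"] d Suc.prems
    by (auto simp: eqjet_Suc)
qed (auto simp: eqjet_0)

lemma eqjet_sum:
  assumes S: "open S" "0 \<in> S" and "\<And>j. j \<in> J \<Longrightarrow> smooth_real_on S (f j)" "\<And>j. j \<in> J \<Longrightarrow> smooth_real_on S (g j)"
    "\<And>j. j \<in> J \<Longrightarrow> eqjet k (f j) (g j)"
  shows "eqjet k (\<lambda>t. \<Sum>j\<in>J. f j t) (\<lambda>t. \<Sum>j\<in>J. g j t)"
  using assms(3-)
proof (induction J rule: infinite_finite_induct)
  case (insert j J)
  have "eqjet k (\<lambda>t. f j t + (\<Sum>j\<in>J. f j t)) (\<lambda>t. g j t + (\<Sum>j\<in>J. g j t))"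
    by (rule eqjet_add[OF S]) (use insert S in \<open>auto intro: smooth_real_on_sum\<close>)
  then show ?case using insert.hyps by simp
qed (simp_all add: eqjet_refl)

text \<open>The jet of \<open>f \<circ> u\<close> depends on the jet of \<open>u\<close> only: differentiate once and use induction.\<close>

lemma eqjet_compose:
  assumes S: "open S" "0 \<in> S" and T: "openin (Rn J) T" "finite J" and f: "smooth_on J T f"
    and u: "\<And>j. j \<in> J \<Longrightarrow> smooth_real_on S (\<lambda>t. u t j)" "\<And>t. t \<in> S \<Longrightarrow> u t \<in> T"
    and v: "\<And>j. j \<in> J \<Longrightarrow> smooth_real_on S (\<lambda>t. v t j)" "\<And>t. t \<in> S \<Longrightarrow> v t \<in> T"
    and uv: "\<And>j. j \<in> J \<Longrightarrow> eqjet k (\<lambda>t. u t j) (\<lambda>t. v t j)"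
  shows "eqjet k (\<lambda>t. f (u t)) (\<lambda>t. f (v t))"
proof -
  have "u 0 \<in> extensional J" "v 0 \<in> extensional J" using openin_Rn_ext[OF T(1)] u(2) v(2) S(2) by auto
  moreover have "u 0 j = v 0 j" if "j \<in> J" for j using eqjet_mono[OF uv[OF that], of 0] by (simp add: eqjet_0)
  ultimately have uv0: "u 0 = v 0" by (rule extensionalityI) auto
  have d: "deriv (\<lambda>t. f (w t)) t = (\<Sum>j\<in>J. pdiff j f (w t) * deriv (\<lambda>t. w t j) t)"
    if w: "\<And>j. j \<in> J \<Longrightarrow> smooth_real_on S (\<lambda>t. w t j)" "\<And>t. t \<in> S \<Longrightarrow> w t \<in> T" and t: "t \<in> S"
      and f: "smooth_on J T f" for w t f
  proof -
    let ?w = "\<lambda>t. restrict (w t) J"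
    have eq: "?w t = w t" if "t \<in> S" for t using openin_Rn_ext[OF T(1) w(2)[OF that]] by (simp add: extensional_restrict)
    have "((\<lambda>t. f (?w t)) has_real_derivative (\<Sum>j\<in>J. pdiff j f (?w t) * deriv (\<lambda>t. w t j) t)) (at t)"
      by (rule smooth_on_chain_rule[OF T(2,1) f])
        (use eq[OF t] w t smooth_real_on_has_deriv[OF w(1) t] in auto)
    then have "deriv (\<lambda>t. f (?w t)) t = (\<Sum>j\<in>J. pdiff j f (?w t) * deriv (\<lambda>t. w t j) t)"
      by (rule DERIV_imp_deriv)
    moreover have "deriv (\<lambda>t. f (?w t)) t = deriv (\<lambda>t. f (w t)) t"
      using derivs_cong[OF S(1) t, of "\<lambda>t. f (?w t)" "\<lambda>t. f (w t)" 1] eq by simp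
    ultimately show ?thesis using eq[OF t] by simp
  qed
  show ?thesis using f uv
  proof (induction k arbitrary: f)
    case 0
    then show ?case using uv0 by (simp add: eqjet_0)
  next
    case (Suc k)
    have e: "eqjet k (\<lambda>t. u t j) (\<lambda>t. v t j)" "eqjet k (deriv (\<lambda>t. u t j)) (deriv (\<lambda>t. v t j))" if "j \<in> J" for j
      using Suc.prems(2)[OF that] eqjet_mono[OF Suc.prems(2)[OF that], of k] by (auto simp: eqjet_Suc)
    have sm: "smooth_real_on S (\<lambda>t. pdiff j f (w t))"
      if w: "\<And>j. j \<in> J \<Longrightarrow> smooth_real_on S (\<lambda>t. w t j)" "\<And>t. t \<in> S \<Longrightarrow> w t \<in> T" and j: "j \<in> J" for w j
      by (rule smooth_real_on_compose_Rn[OF S(1) T smooth_onD(3)[OF Suc.prems(1) j] w])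
    have "eqjet k (\<lambda>t. \<Sum>j\<in>J. pdiff j f (u t) * deriv (\<lambda>t. u t j) t) (\<lambda>t. \<Sum>j\<in>J. pdiff j f (v t) * deriv (\<lambda>t. v t j) t)"
      by (intro eqjet_sum[OF S] eqjet_mult[OF S] smooth_real_on_mult S smooth_real_on_deriv u v sm e
          Suc.IH smooth_onD(3)[OF Suc.prems(1)])
    then have "eqjet k (deriv (\<lambda>t. f (u t))) (deriv (\<lambda>t. f (v t)))"
      using eqjet_cong[OF S, of "deriv (\<lambda>t. f (u t))" _ "deriv (\<lambda>t. f (v t))"] d[OF u _ Suc.prems(1)] d[OF v _ Suc.prems(1)] by auto
    then show ?case unfolding eqjet_Suc using uv0 by simp
  qed
qed

section \<open>Smooth local solutions of ordinary differential equations\<close>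

text \<open>
  Along a solution of \<open>z' = F(z)\<close> every smooth function \<open>f\<close> has the derivative \<open>(F f)(z)\<close>, where \<open>F f\<close> is again
  smooth; hence solutions are smooth.
\<close>

lemma ode_solution_smooth:
  assumes J: "finite J" and T: "openin (Rn J) T" and F: "\<And>j. j \<in> J \<Longrightarrow> smooth_on J T (F j)"
    and S: "open S" and z: "\<And>t. z t \<in> extensional J" "\<And>t. t \<in> S \<Longrightarrow> z t \<in> T"
    and D: "\<And>t j. t \<in> S \<Longrightarrow> j \<in> J \<Longrightarrow> ((\<lambda>t. z t j) has_real_derivative F j (z t)) (at t)"
    and f: "smooth_on J T f"
  shows "smooth_real_on S (\<lambda>t. f (z t))"
proof -
  have *: "((\<lambda>t. f (z t)) has_real_derivative (\<Sum>j\<in>J. pdiff j f (z t) * F j (z t))) (at t)"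
    if "smooth_on J T f" "t \<in> S" for f t
    by (rule smooth_on_chain_rule[OF J T that(1) z(2)[OF that(2)] z(1) D[OF that(2)]])
  have "\<forall>t\<in>S. (deriv ^^ n) (\<lambda>t. f (z t)) differentiable (at t)" for n
    using f
  proof (induction n arbitrary: f)
    case 0
    then show ?case using * by (auto simp: real_differentiable_def)
  next
    case (Suc n)
    let ?g = "\<lambda>x. \<Sum>j\<in>J. pdiff j f x * F j x"
    have g: "smooth_on J T ?g"
      by (intro smooth_on_sum[OF T J] smooth_on_mult[OF T J] smooth_onD(3)[OF Suc.prems] F)
    show ?case
    proof
      fix t assume t: "t \<in> S"
      have "\<forall>\<^sub>F s in nhds t. (deriv ^^ Suc n) (\<lambda>t. f (z t)) s = (deriv ^^ n) (\<lambda>t. ?g (z t)) s"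
      proof (rule eventually_mono[OF eventually_nhds_open[OF S t]])
        fix s assume s: "s \<in> S"
        show "(deriv ^^ Suc n) (\<lambda>t. f (z t)) s = (deriv ^^ n) (\<lambda>t. ?g (z t)) s"
          unfolding funpow_deriv_Suc
          by (rule derivs_cong[OF S s]) (rule DERIV_imp_deriv[OF *[OF Suc.prems]])
      qed
      then show "(deriv ^^ Suc n) (\<lambda>t. f (z t)) differentiable at t"
        by (rule differentiable_cong_ev) (use Suc.IH[OF g] t in blast)
    qed
  qed
  then show ?thesis by (auto simp: smooth_real_on_def)
qed

text \<open>
  Picard iteration. On a box of radius \<open>d\<close> the field is bounded by \<open>B\<close> and Lipschitz with constant \<open>K\<close>; the time
  \<open>\<delta>\<close> is so small that the iterates stay in the box and that their distances are halved in each step.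
\<close>

lemma ode_local_solution:
  assumes J: "finite J" and T: "openin (Rn J) T" and F: "\<And>j. j \<in> J \<Longrightarrow> smooth_on J T (F j)" and z0: "z0 \<in> T"
  obtains \<delta> z where "\<delta> > 0" "z 0 = z0" "\<And>t. z t \<in> extensional J" "\<And>t. t \<in> {-\<delta><..<\<delta>} \<Longrightarrow> z t \<in> T"
    "\<And>t j. t \<in> {-\<delta><..<\<delta>} \<Longrightarrow> j \<in> J \<Longrightarrow> ((\<lambda>t. z t j) has_real_derivative F j (z t)) (at t)"
    "\<And>j. j \<in> J \<Longrightarrow> smooth_real_on {-\<delta><..<\<delta>} (\<lambda>t. z t j)"
proof -
  have ext0: "z0 \<in> extensional J" using openin_Rn_ext[OF T z0] .
  \<comment> \<open>The Lipschitz estimates for the components are made uniform by the smallest radius and the sum of the constants.\<close>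
  define G where "G j d L \<longleftrightarrow> (\<forall>y y'. y \<in> extensional J \<longrightarrow> (\<forall>i\<in>J. \<bar>y i - z0 i\<bar> < d) \<longrightarrow>
       y' \<in> extensional J \<longrightarrow> (\<forall>i\<in>J. \<bar>y' i - z0 i\<bar> < d) \<longrightarrow>
       \<bar>F j y - F j y'\<bar> \<le> L * (\<Sum>i\<in>J. \<bar>y i - y' i\<bar>))" for j d L
  have "\<exists>d L. d > 0 \<and> L \<ge> 0 \<and> G j d L" if j: "j \<in> J" for j
  proof -
    obtain d L where "d > 0" "L \<ge> 0"
      "\<And>y. y \<in> extensional J \<Longrightarrow> (\<forall>i\<in>J. \<bar>y i - z0 i\<bar> < d) \<Longrightarrow> y \<in> T"
      "\<And>y y'. y \<in> extensional J \<Longrightarrow> (\<forall>i\<in>J. \<bar>y i - z0 i\<bar> < d) \<Longrightarrow>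
       y' \<in> extensional J \<Longrightarrow> (\<forall>i\<in>J. \<bar>y' i - z0 i\<bar> < d) \<Longrightarrow>
       \<bar>F j y - F j y'\<bar> \<le> L * (\<Sum>i\<in>J. \<bar>y i - y' i\<bar>)"
      using smooth_on_locally_Lipschitz[OF J T F[OF j] z0] by blast
    then show ?thesis by (intro exI[of _ d] exI[of _ L]) (simp add: G_def)
  qed
  then obtain D L where DL0: "\<And>j. j \<in> J \<Longrightarrow> D j > 0 \<and> L j \<ge> 0 \<and> G j (D j) (L j)" by metis
  have DL: "\<And>j. j \<in> J \<Longrightarrow> D j > 0" "\<And>j. j \<in> J \<Longrightarrow> L j \<ge> 0"
    "\<And>j y y'. j \<in> J \<Longrightarrow> y \<in> extensional J \<Longrightarrow> (\<forall>i\<in>J. \<bar>y i - z0 i\<bar> < D j) \<Longrightarrow>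
       y' \<in> extensional J \<Longrightarrow> (\<forall>i\<in>J. \<bar>y' i - z0 i\<bar> < D j) \<Longrightarrow>
       \<bar>F j y - F j y'\<bar> \<le> L j * (\<Sum>i\<in>J. \<bar>y i - y' i\<bar>)"
    using DL0 unfolding G_def by blast+
  obtain d0 where d0: "d0 > 0" "\<And>y. y \<in> extensional J \<Longrightarrow> (\<And>i. i \<in> J \<Longrightarrow> \<bar>y i - z0 i\<bar> < d0) \<Longrightarrow> y \<in> T"
    using openin_RnE[OF T J z0] by blast
  define d where "d = Min (insert d0 (D ` J))"
  have d: "d > 0" "d \<le> d0" "\<And>j. j \<in> J \<Longrightarrow> d \<le> D j" using J DL(1) d0(1) by (auto simp: d_def)
  define K where "K = (\<Sum>j\<in>J. L j) * real (card J)"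
  have K0: "K \<ge> 0" unfolding K_def using DL(2) by (intro mult_nonneg_nonneg sum_nonneg) auto
  define B where "B = (\<Sum>j\<in>J. \<bar>F j z0\<bar>) + K * d + 1"
  have B0: "B > 0" unfolding B_def using K0 d(1) by (intro add_nonneg_pos add_nonneg_nonneg sum_nonneg) auto
  \<comment> \<open>The iterates are kept in the closed box of radius \<open>d / 2\<close>, inside the open box of the estimates.\<close>
  have lip: "\<bar>F j y - F j y'\<bar> \<le> K * c"
    if j: "j \<in> J" and y: "y \<in> extensional J" "\<forall>i\<in>J. \<bar>y i - z0 i\<bar> \<le> d / 2"
      and y': "y' \<in> extensional J" "\<forall>i\<in>J. \<bar>y' i - z0 i\<bar> \<le> d / 2"
      and c: "\<forall>i\<in>J. \<bar>y i - y' i\<bar> \<le> c" for j y y' c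
  proof -
    have "\<forall>i\<in>J. \<bar>y i - z0 i\<bar> < D j" "\<forall>i\<in>J. \<bar>y' i - z0 i\<bar> < D j"
      using y(2) y'(2) d(3)[OF j] d(1) by fastforce+
    then have "\<bar>F j y - F j y'\<bar> \<le> L j * (\<Sum>i\<in>J. \<bar>y i - y' i\<bar>)" using DL(3)[OF j] y y' by blast
    also have "\<dots> \<le> L j * (\<Sum>i\<in>J. c)" using c DL(2)[OF j] by (intro mult_left_mono sum_mono) auto
    also have "\<dots> = L j * (real (card J) * c)" by simp
    also have "\<dots> \<le> (\<Sum>j\<in>J. L j) * (real (card J) * c)"
    proof (rule mult_right_mono)
      show "L j \<le> (\<Sum>j\<in>J. L j)" by (rule member_le_sum) (use DL(2) j J in auto)
      have "c \<ge> 0" using c j by fastforce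
      then show "0 \<le> real (card J) * c" by simp
    qed
    finally show ?thesis by (simp add: K_def mult.assoc)
  qed
  have bound: "\<bar>F j y\<bar> \<le> B" if j: "j \<in> J" and y: "y \<in> extensional J" "\<forall>i\<in>J. \<bar>y i - z0 i\<bar> \<le> d / 2" for j y
  proof -
    have "\<bar>F j y - F j z0\<bar> \<le> K * d" by (rule lip[OF j y ext0]) (use d y in fastforce)+
    moreover have "\<bar>F j z0\<bar> \<le> (\<Sum>j\<in>J. \<bar>F j z0\<bar>)" by (rule member_le_sum) (use j J in auto)
    ultimately show ?thesis unfolding B_def by linarith
  qed
  define \<delta> where "\<delta> = min (d / (2 * B)) (1 / (2 * (K + 1)))"
  have \<delta>: "\<delta> > 0" using d(1) B0 K0 by (simp add: \<delta>_def)
  have \<delta>B: "B * \<delta> \<le> d / 2"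
  proof -
    have "B * \<delta> \<le> B * (d / (2 * B))" using B0 by (intro mult_left_mono) (auto simp: \<delta>_def)
    then show ?thesis using B0 by simp
  qed
  have \<delta>K: "K * \<delta> \<le> 1 / 2"
  proof -
    have "K * \<delta> \<le> K * (1 / (2 * (K + 1)))" using K0 by (intro mult_left_mono) (auto simp: \<delta>_def)
    also have "\<dots> \<le> 1 / 2" using K0 by (simp add: field_simps)
    finally show ?thesis .
  qed
  let ?I = "{-\<delta>..\<delta>}"
  define X where "X u \<longleftrightarrow> (\<forall>t. u t \<in> extensional J) \<and> (\<forall>t\<in>?I. \<forall>j\<in>J. \<bar>u t j - z0 j\<bar> \<le> d / 2) \<and>
      (\<forall>j\<in>J. continuous_on ?I (\<lambda>t. u t j))" for u
  define P where "P u w \<longleftrightarrow> X w \<and> w 0 = z0 \<and>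
      (\<forall>j\<in>J. \<forall>t\<in>?I. ((\<lambda>t. w t j) has_real_derivative F j (u t)) (at t within ?I))" for u w
  have XT: "u t \<in> T" if "X u" "t \<in> ?I" for u t
  proof (rule d0(2))
    show "u t \<in> extensional J" using that by (simp add: X_def)
    fix i assume "i \<in> J"
    then have "\<bar>u t i - z0 i\<bar> \<le> d / 2" using that unfolding X_def by blast
    then show "\<bar>u t i - z0 i\<bar> < d0" using d(1,2) by linarith
  qed
  have step: "\<exists>w. P u w" if u: "X u" for u
  proof -
    have cont: "continuous_on ?I (\<lambda>t. F j (u t))" if j: "j \<in> J" for j
    proof -
      have "continuous_map (subtopology euclideanreal ?I) (Rn J) u"
        unfolding continuous_map_componentwise using u by (auto simp: X_def)
      then have "continuous_map (subtopology euclideanreal ?I) (subtopology (Rn J) T) u"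
        unfolding continuous_map_in_subtopology using XT[OF u] by auto
      from continuous_map_compose[OF this smooth_onD(1)[OF F[OF j]]] show ?thesis by (simp add: o_def)
    qed
    have "\<exists>g. \<forall>t\<in>?I. (g has_vector_derivative F j (u t)) (at t within ?I)" if "j \<in> J" for j
      using antiderivative_continuous[OF cont[OF that]] by metis
    then obtain g where g: "\<And>j t. j \<in> J \<Longrightarrow> t \<in> ?I \<Longrightarrow> (g j has_real_derivative F j (u t)) (at t within ?I)"
      unfolding has_real_derivative_iff_has_vector_derivative by metis
    define w where "w t = (\<lambda>j\<in>J. z0 j + (g j t - g j 0))" for t
    have D: "((\<lambda>t. w t j) has_real_derivative F j (u t)) (at t within ?I)" if "j \<in> J" "t \<in> ?I" for j t
      using that by (auto simp: w_def intro!: derivative_eq_intros g)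
    have w0: "w 0 = z0" using ext0 by (auto simp: w_def extensional_def)
    have "\<bar>w t j - z0 j\<bar> \<le> d / 2" if j: "j \<in> J" and t: "t \<in> ?I" for j t
    proof -
      have "\<bar>w t j - w 0 j\<bar> \<le> B * \<bar>t - 0\<bar>"
      proof (rule field_differentiable_bound[where S = ?I, unfolded real_norm_def])
        show "\<bar>F j (u s)\<bar> \<le> B" if "s \<in> ?I" for s
          by (rule bound[OF j]) (use u that in \<open>auto simp: X_def\<close>)
      qed (use D j t \<delta> in auto)
      also have "\<dots> \<le> B * \<delta>" using t B0 by (intro mult_left_mono) auto
      finally show ?thesis using \<delta>B w0 by simp
    qed
    moreover have "continuous_on ?I (\<lambda>t. w t j)" if "j \<in> J" for j
      by (rule DERIV_continuous_on) (rule D[OF that])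
    ultimately have "X w" by (auto simp: X_def w_def)
    then show ?thesis using D w0 unfolding P_def by blast
  qed
  have contraction: "\<bar>w t j - w' t j\<bar> \<le> c / 2"
    if u: "X u" "P u w" and u': "X u'" "P u' w'" and c: "\<And>t j. t \<in> ?I \<Longrightarrow> j \<in> J \<Longrightarrow> \<bar>u t j - u' t j\<bar> \<le> c"
      and j: "j \<in> J" and t: "t \<in> ?I" for u w u' w' c j t
  proof -
    have "\<bar>(w t j - w' t j) - (w 0 j - w' 0 j)\<bar> \<le> (K * c) * \<bar>t - 0\<bar>"
    proof (rule field_differentiable_bound[where S = ?I and f' = "\<lambda>s. F j (u s) - F j (u' s)", unfolded real_norm_def])
      show "((\<lambda>s. w s j - w' s j) has_real_derivative F j (u s) - F j (u' s)) (at s within ?I)" if "s \<in> ?I" for s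
        using u(2) u'(2) j that unfolding P_def by (intro DERIV_diff) auto
      show "\<bar>F j (u s) - F j (u' s)\<bar> \<le> K * c" if "s \<in> ?I" for s
        by (rule lip[OF j]) (use u(1) u'(1) c that in \<open>auto simp: X_def\<close>)
    qed (use t \<delta> in auto)
    moreover have "c \<ge> 0" using c[OF t j] by linarith
    then have "(K * c) * \<bar>t - 0\<bar> \<le> (K * c) * \<delta>" using t K0 by (intro mult_left_mono) auto
    moreover have "(K * c) * \<delta> \<le> c / 2"
      using mult_right_mono[OF \<delta>K \<open>c \<ge> 0\<close>] by (simp add: mult_ac)
    ultimately show ?thesis using u(2) u'(2) by (simp add: P_def)
  qed
  define Q where "Q u = (SOME w. P u w)" for u
  have Q: "P u (Q u)" if "X u" for u unfolding Q_def by (rule someI_ex[OF step[OF that]])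
  define u where "u n = (Q ^^ n) (\<lambda>_. z0)" for n
  have uX: "X (u n)" for n
  proof (induction n)
    case 0
    then show ?case using ext0 d(1) by (auto simp: u_def X_def)
  next
    case (Suc n)
    then show ?case using Q[OF Suc] by (simp add: u_def P_def)
  qed
  have uP: "P (u n) (u (Suc n))" for n using Q[OF uX[of n]] by (simp add: u_def)
  have udiff: "\<bar>u (Suc n) t j - u n t j\<bar> \<le> d / 2 * (1/2) ^ n" if "j \<in> J" "t \<in> ?I" for n t j
    using that
  proof (induction n arbitrary: t j)
    case 0
    then show ?case using uX[of 1] by (auto simp: X_def u_def)
  next
    case (Suc n)
    then show ?case using contraction[OF uX uP uX uP Suc.IH] by fastforce
  qed
  define z where "z t = (\<lambda>j\<in>J. z0 j + (\<Sum>n. u (Suc n) t j - u n t j))" for t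
  have unif: "uniform_limit ?I (\<lambda>n t. u n t j) (\<lambda>t. z t j) sequentially" if j: "j \<in> J" for j
  proof -
    have "uniform_limit ?I (\<lambda>n t. \<Sum>i<n. u (Suc i) t j - u i t j) (\<lambda>t. \<Sum>n. u (Suc n) t j - u n t j) sequentially"
      by (rule Weierstrass_m_test[where M = "\<lambda>n. d / 2 * (1/2) ^ n"])
        (use udiff[OF j] in \<open>auto intro!: summable_mult summable_geometric\<close>)
    then have "uniform_limit ?I (\<lambda>n t. z0 j + (\<Sum>i<n. u (Suc i) t j - u i t j)) (\<lambda>t. z0 j + (\<Sum>n. u (Suc n) t j - u n t j)) sequentially"
      by (intro uniform_limit_intros)
    moreover have "z0 j + (\<Sum>i<n. u (Suc i) t j - u i t j) = u n t j" for n t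
      by (induction n) (auto simp: u_def)
    ultimately show ?thesis using j by (simp add: z_def)
  qed
  have zX: "X z" unfolding X_def
  proof (intro conjI allI ballI)
    show "z t \<in> extensional J" for t by (simp add: z_def)
    fix j assume j: "j \<in> J"
    show "continuous_on ?I (\<lambda>t. z t j)"
      by (rule uniform_limit_theorem[OF _ unif[OF j]]) (use uX j in \<open>auto simp: X_def\<close>)
  next
    fix t j assume t: "t \<in> ?I" and j: "j \<in> J"
    have "(\<lambda>n. \<bar>u n t j - z0 j\<bar>) \<longlonglongrightarrow> \<bar>z t j - z0 j\<bar>"
      by (intro tendsto_intros tendsto_uniform_limitI[OF unif[OF j] t])
    then show "\<bar>z t j - z0 j\<bar> \<le> d / 2"
      by (rule LIMSEQ_le_const2) (use uX t j in \<open>auto simp: X_def\<close>)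
  qed
  \<comment> \<open>The uniform limit is a fixed point of the iteration \<open>Q\<close>, by the contraction estimate.\<close>
  have fix_pt: "Q z t j = z t j" if j: "j \<in> J" and t: "t \<in> ?I" for t j
  proof (rule ccontr)
    assume ne: "Q z t j \<noteq> z t j"
    define e where "e = \<bar>Q z t j - z t j\<bar> / 2"
    have e: "e > 0" using ne by (simp add: e_def)
    have "\<forall>\<^sub>F n in sequentially. \<forall>i\<in>J. \<forall>s\<in>?I. dist (u n s i) (z s i) < e"
      by (rule eventually_ball_finite[OF J]) (use unif e in \<open>auto simp: uniform_limit_iff\<close>)
    then obtain N where N: "\<And>n i s. n \<ge> N \<Longrightarrow> i \<in> J \<Longrightarrow> s \<in> ?I \<Longrightarrow> dist (u n s i) (z s i) < e"
      unfolding eventually_sequentially by blast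
    have "\<bar>Q z t j - u (Suc N) t j\<bar> \<le> e / 2"
      by (rule contraction[OF zX Q[OF zX] uX[of N] uP]) (use N[of N] j t in \<open>auto simp: dist_real_def abs_minus_commute less_imp_le\<close>)
    moreover have "\<bar>u (Suc N) t j - z t j\<bar> < e" using N[of "Suc N" j t] j t by (simp add: dist_real_def)
    moreover have "\<bar>Q z t j - z t j\<bar> \<le> \<bar>Q z t j - u (Suc N) t j\<bar> + \<bar>u (Suc N) t j - z t j\<bar>" by linarith
    moreover have "\<bar>Q z t j - z t j\<bar> = 2 * e" by (simp add: e_def)
    ultimately show False using e by linarith
  qed
  have Pz: "((\<lambda>t. z t j) has_real_derivative F j (z t)) (at t)" if t: "t \<in> {-\<delta><..<\<delta>}" and j: "j \<in> J" for t j
  proof -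
    have "((\<lambda>t. Q z t j) has_real_derivative F j (z t)) (at t within ?I)"
      using Q[OF zX] t j by (auto simp: P_def)
    then have "((\<lambda>t. z t j) has_real_derivative F j (z t)) (at t within ?I)"
      by (rule has_field_derivative_transform_within[OF _ zero_less_one]) (use t fix_pt[OF j] in auto)
    moreover have "at t within ?I = at t" by (rule at_within_interior) (use t in auto)
    ultimately show ?thesis by simp
  qed
  have inT: "z t \<in> T" if "t \<in> {-\<delta><..<\<delta>}" for t by (rule XT[OF zX]) (use that in auto)
  have ext: "z t \<in> extensional J" for t by (simp add: z_def)
  have z_init: "z 0 = z0"
  proof (rule extensionalityI[OF ext ext0])
    fix j assume j: "j \<in> J"
    have "z 0 j = Q z 0 j" by (rule fix_pt[OF j, symmetric]) (use \<delta> in auto)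
    then show "z 0 j = z0 j" using Q[OF zX] by (simp add: P_def)
  qed
  have sm: "smooth_real_on {-\<delta><..<\<delta>} (\<lambda>t. z t j)" if "j \<in> J" for j
    by (rule ode_solution_smooth[OF J T F _ ext inT Pz smooth_on_coord[OF T J that]]) auto
  show thesis by (rule that[OF \<delta> z_init ext inT Pz sm])
qed

section \<open>Curves and jets in charts\<close>

lemma open_preimage_Rn:
  assumes S: "open S" and J: "finite J" and T: "openin (Rn J) T"
    and u: "\<And>j. j \<in> J \<Longrightarrow> smooth_real_on S (\<lambda>t. u t j)" "\<And>t. t \<in> S \<Longrightarrow> u t \<in> extensional J"
  shows "open {t \<in> S. u t \<in> T}"
proof -
  have "continuous_on S (\<lambda>t. u t j)" if "j \<in> J" for j
    by (rule DERIV_continuous_on)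
      (rule has_field_derivative_at_within[OF smooth_real_on_has_deriv[OF u(1)[OF that]]])
  then have "continuous_map (subtopology euclideanreal S) (Rn J) u"
    unfolding continuous_map_componentwise using u(2) by auto
  from openin_continuous_map_preimage[OF this T]
  have "openin (subtopology euclideanreal S) {t \<in> S. u t \<in> T}" by simp
  then show ?thesis using S openin_open_eq by auto
qed

lemma is_chartD:
  assumes "is_chart I (U, \<phi>)"
  shows "inj_on \<phi> U" "openin (Rn I) (\<phi> ` U)" "\<And>p. p \<in> U \<Longrightarrow> \<phi> p \<in> extensional I"
  using assms openin_Rn_ext[of I "\<phi> ` U"] unfolding is_chart_def by auto

text \<open>
  Reading a partial function \<open>g\<close>, defined on \<open>P\<close> and smooth in the chart \<open>\<phi>\<close>, along curves in the chart domain.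
\<close>

lemma curve_in_chart_compose:
  assumes J: "finite J" and ch: "is_chart J (U, \<phi>)" and P: "openin (Rn J) (\<phi> ` (U \<inter> P))"
    and S: "open S" and \<gamma>: "\<And>t. t \<in> S \<Longrightarrow> \<gamma> t \<in> U" "\<And>i. i \<in> J \<Longrightarrow> smooth_real_on S (\<lambda>t. \<phi> (\<gamma> t) i)"
  shows "open {t \<in> S. \<gamma> t \<in> P}"
    and "smooth_on J (\<phi> ` (U \<inter> P)) (\<lambda>x. g (inv_into U \<phi> x)) \<Longrightarrow> smooth_real_on {t \<in> S. \<gamma> t \<in> P} (\<lambda>t. g (\<gamma> t))"
proof -
  note inj = is_chartD(1)[OF ch]
  have iff: "\<phi> (\<gamma> t) \<in> \<phi> ` (U \<inter> P) \<longleftrightarrow> \<gamma> t \<in> P" if "t \<in> S" for t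
    using inj_on_image_mem_iff[OF inj, of "\<gamma> t" "U \<inter> P"] \<gamma>(1)[OF that] by auto
  have "open {t \<in> S. \<phi> (\<gamma> t) \<in> \<phi> ` (U \<inter> P)}"
    by (rule open_preimage_Rn[OF S J P \<gamma>(2)]) (auto intro: is_chartD(3)[OF ch] \<gamma>(1))
  moreover have "{t \<in> S. \<phi> (\<gamma> t) \<in> \<phi> ` (U \<inter> P)} = {t \<in> S. \<gamma> t \<in> P}" using iff by auto
  ultimately show o: "open {t \<in> S. \<gamma> t \<in> P}" by simp
  assume sm: "smooth_on J (\<phi> ` (U \<inter> P)) (\<lambda>x. g (inv_into U \<phi> x))"
  have "smooth_real_on {t \<in> S. \<gamma> t \<in> P} (\<lambda>t. g (inv_into U \<phi> (\<phi> (\<gamma> t))))"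
    by (rule smooth_real_on_compose_Rn[OF o P J sm])
      (use iff in \<open>auto intro: smooth_real_on_mono[OF \<gamma>(2)]\<close>)
  then show "smooth_real_on {t \<in> S. \<gamma> t \<in> P} (\<lambda>t. g (\<gamma> t))"
    by (rule smooth_real_on_cong[OF o]) (use \<gamma>(1) inj in auto)
qed

lemma curve_in_chart_eqjet:
  assumes J: "finite J" and ch: "is_chart J (U, \<phi>)" and P: "openin (Rn J) (\<phi> ` (U \<inter> P))"
    and sm: "smooth_on J (\<phi> ` (U \<inter> P)) (\<lambda>x. g (inv_into U \<phi> x))"
    and S: "open S" "0 \<in> S"
    and \<gamma>: "\<And>t. t \<in> S \<Longrightarrow> \<gamma> t \<in> U" "\<And>i. i \<in> J \<Longrightarrow> smooth_real_on S (\<lambda>t. \<phi> (\<gamma> t) i)"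
    and \<delta>: "\<And>t. t \<in> S \<Longrightarrow> \<delta> t \<in> U" "\<And>i. i \<in> J \<Longrightarrow> smooth_real_on S (\<lambda>t. \<phi> (\<delta> t) i)"
    and P0: "\<gamma> 0 \<in> P" "\<delta> 0 \<in> P"
    and eq: "\<And>i. i \<in> J \<Longrightarrow> eqjet k (\<lambda>t. \<phi> (\<gamma> t) i) (\<lambda>t. \<phi> (\<delta> t) i)"
  shows "eqjet k (\<lambda>t. g (\<gamma> t)) (\<lambda>t. g (\<delta> t))"
proof -
  note inj = is_chartD(1)[OF ch]
  let ?S = "{t \<in> S. \<gamma> t \<in> P} \<inter> {t \<in> S. \<delta> t \<in> P}"
  have o: "open ?S" by (intro open_Int curve_in_chart_compose(1)[OF J ch P S(1)] \<gamma> \<delta>)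
  have "eqjet k (\<lambda>t. g (inv_into U \<phi> (\<phi> (\<gamma> t)))) (\<lambda>t. g (inv_into U \<phi> (\<phi> (\<delta> t))))"
    by (rule eqjet_compose[OF o _ P J sm])
      (use S P0 \<gamma>(1) \<delta>(1) eq in \<open>auto intro: smooth_real_on_mono[OF \<gamma>(2)] smooth_real_on_mono[OF \<delta>(2)]\<close>)
  then show ?thesis
    by (subst (asm) eqjet_cong[OF o, of _ "\<lambda>t. g (\<gamma> t)" _ "\<lambda>t. g (\<delta> t)"])
      (use S P0 \<gamma>(1) \<delta>(1) inj in auto)
qed

text \<open>
  Curves with an explicit parameter domain, so that a curve may be restarted at any of its points, as admissibility
  requires.
\<close>

definition curve_on :: "('m, 'i) mfd \<Rightarrow> real set \<Rightarrow> (real \<Rightarrow> 'm) \<Rightarrow> bool" where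
  "curve_on M S \<gamma> \<longleftrightarrow> open S \<and> \<gamma> ` S \<subseteq> pts M \<and>
    (\<forall>(V, \<psi>) \<in> atlas M. open {t \<in> S. \<gamma> t \<in> V} \<and>
       (\<forall>j \<in> idx M. smooth_real_on {t \<in> S. \<gamma> t \<in> V} (\<lambda>t. \<psi> (\<gamma> t) j)))"

text \<open>
  The parameter space of curves is the coordinate space over the unit type; its open sets are identified with those of the
  reals.
\<close>

lemma curve_iff: "curve M \<gamma> \<longleftrightarrow> (\<exists>S. 0 \<in> S \<and> curve_on M S \<gamma>)"
proof -
  have key: "openin (Rn (UNIV :: unit set)) {z. z () \<in> S} \<and> smooth_map (open_mfd UNIV {z :: unit \<Rightarrow> real. z () \<in> S}) M (\<lambda>z. \<gamma> (z ())) \<longleftrightarrow> curve_on M S \<gamma>" for S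
  proof (cases "open S")
    case False
    then show ?thesis by (simp add: openin_Rn_unit curve_on_def)
  next
    case S: True
    let ?S = "{z :: unit \<Rightarrow> real. z () \<in> S}"
    have im: "(\<lambda>z. \<gamma> (z ())) ` ?S = \<gamma> ` S" by (auto simp: image_iff intro!: exI[of _ "\<lambda>_. _"])
    have e: "id ` (?S \<inter> (\<lambda>z. \<gamma> (z ())) -` V) = {z. z () \<in> {t \<in> S. \<gamma> t \<in> V}}" for V by auto
    have sm: "smooth_on UNIV {z. z () \<in> {t \<in> S. \<gamma> t \<in> V}} (\<lambda>x. \<psi> (\<gamma> (inv_into ?S id x ())) j) \<longleftrightarrow>
       smooth_real_on {t \<in> S. \<gamma> t \<in> V} (\<lambda>t. \<psi> (\<gamma> t) j)" if o: "open {t \<in> S. \<gamma> t \<in> V}" for V and \<psi> :: "_ \<Rightarrow> 'b \<Rightarrow> real" and j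
    proof -
      have o': "openin (Rn (UNIV :: unit set)) {z. z () \<in> {t \<in> S. \<gamma> t \<in> V}}" unfolding openin_Rn_unit by (rule o)
      have eq: "\<psi> (\<gamma> (inv_into ?S id x ())) j = \<psi> (\<gamma> (x ())) j" if "x \<in> {z. z () \<in> {t \<in> S. \<gamma> t \<in> V}}" for x
        using inv_into_f_f[of id ?S x] that by simp
      have "smooth_on UNIV {z. z () \<in> {t \<in> S. \<gamma> t \<in> V}} (\<lambda>x. \<psi> (\<gamma> (inv_into ?S id x ())) j) \<longleftrightarrow>
          smooth_on UNIV {z. z () \<in> {t \<in> S. \<gamma> t \<in> V}} (\<lambda>x. \<psi> (\<gamma> (x ())) j)"
        by (rule iffI; erule smooth_on_cong[OF o' finite]; simp only: eq)
      then show ?thesis by (rule trans) (rule smooth_on_unit_iff)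
    qed
    have pt: "pts (open_mfd (UNIV :: unit set) ?S) = ?S" by (simp add: pts_def open_mfd_def)
    let ?f = "\<lambda>z :: unit \<Rightarrow> real. \<gamma> (z ())"
    define P1 P2 where "P1 V \<psi> \<longleftrightarrow> openin (Rn UNIV) (id ` (?S \<inter> ?f -` V)) \<and>
        (\<forall>j \<in> idx M. smooth_on UNIV (id ` (?S \<inter> ?f -` V)) (\<lambda>x. \<psi> (?f (inv_into ?S id x)) j))"
      and "P2 V \<psi> \<longleftrightarrow> open {t \<in> S. \<gamma> t \<in> V} \<and>
        (\<forall>j \<in> idx M. smooth_real_on {t \<in> S. \<gamma> t \<in> V} (\<lambda>t. \<psi> (\<gamma> t) j))" for V \<psi>
    have "P1 V \<psi> \<longleftrightarrow> P2 V \<psi>" for V \<psi>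
      unfolding P1_def P2_def e openin_Rn_unit by (intro conj_cong refl ball_cong sm)
    moreover have "smooth_map (open_mfd UNIV ?S) M ?f \<longleftrightarrow> ?f ` ?S \<subseteq> pts M \<and> (\<forall>c\<in>atlas M. P1 (fst c) (snd c))"
      unfolding smooth_map_def pt P1_def by (simp add: open_mfd_def case_prod_beta)
    moreover have "curve_on M S \<gamma> \<longleftrightarrow> ?f ` ?S \<subseteq> pts M \<and> (\<forall>c\<in>atlas M. P2 (fst c) (snd c))"
      unfolding curve_on_def P2_def im by (simp add: S case_prod_beta)
    ultimately show ?thesis using S by (simp add: openin_Rn_unit)
  qed
  have "(\<exists>S. openin (Rn (UNIV :: unit set)) S \<and> (\<lambda>_. 0) \<in> S \<and> smooth_map (open_mfd UNIV S) M (\<lambda>z. \<gamma> (z ())))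
     \<longleftrightarrow> (\<exists>S. 0 \<in> S \<and> curve_on M S \<gamma>)"
  proof safe
    fix S :: "(unit \<Rightarrow> real) set"
    assume *: "openin (Rn UNIV) S" "(\<lambda>_. 0) \<in> S" "smooth_map (open_mfd UNIV S) M (\<lambda>z. \<gamma> (z ()))"
    have eq: "S = {z. z () \<in> {t. (\<lambda>_. t) \<in> S}}"
    proof -
      have "(\<lambda>_. z ()) = z" for z :: "unit \<Rightarrow> real" by auto
      then show ?thesis by simp
    qed
    then show "\<exists>S. 0 \<in> S \<and> curve_on M S \<gamma>"
      using * key[of "{t. (\<lambda>_. t) \<in> S}"] by (intro exI[of _ "{t. (\<lambda>_. t) \<in> S}"]) auto
  next
    fix S assume "0 \<in> S" "curve_on M S \<gamma>"
    then show "\<exists>S. openin (Rn UNIV) S \<and> (\<lambda>_. 0) \<in> S \<and> smooth_map (open_mfd UNIV S) M (\<lambda>z. \<gamma> (z ()))"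
      using key[of S] by (intro exI[of _ "{z. z () \<in> S}"]) simp
  qed
  then show ?thesis by (simp add: curve_def)
qed

lemma smooth_chart_atlas: "manifold M \<Longrightarrow> c \<in> atlas M \<Longrightarrow> smooth_chart M c"
  by (auto simp: smooth_chart_def manifold_def pts_def)

lemma manifold_finite: "manifold M \<Longrightarrow> finite (idx M)"
  by (simp add: manifold_def)

lemma smooth_chartD:
  assumes "smooth_chart M (U, \<phi>)"
  shows "U \<subseteq> pts M" "is_chart (idx M) (U, \<phi>)"
    and "\<And>V \<psi>. (V, \<psi>) \<in> atlas M \<Longrightarrow> openin (Rn (idx M)) (\<phi> ` (U \<inter> V)) \<and>
       (\<forall>j \<in> idx M. smooth_on (idx M) (\<phi> ` (U \<inter> V)) (\<lambda>x. \<psi> (inv_into U \<phi> x) j))"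
    and "\<And>V \<psi>. (V, \<psi>) \<in> atlas M \<Longrightarrow> openin (Rn (idx M)) (\<psi> ` (V \<inter> U)) \<and>
       (\<forall>j \<in> idx M. smooth_on (idx M) (\<psi> ` (V \<inter> U)) (\<lambda>x. \<phi> (inv_into V \<psi> x) j))"
  using assms unfolding smooth_chart_def smooth_transition_def by auto

lemma pts_chartE:
  assumes "p \<in> pts M"
  obtains U \<phi> where "(U, \<phi>) \<in> atlas M" "p \<in> U"
  using assms by (auto simp: pts_def)

lemma open_locally:
  assumes "\<And>t. t \<in> S \<Longrightarrow> \<exists>S'. open S' \<and> t \<in> S' \<and> S' \<subseteq> S"
  shows "open S"
  by (subst open_subopen) (use assms in blast)

lemma curve_on_open: "curve_on M S \<gamma> \<Longrightarrow> open S" by (simp add: curve_on_def)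

lemma curve_on_atlas:
  assumes "curve_on M S \<gamma>" "(V, \<psi>) \<in> atlas M"
  shows "open {t \<in> S. \<gamma> t \<in> V}" "\<And>j. j \<in> idx M \<Longrightarrow> smooth_real_on {t \<in> S. \<gamma> t \<in> V} (\<lambda>t. \<psi> (\<gamma> t) j)"
  using assms by (auto simp: curve_on_def)

text \<open>
  A curve in \<open>M\<close> read through a function that is smooth in all charts; smooth charts and smooth maps are the
  two applications.
\<close>

lemma curve_on_read:
  assumes fin: "finite (idx M)" and ch: "\<And>U \<phi>. (U, \<phi>) \<in> atlas M \<Longrightarrow> is_chart (idx M) (U, \<phi>)"
    and P: "\<And>U \<phi>. (U, \<phi>) \<in> atlas M \<Longrightarrow> openin (Rn (idx M)) (\<phi> ` (U \<inter> P))"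
    and \<gamma>: "curve_on M S \<gamma>"
  shows "open {t \<in> S. \<gamma> t \<in> P}"
    and "(\<And>U \<phi>. (U, \<phi>) \<in> atlas M \<Longrightarrow> smooth_on (idx M) (\<phi> ` (U \<inter> P)) (\<lambda>x. g (inv_into U \<phi> x))) \<Longrightarrow>
       smooth_real_on {t \<in> S. \<gamma> t \<in> P} (\<lambda>t. g (\<gamma> t))"
proof -
  have loc: "open {t \<in> {t \<in> S. \<gamma> t \<in> U}. \<gamma> t \<in> P}" if "(U, \<phi>) \<in> atlas M" for U \<phi>
    by (rule curve_in_chart_compose(1)[OF fin ch[OF that] P[OF that] curve_on_atlas(1)[OF \<gamma> that] _ curve_on_atlas(2)[OF \<gamma> that]]) auto
  have cov: "\<exists>U \<phi>. (U, \<phi>) \<in> atlas M \<and> \<gamma> t \<in> U" if "t \<in> S" for t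
  proof -
    have "\<gamma> t \<in> pts M" using \<gamma> that by (auto simp: curve_on_def)
    then show ?thesis using pts_chartE by metis
  qed
  show "open {t \<in> S. \<gamma> t \<in> P}"
  proof (rule open_locally)
    fix t assume t: "t \<in> {t \<in> S. \<gamma> t \<in> P}"
    then obtain U \<phi> where U: "(U, \<phi>) \<in> atlas M" "\<gamma> t \<in> U" using cov by blast
    show "\<exists>S'. open S' \<and> t \<in> S' \<and> S' \<subseteq> {t \<in> S. \<gamma> t \<in> P}"
      by (intro exI[of _ "{t \<in> {t \<in> S. \<gamma> t \<in> U}. \<gamma> t \<in> P}"] conjI loc[OF U(1)]) (use t U in auto)
  qed
  assume g: "\<And>U \<phi>. (U, \<phi>) \<in> atlas M \<Longrightarrow> smooth_on (idx M) (\<phi> ` (U \<inter> P)) (\<lambda>x. g (inv_into U \<phi> x))"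
  show "smooth_real_on {t \<in> S. \<gamma> t \<in> P} (\<lambda>t. g (\<gamma> t))"
    unfolding smooth_real_on_def
  proof (intro allI ballI)
    fix n t assume t: "t \<in> {t \<in> S. \<gamma> t \<in> P}"
    then obtain U \<phi> where U: "(U, \<phi>) \<in> atlas M" "\<gamma> t \<in> U" using cov by blast
    have "smooth_real_on {t \<in> {t \<in> S. \<gamma> t \<in> U}. \<gamma> t \<in> P} (\<lambda>t. g (\<gamma> t))"
      by (rule curve_in_chart_compose(2)[OF fin ch[OF U(1)] P[OF U(1)] curve_on_atlas(1)[OF \<gamma> U(1)] _ curve_on_atlas(2)[OF \<gamma> U(1)] g[OF U(1)]]) auto
    then show "(deriv ^^ n) (\<lambda>t. g (\<gamma> t)) differentiable at t" using t U by (simp add: smooth_real_on_def)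
  qed
qed

lemma manifold_atlas_chart: "manifold M \<Longrightarrow> (U, \<phi>) \<in> atlas M \<Longrightarrow> is_chart (idx M) (U, \<phi>)"
  by (auto simp: manifold_def)

lemma curve_on_smooth_chart:
  assumes M: "manifold M" and \<gamma>: "curve_on M S \<gamma>" and c: "smooth_chart M (U, \<phi>)"
  shows "open {t \<in> S. \<gamma> t \<in> U}" "\<And>j. j \<in> idx M \<Longrightarrow> smooth_real_on {t \<in> S. \<gamma> t \<in> U} (\<lambda>t. \<phi> (\<gamma> t) j)"
proof -
  note P = conjunct1[OF smooth_chartD(4)[OF c]]
  show "open {t \<in> S. \<gamma> t \<in> U}"
    by (rule curve_on_read(1)[OF manifold_finite[OF M] manifold_atlas_chart[OF M] P \<gamma>])
  show "smooth_real_on {t \<in> S. \<gamma> t \<in> U} (\<lambda>t. \<phi> (\<gamma> t) j)" if "j \<in> idx M" for j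
    by (rule curve_on_read(2)[OF manifold_finite[OF M] manifold_atlas_chart[OF M] P \<gamma>])
      (use smooth_chartD(4)[OF c] that in blast)+
qed

lemma curve_on_smooth_map:
  assumes fin: "finite (idx M)" and ch: "\<And>U \<phi>. (U, \<phi>) \<in> atlas M \<Longrightarrow> is_chart (idx M) (U, \<phi>)"
    and f: "smooth_map M N f" and \<gamma>: "curve_on M S \<gamma>"
  shows "curve_on N S (f \<circ> \<gamma>)"
  unfolding curve_on_def
proof (intro conjI ballI; clarify?)
  show "open S" using \<gamma> by (rule curve_on_open)
  show "(f \<circ> \<gamma>) t \<in> pts N" if "t \<in> S" for t
  proof -
    have "\<gamma> t \<in> pts M" using \<gamma> that by (auto simp: curve_on_def)
    then show ?thesis using f by (auto simp: smooth_map_def)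
  qed
  fix V \<psi> assume V: "(V, \<psi>) \<in> atlas N"
  have P: "openin (Rn (idx M)) (\<phi> ` (U \<inter> f -` V))"
    "\<And>j. j \<in> idx N \<Longrightarrow> smooth_on (idx M) (\<phi> ` (U \<inter> f -` V)) (\<lambda>x. \<psi> (f (inv_into U \<phi> x)) j)"
    if "(U, \<phi>) \<in> atlas M" for U \<phi>
    using f that V unfolding smooth_map_def by blast+
  have "open {t \<in> S. \<gamma> t \<in> f -` V}" by (rule curve_on_read(1)[OF fin ch P(1) \<gamma>])
  moreover have "smooth_real_on {t \<in> S. \<gamma> t \<in> f -` V} (\<lambda>t. \<psi> (f (\<gamma> t)) j)" if "j \<in> idx N" for j
    by (rule curve_on_read(2)[OF fin ch P(1) \<gamma> P(2)[OF _ that]])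
  ultimately show "open {t \<in> S. (f \<circ> \<gamma>) t \<in> V} \<and> (\<forall>j\<in>idx N. smooth_real_on {t \<in> S. (f \<circ> \<gamma>) t \<in> V} (\<lambda>t. \<psi> ((f \<circ> \<gamma>) t) j))"
    by simp
qed

lemma curve_smooth_map:
  assumes "manifold M" "smooth_map M N f" "curve M \<gamma>"
  shows "curve N (f \<circ> \<gamma>)"
  using assms curve_on_smooth_map[OF manifold_finite[OF assms(1)] manifold_atlas_chart[OF assms(1)] assms(2)]
  unfolding curve_iff by blast

lemma curve_on_mono:
  assumes "curve_on M S \<gamma>" "open S'" "S' \<subseteq> S"
  shows "curve_on M S' \<gamma>"
  unfolding curve_on_def
proof (intro conjI ballI; clarify?)
  show "\<gamma> t \<in> pts M" if "t \<in> S'" for t using assms that by (auto simp: curve_on_def)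
  fix V \<psi> assume V: "(V, \<psi>) \<in> atlas M"
  have "{t \<in> S'. \<gamma> t \<in> V} = S' \<inter> {t \<in> S. \<gamma> t \<in> V}" using assms by auto
  then show "open {t \<in> S'. \<gamma> t \<in> V} \<and> (\<forall>j\<in>idx M. smooth_real_on {t \<in> S'. \<gamma> t \<in> V} (\<lambda>t. \<psi> (\<gamma> t) j))"
    using curve_on_atlas[OF assms(1) V] assms(2) by (auto intro: smooth_real_on_mono)
qed (rule assms)

lemma curve_on_reparam:
  assumes \<gamma>: "curve_on M S \<gamma>" and S': "open S'" and u: "smooth_real_on S' u" "\<And>t. t \<in> S' \<Longrightarrow> u t \<in> S"
  shows "curve_on M S' (\<lambda>t. \<gamma> (u t))"
  unfolding curve_on_def
proof (intro conjI ballI; clarify?)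
  show "\<gamma> (u t) \<in> pts M" if "t \<in> S'" for t using \<gamma> u(2)[OF that] by (auto simp: curve_on_def)
  fix V \<psi> assume V: "(V, \<psi>) \<in> atlas M"
  have cont: "continuous_on S' u"
    by (rule DERIV_continuous_on) (rule has_field_derivative_at_within[OF smooth_real_on_has_deriv[OF u(1)]])
  have "open (S' \<inter> u -` {t \<in> S. \<gamma> t \<in> V})"
    by (rule continuous_open_preimage[OF cont S' curve_on_atlas(1)[OF \<gamma> V]])
  moreover have "S' \<inter> u -` {t \<in> S. \<gamma> t \<in> V} = {t \<in> S'. \<gamma> (u t) \<in> V}" using u(2) by auto
  ultimately have o: "open {t \<in> S'. \<gamma> (u t) \<in> V}" by simp
  have "smooth_real_on {t \<in> S'. \<gamma> (u t) \<in> V} (\<lambda>t. \<psi> (\<gamma> (u t)) j)" if "j \<in> idx M" for j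
    by (rule smooth_real_on_compose[OF o curve_on_atlas(1)[OF \<gamma> V] curve_on_atlas(2)[OF \<gamma> V that]])
      (use u(2) in \<open>auto intro: smooth_real_on_mono[OF u(1)]\<close>)
  then show "open {t \<in> S'. \<gamma> (u t) \<in> V} \<and> (\<forall>j\<in>idx M. smooth_real_on {t \<in> S'. \<gamma> (u t) \<in> V} (\<lambda>t. \<psi> (\<gamma> (u t)) j))"
    using o by blast
qed (rule S')

lemma curve_onI:
  assumes M: "manifold M" and S: "open S" and c: "smooth_chart M (U, \<phi>)"
    and \<gamma>: "\<And>t. t \<in> S \<Longrightarrow> \<gamma> t \<in> U" "\<And>i. i \<in> idx M \<Longrightarrow> smooth_real_on S (\<lambda>t. \<phi> (\<gamma> t) i)"
  shows "curve_on M S \<gamma>"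
  unfolding curve_on_def
proof (intro conjI ballI; clarify?)
  show "\<gamma> t \<in> pts M" if "t \<in> S" for t using \<gamma>(1)[OF that] smooth_chartD(1)[OF c] by auto
  fix V \<psi> assume V: "(V, \<psi>) \<in> atlas M"
  show "open {t \<in> S. \<gamma> t \<in> V} \<and> (\<forall>j\<in>idx M. smooth_real_on {t \<in> S. \<gamma> t \<in> V} (\<lambda>t. \<psi> (\<gamma> t) j))"
  proof (intro conjI ballI)
    note P = conjunct1[OF smooth_chartD(3)[OF c V]]
    show "open {t \<in> S. \<gamma> t \<in> V}"
      by (rule curve_in_chart_compose(1)[OF manifold_finite[OF M] smooth_chartD(2)[OF c] P S \<gamma>])
    show "smooth_real_on {t \<in> S. \<gamma> t \<in> V} (\<lambda>t. \<psi> (\<gamma> t) j)" if "j \<in> idx M" for j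
      by (rule curve_in_chart_compose(2)[OF manifold_finite[OF M] smooth_chartD(2)[OF c] P S \<gamma>])
        (use smooth_chartD(3)[OF c V] that in auto)
  qed
qed (rule S)

lemma curve_near_chart:
  assumes M: "manifold M" and \<gamma>: "curve M \<gamma>" and c: "smooth_chart M (U, \<phi>)" "\<gamma> 0 \<in> U"
  obtains S where "open S" "0 \<in> S" "\<And>t. t \<in> S \<Longrightarrow> \<gamma> t \<in> U" "\<And>i. i \<in> idx M \<Longrightarrow> smooth_real_on S (\<lambda>t. \<phi> (\<gamma> t) i)"
proof -
  obtain S where "0 \<in> S" "curve_on M S \<gamma>" using \<gamma> by (auto simp: curve_iff)
  show thesis
    by (rule that[OF curve_on_smooth_chart(1)[OF M \<open>curve_on M S \<gamma>\<close> c(1)] _ _ curve_on_smooth_chart(2)[OF M \<open>curve_on M S \<gamma>\<close> c(1)]])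
      (use \<open>0 \<in> S\<close> c(2) in auto)
qed

lemma curve_near_chart2:
  assumes M: "manifold M" and \<gamma>: "curve M \<gamma>" "curve M \<delta>" and c: "smooth_chart M (U, \<phi>)" "\<gamma> 0 \<in> U" "\<delta> 0 \<in> U"
  obtains S where "open S" "0 \<in> S" "\<And>t. t \<in> S \<Longrightarrow> \<gamma> t \<in> U" "\<And>i. i \<in> idx M \<Longrightarrow> smooth_real_on S (\<lambda>t. \<phi> (\<gamma> t) i)"
    "\<And>t. t \<in> S \<Longrightarrow> \<delta> t \<in> U" "\<And>i. i \<in> idx M \<Longrightarrow> smooth_real_on S (\<lambda>t. \<phi> (\<delta> t) i)"
proof -
  obtain S where S: "open S" "0 \<in> S" "\<And>t. t \<in> S \<Longrightarrow> \<gamma> t \<in> U" "\<And>i. i \<in> idx M \<Longrightarrow> smooth_real_on S (\<lambda>t. \<phi> (\<gamma> t) i)"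
    using curve_near_chart[OF M \<gamma>(1) c(1,2)] by blast
  obtain S' where S': "open S'" "0 \<in> S'" "\<And>t. t \<in> S' \<Longrightarrow> \<delta> t \<in> U" "\<And>i. i \<in> idx M \<Longrightarrow> smooth_real_on S' (\<lambda>t. \<phi> (\<delta> t) i)"
    using curve_near_chart[OF M \<gamma>(2) c(1,3)] by blast
  show thesis
    by (rule that[of "S \<inter> S'"])
      (use S(1-3) S'(1-3) in \<open>auto intro: smooth_real_on_mono[OF S(4)] smooth_real_on_mono[OF S'(4)]\<close>)
qed

lemma jet_iff: "\<delta> \<in> jet M k \<gamma> \<longleftrightarrow> curve M \<delta> \<and> \<delta> 0 = \<gamma> 0 \<and>
    (\<forall>(U, \<phi>) \<in> atlas M. \<gamma> 0 \<in> U \<longrightarrow> (\<forall>i \<in> idx M. eqjet k (\<lambda>t. \<phi> (\<delta> t) i) (\<lambda>t. \<phi> (\<gamma> t) i)))"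
  unfolding jet_def eqjet_def by simp

text \<open>Transition maps carry curves with equal derivatives to curves with equal derivatives, by the chain rule, so one chart decides.\<close>

lemma jet_iff_chart:
  assumes M: "manifold M" and c: "smooth_chart M (U, \<phi>)" "\<gamma> 0 \<in> U" and \<gamma>: "curve M \<gamma>"
  shows "\<delta> \<in> jet M k \<gamma> \<longleftrightarrow> curve M \<delta> \<and> \<delta> 0 = \<gamma> 0 \<and> (\<forall>i \<in> idx M. eqjet k (\<lambda>t. \<phi> (\<delta> t) i) (\<lambda>t. \<phi> (\<gamma> t) i))"
proof (intro iffI conjI ballI)
  assume *: "\<delta> \<in> jet M k \<gamma>"
  then show \<delta>: "curve M \<delta>" "\<delta> 0 = \<gamma> 0" by (auto simp: jet_iff)
  fix i assume i: "i \<in> idx M"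
  obtain V \<psi> where V: "(V, \<psi>) \<in> atlas M" "\<gamma> 0 \<in> V" using smooth_chartD(1)[OF c(1)] c(2) pts_chartE by (metis subsetD)
  note cV = smooth_chart_atlas[OF M V(1)]
  obtain S where S: "open S" "0 \<in> S" "\<And>t. t \<in> S \<Longrightarrow> \<delta> t \<in> V" "\<And>i. i \<in> idx M \<Longrightarrow> smooth_real_on S (\<lambda>t. \<psi> (\<delta> t) i)"
    "\<And>t. t \<in> S \<Longrightarrow> \<gamma> t \<in> V" "\<And>i. i \<in> idx M \<Longrightarrow> smooth_real_on S (\<lambda>t. \<psi> (\<gamma> t) i)"
    using curve_near_chart2[OF M \<delta>(1) \<gamma> cV] V(2) \<delta>(2) by metis
  show "eqjet k (\<lambda>t. \<phi> (\<delta> t) i) (\<lambda>t. \<phi> (\<gamma> t) i)"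
    using curve_in_chart_eqjet[OF manifold_finite[OF M] smooth_chartD(2)[OF cV] _ _ S, of U "\<lambda>p. \<phi> p i"] smooth_chartD(4)[OF c(1) V(1)]
      i c(2) \<delta>(2) * V unfolding jet_iff by fastforce
next
  assume *: "curve M \<delta> \<and> \<delta> 0 = \<gamma> 0 \<and> (\<forall>i \<in> idx M. eqjet k (\<lambda>t. \<phi> (\<delta> t) i) (\<lambda>t. \<phi> (\<gamma> t) i))"
  then have \<delta>: "curve M \<delta>" "\<delta> 0 = \<gamma> 0" "\<And>i. i \<in> idx M \<Longrightarrow> eqjet k (\<lambda>t. \<phi> (\<delta> t) i) (\<lambda>t. \<phi> (\<gamma> t) i)" by auto
  obtain S where S: "open S" "0 \<in> S" "\<And>t. t \<in> S \<Longrightarrow> \<delta> t \<in> U" "\<And>i. i \<in> idx M \<Longrightarrow> smooth_real_on S (\<lambda>t. \<phi> (\<delta> t) i)"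
    "\<And>t. t \<in> S \<Longrightarrow> \<gamma> t \<in> U" "\<And>i. i \<in> idx M \<Longrightarrow> smooth_real_on S (\<lambda>t. \<phi> (\<gamma> t) i)"
    using curve_near_chart2[OF M \<delta>(1) \<gamma> c(1)] c(2) \<delta>(2) by metis
  have "eqjet k (\<lambda>t. \<psi> (\<delta> t) i) (\<lambda>t. \<psi> (\<gamma> t) i)" if V: "(V, \<psi>) \<in> atlas M" "\<gamma> 0 \<in> V" and i: "i \<in> idx M" for V \<psi> i
    using curve_in_chart_eqjet[OF manifold_finite[OF M] smooth_chartD(2)[OF c(1)] _ _ S _ _ \<delta>(3), of V "\<lambda>p. \<psi> p i"] smooth_chartD(3)[OF c(1) V(1)]
      i V \<delta>(2) by auto
  then show "\<delta> \<in> jet M k \<gamma>" unfolding jet_iff using \<delta> by auto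
qed

lemma jet_refl: "curve M \<gamma> \<Longrightarrow> \<gamma> \<in> jet M k \<gamma>"
  by (auto simp: jet_iff eqjet_refl)

lemma jet_eq_iff: "curve M \<gamma> \<Longrightarrow> jet M k \<gamma> = jet M k \<delta> \<longleftrightarrow> \<gamma> \<in> jet M k \<delta>"
proof
  show "jet M k \<gamma> = jet M k \<delta>" if "\<gamma> \<in> jet M k \<delta>"
  proof (intro set_eqI)
    fix \<epsilon>
    have *: "eqjet k c a \<longleftrightarrow> eqjet k c b" if "eqjet k a b" for a b c using that by (simp add: eqjet_def)
    have "\<gamma> 0 = \<delta> 0" using that by (simp add: jet_iff)
    moreover have "eqjet k (\<lambda>t. \<phi> (\<epsilon> t) i) (\<lambda>t. \<phi> (\<gamma> t) i) \<longleftrightarrow> eqjet k (\<lambda>t. \<phi> (\<epsilon> t) i) (\<lambda>t. \<phi> (\<delta> t) i)"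
      if "(U, \<phi>) \<in> atlas M" "\<delta> 0 \<in> U" "i \<in> idx M" for U \<phi> i
      by (rule *) (use \<open>\<gamma> \<in> jet M k \<delta>\<close> that in \<open>auto simp: jet_iff\<close>)
    ultimately show "\<epsilon> \<in> jet M k \<gamma> \<longleftrightarrow> \<epsilon> \<in> jet M k \<delta>" unfolding jet_iff[of \<epsilon>] by auto
  qed
qed (use jet_refl in blast)

lemma rep_jet: "curve M \<gamma> \<Longrightarrow> rep (jet M k \<gamma>) \<in> jet M k \<gamma>"
  unfolding rep_def by (rule someI[of "\<lambda>x. x \<in> jet M k \<gamma>"]) (rule jet_refl)

lemma rep_jet_curve: "curve M \<gamma> \<Longrightarrow> curve M (rep (jet M k \<gamma>))"
  using rep_jet by (auto simp: jet_iff)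

lemma base_pt_jet: "curve M \<gamma> \<Longrightarrow> base_pt (jet M k \<gamma>) = \<gamma> 0"
  using rep_jet[of M \<gamma> k] by (auto simp: jet_iff base_pt_def)

lemma jets_rep:
  assumes "X \<in> jets M k"
  shows "curve M (rep X)" "X = jet M k (rep X)"
proof -
  obtain \<gamma> where "curve M \<gamma>" "X = jet M k \<gamma>" using assms by (auto simp: jets_def)
  then show "curve M (rep X)" "X = jet M k (rep X)"
    using rep_jet_curve rep_jet jet_eq_iff by metis+
qed

lemma jet_in_jets: "curve M \<gamma> \<Longrightarrow> jet M k \<gamma> \<in> jets M k"
  by (auto simp: jets_def)

lemma curve_pts: "curve M \<gamma> \<Longrightarrow> \<gamma> 0 \<in> pts M"
  by (auto simp: curve_iff curve_on_def)

lemma pts_Tk: "pts (Tk k M) = jets M k"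
proof -
  have "base_pt X \<in> pts M" if "X \<in> jets M k" for X
    using curve_pts[OF jets_rep(1)[OF that]] by (simp add: base_pt_def)
  then have "\<exists>c \<in> atlas M. base_pt X \<in> fst c" if "X \<in> jets M k" for X using that by (auto simp: pts_def)
  moreover have "pts (Tk k M) = {X \<in> jets M k. \<exists>c \<in> atlas M. base_pt X \<in> fst c}"
    by (auto simp: pts_def Tk_def case_prod_beta)
  ultimately show ?thesis by auto
qed

lemma jet_mono: "\<delta> \<in> jet M k \<gamma> \<Longrightarrow> j \<le> k \<Longrightarrow> \<delta> \<in> jet M j \<gamma>"
  unfolding jet_iff using eqjet_mono by fast

lemma jet_coords_jet:
  assumes "curve M \<gamma>" "(U, \<phi>) \<in> atlas M" "\<gamma> 0 \<in> U" "\<alpha> \<le> k" "i \<in> idx M"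
  shows "jet_coords k (idx M) \<phi> (jet M k \<gamma>) (\<alpha>, i) = (deriv ^^ \<alpha>) (\<lambda>t. \<phi> (\<gamma> t) i) 0"
  using rep_jet[OF assms(1), of k] assms by (auto simp: jet_coords_def jet_def)

lemma jets1_eqI:
  assumes M: "manifold M" and U: "(U, \<phi>) \<in> atlas M" and Y: "Y \<in> jets M 1" "Y' \<in> jets M 1" "base_pt Y \<in> U" "base_pt Y' = base_pt Y"
    "\<And>i. i \<in> idx M \<Longrightarrow> jet_coords 1 (idx M) \<phi> Y (1, i) = jet_coords 1 (idx M) \<phi> Y' (1, i)"
  shows "Y = Y'"
proof -
  have "rep Y \<in> jet M 1 (rep Y')"
    unfolding jet_iff_chart[OF M smooth_chart_atlas[OF M U] Y(3)[folded Y(4), unfolded base_pt_def] jets_rep(1)[OF Y(2)]]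
    using jets_rep(1)[OF Y(1)] Y(4,5) by (auto simp: base_pt_def eqjet_def le_Suc_eq jet_coords_def)
  then show ?thesis using jets_rep[OF Y(1)] jets_rep[OF Y(2)] jet_eq_iff by metis
qed

lemma smooth_map_jet:
  assumes M: "manifold M" and f: "smooth_map M N f" and \<gamma>: "curve M \<gamma>" and \<delta>: "\<delta> \<in> jet M k \<gamma>"
  shows "f \<circ> \<delta> \<in> jet N k (f \<circ> \<gamma>)"
  unfolding jet_iff
proof (intro conjI ballI; clarify?)
  have \<delta>': "curve M \<delta>" "\<delta> 0 = \<gamma> 0" using \<delta> by (auto simp: jet_iff)
  show "curve N (f \<circ> \<delta>)" by (rule curve_smooth_map[OF M f \<delta>'(1)])
  show "(f \<circ> \<delta>) 0 = (f \<circ> \<gamma>) 0" by (simp add: \<delta>')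
  fix V \<psi> i assume V: "(V, \<psi>) \<in> atlas N" "(f \<circ> \<gamma>) 0 \<in> V" and i: "i \<in> idx N"
  obtain U \<phi> where U: "(U, \<phi>) \<in> atlas M" "\<gamma> 0 \<in> U" using pts_chartE[OF curve_pts[OF \<gamma>]] by metis
  note cU = smooth_chart_atlas[OF M U(1)]
  obtain S where S: "open S" "0 \<in> S" "\<And>t. t \<in> S \<Longrightarrow> \<delta> t \<in> U" "\<And>i. i \<in> idx M \<Longrightarrow> smooth_real_on S (\<lambda>t. \<phi> (\<delta> t) i)"
    "\<And>t. t \<in> S \<Longrightarrow> \<gamma> t \<in> U" "\<And>i. i \<in> idx M \<Longrightarrow> smooth_real_on S (\<lambda>t. \<phi> (\<gamma> t) i)"
    using curve_near_chart2[OF M \<delta>'(1) \<gamma> cU] U(2) \<delta>'(2) by metis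
  have "openin (Rn (idx M)) (\<phi> ` (U \<inter> f -` V))" "smooth_on (idx M) (\<phi> ` (U \<inter> f -` V)) (\<lambda>x. \<psi> (f (inv_into U \<phi> x)) i)"
    using f U(1) V(1) i unfolding smooth_map_def by blast+
  then have "eqjet k (\<lambda>t. \<psi> (f (\<delta> t)) i) (\<lambda>t. \<psi> (f (\<gamma> t)) i)"
    by (rule curve_in_chart_eqjet[OF manifold_finite[OF M] smooth_chartD(2)[OF cU] _ _ S])
      (use V(2) \<delta>' \<delta> U in \<open>auto simp: jet_iff\<close>)
  then show "eqjet k (\<lambda>t. \<psi> ((f \<circ> \<delta>) t) i) (\<lambda>t. \<psi> ((f \<circ> \<gamma>) t) i)" by simp
qed

lemma curve_reparam:
  assumes "curve M \<gamma>" "open S" "s \<in> S" "smooth_real_on S u" "u s = 0"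
  obtains S' where "open S'" "s \<in> S'" "curve_on M S' (\<lambda>t. \<gamma> (u t))"
proof -
  obtain T where T: "0 \<in> T" "curve_on M T \<gamma>" using assms(1) by (auto simp: curve_iff)
  have cont: "continuous_on S u"
    by (rule DERIV_continuous_on) (rule has_field_derivative_at_within[OF smooth_real_on_has_deriv[OF assms(4)]])
  have o: "open (S \<inter> u -` T)" by (rule continuous_open_preimage[OF cont assms(2) curve_on_open[OF T(2)]])
  show thesis
    by (rule that[OF o _ curve_on_reparam[OF T(2) o smooth_real_on_mono[OF assms(4)]]]) (use assms T in auto)
qed

lemma smooth_real_on_affine: "open S \<Longrightarrow> smooth_real_on S (\<lambda>t. c * t)" "open S \<Longrightarrow> smooth_real_on S (\<lambda>t. c + t)"
  by (rule smooth_real_on_mult smooth_real_on_add; simp add: smooth_real_on_const smooth_real_on_ident)+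

lemma curve_scale: "curve M \<gamma> \<Longrightarrow> curve M (\<lambda>t. \<gamma> (c * t))"
  by (rule curve_reparam[of M \<gamma> UNIV 0 "\<lambda>t. c * t"])
    (use curve_iff in \<open>auto simp: smooth_real_on_affine\<close>)

lemma curve_shift:
  assumes "curve_on M S \<gamma>" "t \<in> S"
  shows "curve M (\<lambda>s. \<gamma> (t + s))"
proof -
  let ?S = "(\<lambda>s. t + s) -` S"
  have o: "open ?S" by (rule open_vimage[OF curve_on_open[OF assms(1)]]) (intro continuous_intros)
  have "curve_on M ?S (\<lambda>s. \<gamma> (t + s))"
    by (rule curve_on_reparam[OF assms(1) o]) (auto simp: smooth_real_on_affine o)
  then show ?thesis using assms(2) unfolding curve_iff by (intro exI[of _ ?S]) auto
qed

definition pt2 :: "real \<Rightarrow> real \<Rightarrow> bool \<Rightarrow> real" where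
  "pt2 s t = (\<lambda>b. if b then t else s)"

lemma pt2_simps [simp]: "pt2 s t True = t" "pt2 s t False = s" "(pt2 s t)(True := t') = pt2 s t'"
    "(pt2 s t)(False := s') = pt2 s' t"
  by (auto simp: pt2_def)

lemma pdiffs_pt2: "(deriv ^^ \<alpha>) (\<lambda>t. f (pt2 s t)) t = pdiffs (replicate \<alpha> True) f (pt2 s t)"
proof (induction \<alpha> arbitrary: t)
  case (Suc \<alpha>)
  have "(deriv ^^ \<alpha>) (\<lambda>t. f (pt2 s t)) = (\<lambda>t. pdiffs (replicate \<alpha> True) f (pt2 s t))" using Suc by blast
  then show ?case by (simp add: pdiff_def)
qed simp

text \<open>
  In coordinates the canonical flip only exchanges the two orders of differentiation of a surface, and mixed partial
  derivatives commute.
\<close>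

lemma surface_flip:
  assumes \<Gamma>: "surface M \<Gamma>" and U: "(U, \<phi>) \<in> atlas M" "\<Gamma> 0 0 \<in> U" and i: "i \<in> idx M"
  shows "(deriv ^^ \<alpha>) (\<lambda>t. deriv (\<lambda>s. \<phi> (\<Gamma> s t) i) 0) 0 = deriv (\<lambda>s. (deriv ^^ \<alpha>) (\<lambda>t. \<phi> (\<Gamma> s t) i) 0) 0"
proof -
  obtain S where S: "openin (Rn (UNIV :: bool set)) S" "(\<lambda>_. 0) \<in> S"
    "smooth_map (open_mfd UNIV S) M (\<lambda>z. \<Gamma> (z False) (z True))"
    using \<Gamma> by (auto simp: surface_def)
  define P where "P = id ` (S \<inter> (\<lambda>z. \<Gamma> (z False) (z True)) -` U)"
  define f where "f z = \<phi> (\<Gamma> (z False) (z True)) i" for z :: "bool \<Rightarrow> real"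
  have "openin (Rn UNIV) P" "smooth_on UNIV P (\<lambda>x. \<phi> (\<Gamma> (inv_into S id x False) (inv_into S id x True)) i)"
    using S(3) U i unfolding smooth_map_def P_def by (auto simp: open_mfd_def)
  then have P: "openin (Rn UNIV) P" "smooth_on UNIV P f"
  proof -
    assume *: "openin (Rn UNIV) P" "smooth_on UNIV P (\<lambda>x. \<phi> (\<Gamma> (inv_into S id x False) (inv_into S id x True)) i)"
    show "smooth_on UNIV P f"
    proof (rule smooth_on_cong[OF *(1) finite *(2)])
      fix x assume "x \<in> P"
      then have "inv_into S id x = x" using inv_into_f_f[of id S x] by (auto simp: P_def)
      then show "f x = \<phi> (\<Gamma> (inv_into S id x False) (inv_into S id x True)) i" by (simp add: f_def)
    qed
  qed
  have "pt2 0 0 = (\<lambda>_. 0)" by (auto simp: pt2_def)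
  then have 0: "pt2 0 0 \<in> P" using S(2) U(2) by (auto simp: P_def)
  have "(deriv ^^ \<alpha>) (\<lambda>t. deriv (\<lambda>s. \<phi> (\<Gamma> s t) i) 0) 0 = (deriv ^^ \<alpha>) (\<lambda>t. pdiff False f (pt2 0 t)) 0"
    by (simp add: pdiff_def f_def)
  also have "\<dots> = pdiffs (replicate \<alpha> True) (pdiff False f) (pt2 0 0)" by (rule pdiffs_pt2)
  also have "\<dots> = pdiff False (pdiffs (replicate \<alpha> True) f) (pt2 0 0)"
    by (rule pdiff_pdiffs_commute[OF finite P 0, symmetric]) auto
  also have "\<dots> = deriv (\<lambda>s. pdiffs (replicate \<alpha> True) f (pt2 s 0)) 0" by (simp add: pdiff_def)
  also have "\<dots> = deriv (\<lambda>s. (deriv ^^ \<alpha>) (\<lambda>t. \<phi> (\<Gamma> s t) i) 0) 0"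
    unfolding pdiffs_pt2[symmetric] by (simp add: f_def)
  finally show ?thesis .
qed

lemma surface_curves:
  assumes \<Gamma>: "surface M \<Gamma>" and U: "(U, \<phi>) \<in> atlas M" "\<Gamma> 0 0 \<in> U"
  obtains S where "open S" "0 \<in> S" "\<And>t. t \<in> S \<Longrightarrow> curve M (\<lambda>s. \<Gamma> s t) \<and> \<Gamma> 0 t \<in> U"
    "\<And>s. s \<in> S \<Longrightarrow> curve M (\<lambda>t. \<Gamma> s t) \<and> \<Gamma> s 0 \<in> U"
proof -
  obtain T where T: "openin (Rn (UNIV :: bool set)) T" "(\<lambda>_. 0) \<in> T"
    "smooth_map (open_mfd UNIV T) M (\<lambda>z. \<Gamma> (z False) (z True))"
    using \<Gamma> by (auto simp: surface_def)
  let ?O = "open_mfd (UNIV :: bool set) T"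
  have ch: "is_chart (idx ?O) (V, \<psi>)" if "(V, \<psi>) \<in> atlas ?O" for V \<psi>
    using that T(1) by (auto simp: open_mfd_def is_chart_def)
  have fin: "finite (idx ?O)" by (simp add: open_mfd_def)
  have sm: "smooth_real_on UNIV (\<lambda>s. pt2 s t b)" "smooth_real_on UNIV (\<lambda>t. pt2 s t b)" for s t b
    by (cases b; simp add: smooth_real_on_const smooth_real_on_ident)+
  have ext: "pt2 s t \<in> extensional UNIV" for s t by (simp add: extensional_def)
  have opn: "open {s. pt2 s t \<in> T}" "open {t. pt2 s t \<in> T}" for s t
    using open_preimage_Rn[OF open_UNIV finite T(1) sm(1)[of t]] open_preimage_Rn[OF open_UNIV finite T(1) sm(2)[of s]] ext by simp_all
  have c1: "curve_on ?O {s. pt2 s t \<in> T} (\<lambda>s. pt2 s t)" for t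
    using opn(1)[of t] smooth_real_on_mono[OF sm(1)[of t]] by (simp add: curve_on_def open_mfd_def pts_def image_subset_iff)
  have c2: "curve_on ?O {t. pt2 s t \<in> T} (\<lambda>t. pt2 s t)" for s
    using opn(2)[of s] smooth_real_on_mono[OF sm(2)[of s]] by (simp add: curve_on_def open_mfd_def pts_def image_subset_iff)
  have d1: "curve_on M {s. pt2 s t \<in> T} (\<lambda>s. \<Gamma> s t)" for t
    using curve_on_smooth_map[OF fin ch T(3) c1[of t]] by (simp add: o_def)
  have d2: "curve_on M {t. pt2 s t \<in> T} (\<lambda>t. \<Gamma> s t)" for s
    using curve_on_smooth_map[OF fin ch T(3) c2[of s]] by (simp add: o_def)
  have 00: "pt2 0 0 \<in> T" using T(2) by (simp add: pt2_def)
  let ?S = "{t \<in> {t. pt2 0 t \<in> T}. \<Gamma> 0 t \<in> U} \<inter> {s \<in> {s. pt2 s 0 \<in> T}. \<Gamma> s 0 \<in> U}"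
  show thesis
  proof (rule that[of ?S])
    show "open ?S" by (intro open_Int curve_on_atlas(1)[OF d1 U(1)] curve_on_atlas(1)[OF d2 U(1)])
    show "0 \<in> ?S" using 00 U(2) by simp
    show "curve M (\<lambda>s. \<Gamma> s t) \<and> \<Gamma> 0 t \<in> U" if "t \<in> ?S" for t
      using that by (intro conjI curve_iff[THEN iffD2] exI[of _ "{s. pt2 s t \<in> T}"] d1) auto
    show "curve M (\<lambda>t. \<Gamma> s t) \<and> \<Gamma> s 0 \<in> U" if "s \<in> ?S" for s
      using that by (intro conjI curve_iff[THEN iffD2] exI[of _ "{t. pt2 s t \<in> T}"] d2) auto
  qed
qed

section \<open>Charts and homotheties of graded bundles\<close>

text \<open>
  A bundle chart together with the chart of the base that it covers, whose existence is part of the definition of graded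
  bundles.
\<close>

definition gchart ::
  "('e, 'm, 'i) gbundle \<Rightarrow> 'e set \<Rightarrow> ('e \<Rightarrow> 'i \<Rightarrow> real) \<Rightarrow> 'm set \<Rightarrow> ('m \<Rightarrow> 'i \<Rightarrow> real) \<Rightarrow> bool" where
  "gchart E W \<psi> U \<phi> \<longleftrightarrow> (W, \<psi>) \<in> atlas (tot E) \<and> smooth_chart (base E) (U, \<phi>) \<and>
     W = {e \<in> pts (tot E). proj E e \<in> U} \<and>
     (\<forall>e\<in>W. restrict (\<psi> e) (idx (base E)) = \<phi> (proj E e)) \<and>
     \<psi> ` W = {z \<in> extensional (idx (tot E)). restrict z (idx (base E)) \<in> \<phi> ` U}"

lemma graded_bundleD:
  assumes "graded_bundle k E"
  shows "manifold (tot E)" "manifold (base E)" "\<And>i. i \<in> idx (tot E) \<Longrightarrow> wt E i \<le> k"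
    "idx (base E) = {i \<in> idx (tot E). wt E i = 0}" "proj E ` pts (tot E) = pts (base E)"
  using assms by (auto simp: graded_bundle_def)

lemma gchart_exists:
  assumes "graded_bundle k E" "(W, \<psi>) \<in> atlas (tot E)"
  obtains U \<phi> where "gchart E W \<psi> U \<phi>"
proof -
  have "\<exists>U \<phi>. smooth_chart (base E) (U, \<phi>) \<and>
        W = {e \<in> pts (tot E). proj E e \<in> U} \<and>
        (\<forall>e\<in>W. restrict (\<psi> e) (idx (base E)) = \<phi> (proj E e)) \<and>
        \<psi> ` W = {z \<in> topspace (Rn (idx (tot E))). restrict z (idx (base E)) \<in> \<phi> ` U}"
    using assms unfolding graded_bundle_def by fast
  then show thesis using that assms(2) unfolding gchart_def by auto
qed

lemma gchart_over:
  assumes "graded_bundle k E" "x \<in> pts (base E)"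
  obtains W \<psi> U \<phi> where "gchart E W \<psi> U \<phi>" "x \<in> U"
proof -
  have "x \<in> proj E ` pts (tot E)" using graded_bundleD(5)[OF assms(1)] assms(2) by simp
  then obtain e where e: "e \<in> pts (tot E)" "proj E e = x" by blast
  obtain W \<psi> where W: "(W, \<psi>) \<in> atlas (tot E)" "e \<in> W" using pts_chartE[OF e(1)] .
  obtain U \<phi> where "gchart E W \<psi> U \<phi>" using gchart_exists[OF assms(1) W(1)] .
  then show thesis using that e W by (auto simp: gchart_def)
qed

locale graded_bundle_chart =
  fixes k :: nat and E :: "('e, 'm, 'i) gbundle" and W \<psi> U \<phi>
  assumes gb: "graded_bundle k E" and gch: "gchart E W \<psi> U \<phi>"
begin

lemmas mfd = graded_bundleD(1)[OF gb] and base_mfd = graded_bundleD(2)[OF gb]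
  and base_idx = graded_bundleD(4)[OF gb] and wt_le = graded_bundleD(3)[OF gb]

lemma atlas: "(W, \<psi>) \<in> atlas (tot E)" and base_chart: "smooth_chart (base E) (U, \<phi>)"
  using gch by (auto simp: gchart_def)

lemma smooth_chart: "smooth_chart (tot E) (W, \<psi>)"
  by (rule smooth_chart_atlas[OF mfd atlas])

lemma fin: "finite (idx (tot E))" "finite (idx (base E))" "finite (fib_idx E)"
  using manifold_finite[OF mfd] manifold_finite[OF base_mfd] by (auto simp: fib_idx_def)

lemma idx_cases: "i \<in> idx (tot E) \<longleftrightarrow> i \<in> idx (base E) \<or> i \<in> fib_idx E"
  and idx_disj: "i \<in> fib_idx E \<Longrightarrow> i \<notin> idx (base E)"
  and wt_base: "i \<in> idx (base E) \<Longrightarrow> wt E i = 0"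
  using base_idx by (auto simp: fib_idx_def)

lemma inj: "inj_on \<psi> W" and ext: "e \<in> W \<Longrightarrow> \<psi> e \<in> extensional (idx (tot E))"
  using is_chartD[OF manifold_atlas_chart[OF mfd atlas]] by blast+

lemma base_inj: "inj_on \<phi> U" and base_ext: "x \<in> U \<Longrightarrow> \<phi> x \<in> extensional (idx (base E))"
  using is_chartD[OF smooth_chartD(2)[OF base_chart]] by blast+

lemma mem_iff: "e \<in> W \<longleftrightarrow> e \<in> pts (tot E) \<and> proj E e \<in> U"
  using gch by (auto simp: gchart_def)

lemma base_coord: "e \<in> W \<Longrightarrow> i \<in> idx (base E) \<Longrightarrow> \<psi> e i = \<phi> (proj E e) i"
proof -
  assume "e \<in> W" "i \<in> idx (base E)"
  then have "restrict (\<psi> e) (idx (base E)) i = \<phi> (proj E e) i" using gch unfolding gchart_def by simp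
  then show ?thesis using \<open>i \<in> idx (base E)\<close> by simp
qed

lemma eqI:
  assumes "e \<in> W" "e' \<in> W" "\<And>i. i \<in> idx (tot E) \<Longrightarrow> \<psi> e i = \<psi> e' i"
  shows "e = e'"
  by (rule inj_onD[OF inj extensionalityI[OF ext ext]]) (use assms in auto)

lemma base_eqI:
  assumes "x \<in> U" "x' \<in> U" "\<And>i. i \<in> idx (base E) \<Longrightarrow> \<phi> x i = \<phi> x' i"
  shows "x = x'"
  by (rule inj_onD[OF base_inj extensionalityI[OF base_ext base_ext]]) (use assms in auto)

definition coords :: "'m \<Rightarrow> ('i \<Rightarrow> real) \<Rightarrow> 'i \<Rightarrow> real" where
  "coords x y = (\<lambda>i\<in>idx (tot E). if i \<in> idx (base E) then \<phi> x i else y i)"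

definition point :: "'m \<Rightarrow> ('i \<Rightarrow> real) \<Rightarrow> 'e" where
  "point x y = inv_into W \<psi> (coords x y)"

lemma coords_in: 
  assumes "x \<in> U" shows "coords x y \<in> \<psi> ` W"
proof -
  have "restrict (coords x y) (idx (base E)) = \<phi> x"
    by (rule extensionalityI[of _ "idx (base E)"])
      (use base_ext[OF assms] idx_cases in \<open>auto simp: coords_def\<close>)
  then show ?thesis using assms gch by (auto simp: gchart_def coords_def)
qed

lemma point:
  assumes "x \<in> U"
  shows "point x y \<in> W" "\<psi> (point x y) = coords x y" "proj E (point x y) = x"
    "i \<in> idx (base E) \<Longrightarrow> \<psi> (point x y) i = \<phi> x i" "i \<in> fib_idx E \<Longrightarrow> \<psi> (point x y) i = y i"
proof -
  show p: "point x y \<in> W" "\<psi> (point x y) = coords x y"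
    unfolding point_def using coords_in[OF assms] by (auto intro: inv_into_into f_inv_into_f)
  show 0: "\<psi> (point x y) i = \<phi> x i" if "i \<in> idx (base E)" for i
    using that idx_cases p by (simp add: coords_def)
  show "\<psi> (point x y) i = y i" if "i \<in> fib_idx E" for i
    using that idx_cases idx_disj p by (simp add: coords_def)
  show "proj E (point x y) = x"
    by (rule base_eqI) (use p mem_iff assms base_coord[OF p(1)] 0 in auto)
qed

lemma curve_on_point:
  assumes S: "open S" and c: "\<And>t. t \<in> S \<Longrightarrow> c t \<in> U"
    "\<And>i. i \<in> idx (base E) \<Longrightarrow> smooth_real_on S (\<lambda>t. \<phi> (c t) i)"
    and y: "\<And>i. i \<in> fib_idx E \<Longrightarrow> smooth_real_on S (\<lambda>t. y t i)"
  shows "curve_on (tot E) S (\<lambda>t. point (c t) (y t))"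
proof (rule curve_onI[OF mfd S smooth_chart])
  fix i assume "i \<in> idx (tot E)"
  then show "smooth_real_on S (\<lambda>t. \<psi> (point (c t) (y t)) i)"
    using point(4,5)[OF c(1)] c(2)[of i] y[of i] idx_cases
    by (cases "i \<in> idx (base E)") (auto intro: smooth_real_on_cong[OF S])
qed (use point(1)[OF c(1)] in auto)

lemma proj_curve:
  assumes \<gamma>: "curve (tot E) \<gamma>" and 0: "\<gamma> 0 \<in> W"
  shows "curve (base E) (proj E \<circ> \<gamma>)"
proof -
  obtain S where S: "open S" "0 \<in> S" "\<And>t. t \<in> S \<Longrightarrow> \<gamma> t \<in> W"
    "\<And>i. i \<in> idx (tot E) \<Longrightarrow> smooth_real_on S (\<lambda>t. \<psi> (\<gamma> t) i)"
    using curve_near_chart[OF mfd \<gamma> smooth_chart 0] by blast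
  have "curve_on (base E) S (proj E \<circ> \<gamma>)"
  proof (rule curve_onI[OF base_mfd S(1) base_chart])
    fix i assume "i \<in> idx (base E)"
    then show "smooth_real_on S (\<lambda>t. \<phi> ((proj E \<circ> \<gamma>) t) i)"
      using base_coord[OF S(3)] idx_cases by (intro smooth_real_on_cong[OF S(1) S(4)[of i]]) auto
  qed (use S(3) mem_iff in auto)
  then show ?thesis using S(2) by (auto simp: curve_iff)
qed

text \<open>
  The base part and the fibre part of a jet may be compared separately; the base part is independent of the chart.
\<close>

lemma jet_iff_coords:
  assumes \<gamma>: "curve (tot E) \<gamma>" "\<gamma> 0 \<in> W"
  shows "\<delta> \<in> jet (tot E) n \<gamma> \<longleftrightarrow> curve (tot E) \<delta> \<and> \<delta> 0 \<in> W \<and> proj E \<circ> \<delta> \<in> jet (base E) n (proj E \<circ> \<gamma>) \<and>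
     (\<forall>i \<in> fib_idx E. eqjet n (\<lambda>t. \<psi> (\<delta> t) i) (\<lambda>t. \<psi> (\<gamma> t) i))"
proof -
  have pc: "curve (base E) (proj E \<circ> \<gamma>)" using proj_curve[OF \<gamma>] .
  have p0: "(proj E \<circ> \<gamma>) 0 \<in> U" using \<gamma>(2) mem_iff by auto
  have bc: "eqjet n (\<lambda>t. \<psi> (\<delta> t) i) (\<lambda>t. \<psi> (\<gamma> t) i) \<longleftrightarrow> eqjet n (\<lambda>t. \<phi> ((proj E \<circ> \<delta>) t) i) (\<lambda>t. \<phi> ((proj E \<circ> \<gamma>) t) i)"
    if \<delta>: "curve (tot E) \<delta>" "\<delta> 0 \<in> W" and i: "i \<in> idx (base E)" for i
  proof -
    obtain S where S: "open S" "0 \<in> S" "\<And>t. t \<in> S \<Longrightarrow> \<delta> t \<in> W" "\<And>i. i \<in> idx (tot E) \<Longrightarrow> smooth_real_on S (\<lambda>t. \<psi> (\<delta> t) i)"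
      "\<And>t. t \<in> S \<Longrightarrow> \<gamma> t \<in> W" "\<And>i. i \<in> idx (tot E) \<Longrightarrow> smooth_real_on S (\<lambda>t. \<psi> (\<gamma> t) i)"
      using curve_near_chart2[OF mfd \<delta>(1) \<gamma>(1) smooth_chart \<delta>(2) \<gamma>(2)] by blast
    show ?thesis by (rule eqjet_cong[OF S(1,2)]) (use base_coord[OF S(3) i] base_coord[OF S(5) i] in auto)
  qed
  show ?thesis
  proof
    assume *: "\<delta> \<in> jet (tot E) n \<gamma>"
    then have \<delta>: "curve (tot E) \<delta>" "\<delta> 0 = \<gamma> 0" by (auto simp: jet_iff)
    have \<delta>0: "\<delta> 0 \<in> W" using \<delta> \<gamma> by simp
    have c: "\<forall>i\<in>idx (tot E). eqjet n (\<lambda>t. \<psi> (\<delta> t) i) (\<lambda>t. \<psi> (\<gamma> t) i)"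
      using * jet_iff_chart[OF mfd smooth_chart \<gamma>(2,1)] by blast
    have "proj E \<circ> \<delta> \<in> jet (base E) n (proj E \<circ> \<gamma>)"
      unfolding jet_iff_chart[where \<gamma> = "proj E \<circ> \<gamma>", OF base_mfd base_chart p0 pc]
      using proj_curve[OF \<delta>(1) \<delta>0] \<delta>(2) bc[OF \<delta>(1) \<delta>0] c idx_cases by auto
    then show "curve (tot E) \<delta> \<and> \<delta> 0 \<in> W \<and> proj E \<circ> \<delta> \<in> jet (base E) n (proj E \<circ> \<gamma>) \<and>
       (\<forall>i \<in> fib_idx E. eqjet n (\<lambda>t. \<psi> (\<delta> t) i) (\<lambda>t. \<psi> (\<gamma> t) i))"
      using \<delta> \<delta>0 c idx_cases by blast
  next
    assume *: "curve (tot E) \<delta> \<and> \<delta> 0 \<in> W \<and> proj E \<circ> \<delta> \<in> jet (base E) n (proj E \<circ> \<gamma>) \<and>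
       (\<forall>i \<in> fib_idx E. eqjet n (\<lambda>t. \<psi> (\<delta> t) i) (\<lambda>t. \<psi> (\<gamma> t) i))"
    have c: "eqjet n (\<lambda>t. \<psi> (\<delta> t) i) (\<lambda>t. \<psi> (\<gamma> t) i)" if "i \<in> idx (tot E)" for i
      using * that idx_cases bc[of i] jet_iff_chart[where \<gamma> = "proj E \<circ> \<gamma>", OF base_mfd base_chart p0 pc] by blast
    have "\<delta> 0 = \<gamma> 0"
      by (rule eqI) (use * \<gamma> eqjet_mono[OF c, of _ 0] in \<open>auto simp: eqjet_0\<close>)
    then show "\<delta> \<in> jet (tot E) n \<gamma>"
      unfolding jet_iff_chart[OF mfd smooth_chart \<gamma>(2,1)] using * c by blast
  qed
qed

text \<open>
  The homothety multiplies the coordinates of weight \<open>w\<close> by \<open>t\<^sup>w\<close> in every chart at once, because the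
  transition functions are homogeneous.
\<close>

lemma act_exists:
  assumes e: "e \<in> W"
  shows "\<exists>!e'. e' \<in> pts (tot E) \<and>
     (\<forall>(W', \<psi>') \<in> atlas (tot E). e \<in> W' \<longrightarrow> e' \<in> W' \<and> (\<forall>i \<in> idx (tot E). \<psi>' e' i = t ^ wt E i * \<psi>' e i))"
proof -
  have x: "proj E e \<in> U" using e mem_iff by auto
  define e' where "e' = point (proj E e) (\<lambda>i. t ^ wt E i * \<psi> e i)"
  note p = point[OF x, where y = "\<lambda>i. t ^ wt E i * \<psi> e i", folded e'_def]
  have co: "\<psi> e' i = t ^ wt E i * \<psi> e i" if "i \<in> idx (tot E)" for i
    using that p(4,5) idx_cases[of i] base_coord[OF e] wt_base by auto
  have "e' \<in> W' \<and> (\<forall>i \<in> idx (tot E). \<psi>' e' i = t ^ wt E i * \<psi>' e i)"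
    if W': "(W', \<psi>') \<in> atlas (tot E)" and eW': "e \<in> W'" for W' \<psi>'
  proof -
    obtain U' \<phi>' where g': "gchart E W' \<psi>' U' \<phi>'" using gchart_exists[OF gb W'] .
    interpret c': graded_bundle_chart k E W' \<psi>' U' \<phi>' using gb g' by unfold_locales
    have e'W': "e' \<in> W'" using c'.mem_iff eW' p(1,3) mem_iff by auto
    moreover have "\<psi>' e' i = t ^ wt E i * \<psi>' e i" if i: "i \<in> idx (tot E)" for i
    proof (cases "i \<in> idx (base E)")
      case True
      then show ?thesis using c'.base_coord[OF e'W' True] c'.base_coord[OF eW' True] p(3) wt_base by simp
    next
      case False
      then have fib: "i \<in> fib_idx E" using i idx_cases by blast
      have "\<forall>(W, \<psi>) \<in> atlas (tot E). \<forall>(W', \<psi>') \<in> atlas (tot E). \<forall>j \<in> fib_idx E. \<exists>c.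
        (\<forall>m \<in> monomials E (wt E j). smooth_fun (base E) (proj E ` (W \<inter> W')) (c m)) \<and>
        (\<forall>e \<in> W \<inter> W'. \<psi>' e j =
           (\<Sum>m \<in> monomials E (wt E j). c m (proj E e) * (\<Prod>i \<in> fib_idx E. \<psi> e i ^ m i)))"
        using gb unfolding graded_bundle_def by (elim conjE)
      from bspec[OF bspec[OF this atlas, unfolded prod.case] W', unfolded prod.case]
      obtain c where c: "\<And>e. e \<in> W \<inter> W' \<Longrightarrow> \<psi>' e i =
           (\<Sum>m \<in> monomials E (wt E i). c m (proj E e) * (\<Prod>l \<in> fib_idx E. \<psi> e l ^ m l))"
        using fib by blast
      have "(\<Prod>l \<in> fib_idx E. \<psi> e' l ^ m l) = t ^ wt E i * (\<Prod>l \<in> fib_idx E. \<psi> e l ^ m l)"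
        if m: "m \<in> monomials E (wt E i)" for m
      proof -
        have "(\<Prod>l \<in> fib_idx E. \<psi> e' l ^ m l) = (\<Prod>l \<in> fib_idx E. t ^ (m l * wt E l) * \<psi> e l ^ m l)"
          by (rule prod.cong) (use co idx_cases in \<open>auto simp: power_mult_distrib power_mult[symmetric] mult.commute\<close>)
        also have "\<dots> = t ^ (\<Sum>l\<in>fib_idx E. m l * wt E l) * (\<Prod>l \<in> fib_idx E. \<psi> e l ^ m l)"
          by (simp add: prod.distrib power_sum)
        finally show ?thesis using m by (simp add: monomials_def)
      qed
      then show ?thesis
        using c[of e'] c[of e] e eW' e'W' p(1,3) by (simp add: sum_distrib_left mult_ac)
    qed
    ultimately show ?thesis by blast
  qed
  then have ex: "e' \<in> pts (tot E) \<and>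
     (\<forall>(W', \<psi>') \<in> atlas (tot E). e \<in> W' \<longrightarrow> e' \<in> W' \<and> (\<forall>i \<in> idx (tot E). \<psi>' e' i = t ^ wt E i * \<psi>' e i))"
    using p(1) mem_iff by blast
  show ?thesis
  proof (rule ex1I[of _ e'], rule ex)
    fix e'' assume *: "e'' \<in> pts (tot E) \<and>
     (\<forall>(W', \<psi>') \<in> atlas (tot E). e \<in> W' \<longrightarrow> e'' \<in> W' \<and> (\<forall>i \<in> idx (tot E). \<psi>' e'' i = t ^ wt E i * \<psi>' e i))"
    then have "e'' \<in> W" "\<And>i. i \<in> idx (tot E) \<Longrightarrow> \<psi> e'' i = t ^ wt E i * \<psi> e i" using atlas e by blast+
    then show "e'' = e'" using co p(1) by (intro eqI) auto
  qed
qed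

lemma gact:
  assumes e: "e \<in> W"
  shows "gact E t e \<in> W" "i \<in> idx (tot E) \<Longrightarrow> \<psi> (gact E t e) i = t ^ wt E i * \<psi> e i"
    "proj E (gact E t e) = proj E e"
proof -
  note * = theI'[OF act_exists[OF e, of t], folded act_def]
  show 1: "gact E t e \<in> W" using * atlas e by blast
  show 2: "\<psi> (gact E t e) i = t ^ wt E i * \<psi> e i" if "i \<in> idx (tot E)" for i using * atlas e that by blast
  show "proj E (gact E t e) = proj E e"
    by (rule base_eqI) (use 1 2 e mem_iff base_coord[OF 1] base_coord[OF e] idx_cases wt_base in auto)
qed

lemma gact_eqI:
  assumes "e \<in> W" "e' \<in> W" "\<And>i. i \<in> idx (tot E) \<Longrightarrow> \<psi> e' i = t ^ wt E i * \<psi> e i"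
  shows "e' = gact E t e"
  by (rule eqI) (use assms gact in auto)

lemma curve_on_gact:
  assumes S: "open S" and \<gamma>: "\<And>t. t \<in> S \<Longrightarrow> \<gamma> t \<in> W"
    "\<And>i. i \<in> idx (tot E) \<Longrightarrow> smooth_real_on S (\<lambda>t. \<psi> (\<gamma> t) i)"
    and u: "smooth_real_on S u"
  shows "curve_on (tot E) S (\<lambda>t. gact E (u t) (\<gamma> t))"
proof (rule curve_onI[OF mfd S smooth_chart])
  fix i assume i: "i \<in> idx (tot E)"
  have "smooth_real_on S (\<lambda>t. u t ^ wt E i * \<psi> (\<gamma> t) i)"
    by (intro smooth_real_on_mult smooth_real_on_power S u \<gamma> i)
  then show "smooth_real_on S (\<lambda>t. \<psi> (gact E (u t) (\<gamma> t)) i)"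
    by (rule smooth_real_on_cong[OF S]) (use gact \<gamma> i in auto)
qed (use gact \<gamma> in auto)

lemma tangent_eqI:
  assumes "Y \<in> jets (tot E) 1" "Y' \<in> jets (tot E) 1" "base_pt Y \<in> W" "base_pt Y' = base_pt Y"
    "\<And>i. i \<in> idx (tot E) \<Longrightarrow> jet_coords 1 (idx (tot E)) \<psi> Y (1, i) = jet_coords 1 (idx (tot E)) \<psi> Y' (1, i)"
  shows "Y = Y'"
  by (rule jets1_eqI[OF mfd atlas assms])

text \<open>
  The weight vector is the velocity of the homotheties at \<open>t = 1\<close>, and \<open>s \<mapsto> h\<^sub>1\<^sub>+\<^sub>s(e)\<close> is a representative.
\<close>

lemma weight_field:
  assumes e: "e \<in> W"
  shows "weight_field (tot E) (wt E) e = jet (tot E) 1 (\<lambda>s. gact E (1 + s) e)"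
    "curve (tot E) (\<lambda>s. gact E (1 + s) e)" "gact E 1 e = e"
    "i \<in> idx (tot E) \<Longrightarrow> jet_coords 1 (idx (tot E)) \<psi> (weight_field (tot E) (wt E) e) (1, i) = real (wt E i) * \<psi> e i"
proof -
  let ?\<gamma> = "\<lambda>s. gact E (1 + s) e"
  show g1: "gact E 1 e = e" by (rule gact_eqI[symmetric]) (use e in auto)
  have "curve_on (tot E) UNIV ?\<gamma>"
    by (rule curve_on_gact) (use e in \<open>auto simp: smooth_real_on_const smooth_real_on_affine\<close>)
  then show c: "curve (tot E) ?\<gamma>" by (auto simp: curve_iff)
  have co: "jet_coords 1 (idx (tot E)) \<psi>' (jet (tot E) 1 ?\<gamma>) (1, i) = real (wt E i) * \<psi>' e i"
    if W': "(W', \<psi>') \<in> atlas (tot E)" "e \<in> W'" and i: "i \<in> idx (tot E)" for W' \<psi>' i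
  proof -
    obtain U' \<phi>' where g': "gchart E W' \<psi>' U' \<phi>'" using gchart_exists[OF gb W'(1)] .
    interpret c': graded_bundle_chart k E W' \<psi>' U' \<phi>' using gb g' by unfold_locales
    have "((\<lambda>s. (1 + s) ^ wt E i * \<psi>' e i) has_real_derivative real (wt E i) * \<psi>' e i) (at 0)"
      by (auto intro!: derivative_eq_intros)
    then have "deriv (\<lambda>s. \<psi>' (?\<gamma> s) i) 0 = real (wt E i) * \<psi>' e i"
      using c'.gact(2)[OF W'(2) i] by (simp add: DERIV_imp_deriv)
    then show ?thesis using jet_coords_jet[OF c W'(1), of 1 1 i] W'(2) i g1 by simp
  qed
  have "weight_field (tot E) (wt E) e = jet (tot E) 1 ?\<gamma>"
    unfolding weight_field_def
  proof (rule the_equality)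
    show "jet (tot E) 1 ?\<gamma> \<in> jets (tot E) 1 \<and> base_pt (jet (tot E) 1 ?\<gamma>) = e \<and>
     (\<forall>(W, \<psi>) \<in> atlas (tot E). e \<in> W \<longrightarrow>
        (\<forall>i \<in> idx (tot E). jet_coords 1 (idx (tot E)) \<psi> (jet (tot E) 1 ?\<gamma>) (1, i) = real (wt E i) * \<psi> e i))"
      using co jet_in_jets[OF c] base_pt_jet[OF c] g1 by auto
    fix Y assume Y: "Y \<in> jets (tot E) 1 \<and> base_pt Y = e \<and> (\<forall>(W, \<psi>) \<in> atlas (tot E). e \<in> W \<longrightarrow>
        (\<forall>i \<in> idx (tot E). jet_coords 1 (idx (tot E)) \<psi> Y (1, i) = real (wt E i) * \<psi> e i))"
    then have "jet_coords 1 (idx (tot E)) \<psi> Y (1, i) = real (wt E i) * \<psi> e i" if "i \<in> idx (tot E)" for i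
      using atlas e that by blast
    then show "Y = jet (tot E) 1 ?\<gamma>"
      using co[OF atlas e] Y e base_pt_jet[OF c] g1 by (intro tangent_eqI jet_in_jets[OF c]) simp_all
  qed
  then show "weight_field (tot E) (wt E) e = jet (tot E) 1 ?\<gamma>" .
  then show "jet_coords 1 (idx (tot E)) \<psi> (weight_field (tot E) (wt E) e) (1, i) = real (wt E i) * \<psi> e i" if "i \<in> idx (tot E)"
    using co[OF atlas e that] by simp
qed

end

section \<open>Jets under homotheties and bundle projections\<close>

lemma jet_local:
  assumes "curve M \<gamma>" "curve M \<delta>" "open S" "0 \<in> S" "\<And>t. t \<in> S \<Longrightarrow> \<gamma> t = \<delta> t"
  shows "jet M k \<gamma> = jet M k \<delta>"
proof -
  have eq: "eqjet k (\<lambda>t. \<phi> (\<gamma> t) i) (\<lambda>t. \<phi> (\<delta> t) i)" for \<phi> :: "'a \<Rightarrow> 'b \<Rightarrow> real" and i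
    using eqjet_cong[OF assms(3,4), of "\<lambda>t. \<phi> (\<gamma> t) i" "\<lambda>t. \<phi> (\<delta> t) i" "\<lambda>t. \<phi> (\<delta> t) i" "\<lambda>t. \<phi> (\<delta> t) i"] assms(5)
    by (simp add: eqjet_refl)
  have "\<gamma> \<in> jet M k \<delta>"
    unfolding jet_iff case_prod_beta by (intro conjI assms(1) assms(5)[OF assms(4)] ballI impI eq)
  then show ?thesis unfolding jet_eq_iff[OF assms(1)] .
qed

lemma jet_act:
  assumes "X \<in> jets M n"
  shows "jet_act M n t X \<in> jets M n" "base_pt (jet_act M n t X) = base_pt X"
    "(U, \<phi>) \<in> atlas M \<Longrightarrow> manifold M \<Longrightarrow> base_pt X \<in> U \<Longrightarrow> \<alpha> \<le> n \<Longrightarrow> i \<in> idx M \<Longrightarrow>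
      jet_coords n (idx M) \<phi> (jet_act M n t X) (\<alpha>, i) = t ^ \<alpha> * jet_coords n (idx M) \<phi> X (\<alpha>, i)"
proof -
  note c = curve_scale[OF jets_rep(1)[OF assms], of t]
  show "jet_act M n t X \<in> jets M n" unfolding jet_act_def by (rule jet_in_jets[OF c])
  show "base_pt (jet_act M n t X) = base_pt X" unfolding jet_act_def base_pt_jet[OF c] by (simp add: base_pt_def)
  assume U: "(U, \<phi>) \<in> atlas M" "base_pt X \<in> U" and M: "manifold M" and \<alpha>: "\<alpha> \<le> n" "i \<in> idx M"
  have "rep X 0 \<in> U" using U(2) by (simp add: base_pt_def)
  then obtain S where S: "open S" "0 \<in> S" "\<And>t. t \<in> S \<Longrightarrow> rep X t \<in> U" "\<And>i. i \<in> idx M \<Longrightarrow> smooth_real_on S (\<lambda>t. \<phi> (rep X t) i)"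
    using curve_near_chart[OF M jets_rep(1)[OF assms] smooth_chart_atlas[OF M U(1)]] by blast
  have "jet_coords n (idx M) \<phi> (jet_act M n t X) (\<alpha>, i) = (deriv ^^ \<alpha>) (\<lambda>s. \<phi> (rep X (t * s)) i) 0"
    unfolding jet_act_def by (rule jet_coords_jet[OF c U(1) _ \<alpha>]) (use U(2) in \<open>simp add: base_pt_def\<close>)
  also have "\<dots> = t ^ \<alpha> * (deriv ^^ \<alpha>) (\<lambda>s. \<phi> (rep X s) i) 0"
    using derivs_scale[OF S(4)[OF \<alpha>(2)] S(1), of t 0] S(2) by simp
  finally show "jet_coords n (idx M) \<phi> (jet_act M n t X) (\<alpha>, i) = t ^ \<alpha> * jet_coords n (idx M) \<phi> X (\<alpha>, i)"
    using \<alpha> by (simp add: jet_coords_def)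
qed

lemma jet_act_jet:
  assumes M: "manifold M" and \<gamma>: "curve M \<gamma>"
  shows "jet_act M n t (jet M n \<gamma>) = jet M n (\<lambda>s. \<gamma> (t * s))"
proof -
  have J: "jet M n \<gamma> \<in> jets M n" by (rule jet_in_jets[OF \<gamma>])
  note c = curve_scale[OF jets_rep(1)[OF J], of t] and c' = curve_scale[OF \<gamma>, of t]
  obtain U \<phi> where U: "(U, \<phi>) \<in> atlas M" "\<gamma> 0 \<in> U" using pts_chartE[OF curve_pts[OF \<gamma>]] .
  note cU = smooth_chart_atlas[OF M U(1)]
  have r0: "rep (jet M n \<gamma>) 0 = \<gamma> 0" using rep_jet[OF \<gamma>] by (auto simp: jet_iff)
  obtain S where S: "open S" "0 \<in> S" "\<And>i. i \<in> idx M \<Longrightarrow> smooth_real_on S (\<lambda>t. \<phi> (rep (jet M n \<gamma>) t) i)"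
     "\<And>i. i \<in> idx M \<Longrightarrow> smooth_real_on S (\<lambda>t. \<phi> (\<gamma> t) i)"
    using curve_near_chart2[OF M jets_rep(1)[OF J] \<gamma> cU] U(2) r0 by metis
  have "(deriv ^^ \<alpha>) (\<lambda>s. \<phi> (rep (jet M n \<gamma>) (t * s)) i) 0 = (deriv ^^ \<alpha>) (\<lambda>s. \<phi> (\<gamma> (t * s)) i) 0"
    if "i \<in> idx M" "\<alpha> \<le> n" for i \<alpha>
    using derivs_scale[OF S(3)[OF that(1)] S(1), of t 0] derivs_scale[OF S(4)[OF that(1)] S(1), of t 0] S(2)
      rep_jet[OF \<gamma>, of n] U that by (auto simp: jet_def)
  then have "(\<lambda>s. rep (jet M n \<gamma>) (t * s)) \<in> jet M n (\<lambda>s. \<gamma> (t * s))"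
    using jet_iff_chart[OF M cU, of "\<lambda>s. \<gamma> (t * s)"] U(2) c c' r0 by (auto simp: eqjet_def)
  then show ?thesis unfolding jet_act_def jet_eq_iff[OF c] .
qed

lemma graded_bundle_curveE:
  assumes "graded_bundle k E" "e \<in> pts (tot E)"
  obtains W \<psi> U \<phi> where "graded_bundle_chart k E W \<psi> U \<phi>" "e \<in> W"
proof -
  obtain W \<psi> where W: "(W, \<psi>) \<in> atlas (tot E)" "e \<in> W" using pts_chartE[OF assms(2)] .
  obtain U \<phi> where "gchart E W \<psi> U \<phi>" using gchart_exists[OF assms(1) W(1)] .
  then show thesis using that W assms(1) by (auto simp: graded_bundle_chart_def)
qed

lemma graded_bundle_proj_curve:
  assumes "graded_bundle k E" "curve (tot E) \<gamma>"
  shows "curve (base E) (proj E \<circ> \<gamma>)"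
proof -
  obtain W \<psi> U \<phi> where "graded_bundle_chart k E W \<psi> U \<phi>" "\<gamma> 0 \<in> W"
    using graded_bundle_curveE[OF assms(1) curve_pts[OF assms(2)]] .
  then show ?thesis using graded_bundle_chart.proj_curve assms(2) by metis
qed

lemma graded_bundle_proj_jet:
  assumes "graded_bundle k E" "curve (tot E) \<gamma>" "\<delta> \<in> jet (tot E) n \<gamma>"
  shows "proj E \<circ> \<delta> \<in> jet (base E) n (proj E \<circ> \<gamma>)"
proof -
  obtain W \<psi> U \<phi> where "graded_bundle_chart k E W \<psi> U \<phi>" "\<gamma> 0 \<in> W"
    using graded_bundle_curveE[OF assms(1) curve_pts[OF assms(2)]] .
  then show ?thesis using graded_bundle_chart.jet_iff_coords assms(2,3) by metis
qed

lemma graded_bundle_gact: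
  assumes "graded_bundle k E" "e \<in> pts (tot E)"
  shows "gact E t e \<in> pts (tot E)" "proj E (gact E t e) = proj E e" "proj E e \<in> pts (base E)" "gact E 1 e = e"
proof -
  obtain W \<psi> U \<phi> where c: "graded_bundle_chart k E W \<psi> U \<phi>" "e \<in> W"
    using graded_bundle_curveE[OF assms] .
  interpret graded_bundle_chart k E W \<psi> U \<phi> by (rule c(1))
  show "gact E t e \<in> pts (tot E)" "proj E (gact E t e) = proj E e" "gact E 1 e = e"
    using gact[OF c(2), where t = t] mem_iff weight_field(3)[OF c(2)] by auto
  show "proj E e \<in> pts (base E)" using graded_bundleD(5)[OF assms(1)] assms(2) by auto
qed

lemma graded_bundle_gact_curve:
  assumes "graded_bundle k E" "curve (tot E) \<gamma>" "smooth_real_on UNIV u"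
  shows "curve (tot E) (\<lambda>s. gact E (u s) (\<gamma> s))"
proof -
  obtain W \<psi> U \<phi> where c: "graded_bundle_chart k E W \<psi> U \<phi>" "\<gamma> 0 \<in> W"
    using graded_bundle_curveE[OF assms(1) curve_pts[OF assms(2)]] .
  interpret graded_bundle_chart k E W \<psi> U \<phi> by (rule c(1))
  obtain S where S: "open S" "0 \<in> S" "\<And>t. t \<in> S \<Longrightarrow> \<gamma> t \<in> W"
    "\<And>i. i \<in> idx (tot E) \<Longrightarrow> smooth_real_on S (\<lambda>t. \<psi> (\<gamma> t) i)"
    using curve_near_chart[OF mfd assms(2) smooth_chart c(2)] by blast
  show ?thesis
    using curve_on_gact[OF S(1,3,4) smooth_real_on_mono[OF assms(3)]] S(2) by (auto simp: curve_iff)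
qed


lemma eqjet_deriv: "eqjet 1 f g \<Longrightarrow> deriv f 0 = deriv g 0"
  by (simp add: eqjet_Suc eqjet_0)


section \<open>Anchored comorphisms and the jets of admissible curves\<close>

locale anchored_comorphism =
  fixes k :: nat and A :: "('a, 'm, 'i) gbundle" and E :: "('e, 'm, 'i) gbundle"
    and \<kappa> :: "((real \<Rightarrow> 'a) set \<times> (real \<Rightarrow> 'e) set) set" and anc :: "'e \<Rightarrow> (real \<Rightarrow> 'm) set"
    and sharp :: "'a \<Rightarrow> (real \<Rightarrow> 'm) set"
  assumes k: "1 \<le> k" and gbA: "graded_bundle 1 A" and gbE: "graded_bundle k E" and base_A: "base A = base E"
    and gc: "graded_comorphism k A E \<kappa> anc"
    and sharp: "graded_morphism (tot A) (gact A) (Tk 1 (base E)) (jet_act (base E) 1) sharp"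
    and sharp_base: "\<And>a. a \<in> pts (tot A) \<Longrightarrow> base_pt (sharp a) = proj A a"
    and flip: "\<And>X Y. (X, Y) \<in> \<kappa> \<Longrightarrow>
      (Tk_map (Tk 1 (base E)) k sharp X, Tk_map (Tk k (base E)) 1 anc Y) \<in> flip_graph k (base E)"
begin

abbreviation "M \<equiv> base E"

lemma mfds: "manifold M" "manifold (tot A)" "manifold (tot E)"
  using graded_bundleD gbA gbE by blast+

lemma anc_morphism:
  shows "smooth_map (tot E) (Tk k M) anc"
    and "e \<in> pts (tot E) \<Longrightarrow> anc (gact E t e) = jet_act M k t (anc e)"
    and "e \<in> pts (tot E) \<Longrightarrow> base_pt (anc e) = proj E e"
    and "e \<in> pts (tot E) \<Longrightarrow> anc e \<in> jets M k"
proof -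
  show 1: "smooth_map (tot E) (Tk k M) anc" "e \<in> pts (tot E) \<Longrightarrow> anc (gact E t e) = jet_act M k t (anc e)"
    "e \<in> pts (tot E) \<Longrightarrow> base_pt (anc e) = proj E e"
    using gc unfolding graded_comorphism_def graded_morphism_def by blast+
  show "e \<in> pts (tot E) \<Longrightarrow> anc e \<in> jets M k"
    using 1(1) unfolding smooth_map_def pts_Tk by blast
qed

lemma sharp_morphism:
  shows "smooth_map (tot A) (Tk 1 M) sharp"
    and "e \<in> pts (tot A) \<Longrightarrow> sharp (gact A t e) = jet_act M 1 t (sharp e)"
    and "e \<in> pts (tot A) \<Longrightarrow> sharp e \<in> jets M 1"
proof -
  show 1: "smooth_map (tot A) (Tk 1 M) sharp" "e \<in> pts (tot A) \<Longrightarrow> sharp (gact A t e) = jet_act M 1 t (sharp e)"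
    using sharp unfolding graded_morphism_def by blast+
  show "e \<in> pts (tot A) \<Longrightarrow> sharp e \<in> jets M 1"
    using 1(1) unfolding smooth_map_def pts_Tk by blast
qed

lemma kappa:
  shows "(X, Y) \<in> \<kappa> \<Longrightarrow> X \<in> jets (tot A) k" "(X, Y) \<in> \<kappa> \<Longrightarrow> Y \<in> jets (tot E) 1"
    and "(X, Y) \<in> \<kappa> \<Longrightarrow> Tk_map M k (proj A) X = anc (base_pt Y)"
    and "V \<in> pts (tot E) \<Longrightarrow> X \<in> jets (tot A) k \<Longrightarrow> Tk_map M k (proj A) X = anc V \<Longrightarrow>
      \<exists>!Y. (X, Y) \<in> \<kappa> \<and> base_pt Y = V"
    and "(X, Y) \<in> \<kappa> \<Longrightarrow> (jet_act (tot A) k t X, Tk_map (tot E) 1 (gact E t) Y) \<in> \<kappa>"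
proof -
  have vb: "vb_comorphism (Tk_vb k A) (tangent_vb (tot E)) \<kappa> anc" using gc by (simp add: graded_comorphism_def)
  have 1: "\<kappa> \<subseteq> jets (tot A) k \<times> jets (tot E) 1"
    using vb unfolding vb_comorphism_def Tk_vb_def tangent_vb_def vbundle.simps pts_Tk by (elim conjE)
  have 2: "\<forall>(X, Y) \<in> \<kappa>. Tk_map M k (proj A) X = anc (base_pt Y)"
    using vb unfolding vb_comorphism_def Tk_vb_def tangent_vb_def vbundle.simps base_A by (elim conjE)
  have 3: "\<forall>y \<in> pts (tot E). \<forall>X \<in> jets (tot A) k. Tk_map M k (proj A) X = anc y \<longrightarrow> (\<exists>!Y. (X, Y) \<in> \<kappa> \<and> base_pt Y = y)"
    using vb unfolding vb_comorphism_def Tk_vb_def tangent_vb_def vbundle.simps base_A pts_Tk by (elim conjE)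
  show "(X, Y) \<in> \<kappa> \<Longrightarrow> X \<in> jets (tot A) k" "(X, Y) \<in> \<kappa> \<Longrightarrow> Y \<in> jets (tot E) 1"
    "(X, Y) \<in> \<kappa> \<Longrightarrow> Tk_map M k (proj A) X = anc (base_pt Y)"
    "V \<in> pts (tot E) \<Longrightarrow> X \<in> jets (tot A) k \<Longrightarrow> Tk_map M k (proj A) X = anc V \<Longrightarrow>
      \<exists>!Y. (X, Y) \<in> \<kappa> \<and> base_pt Y = V"
    using 1 2 3 by auto
  have "\<forall>t. \<forall>e\<in>\<kappa>. (\<lambda>(X, Y). (jet_act (tot A) k t X, Tk_map (tot E) 1 (gact E t) Y)) e \<in> \<kappa>"
    using gc unfolding graded_comorphism_def graded_subbundle_def by (elim conjE)
  then show "(X, Y) \<in> \<kappa> \<Longrightarrow> (jet_act (tot A) k t X, Tk_map (tot E) 1 (gact E t) Y) \<in> \<kappa>" by auto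
qed

lemma kappa_matrix:
  assumes W: "(W, \<psi>) \<in> atlas (tot A)" "(W', \<psi>') \<in> atlas (tot E)"
  obtains Q where
    "\<And>j i. j \<in> idx (tot E) \<Longrightarrow> i \<in> {..k} \<times> fib_idx A \<Longrightarrow>
       smooth_fun (tot E) (base_pt ` {Y \<in> jets (tot E) 1. base_pt Y \<in> W'} \<inter>
         anc -` Tk_map M k (proj A) ` {X \<in> jets (tot A) k. base_pt X \<in> W}) (Q j i)"
    "\<And>X Y j. (X, Y) \<in> \<kappa> \<Longrightarrow> base_pt X \<in> W \<Longrightarrow> base_pt Y \<in> W' \<Longrightarrow> j \<in> idx (tot E) \<Longrightarrow>
       jet_coords 1 (idx (tot E)) \<psi>' Y (1, j) =
         (\<Sum>i \<in> {..k} \<times> fib_idx A. Q j i (base_pt Y) * jet_coords k (idx (tot A)) \<psi> X i)"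
proof -
  have vb: "vb_comorphism (Tk_vb k A) (tangent_vb (tot E)) \<kappa> anc" using gc by (simp add: graded_comorphism_def)
  let ?WA = "{X \<in> jets (tot A) k. base_pt X \<in> W}" and ?WE = "{Y \<in> jets (tot E) 1. base_pt Y \<in> W'}"
  have 1: "(?WA, jet_coords k (idx (tot A)) \<psi>) \<in> atlas (Tk k (tot A))"
    using W(1) unfolding Tk_def by force
  have 2: "(?WE, jet_coords 1 (idx (tot E)) \<psi>') \<in> atlas (Tk 1 (tot E))"
    using W(2) unfolding Tk_def by force
  have "\<forall>(W, \<psi>) \<in> atlas (Tk k (tot A)). \<forall>(W', \<psi>') \<in> atlas (Tk 1 (tot E)). \<exists>Q.
        (\<forall>j \<in> {1} \<times> idx (tot E). \<forall>i \<in> {..k} \<times> fib_idx A.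
           smooth_fun (tot E) (base_pt ` W' \<inter> anc -` Tk_map M k (proj A) ` W) (Q j i)) \<and>
        (\<forall>(X, Y) \<in> \<kappa>. X \<in> W \<longrightarrow> Y \<in> W' \<longrightarrow>
           (\<forall>j \<in> {1} \<times> idx (tot E). \<psi>' Y j = (\<Sum>i \<in> {..k} \<times> fib_idx A. Q j i (base_pt Y) * \<psi> X i)))"
    using vb unfolding vb_comorphism_def Tk_vb_def tangent_vb_def vbundle.simps base_A by (elim conjE)
  from bspec[OF bspec[OF this 1, unfolded prod.case] 2, unfolded prod.case]
  obtain Q where Q: "\<forall>j \<in> {1} \<times> idx (tot E). \<forall>i \<in> {..k} \<times> fib_idx A.
           smooth_fun (tot E) (base_pt ` ?WE \<inter> anc -` Tk_map M k (proj A) ` ?WA) (Q j i)"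
    "\<forall>(X, Y) \<in> \<kappa>. X \<in> ?WA \<longrightarrow> Y \<in> ?WE \<longrightarrow>
       (\<forall>j \<in> {1} \<times> idx (tot E). jet_coords 1 (idx (tot E)) \<psi>' Y j =
         (\<Sum>i \<in> {..k} \<times> fib_idx A. Q j i (base_pt Y) * jet_coords k (idx (tot A)) \<psi> X i))"
    by (elim exE conjE)
  show thesis
  proof (rule that[of "\<lambda>j. Q (1, j)"])
    show "smooth_fun (tot E) (base_pt ` ?WE \<inter> anc -` Tk_map M k (proj A) ` ?WA) (Q (1, j) i)"
      if "j \<in> idx (tot E)" "i \<in> {..k} \<times> fib_idx A" for j i
      using bspec[OF bspec[OF Q(1)] that(2), of "(1, j)"] that(1) by simp
    show "jet_coords 1 (idx (tot E)) \<psi>' Y (1, j) =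
         (\<Sum>i \<in> {..k} \<times> fib_idx A. Q (1, j) i (base_pt Y) * jet_coords k (idx (tot A)) \<psi> X i)"
      if "(X, Y) \<in> \<kappa>" "base_pt X \<in> W" "base_pt Y \<in> W'" "j \<in> idx (tot E)" for X Y j
      using bspec[OF Q(2) that(1), unfolded prod.case] kappa(1,2)[OF that(1)] that(2-4) by simp
  qed
qed

abbreviation vel :: "('m \<Rightarrow> 'i \<Rightarrow> real) \<Rightarrow> 'i \<Rightarrow> 'a \<Rightarrow> real" where
  "vel \<phi> l a \<equiv> jet_coords 1 (idx M) \<phi> (sharp a) (1, l)"

lemma Tk_chart: "(U, \<phi>) \<in> atlas N \<Longrightarrow> ({X \<in> jets N n. base_pt X \<in> U}, jet_coords n (idx N) \<phi>) \<in> atlas (Tk n N)"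
  by (force simp: Tk_def)

lemma idx_Tk: "idx (Tk n N) = {..n} \<times> idx N"
  by (simp add: Tk_def)

lemma vel_smooth:
  assumes W: "(W, \<psi>) \<in> atlas (tot A)" and U: "(U, \<phi>) \<in> atlas M" and l: "l \<in> idx M"
  shows "openin (Rn (idx (tot A))) (\<psi> ` (W \<inter> {a \<in> pts (tot A). proj A a \<in> U}))"
    "smooth_on (idx (tot A)) (\<psi> ` (W \<inter> {a \<in> pts (tot A). proj A a \<in> U})) (\<lambda>x. vel \<phi> l (inv_into W \<psi> x))"
proof -
  have Wp: "W \<subseteq> pts (tot A)" using W by (auto simp: pts_def)
  have eq: "W \<inter> sharp -` {X \<in> jets M 1. base_pt X \<in> U} = W \<inter> {a \<in> pts (tot A). proj A a \<in> U}"
    using Wp sharp_morphism(3) sharp_base by auto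
  have "\<forall>(U, \<phi>) \<in> atlas (tot A). \<forall>(V, \<psi>) \<in> atlas (Tk 1 M).
        openin (Rn (idx (tot A))) (\<phi> ` (U \<inter> sharp -` V)) \<and>
        (\<forall>j \<in> idx (Tk 1 M). smooth_on (idx (tot A)) (\<phi> ` (U \<inter> sharp -` V)) (\<lambda>x. \<psi> (sharp (inv_into U \<phi> x)) j))"
    using sharp_morphism(1) unfolding smooth_map_def by (elim conjE)
  from bspec[OF bspec[OF this W, unfolded prod.case] Tk_chart[OF U], unfolded prod.case, unfolded eq]
  show "openin (Rn (idx (tot A))) (\<psi> ` (W \<inter> {a \<in> pts (tot A). proj A a \<in> U}))"
    "smooth_on (idx (tot A)) (\<psi> ` (W \<inter> {a \<in> pts (tot A). proj A a \<in> U})) (\<lambda>x. vel \<phi> l (inv_into W \<psi> x))"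
    using l by (auto simp: idx_Tk)
qed

lemma vel_gact:
  assumes "(U, \<phi>) \<in> atlas M" "a \<in> pts (tot A)" "proj A a \<in> U" "l \<in> idx M"
  shows "vel \<phi> l (gact A t a) = t * vel \<phi> l a"
  using jet_act(3)[OF sharp_morphism(3)[OF assms(2)] assms(1) mfds(1) _ _ assms(4), of 1 t] assms sharp_base sharp_morphism(2) by simp

lemma vel_curve:
  assumes b: "curve (tot A) b" and U: "(U, \<phi>) \<in> atlas M" "proj A (b 0) \<in> U" and l: "l \<in> idx M"
  obtains S where "open S" "0 \<in> S" "smooth_real_on S (\<lambda>t. vel \<phi> l (b t))"
    "\<And>t. t \<in> S \<Longrightarrow> b t \<in> pts (tot A) \<and> proj A (b t) \<in> U" "curve_on (tot A) S b"
    "curve_on M S (proj A \<circ> b)"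
proof -
  obtain W \<psi> V \<zeta> where c: "graded_bundle_chart 1 A W \<psi> V \<zeta>" "b 0 \<in> W"
    using graded_bundle_curveE[OF gbA curve_pts[OF b]] .
  interpret graded_bundle_chart 1 A W \<psi> V \<zeta> by (rule c(1))
  obtain S where S: "open S" "0 \<in> S" "\<And>t. t \<in> S \<Longrightarrow> b t \<in> W" "\<And>i. i \<in> idx (tot A) \<Longrightarrow> smooth_real_on S (\<lambda>t. \<psi> (b t) i)"
    using curve_near_chart[OF mfd b smooth_chart c(2)] by blast
  let ?P = "{a \<in> pts (tot A). proj A a \<in> U}"
  note v = vel_smooth[OF atlas U(1) l]
  have op: "open {t \<in> S. b t \<in> ?P}"
    by (rule curve_in_chart_compose(1)[OF fin(1) smooth_chartD(2)[OF smooth_chart] v(1) S(1,3,4)])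
  have sm: "smooth_real_on {t \<in> S. b t \<in> ?P} (\<lambda>t. vel \<phi> l (b t))"
    by (rule curve_in_chart_compose(2)[OF fin(1) smooth_chartD(2)[OF smooth_chart] v(1) S(1,3,4) v(2)])
  have bp: "b 0 \<in> ?P" using U(2) c(2) mem_iff by auto
  obtain S1 where S1: "0 \<in> S1" "curve_on (tot A) S1 b" using b by (auto simp: curve_iff)
  have "curve (base A) (proj A \<circ> b)" by (rule proj_curve[OF b c(2)])
  then obtain S2 where S2: "0 \<in> S2" "curve_on M S2 (proj A \<circ> b)" unfolding curve_iff base_A by blast
  let ?S = "{t \<in> S. b t \<in> ?P} \<inter> (S1 \<inter> S2)"
  have o: "open ?S" by (intro open_Int op curve_on_open[OF S1(2)] curve_on_open[OF S2(2)])
  show thesis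
    by (rule that[OF o _ smooth_real_on_mono[OF sm] _ curve_on_mono[OF S1(2) o] curve_on_mono[OF S2(2) o]])
      (use S(2) bp S1 S2 in auto)
qed

text \<open>
  Admissibility of a curve at \<open>0\<close> to finite order: the derivatives of the base curve are those of its velocity
  components under the anchor. Together with the fibre coordinates this determines the jet.
\<close>

definition velocity_jet :: "nat \<Rightarrow> (real \<Rightarrow> 'a) \<Rightarrow> bool" where
  "velocity_jet n b \<longleftrightarrow> (\<forall>U \<phi> l m. (U, \<phi>) \<in> atlas M \<longrightarrow> proj A (b 0) \<in> U \<longrightarrow> l \<in> idx M \<longrightarrow> m < n \<longrightarrow>
     (deriv ^^ Suc m) (\<lambda>t. \<phi> (proj A (b t)) l) 0 = (deriv ^^ m) (\<lambda>t. vel \<phi> l (b t)) 0)"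

text \<open>
  Induction on the order: the jet of order \<open>m\<close> of the curve determines the jet of order \<open>m\<close> of its velocity under the
  anchor, and this is the next derivative of the base curve.
\<close>

lemma velocity_jet_unique:
  assumes ch: "graded_bundle_chart 1 A W \<psi> V \<zeta>"
    and a: "curve (tot A) a" "a 0 \<in> W" "velocity_jet n a" and b: "curve (tot A) b" "b 0 \<in> W" "velocity_jet n b"
    and ab: "proj A (a 0) = proj A (b 0)" "\<And>i. i \<in> fib_idx A \<Longrightarrow> eqjet (n - 1) (\<lambda>t. \<psi> (a t) i) (\<lambda>t. \<psi> (b t) i)"
    and m: "m \<le> n"
  shows "proj A \<circ> a \<in> jet M m (proj A \<circ> b)"
proof -
  interpret graded_bundle_chart 1 A W \<psi> V \<zeta> by (rule ch)
  have pc: "curve M (proj A \<circ> a)" "curve M (proj A \<circ> b)" using proj_curve a b base_A by auto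
  have "proj A (b 0) \<in> pts M" using curve_pts[OF pc(2)] by simp
  then obtain U \<phi> where U: "(U, \<phi>) \<in> atlas M" "proj A (b 0) \<in> U" by (rule pts_chartE)
  have "(proj A \<circ> b) 0 \<in> U" using U(2) by simp
  note iff = jet_iff_chart[OF mfds(1) smooth_chart_atlas[OF mfds(1) U(1)] this pc(2)]
  show ?thesis using m
  proof (induction m)
    case 0
    then show ?case unfolding iff using pc ab by (auto simp: eqjet_0)
  next
    case (Suc m)
    then have mn: "m < n" by simp
    have IH: "proj A \<circ> a \<in> jet M m (proj A \<circ> b)" by (rule Suc.IH) (use mn in simp)
    have "eqjet m (\<lambda>t. \<psi> (a t) i) (\<lambda>t. \<psi> (b t) i)" if "i \<in> fib_idx A" for i
      by (rule eqjet_mono[OF ab(2)[OF that]]) (use mn in auto)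
    then have jab: "a \<in> jet (tot A) m b" using jet_iff_coords[OF b(1,2)] a IH base_A by simp
    obtain S where S: "open S" "0 \<in> S" "\<And>t. t \<in> S \<Longrightarrow> a t \<in> W" "\<And>i. i \<in> idx (tot A) \<Longrightarrow> smooth_real_on S (\<lambda>t. \<psi> (a t) i)"
      "\<And>t. t \<in> S \<Longrightarrow> b t \<in> W" "\<And>i. i \<in> idx (tot A) \<Longrightarrow> smooth_real_on S (\<lambda>t. \<psi> (b t) i)"
      using curve_near_chart2[OF mfds(2) a(1) b(1) smooth_chart a(2) b(2)] by blast
    have "eqjet m (\<lambda>t. vel \<phi> l (a t)) (\<lambda>t. vel \<phi> l (b t))" if l: "l \<in> idx M" for l
      by (rule curve_in_chart_eqjet[OF fin(1) smooth_chartD(2)[OF smooth_chart] vel_smooth[OF atlas U(1) l] S])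
        (use a b ab U mem_iff jab jet_iff_chart[OF mfds(2) smooth_chart b(2,1)] in auto)
    then have "(deriv ^^ Suc m) (\<lambda>t. \<phi> (proj A (a t)) l) 0 = (deriv ^^ Suc m) (\<lambda>t. \<phi> (proj A (b t)) l) 0" if l: "l \<in> idx M" for l
      using a(3) b(3) U ab(1) mn l unfolding velocity_jet_def eqjet_def by (metis order_refl)
    moreover have "eqjet m (\<lambda>t. \<phi> ((proj A \<circ> a) t) l) (\<lambda>t. \<phi> ((proj A \<circ> b) t) l)" if "l \<in> idx M" for l
      using IH that unfolding iff by blast
    ultimately show ?case unfolding iff using pc ab(1) by (auto simp: eqjet_def le_Suc_eq simp del: funpow.simps)
  qed
qed

lemma admissible_velocity_jet:
  assumes "admissible A sharp a"
  shows "velocity_jet n a"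
  unfolding velocity_jet_def
proof (intro allI impI)
  fix U \<phi> l m assume U: "(U, \<phi>) \<in> atlas M" "proj A (a 0) \<in> U" and l: "l \<in> idx M"
  have a: "curve (tot A) a" and ev: "\<forall>\<^sub>F t in nhds 0. jet M 1 (\<lambda>s. proj A (a (t + s))) = sharp (a t)"
    using assms by (auto simp: admissible_def base_A)
  obtain S0 where S0: "open S0" "0 \<in> S0" "\<And>t. t \<in> S0 \<Longrightarrow> jet M 1 (\<lambda>s. proj A (a (t + s))) = sharp (a t)"
    using ev unfolding eventually_nhds by blast
  obtain S where S: "open S" "0 \<in> S" "\<And>t. t \<in> S \<Longrightarrow> a t \<in> pts (tot A) \<and> proj A (a t) \<in> U" "curve_on M S (proj A \<circ> a)"
    using vel_curve[OF a U l] by metis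
  have "deriv (\<lambda>t. \<phi> (proj A (a t)) l) t = vel \<phi> l (a t)" if t: "t \<in> S \<inter> S0" for t
  proof -
    have "curve M (\<lambda>s. (proj A \<circ> a) (t + s))" by (rule curve_shift[OF S(4)]) (use t in auto)
    then have "curve M (\<lambda>s. proj A (a (t + s)))" by simp
    then have "jet_coords 1 (idx M) \<phi> (jet M 1 (\<lambda>s. proj A (a (t + s)))) (1, l) = (deriv ^^ 1) (\<lambda>s. \<phi> (proj A (a (t + s))) l) 0"
      by (rule jet_coords_jet[OF _ U(1)]) (use S(3) t l in auto)
    then show ?thesis using S0(3) t deriv_shift_0[of "\<lambda>t. \<phi> (proj A (a t)) l" t] by (simp add: o_def)
  qed
  then show "(deriv ^^ Suc m) (\<lambda>t. \<phi> (proj A (a t)) l) 0 = (deriv ^^ m) (\<lambda>t. vel \<phi> l (a t)) 0"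
    unfolding funpow_deriv_Suc using S S0 by (intro derivs_cong[of "S \<inter> S0"]) auto
qed

text \<open>
  The almost Lie condition, evaluated on the pair formed by the jet of \<open>t b(t)\<close> and the weight vector at \<open>V\<close>. In a chart
  of the base its two sides are \<open>\<alpha>\<close> times the derivative of order \<open>\<alpha> - 1\<close> of the velocity of \<open>b\<close>, and \<open>\<alpha>\<close> times
  the coordinate of order \<open>\<alpha>\<close> of the anchor of \<open>V\<close>.
\<close>

lemma weight_field_velocity_jet:
  assumes V: "V \<in> pts (tot E)" and b: "curve (tot A) b" "jet M k (proj A \<circ> b) = anc V"
    and K: "(jet (tot A) k (\<lambda>t. gact A t (b t)), weight_field (tot E) (wt E) V) \<in> \<kappa>"
  shows "velocity_jet k b"
  unfolding velocity_jet_def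
proof (intro allI impI)
  fix U \<phi> l m assume U: "(U, \<phi>) \<in> atlas M" "proj A (b 0) \<in> U" and l: "l \<in> idx M" and m: "m < k"
  let ?X = "jet (tot A) k (\<lambda>t. gact A t (b t))" and ?Y = "weight_field (tot E) (wt E) V"
  let ?\<gamma> = "\<lambda>t. gact A t (b t)" and ?\<eta> = "\<lambda>s. gact E (1 + s) V"
  obtain W' \<psi>' U' \<phi>' where c: "graded_bundle_chart k E W' \<psi>' U' \<phi>'" "V \<in> W'"
    using graded_bundle_curveE[OF gbE V] .
  note wf = graded_bundle_chart.weight_field[OF c]
  have \<gamma>: "curve (tot A) ?\<gamma>"
    by (rule graded_bundle_gact_curve[OF gbA b(1)]) (simp add: smooth_real_on_ident)
  have pb: "curve M (proj A \<circ> b)" using graded_bundle_proj_curve[OF gbA b(1)] base_A by simp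
  have bV: "proj A (b 0) = proj E V" using base_pt_jet[OF pb, of k] b(2) anc_morphism(3)[OF V] by simp
  obtain \<Gamma> where \<Gamma>: "surface M \<Gamma>"
    "jet (Tk 1 M) k (sharp \<circ> rep ?X) = jet (Tk 1 M) k (\<lambda>t. jet M 1 (\<lambda>s. \<Gamma> s t))"
    "jet (Tk k M) 1 (anc \<circ> rep ?Y) = jet (Tk k M) 1 (\<lambda>s. jet M k (\<lambda>t. \<Gamma> s t))"
    using flip[OF K] unfolding flip_graph_def Tk_map_def by auto
  have X: "?\<gamma> \<in> jet (tot A) k (rep ?X)"
    using jets_rep(2)[OF jet_in_jets[OF \<gamma>]] jet_refl[OF \<gamma>] by metis
  have Y: "?\<eta> \<in> jet (tot E) 1 (rep ?Y)"
    using jets_rep(2)[OF jet_in_jets[OF wf(2)]] jet_refl[OF wf(2)] wf(1) by metis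
  have sX: "sharp \<circ> ?\<gamma> \<in> jet (Tk 1 M) k (\<lambda>t. jet M 1 (\<lambda>s. \<Gamma> s t))"
    using smooth_map_jet[OF mfds(2) sharp_morphism(1) _ X] jets_rep(1)[OF jet_in_jets[OF \<gamma>]] \<Gamma>(2) by simp
  have sY: "anc \<circ> ?\<eta> \<in> jet (Tk k M) 1 (\<lambda>s. jet M k (\<lambda>t. \<Gamma> s t))"
    using smooth_map_jet[OF mfds(3) anc_morphism(1) _ Y] jets_rep(1)[OF jet_in_jets[OF wf(2)]] \<Gamma>(3) wf(1) by simp
  have b0: "b 0 \<in> pts (tot A)" by (rule curve_pts[OF b(1)])
  obtain T where T: "(\<lambda>_. 0) \<in> T" "smooth_map (open_mfd (UNIV :: bool set) T) M (\<lambda>z. \<Gamma> (z False) (z True))"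
    using \<Gamma>(1) unfolding surface_def by blast
  have "(\<lambda>z. \<Gamma> (z False) (z True)) ` T \<subseteq> pts M"
  proof -
    have "pts (open_mfd UNIV T) = T" by (simp add: pts_def open_mfd_def)
    then show ?thesis using T(2) unfolding smooth_map_def by simp
  qed
  then have "\<Gamma> 0 0 \<in> pts M" using imageI[OF T(1), of "\<lambda>z. \<Gamma> (z False) (z True)"] by auto
  then obtain U1 \<phi>1 where U1: "(U1, \<phi>1) \<in> atlas M" "\<Gamma> 0 0 \<in> U1" by (rule pts_chartE)
  obtain S1 where "0 \<in> S1" "\<And>t. t \<in> S1 \<Longrightarrow> curve M (\<lambda>s. \<Gamma> s t)" "\<And>s. s \<in> S1 \<Longrightarrow> curve M (\<lambda>t. \<Gamma> s t)"
    using surface_curves[OF \<Gamma>(1) U1] by metis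
  then have c00: "curve M (\<lambda>s. \<Gamma> s 0)" "curve M (\<lambda>t. \<Gamma> 0 t)" by auto
  have s0: "sharp (?\<gamma> 0) = jet M 1 (\<lambda>s. \<Gamma> s 0)" using sX by (auto simp: jet_iff)
  have \<Gamma>0: "\<Gamma> 0 0 = proj A (b 0)"
    using base_pt_jet[OF c00(1), of 1] s0 sharp_base graded_bundle_gact(2)[OF gbA b0, of 0] sharp_base[OF graded_bundle_gact(1)[OF gbA b0, of 0]] by simp
  obtain S where S: "open S" "0 \<in> S" "\<And>t. t \<in> S \<Longrightarrow> curve M (\<lambda>s. \<Gamma> s t) \<and> \<Gamma> 0 t \<in> U"
    "\<And>s. s \<in> S \<Longrightarrow> curve M (\<lambda>t. \<Gamma> s t) \<and> \<Gamma> s 0 \<in> U"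
    using surface_curves[OF \<Gamma>(1) U(1)] \<Gamma>0 U(2) by metis
  obtain S2 where S2: "open S2" "0 \<in> S2" "smooth_real_on S2 (\<lambda>t. vel \<phi> l (b t))"
    "\<And>t. t \<in> S2 \<Longrightarrow> b t \<in> pts (tot A) \<and> proj A (b t) \<in> U"
    using vel_curve[OF b(1) U l] by metis
  let ?\<alpha> = "Suc m"
  let ?C = "(deriv ^^ ?\<alpha>) (\<lambda>t. \<phi> (proj A (b t)) l) 0"
  have "eqjet k (\<lambda>t. vel \<phi> l (?\<gamma> t)) (\<lambda>t. jet_coords 1 (idx M) \<phi> (jet M 1 (\<lambda>s. \<Gamma> s t)) (1, l))"
    using sX Tk_chart[OF U(1), of 1] l jet_in_jets[OF c00(1), of 1] base_pt_jet[OF c00(1), of 1] \<Gamma>0 U(2)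
    unfolding jet_iff by (force simp: idx_Tk)
  then have "(deriv ^^ ?\<alpha>) (\<lambda>t. vel \<phi> l (?\<gamma> t)) 0 = (deriv ^^ ?\<alpha>) (\<lambda>t. jet_coords 1 (idx M) \<phi> (jet M 1 (\<lambda>s. \<Gamma> s t)) (1, l)) 0"
    using m unfolding eqjet_def by (auto simp del: funpow.simps)
  also have "\<dots> = (deriv ^^ ?\<alpha>) (\<lambda>t. deriv (\<lambda>s. \<phi> (\<Gamma> s t) l) 0) 0"
  proof (rule derivs_cong[OF S(1,2)])
    fix t assume "t \<in> S"
    then show "jet_coords 1 (idx M) \<phi> (jet M 1 (\<lambda>s. \<Gamma> s t)) (1, l) = deriv (\<lambda>s. \<phi> (\<Gamma> s t) l) 0"
      using jet_coords_jet[OF _ U(1), of "\<lambda>s. \<Gamma> s t" 1 1 l] S(3) l by simp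
  qed
  also have "\<dots> = deriv (\<lambda>s. (deriv ^^ ?\<alpha>) (\<lambda>t. \<phi> (\<Gamma> s t) l) 0) 0"
    by (rule surface_flip[OF \<Gamma>(1) U(1) _ l]) (use \<Gamma>0 U(2) in simp)
  also have "\<dots> = deriv (\<lambda>s. jet_coords k (idx M) \<phi> (jet M k (\<lambda>t. \<Gamma> s t)) (?\<alpha>, l)) 0"
  proof (rule deriv_cong_ev[OF eventually_mono[OF eventually_nhds_open[OF S(1,2)]] refl])
    fix s assume "s \<in> S"
    then show "(deriv ^^ ?\<alpha>) (\<lambda>t. \<phi> (\<Gamma> s t) l) 0 = jet_coords k (idx M) \<phi> (jet M k (\<lambda>t. \<Gamma> s t)) (?\<alpha>, l)"
      using jet_coords_jet[OF _ U(1), of "\<lambda>t. \<Gamma> s t" ?\<alpha> k l] S(4) l m by (simp del: funpow.simps)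
  qed
  also have "\<dots> = deriv (\<lambda>s. jet_coords k (idx M) \<phi> (anc (?\<eta> s)) (?\<alpha>, l)) 0"
  proof -
    have "eqjet 1 (\<lambda>s. jet_coords k (idx M) \<phi> (anc (?\<eta> s)) (?\<alpha>, l)) (\<lambda>s. jet_coords k (idx M) \<phi> (jet M k (\<lambda>t. \<Gamma> s t)) (?\<alpha>, l))"
      using sY Tk_chart[OF U(1), of k] l m jet_in_jets[OF c00(2), of k] base_pt_jet[OF c00(2), of k] \<Gamma>0 U(2)
      unfolding jet_iff by (force simp: idx_Tk)
    then show ?thesis by (rule eqjet_deriv[symmetric])
  qed
  also have "\<dots> = deriv (\<lambda>s. (1 + s) ^ ?\<alpha> * ?C) 0"
  proof -
    have "jet_coords k (idx M) \<phi> (anc V) (?\<alpha>, l) = (deriv ^^ ?\<alpha>) (\<lambda>t. \<phi> ((proj A \<circ> b) t) l) 0"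
      unfolding b(2)[symmetric] by (rule jet_coords_jet[OF pb U(1)]) (use U(2) l m in auto)
    then show ?thesis
      using jet_act(3)[OF anc_morphism(4)[OF V] U(1) mfds(1), of ?\<alpha> l] m l bV U(2) anc_morphism(2,3)[OF V] by (simp del: funpow.simps)
  qed
  also have "\<dots> = real ?\<alpha> * ?C"
  proof (rule DERIV_imp_deriv)
    have "((\<lambda>s. (1 + s) ^ ?\<alpha>) has_real_derivative real ?\<alpha>) (at 0)" by (rule derivative_eq_intros refl | simp)+
    then show "((\<lambda>s. (1 + s) ^ ?\<alpha> * ?C) has_real_derivative real ?\<alpha> * ?C) (at 0)"
      by (rule DERIV_cmult_right)
  qed
  finally have "(deriv ^^ ?\<alpha>) (\<lambda>t. vel \<phi> l (?\<gamma> t)) 0 = real ?\<alpha> * ?C" .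
  moreover have "(deriv ^^ ?\<alpha>) (\<lambda>t. vel \<phi> l (?\<gamma> t)) 0 = (deriv ^^ ?\<alpha>) (\<lambda>t. t * vel \<phi> l (b t)) 0"
    by (rule derivs_cong[OF S2(1,2)]) (use S2(4) vel_gact[OF U(1) _ _ l] in auto)
  moreover have "\<dots> = real ?\<alpha> * (deriv ^^ m) (\<lambda>t. vel \<phi> l (b t)) 0"
    using derivs_times_ident[OF S2(3,1,2), of ?\<alpha>] by (simp del: funpow.simps)
  ultimately show "?C = (deriv ^^ m) (\<lambda>t. vel \<phi> l (b t)) 0" by (simp del: funpow.simps)
qed

end

section \<open>Open sets and transition maps in coordinate spaces\<close>

lemma openin_restrict_preimage:
  assumes I: "finite I" "finite I0" and f: "\<And>i. i \<in> I0 \<Longrightarrow> f i \<in> I" and B: "openin (Rn I0) B"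
  shows "openin (Rn I) {z \<in> extensional I. (\<lambda>i\<in>I0. z (f i)) \<in> B}"
  unfolding openin_Rn_iff[OF I(1)]
proof (intro conjI ballI)
  fix x assume x: "x \<in> {z \<in> extensional I. (\<lambda>i\<in>I0. z (f i)) \<in> B}"
  then obtain e where e: "e > 0" "\<And>y. y \<in> extensional I0 \<Longrightarrow> (\<And>i. i \<in> I0 \<Longrightarrow> \<bar>y i - (\<lambda>i\<in>I0. x (f i)) i\<bar> < e) \<Longrightarrow> y \<in> B"
    using openin_RnE[OF B I(2)] by blast
  have "(\<lambda>i\<in>I0. y (f i)) \<in> B" if "\<forall>i\<in>I. \<bar>y i - x i\<bar> < e" for y
    by (rule e(2)) (use that f in auto)
  then show "\<exists>e>0. \<forall>y\<in>extensional I. (\<forall>i\<in>I. \<bar>y i - x i\<bar> < e) \<longrightarrow> y \<in> {z \<in> extensional I. (\<lambda>i\<in>I0. z (f i)) \<in> B}"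
    using e(1) by (intro exI[of _ e]) blast
qed auto

lemma openin_smooth_preimage:
  assumes S: "openin (Rn I) S" and u: "\<And>j. j \<in> J \<Longrightarrow> smooth_on I S (\<lambda>x. u x j)"
    "\<And>x. x \<in> S \<Longrightarrow> u x \<in> extensional J" and T: "openin (Rn J) T"
  shows "openin (Rn I) {x \<in> S. u x \<in> T}"
proof -
  have "continuous_map (subtopology (Rn I) S) (Rn J) u"
    unfolding continuous_map_componentwise using u(2) smooth_onD(1)[OF u(1)] by auto
  from openin_continuous_map_preimage[OF this T]
  have "openin (subtopology (Rn I) S) {x \<in> topspace (subtopology (Rn I) S). u x \<in> T}" .
  moreover have "topspace (subtopology (Rn I) S) = S" using openin_subset[OF S] by auto
  ultimately have "openin (subtopology (Rn I) S) {x \<in> S. u x \<in> T}" by (simp only:)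
  then show ?thesis using S openin_trans_full by blast
qed

lemma smooth_on_locally:
  assumes loc: "\<And>x. x \<in> S \<Longrightarrow> \<exists>S'. openin (Rn I) S' \<and> x \<in> S' \<and> S' \<subseteq> S \<and> smooth_on I S' f"
  shows "smooth_on I S f"
  unfolding smooth_on_def
proof (intro ballI conjI)
  fix "is" assume "is": "is \<in> lists I"
  show "continuous_map (subtopology (Rn I) S) euclideanreal (pdiffs is f)"
    unfolding continuous_map_def
  proof (intro conjI allI impI)
    fix V assume V: "openin euclideanreal V"
    let ?P = "{x \<in> topspace (subtopology (Rn I) S). pdiffs is f x \<in> V}"
    have "openin (Rn I) ?P"
    proof (subst openin_subopen, intro ballI)
      fix x assume x: "x \<in> ?P"
      then obtain S' where S': "openin (Rn I) S'" "x \<in> S'" "S' \<subseteq> S" "smooth_on I S' f" using loc[of x] by auto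
      have "continuous_map (subtopology (Rn I) S') euclideanreal (pdiffs is f)"
        using S'(4) "is" by (simp add: smooth_on_def)
      from openin_continuous_map_preimage[OF this V]
      have "openin (Rn I) {y \<in> topspace (subtopology (Rn I) S'). pdiffs is f y \<in> V}"
        using S'(1) openin_trans_full by blast
      then show "\<exists>T. openin (Rn I) T \<and> x \<in> T \<and> T \<subseteq> ?P"
        by (intro exI[of _ "{y \<in> topspace (subtopology (Rn I) S'). pdiffs is f y \<in> V}"] conjI)
          (use x S' openin_Rn_ext[OF S'(1)] in auto)
    qed
    then show "openin (subtopology (Rn I) S) ?P"
      unfolding openin_subtopology by (intro exI[of _ ?P]) auto
  qed simp
  fix x i assume x: "x \<in> S" "i \<in> I"
  obtain S' where "x \<in> S'" "smooth_on I S' f" using loc[OF x(1)] by blast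
  then show "(\<lambda>t. pdiffs is f (x(i := t))) differentiable at (x i)"
    using "is" x(2) by (simp add: smooth_on_def)
qed

text \<open>
  Smooth charts are related to the charts of the atlas by definition; two smooth charts are compared through a chart of the
  atlas around each point.
\<close>

lemma smooth_chart_transition:
  assumes M: "manifold M" and c: "smooth_chart M (U, \<phi>)" and c': "smooth_chart M (U', \<phi>')"
  shows "openin (Rn (idx M)) (\<phi> ` (U \<inter> U'))"
    and "j \<in> idx M \<Longrightarrow> smooth_on (idx M) (\<phi> ` (U \<inter> U')) (\<lambda>x. \<phi>' (inv_into U \<phi> x) j)"
proof -
  note fin = manifold_finite[OF M]
  note inj = is_chartD(1)[OF smooth_chartD(2)[OF c]]
  have loc: "openin (Rn (idx M)) (\<phi> ` (U \<inter> V \<inter> U'))"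
    "j \<in> idx M \<Longrightarrow> smooth_on (idx M) (\<phi> ` (U \<inter> V \<inter> U')) (\<lambda>x. \<phi>' (inv_into U \<phi> x) j)"
    if V: "(V, \<psi>) \<in> atlas M" for V \<psi> j
  proof -
    note chV = is_chartD[OF manifold_atlas_chart[OF M V]]
    have 1: "openin (Rn (idx M)) (\<phi> ` (U \<inter> V))" "\<And>j. j \<in> idx M \<Longrightarrow> smooth_on (idx M) (\<phi> ` (U \<inter> V)) (\<lambda>x. \<psi> (inv_into U \<phi> x) j)"
      using smooth_chartD(3)[OF c V] by auto
    have 2: "openin (Rn (idx M)) (\<psi> ` (V \<inter> U'))" "\<And>j. j \<in> idx M \<Longrightarrow> smooth_on (idx M) (\<psi> ` (V \<inter> U')) (\<lambda>x. \<phi>' (inv_into V \<psi> x) j)"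
      using smooth_chartD(4)[OF c' V] by auto
    have inv: "inv_into U \<phi> (\<phi> p) = p" if "p \<in> U" for p using inj that by simp
    have eq: "{x \<in> \<phi> ` (U \<inter> V). \<psi> (inv_into U \<phi> x) \<in> \<psi> ` (V \<inter> U')} = \<phi> ` (U \<inter> V \<inter> U')"
    proof -
      have "\<psi> p \<in> \<psi> ` (V \<inter> U') \<longleftrightarrow> p \<in> U'" if "p \<in> V" for p
        using inj_on_image_mem_iff[OF chV(1) that, of "V \<inter> U'"] that by auto
      then have "p \<in> U \<inter> V \<and> \<psi> (inv_into U \<phi> (\<phi> p)) \<in> \<psi> ` (V \<inter> U') \<longleftrightarrow> p \<in> U \<inter> V \<inter> U'" for p
      proof (cases "p \<in> U \<inter> V")
        case True
        then show ?thesis using inv[of p] \<open>\<And>p. p \<in> V \<Longrightarrow> (\<psi> p \<in> \<psi> ` (V \<inter> U')) = (p \<in> U')\<close>[of p] by simp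
      qed blast
      then have "{p \<in> U \<inter> V. \<psi> (inv_into U \<phi> (\<phi> p)) \<in> \<psi> ` (V \<inter> U')} = U \<inter> V \<inter> U'" by blast
      moreover have "{x \<in> \<phi> ` (U \<inter> V). R x} = \<phi> ` {p \<in> U \<inter> V. R (\<phi> p)}" for R by auto
      ultimately show ?thesis by simp
    qed
    have "openin (Rn (idx M)) {x \<in> \<phi> ` (U \<inter> V). \<psi> (inv_into U \<phi> x) \<in> \<psi> ` (V \<inter> U')}"
      by (rule openin_smooth_preimage[OF 1 _ 2(1)]) (use inv chV(3) in auto)
    then show o: "openin (Rn (idx M)) (\<phi> ` (U \<inter> V \<inter> U'))" unfolding eq .
    assume j: "j \<in> idx M"
    have "smooth_on (idx M) (\<phi> ` (U \<inter> V \<inter> U')) (\<lambda>x. \<phi>' (inv_into V \<psi> (\<psi> (inv_into U \<phi> x))) j)"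
      by (rule smooth_on_compose[OF o fin 2(1) fin 2(2)[OF j] smooth_on_mono[OF 1(2)]]) (use inv in auto)
    then show "smooth_on (idx M) (\<phi> ` (U \<inter> V \<inter> U')) (\<lambda>x. \<phi>' (inv_into U \<phi> x) j)"
      by (rule smooth_on_cong[OF o fin]) (use inv chV(1) in auto)
  qed
  have cov: "\<exists>V \<psi>. (V, \<psi>) \<in> atlas M \<and> p \<in> V" if "p \<in> U" for p
  proof -
    have "p \<in> pts M" using that smooth_chartD(1)[OF c] by auto
    then show ?thesis using pts_chartE by metis
  qed
  have sub: "\<phi> ` (U \<inter> V \<inter> U') \<subseteq> \<phi> ` (U \<inter> U')" for V by auto
  show "openin (Rn (idx M)) (\<phi> ` (U \<inter> U'))"
  proof (subst openin_subopen, intro ballI)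
    fix x assume "x \<in> \<phi> ` (U \<inter> U')"
    then obtain p where p: "p \<in> U" "p \<in> U'" "x = \<phi> p" by auto
    obtain V \<psi> where "(V, \<psi>) \<in> atlas M" "p \<in> V" using cov[OF p(1)] by blast
    then show "\<exists>T. openin (Rn (idx M)) T \<and> x \<in> T \<and> T \<subseteq> \<phi> ` (U \<inter> U')"
      using loc(1) sub p by (intro exI[of _ "\<phi> ` (U \<inter> V \<inter> U')"]) blast
  qed
  assume j: "j \<in> idx M"
  show "smooth_on (idx M) (\<phi> ` (U \<inter> U')) (\<lambda>x. \<phi>' (inv_into U \<phi> x) j)"
  proof (rule smooth_on_locally)
    fix x assume "x \<in> \<phi> ` (U \<inter> U')"
    then obtain p where p: "p \<in> U" "p \<in> U'" "x = \<phi> p" by auto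
    obtain V \<psi> where "(V, \<psi>) \<in> atlas M" "p \<in> V" using cov[OF p(1)] by blast
    then show "\<exists>S'. openin (Rn (idx M)) S' \<and> x \<in> S' \<and> S' \<subseteq> \<phi> ` (U \<inter> U') \<and> smooth_on (idx M) S' (\<lambda>x. \<phi>' (inv_into U \<phi> x) j)"
      using loc(1) loc(2)[OF _ j] sub p by (intro exI[of _ "\<phi> ` (U \<inter> V \<inter> U')"]) blast
  qed
qed

section \<open>The canonical relation in a pair of charts\<close>

context anchored_comorphism
begin

text \<open>
  The canonical relation for a bundle \<open>A\<close> of order one that need not be given as a reduction of \<open>E\<close>.
\<close>

definition theta_rel :: "((real \<Rightarrow> 'a) set \<times> 'e) set" where
  "theta_rel = {(\<xi>, V). \<xi> \<in> prolongation k A sharp \<and> V \<in> pts (tot E) \<and>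
        Tk_map M (k - 1) (proj A) \<xi> = jet_trunc M (k - 1) (anc V) \<and>
        (\<exists>b. curve (tot A) b \<and> jet (tot A) (k - 1) b = \<xi> \<and> jet M k (proj A \<circ> b) = anc V \<and>
           kappa_at \<kappa> V (jet (tot A) k (\<lambda>t. gact A t (b t))) = weight_field (tot E) (wt E) V)}"

lemma kappa_atI:
  assumes "(X, Y) \<in> \<kappa>" shows "kappa_at \<kappa> (base_pt Y) X = Y"
proof -
  have "base_pt Y \<in> pts (tot E)" using curve_pts[OF jets_rep(1)[OF kappa(2)[OF assms]]] by (simp add: base_pt_def)
  then have "\<exists>!Y'. (X, Y') \<in> \<kappa> \<and> base_pt Y' = base_pt Y" using kappa(1,3)[OF assms] kappa(4) by blast
  then show ?thesis unfolding kappa_at_def using assms by (intro the1_equality) auto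
qed

lemma kappa_over_curve:
  assumes V: "V \<in> pts (tot E)" and b: "curve (tot A) b" "jet M k (proj A \<circ> b) = anc V"
  obtains Y where "(jet (tot A) k b, Y) \<in> \<kappa>" "base_pt Y = V"
proof -
  have "proj A \<circ> rep (jet (tot A) k b) \<in> jet (base A) k (proj A \<circ> b)"
    by (rule graded_bundle_proj_jet[OF gbA b(1) rep_jet[OF b(1)]])
  moreover have "curve (base A) (proj A \<circ> rep (jet (tot A) k b))"
    by (rule graded_bundle_proj_curve[OF gbA rep_jet_curve[OF b(1)]])
  ultimately have "Tk_map M k (proj A) (jet (tot A) k b) = anc V"
    unfolding Tk_map_def base_A b(2)[symmetric] by (simp add: jet_eq_iff)
  from kappa(4)[OF V jet_in_jets[OF b(1)] this] that show thesis by blast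
qed

end

locale chart_pair = anchored_comorphism k A E \<kappa> anc sharp
    + cA: graded_bundle_chart 1 A W \<psi> U \<phi> + cE: graded_bundle_chart k E W' \<psi>' U' \<phi>'
  for k and A :: "('a, 'm, 'i) gbundle" and E :: "('e, 'm, 'i) gbundle" and \<kappa> anc sharp W \<psi> U \<phi> W' \<psi>' U' \<phi>'
begin

lemma base_A_idx: "idx (base A) = idx M" by (simp add: base_A)

lemma lift:
  assumes c: "curve M c" "c 0 \<in> U" and S0: "open S0" "0 \<in> S0"
    and y: "\<And>i. i \<in> fib_idx A \<Longrightarrow> smooth_real_on S0 (\<lambda>t. y t i)"
  shows "curve (tot A) (\<lambda>t. cA.point (c t) (y t))" "cA.point (c 0) (y 0) \<in> W" "proj A (cA.point (c 0) (y 0)) = c 0"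
    "i \<in> fib_idx A \<Longrightarrow> (deriv ^^ n) (\<lambda>t. \<psi> (cA.point (c t) (y t)) i) 0 = (deriv ^^ n) (\<lambda>t. y t i) 0"
    "jet M n (proj A \<circ> (\<lambda>t. cA.point (c t) (y t))) = jet M n c"
proof -
  have bc: "smooth_chart M (U, \<phi>)" using cA.base_chart by (simp add: base_A)
  obtain S where S: "open S" "0 \<in> S" "\<And>t. t \<in> S \<Longrightarrow> c t \<in> U" "\<And>i. i \<in> idx M \<Longrightarrow> smooth_real_on S (\<lambda>t. \<phi> (c t) i)"
    using curve_near_chart[OF mfds(1) c(1) bc c(2)] by blast
  let ?S = "S \<inter> S0"
  have o: "open ?S" "0 \<in> ?S" using S S0 by auto
  have "curve_on (tot A) ?S (\<lambda>t. cA.point (c t) (y t))"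
    by (rule cA.curve_on_point[OF o(1)])
      (use S(3) base_A_idx in \<open>auto intro: smooth_real_on_mono[OF S(4)] smooth_real_on_mono[OF y]\<close>)
  then show b: "curve (tot A) (\<lambda>t. cA.point (c t) (y t))" using o(2) unfolding curve_iff by blast
  show W0: "cA.point (c 0) (y 0) \<in> W" "proj A (cA.point (c 0) (y 0)) = c 0" using cA.point[OF c(2)] by auto
  show "(deriv ^^ n) (\<lambda>t. \<psi> (cA.point (c t) (y t)) i) 0 = (deriv ^^ n) (\<lambda>t. y t i) 0" if "i \<in> fib_idx A"
    by (rule derivs_cong[OF S(1,2)]) (use cA.point(5)[OF S(3) that] in auto)
  show "jet M n (proj A \<circ> (\<lambda>t. cA.point (c t) (y t))) = jet M n c"
  proof (rule jet_local[OF _ c(1) S(1,2)])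
    show "curve M (proj A \<circ> (\<lambda>t. cA.point (c t) (y t)))" using cA.proj_curve[OF b W0(1)] by (simp add: base_A)
  qed (use cA.point(3)[OF S(3)] in auto)
qed

definition D where "D = {V \<in> W'. proj E V \<in> U}"

lemma D_iff: "V \<in> D \<longleftrightarrow> V \<in> W' \<and> proj E V \<in> U" and D_pts: "V \<in> D \<Longrightarrow> V \<in> pts (tot E)"
  using cE.mem_iff by (auto simp: D_def)

lemma gact_D: "V \<in> D \<Longrightarrow> gact E t V \<in> D"
  using cE.gact by (auto simp: D_iff)

lemma anc_rep:
  assumes "V \<in> pts (tot E)"
  shows "curve M (rep (anc V))" "rep (anc V) 0 = proj E V" "jet M n (rep (anc V)) = jet_trunc M n (anc V)" "jet M k (rep (anc V)) = anc V"
  using jets_rep[OF anc_morphism(4)[OF assms]] anc_morphism(3)[OF assms] by (auto simp: base_pt_def jet_trunc_def)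

text \<open>
  The coefficients of the comorphism are smooth on the whole part of the chart of \<open>E\<close> over \<open>U\<close>, since each value of the
  anchor there has a lift, with vanishing fibre coordinates, to the domain of the chart of \<open>T\<^sup>kA\<close>.
\<close>

lemma comorphism_domain:
  "base_pt ` {Y \<in> jets (tot E) 1. base_pt Y \<in> W'} \<inter> anc -` Tk_map M k (proj A) ` {X \<in> jets (tot A) k. base_pt X \<in> W} = D"
proof (intro equalityI subsetI)
  fix V assume *: "V \<in> base_pt ` {Y \<in> jets (tot E) 1. base_pt Y \<in> W'} \<inter> anc -` Tk_map M k (proj A) ` {X \<in> jets (tot A) k. base_pt X \<in> W}"
  then obtain X where X: "X \<in> jets (tot A) k" "base_pt X \<in> W" "anc V = Tk_map M k (proj A) X" by auto
  have V: "V \<in> W'" using * by auto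
  have "curve M (proj A \<circ> rep X)" using graded_bundle_proj_curve[OF gbA jets_rep(1)[OF X(1)]] by (simp add: base_A)
  then have "base_pt (anc V) = proj A (rep X 0)" unfolding X(3) Tk_map_def by (simp add: base_pt_jet)
  then have "proj E V = proj A (base_pt X)" using anc_morphism(3) V cE.mem_iff by (simp add: base_pt_def)
  then show "V \<in> D" using V X(2) cA.mem_iff by (simp add: D_iff)
next
  fix V assume V: "V \<in> D"
  then have V': "V \<in> W'" "proj E V \<in> U" by (auto simp: D_iff)
  note wf = cE.weight_field[OF V'(1)]
  have "V = base_pt (jet (tot E) 1 (\<lambda>s. gact E (1 + s) V))" using base_pt_jet[OF wf(2)] wf(3) by simp
  then have 1: "V \<in> base_pt ` {Y \<in> jets (tot E) 1. base_pt Y \<in> W'}"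
    using V'(1) jet_in_jets[OF wf(2)] by (metis (mono_tags, lifting) CollectI imageI)
  note r = anc_rep[OF D_pts[OF V]]
  let ?b = "\<lambda>t. cA.point (rep (anc V) t) (\<lambda>_. 0)"
  have c0: "rep (anc V) 0 \<in> U" using r V' by simp
  note l = lift[OF r(1) c0 open_UNIV UNIV_I, where y = "\<lambda>_ _. 0", OF smooth_real_on_const[OF open_UNIV]]
  have X: "jet (tot A) k ?b \<in> jets (tot A) k" by (rule jet_in_jets[OF l(1)])
  obtain Y where Y: "(jet (tot A) k ?b, Y) \<in> \<kappa>" "base_pt Y = V"
    by (rule kappa_over_curve[OF D_pts[OF V] l(1)]) (use l(5)[of k] r(4) in auto)
  then have "anc V = Tk_map M k (proj A) (jet (tot A) k ?b)" using kappa(3) by metis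
  moreover have "base_pt (jet (tot A) k ?b) \<in> W" using base_pt_jet[OF l(1)] l(2) by simp
  ultimately show "V \<in> base_pt ` {Y \<in> jets (tot E) 1. base_pt Y \<in> W'} \<inter> anc -` Tk_map M k (proj A) ` {X \<in> jets (tot A) k. base_pt X \<in> W}"
    using 1 X by blast
qed

text \<open>
  The coefficients of the comorphism in the two charts; the definition of a comorphism provides their existence, and one
  choice is fixed.
\<close>

abbreviation "P \<equiv> {..k} \<times> fib_idx A"

definition Q where "Q = (SOME Q. (\<forall>j \<in> idx (tot E). \<forall>p \<in> P. smooth_fun (tot E) D (Q j p)) \<and>
   (\<forall>X Y j. (X, Y) \<in> \<kappa> \<longrightarrow> base_pt X \<in> W \<longrightarrow> base_pt Y \<in> W' \<longrightarrow> j \<in> idx (tot E) \<longrightarrow>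
      jet_coords 1 (idx (tot E)) \<psi>' Y (1, j) = (\<Sum>p \<in> P. Q j p (base_pt Y) * jet_coords k (idx (tot A)) \<psi> X p)))"

lemma Q:
  shows Q_smooth_fun: "j \<in> idx (tot E) \<Longrightarrow> p \<in> P \<Longrightarrow> smooth_fun (tot E) D (Q j p)"
    and Q_matrix: "(X, Y) \<in> \<kappa> \<Longrightarrow> base_pt X \<in> W \<Longrightarrow> base_pt Y \<in> W' \<Longrightarrow> j \<in> idx (tot E) \<Longrightarrow>
      jet_coords 1 (idx (tot E)) \<psi>' Y (1, j) = (\<Sum>p \<in> P. Q j p (base_pt Y) * jet_coords k (idx (tot A)) \<psi> X p)"
proof -
  obtain Q' where "\<And>j i. j \<in> idx (tot E) \<Longrightarrow> i \<in> {..k} \<times> fib_idx A \<Longrightarrow> smooth_fun (tot E) D (Q' j i)"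
    "\<And>X Y j. (X, Y) \<in> \<kappa> \<Longrightarrow> base_pt X \<in> W \<Longrightarrow> base_pt Y \<in> W' \<Longrightarrow> j \<in> idx (tot E) \<Longrightarrow>
       jet_coords 1 (idx (tot E)) \<psi>' Y (1, j) =
         (\<Sum>i \<in> {..k} \<times> fib_idx A. Q' j i (base_pt Y) * jet_coords k (idx (tot A)) \<psi> X i)"
    using kappa_matrix[OF cA.atlas cE.atlas, unfolded comorphism_domain] by blast
  then have "\<exists>Q. (\<forall>j \<in> idx (tot E). \<forall>p \<in> P. smooth_fun (tot E) D (Q j p)) \<and>
   (\<forall>X Y j. (X, Y) \<in> \<kappa> \<longrightarrow> base_pt X \<in> W \<longrightarrow> base_pt Y \<in> W' \<longrightarrow> j \<in> idx (tot E) \<longrightarrow>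
      jet_coords 1 (idx (tot E)) \<psi>' Y (1, j) = (\<Sum>p \<in> P. Q j p (base_pt Y) * jet_coords k (idx (tot A)) \<psi> X p))"
    by (intro exI[of _ Q']) simp
  from someI_ex[OF this, folded Q_def]
  show "j \<in> idx (tot E) \<Longrightarrow> p \<in> P \<Longrightarrow> smooth_fun (tot E) D (Q j p)"
    "(X, Y) \<in> \<kappa> \<Longrightarrow> base_pt X \<in> W \<Longrightarrow> base_pt Y \<in> W' \<Longrightarrow> j \<in> idx (tot E) \<Longrightarrow>
      jet_coords 1 (idx (tot E)) \<psi>' Y (1, j) = (\<Sum>p \<in> P. Q j p (base_pt Y) * jet_coords k (idx (tot A)) \<psi> X p)"
    by auto
qed

lemma base_transition: "openin (Rn (idx M)) (\<phi> ` (U \<inter> U'))"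
    "j \<in> idx M \<Longrightarrow> smooth_on (idx M) (\<phi> ` (U \<inter> U')) (\<lambda>x. \<phi>' (inv_into U \<phi> x) j)"
    "openin (Rn (idx M)) (\<phi>' ` (U' \<inter> U))"
  using smooth_chart_transition[OF mfds(1) _ cE.base_chart, of U \<phi>] smooth_chart_transition(1)[OF mfds(1) cE.base_chart, of U \<phi>]
    cA.base_chart by (auto simp: base_A)

lemma psi_D: "\<psi>' ` D = {z \<in> extensional (idx (tot E)). (\<lambda>i\<in>idx M. z i) \<in> \<phi>' ` (U' \<inter> U)}"
proof -
  have im: "\<psi>' ` W' = {z \<in> extensional (idx (tot E)). restrict z (idx M) \<in> \<phi>' ` U'}"
    and co: "\<And>e. e \<in> W' \<Longrightarrow> restrict (\<psi>' e) (idx M) = \<phi>' (proj E e)"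
    using cE.gch by (auto simp: gchart_def)
  have mem: "\<phi>' x \<in> \<phi>' ` (U' \<inter> U) \<longleftrightarrow> x \<in> U" if "x \<in> U'" for x
    using inj_on_image_mem_iff[OF cE.base_inj that, of "U' \<inter> U"] that by auto
  have "z \<in> \<psi>' ` D \<longleftrightarrow> z \<in> extensional (idx (tot E)) \<and> restrict z (idx M) \<in> \<phi>' ` (U' \<inter> U)" for z
  proof
    assume "z \<in> \<psi>' ` D"
    then obtain V where V: "V \<in> D" "z = \<psi>' V" by auto
    then show "z \<in> extensional (idx (tot E)) \<and> restrict z (idx M) \<in> \<phi>' ` (U' \<inter> U)"
      using cE.ext co cE.mem_iff by (auto simp: D_iff)
  next
    assume *: "z \<in> extensional (idx (tot E)) \<and> restrict z (idx M) \<in> \<phi>' ` (U' \<inter> U)"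
    then have "z \<in> \<psi>' ` W'" unfolding im by blast
    then obtain V where V: "V \<in> W'" "z = \<psi>' V" by auto
    then show "z \<in> \<psi>' ` D" using * co[OF V(1)] mem[of "proj E V"] cE.mem_iff by (auto simp: D_iff)
  qed
  then show ?thesis by auto
qed

lemma open_psi_D: "openin (Rn (idx (tot E))) (\<psi>' ` D)"
  unfolding psi_D by (rule openin_restrict_preimage[OF cE.fin(1,2) _ base_transition(3)]) (use cE.idx_cases in auto)

lemma Q_smooth:
  assumes "j \<in> idx (tot E)" "p \<in> P"
  shows "smooth_on (idx (tot E)) (\<psi>' ` D) (\<lambda>x. Q j p (inv_into W' \<psi>' x))"
proof -
  have "W' \<inter> D = D" by (auto simp: D_iff)
  then show ?thesis
    using Q_smooth_fun[OF assms] cE.atlas unfolding smooth_fun_def by fastforce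
qed

lemma kappa_curve:
  assumes V: "V \<in> W'" and b: "curve (tot A) b" "b 0 \<in> W" "jet M k (proj A \<circ> b) = anc V"
  obtains Y where "(jet (tot A) k b, Y) \<in> \<kappa>" "base_pt Y = V"
    "\<And>j. j \<in> idx (tot E) \<Longrightarrow> jet_coords 1 (idx (tot E)) \<psi>' Y (1, j) =
       (\<Sum>p \<in> P. Q j p V * (deriv ^^ fst p) (\<lambda>t. \<psi> (b t) (snd p)) 0)"
proof -
  have Vp: "V \<in> pts (tot E)" using V cE.mem_iff by blast
  obtain Y where Y: "(jet (tot A) k b, Y) \<in> \<kappa>" "base_pt Y = V" by (rule kappa_over_curve[OF Vp b(1,3)])
  have "jet_coords 1 (idx (tot E)) \<psi>' Y (1, j) = (\<Sum>p \<in> P. Q j p V * (deriv ^^ fst p) (\<lambda>t. \<psi> (b t) (snd p)) 0)"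
    if j: "j \<in> idx (tot E)" for j
  proof -
    have "base_pt (jet (tot A) k b) \<in> W" using base_pt_jet[OF b(1)] b(2) by simp
    then have "jet_coords 1 (idx (tot E)) \<psi>' Y (1, j) = (\<Sum>p \<in> P. Q j p V * jet_coords k (idx (tot A)) \<psi> (jet (tot A) k b) p)"
      using Q_matrix[OF Y(1) _ _ j] Y(2) V by simp
    also have "\<dots> = (\<Sum>p \<in> P. Q j p V * (deriv ^^ fst p) (\<lambda>t. \<psi> (b t) (snd p)) 0)"
      by (rule sum.cong) (use jet_coords_jet[OF b(1) cA.atlas b(2), of _ k] cA.idx_cases in auto)
    finally show ?thesis .
  qed
  then show thesis using that Y by blast
qed

text \<open>
  Homogeneity: the entry of the matrix from bi-degree \<open>\<alpha>\<close> to weight \<open>w\<close> is homogeneous of degree \<open>w - \<alpha>\<close>, because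
  \<open>\<kappa>\<close> is invariant under the homotheties. The comparison is made on jets with a single monomial coordinate.
\<close>

lemma Q_homogeneous:
  assumes V: "V \<in> D" and j: "j \<in> idx (tot E)" and p: "(\<alpha>, i) \<in> P"
  shows "t ^ wt E j * Q j (\<alpha>, i) V = t ^ \<alpha> * Q j (\<alpha>, i) (gact E t V)"
proof -
  have V': "V \<in> W'" "proj E V \<in> U" using V by (auto simp: D_iff)
  note r = anc_rep[OF D_pts[OF V]]
  have c0: "rep (anc V) 0 \<in> U" using r V' by simp
  let ?y = "\<lambda>t l. if l = i then t ^ \<alpha> else (0 :: real)"
  define b where "b = (\<lambda>t. cA.point (rep (anc V) t) (?y t))"
  have "smooth_real_on UNIV (\<lambda>t. ?y t l)" for l
    by (cases "l = i") (auto simp: smooth_real_on_power smooth_real_on_ident smooth_real_on_const)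
  note lft = lift[OF r(1) c0 open_UNIV UNIV_I, where y = ?y, OF this]
  have l: "curve (tot A) b" "b 0 \<in> W" "jet M k (proj A \<circ> b) = jet M k (rep (anc V))"
    and l4: "\<And>n l. l \<in> fib_idx A \<Longrightarrow> (deriv ^^ n) (\<lambda>t. \<psi> (b t) l) 0 = (deriv ^^ n) (\<lambda>t. ?y t l) 0"
    unfolding b_def by (rule lft; assumption?)+
  let ?X = "jet (tot A) k b"
  have jb: "jet M k (proj A \<circ> b) = anc V" using l(3) r(4) by simp
  obtain Y where Y: "(?X, Y) \<in> \<kappa>" "base_pt Y = V"
    "\<And>j. j \<in> idx (tot E) \<Longrightarrow> jet_coords 1 (idx (tot E)) \<psi>' Y (1, j) =
       (\<Sum>p \<in> P. Q j p V * (deriv ^^ fst p) (\<lambda>t. \<psi> (b t) (snd p)) 0)"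
    using kappa_curve[OF V'(1) l(1,2) jb] by blast
  have X: "?X \<in> jets (tot A) k" "base_pt ?X \<in> W"
    using jet_in_jets[OF l(1)] base_pt_jet[OF l(1)] l(2) by auto
  have coX: "jet_coords k (idx (tot A)) \<psi> ?X q = (if q = (\<alpha>, i) then fact \<alpha> else 0)" if q: "q \<in> P" for q
  proof -
    have q': "fst q \<le> k" "snd q \<in> fib_idx A" "snd q \<in> idx (tot A)"
      using q cA.idx_cases[of "snd q"] by (simp_all add: mem_Times_iff)
    have "jet_coords k (idx (tot A)) \<psi> ?X (fst q, snd q) = (deriv ^^ fst q) (\<lambda>t. \<psi> (b t) (snd q)) 0"
      by (rule jet_coords_jet[OF l(1) cA.atlas l(2) q'(1,3)])
    also have "\<dots> = (deriv ^^ fst q) (\<lambda>t. ?y t (snd q)) 0" by (rule l4[OF q'(2)])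
    also have "\<dots> = (if q = (\<alpha>, i) then fact \<alpha> else 0)"
    proof (cases "snd q = i")
      case True
      then show ?thesis using derivs_monomial[of "fst q" \<alpha>] by (auto simp: prod_eq_iff)
    next
      case False
      have "(deriv ^^ m) (\<lambda>_ :: real. 0 :: real) = (\<lambda>_. 0)" for m by (induction m) auto
      then show ?thesis using False by auto
    qed
    finally show ?thesis by simp
  qed
  have fP: "finite P" using cA.fin(3) by simp
  have Yj: "jet_coords 1 (idx (tot E)) \<psi>' Y (1, j) = Q j (\<alpha>, i) V * fact \<alpha>"
  proof -
    have "jet_coords 1 (idx (tot E)) \<psi>' Y (1, j) = (\<Sum>q \<in> P. Q j q V * jet_coords k (idx (tot A)) \<psi> ?X q)"
      using Q_matrix[OF Y(1) X(2) _ j] Y(2) V'(1) by simp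
    also have "\<dots> = (\<Sum>q \<in> P. if q = (\<alpha>, i) then Q j (\<alpha>, i) V * fact \<alpha> else 0)"
      by (rule sum.cong) (auto simp: coX)
    finally show ?thesis using p fP by (simp add: sum.delta)
  qed
  let ?Z = "Tk_map (tot E) 1 (gact E t) Y"
  have Z: "(jet_act (tot A) k t ?X, ?Z) \<in> \<kappa>" by (rule kappa(5)[OF Y(1)])
  have cY: "curve (tot E) (rep Y)" "rep Y 0 = V" using jets_rep(1)[OF kappa(2)[OF Y(1)]] Y(2) by (auto simp: base_pt_def)
  have cZ: "curve (tot E) (\<lambda>s. gact E t (rep Y s))"
    by (rule graded_bundle_gact_curve[OF gbE cY(1) smooth_real_on_const]) simp
  have gV: "gact E t V \<in> W'" using cE.gact(1)[OF V'(1)] .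
  have bZ: "base_pt ?Z = gact E t V" unfolding Tk_map_def o_def using base_pt_jet[OF cZ] cY(2) by simp
  have "jet_coords 1 (idx (tot E)) \<psi>' ?Z (1, j) = t ^ wt E j * jet_coords 1 (idx (tot E)) \<psi>' Y (1, j)"
  proof -
    have "rep Y 0 \<in> W'" using cY(2) V'(1) by simp
    then obtain S where S: "open S" "0 \<in> S" "\<And>s. s \<in> S \<Longrightarrow> rep Y s \<in> W'" "\<And>i. i \<in> idx (tot E) \<Longrightarrow> smooth_real_on S (\<lambda>s. \<psi>' (rep Y s) i)"
      using curve_near_chart[OF mfds(3) cY(1) cE.smooth_chart] by blast
    have "jet_coords 1 (idx (tot E)) \<psi>' ?Z (1, j) = (deriv ^^ 1) (\<lambda>s. \<psi>' (gact E t (rep Y s)) j) 0"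
      unfolding Tk_map_def o_def by (rule jet_coords_jet[OF cZ cE.atlas]) (use gV cY(2) j in auto)
    also have "\<dots> = (deriv ^^ 1) (\<lambda>s. t ^ wt E j * \<psi>' (rep Y s) j) 0"
      by (rule derivs_cong[OF S(1,2)]) (use cE.gact(2)[OF S(3) j] in auto)
    also have "\<dots> = t ^ wt E j * deriv (\<lambda>s. \<psi>' (rep Y s) j) 0"
      using DERIV_imp_deriv[OF DERIV_cmult[OF smooth_real_on_has_deriv[OF S(4)[OF j] S(2)]]] by simp
    finally show ?thesis using j by (simp add: jet_coords_def)
  qed
  moreover have "jet_coords 1 (idx (tot E)) \<psi>' ?Z (1, j) = Q j (\<alpha>, i) (gact E t V) * (t ^ \<alpha> * fact \<alpha>)"
  proof -
    have act: "jet_coords k (idx (tot A)) \<psi> (jet_act (tot A) k t ?X) q = t ^ fst q * jet_coords k (idx (tot A)) \<psi> ?X q" if "q \<in> P" for q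
      using jet_act(3)[OF X(1) cA.atlas mfds(2) X(2), of "fst q" "snd q" t] that cA.idx_cases by auto
    have "jet_coords 1 (idx (tot E)) \<psi>' ?Z (1, j) =
        (\<Sum>q \<in> P. Q j q (gact E t V) * jet_coords k (idx (tot A)) \<psi> (jet_act (tot A) k t ?X) q)"
      using Q_matrix[OF Z _ _ j] jet_act(2)[OF X(1)] X(2) bZ gV by simp
    also have "\<dots> = (\<Sum>q \<in> P. if q = (\<alpha>, i) then Q j (\<alpha>, i) (gact E t V) * (t ^ \<alpha> * fact \<alpha>) else 0)"
      by (rule sum.cong) (auto simp: coX act)
    finally show ?thesis using p fP by (simp add: sum.delta)
  qed
  ultimately have "t ^ wt E j * (Q j (\<alpha>, i) V * fact \<alpha>) = Q j (\<alpha>, i) (gact E t V) * (t ^ \<alpha> * fact \<alpha>)"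
    using Yj by simp
  then show ?thesis by (simp add: mult_ac)
qed

text \<open>
  A homogeneous function of degree \<open>d\<close> depends on the coordinates of weight at most \<open>d\<close> only: contracting two points
  that agree in these coordinates, their difference is of order \<open>t\<^sup>d\<^sup>+\<^sup>1\<close>, and the function is Lipschitz near the zero
  section.
\<close>

lemma Q_depends:
  assumes V: "V \<in> D" "V2 \<in> D" "proj E V = proj E V2" and j: "j \<in> idx (tot E)" and p: "(\<alpha>, i) \<in> P"
    and eq: "\<And>l. l \<in> idx (tot E) \<Longrightarrow> wt E l + \<alpha> \<le> wt E j \<Longrightarrow> \<psi>' V l = \<psi>' V2 l"
  shows "Q j (\<alpha>, i) V = Q j (\<alpha>, i) V2"
proof -
  let ?I = "idx (tot E)"
  define x0 where "x0 = \<psi>' (gact E 0 V)"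
  have W: "V \<in> W'" "V2 \<in> W'" using V by (auto simp: D_iff)
  have base_eq: "\<psi>' V l = \<psi>' V2 l" if "l \<in> ?I" "wt E l = 0" for l
    using that cE.base_coord[OF W(1)] cE.base_coord[OF W(2)] V(3) cE.base_idx by simp
  have x0: "x0 \<in> \<psi>' ` D" unfolding x0_def using gact_D[OF V(1)] by auto
  obtain d L where dL: "d > 0" "L \<ge> 0"
    "\<And>y. y \<in> extensional ?I \<Longrightarrow> (\<forall>i\<in>?I. \<bar>y i - x0 i\<bar> < d) \<Longrightarrow> y \<in> \<psi>' ` D"
    "\<And>y y'. y \<in> extensional ?I \<Longrightarrow> (\<forall>i\<in>?I. \<bar>y i - x0 i\<bar> < d) \<Longrightarrow>
       y' \<in> extensional ?I \<Longrightarrow> (\<forall>i\<in>?I. \<bar>y' i - x0 i\<bar> < d) \<Longrightarrow>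
       \<bar>Q j (\<alpha>, i) (inv_into W' \<psi>' y) - Q j (\<alpha>, i) (inv_into W' \<psi>' y')\<bar> \<le> L * (\<Sum>i\<in>?I. \<bar>y i - y' i\<bar>)"
    using smooth_on_locally_Lipschitz[OF cE.fin(1) open_psi_D Q_smooth[OF j p] x0] by blast
  define m where "m = (\<Sum>l\<in>?I. \<bar>\<psi>' V l\<bar> + \<bar>\<psi>' V2 l\<bar>)"
  define C where "C = L * (\<Sum>l\<in>?I. \<bar>\<psi>' V l - \<psi>' V2 l\<bar>)"
  have near: "\<bar>\<psi>' (gact E t Z) l - x0 l\<bar> < d"
    if t: "0 < t" "t \<le> 1" "t * m < d" and Z: "Z = V \<or> Z = V2" and l: "l \<in> ?I" for t Z l
  proof -
    have ZW: "Z \<in> W'" using Z W by auto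
    have g: "\<psi>' (gact E t Z) l = t ^ wt E l * \<psi>' Z l" "x0 l = 0 ^ wt E l * \<psi>' V l"
      unfolding x0_def using cE.gact(2)[OF ZW l] cE.gact(2)[OF W(1) l] by auto
    show ?thesis
    proof (cases "wt E l")
      case 0
      then show ?thesis using g base_eq[OF l] Z dL(1) by auto
    next
      case (Suc w)
      have "\<bar>\<psi>' Z l\<bar> \<le> \<bar>\<psi>' V l\<bar> + \<bar>\<psi>' V2 l\<bar>" using Z by auto
      also have "\<dots> \<le> m" unfolding m_def by (rule member_le_sum) (use l cE.fin(1) in auto)
      finally have le: "\<bar>\<psi>' Z l\<bar> \<le> m" .
      have "t ^ wt E l \<le> t" using t power_decreasing[of 1 "wt E l" t] Suc by simp
      then have "t ^ wt E l * \<bar>\<psi>' Z l\<bar> \<le> t * m" using le t by (intro mult_mono) auto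
      moreover have "\<bar>\<psi>' (gact E t Z) l - x0 l\<bar> = t ^ wt E l * \<bar>\<psi>' Z l\<bar>" using g t Suc by (simp add: abs_mult)
      ultimately show ?thesis using t(3) by linarith
    qed
  qed
  have est: "\<bar>Q j (\<alpha>, i) V - Q j (\<alpha>, i) V2\<bar> \<le> t * C" if t: "0 < t" "t \<le> 1" "t * m < d" for t
  proof -
    have inv: "inv_into W' \<psi>' (\<psi>' (gact E t Z)) = gact E t Z" if "Z \<in> W'" for Z
      using cE.inj cE.gact(1)[OF that] by simp
    have "\<bar>Q j (\<alpha>, i) (gact E t V) - Q j (\<alpha>, i) (gact E t V2)\<bar> \<le>
        L * (\<Sum>l\<in>?I. \<bar>\<psi>' (gact E t V) l - \<psi>' (gact E t V2) l\<bar>)"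
      using dL(4)[of "\<psi>' (gact E t V)" "\<psi>' (gact E t V2)"] near[OF t] cE.ext cE.gact(1) W inv by simp
    then have "t ^ \<alpha> * \<bar>Q j (\<alpha>, i) (gact E t V) - Q j (\<alpha>, i) (gact E t V2)\<bar> \<le>
        t ^ \<alpha> * (L * (\<Sum>l\<in>?I. \<bar>\<psi>' (gact E t V) l - \<psi>' (gact E t V2) l\<bar>))"
      using t by (intro mult_left_mono) auto
    moreover have "t ^ \<alpha> * \<bar>Q j (\<alpha>, i) (gact E t V) - Q j (\<alpha>, i) (gact E t V2)\<bar> = t ^ wt E j * \<bar>Q j (\<alpha>, i) V - Q j (\<alpha>, i) V2\<bar>"
    proof -
      have "t ^ \<alpha> * \<bar>Q j (\<alpha>, i) (gact E t V) - Q j (\<alpha>, i) (gact E t V2)\<bar> =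
         \<bar>t ^ \<alpha> * Q j (\<alpha>, i) (gact E t V) - t ^ \<alpha> * Q j (\<alpha>, i) (gact E t V2)\<bar>"
        using t by (simp add: abs_mult right_diff_distrib[symmetric])
      also have "\<dots> = \<bar>t ^ wt E j * Q j (\<alpha>, i) V - t ^ wt E j * Q j (\<alpha>, i) V2\<bar>"
        using Q_homogeneous[OF V(1) j p, of t] Q_homogeneous[OF V(2) j p, of t] by simp
      also have "\<dots> = t ^ wt E j * \<bar>Q j (\<alpha>, i) V - Q j (\<alpha>, i) V2\<bar>"
        using t by (simp add: abs_mult right_diff_distrib[symmetric])
      finally show ?thesis .
    qed
    moreover have "t ^ \<alpha> * (L * (\<Sum>l\<in>?I. \<bar>\<psi>' (gact E t V) l - \<psi>' (gact E t V2) l\<bar>)) \<le> t ^ wt E j * (t * C)"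
    proof -
      have summand: "t ^ \<alpha> * \<bar>\<psi>' (gact E t V) l - \<psi>' (gact E t V2) l\<bar> \<le> t ^ Suc (wt E j) * \<bar>\<psi>' V l - \<psi>' V2 l\<bar>"
        if l: "l \<in> ?I" for l
      proof -
        have e: "t ^ \<alpha> * \<bar>\<psi>' (gact E t V) l - \<psi>' (gact E t V2) l\<bar> = t ^ (wt E l + \<alpha>) * \<bar>\<psi>' V l - \<psi>' V2 l\<bar>"
        proof -
          have "\<psi>' (gact E t V) l - \<psi>' (gact E t V2) l = t ^ wt E l * (\<psi>' V l - \<psi>' V2 l)"
            using cE.gact(2)[OF W(1) l, of t] cE.gact(2)[OF W(2) l, of t] by (simp add: right_diff_distrib)
          then show ?thesis using t by (simp add: abs_mult power_add)
        qed
        show ?thesis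
        proof (cases "wt E l + \<alpha> \<le> wt E j")
          case True
          then show ?thesis unfolding e using eq[OF l True] by simp
        next
          case False
          then have "t ^ (wt E l + \<alpha>) \<le> t ^ Suc (wt E j)" using t by (intro power_decreasing) auto
          then show ?thesis unfolding e by (intro mult_right_mono) auto
        qed
      qed
      have "t ^ \<alpha> * (L * (\<Sum>l\<in>?I. \<bar>\<psi>' (gact E t V) l - \<psi>' (gact E t V2) l\<bar>)) =
          L * (\<Sum>l\<in>?I. t ^ \<alpha> * \<bar>\<psi>' (gact E t V) l - \<psi>' (gact E t V2) l\<bar>)"
        by (simp add: sum_distrib_left mult_ac)
      also have "\<dots> \<le> L * (\<Sum>l\<in>?I. t ^ Suc (wt E j) * \<bar>\<psi>' V l - \<psi>' V2 l\<bar>)"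
        by (intro mult_left_mono sum_mono summand dL(2))
      also have "\<dots> = t ^ wt E j * (t * C)" by (simp add: C_def sum_distrib_left mult_ac)
      finally show ?thesis .
    qed
    ultimately have "t ^ wt E j * \<bar>Q j (\<alpha>, i) V - Q j (\<alpha>, i) V2\<bar> \<le> t ^ wt E j * (t * C)" by linarith
    then show ?thesis using t by simp
  qed
  have "\<forall>\<^sub>F t in at_right 0. \<bar>Q j (\<alpha>, i) V - Q j (\<alpha>, i) V2\<bar> \<le> t * C"
  proof -
    have lim: "((\<lambda>t. t * m) \<longlongrightarrow> 0 * m) (at_right 0)" by (intro tendsto_intros)
    have "\<forall>\<^sub>F t in at_right 0. t * m < d" by (rule order_tendstoD(2)[OF lim]) (use dL(1) in simp)
    moreover have "\<forall>\<^sub>F t in at_right (0 :: real). 0 < t" by (rule eventually_at_right_less)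
    moreover have "\<forall>\<^sub>F t in at_right (0 :: real). t < 1" by (rule eventually_at_rightI[of 0 1]) auto
    ultimately show ?thesis by eventually_elim (rule est, auto)
  qed
  moreover have "((\<lambda>t. t * C) \<longlongrightarrow> 0 * C) (at_right 0)" by (intro tendsto_intros)
  ultimately have "\<bar>Q j (\<alpha>, i) V - Q j (\<alpha>, i) V2\<bar> \<le> 0 * C"
    by (intro tendsto_lowerbound) auto
  then show ?thesis by simp
qed

end

context chart_pair
begin

text \<open>
  The equation \<open>\<kappa>\<^sub>V(U') = \<Delta>(V)\<close> in coordinates, \<open>U'\<close> being the lift of the jet with coordinates \<open>u\<close>. The coordinate of
  \<open>V\<close> of weight \<open>w\<close> occurs on the left, while only coordinates of smaller weight enter the right hand side.
\<close>

definition theta_eqn :: "(nat \<times> 'i \<Rightarrow> real) \<Rightarrow> 'e \<Rightarrow> bool" where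
  "theta_eqn u V \<longleftrightarrow> (\<forall>j \<in> idx (tot E). real (wt E j) * \<psi>' V j =
     (\<Sum>p \<in> P. Q j p V * (real (fst p) * u (fst p - 1, snd p))))"

lemma theta_eqn_cong:
  assumes "\<And>\<alpha> i. \<alpha> < k \<Longrightarrow> i \<in> fib_idx A \<Longrightarrow> u (\<alpha>, i) = u' (\<alpha>, i)"
  shows "theta_eqn u V \<longleftrightarrow> theta_eqn u' V"
proof -
  have "u (fst p - 1, snd p) = u' (fst p - 1, snd p)" if "p \<in> P" for p
    by (rule assms) (use that k in auto)
  then show ?thesis unfolding theta_eqn_def by (intro ball_cong refl arg_cong2[where f = "(=)"] sum.cong) auto
qed

text \<open>
  Homogeneity at \<open>t = 0\<close>: an entry of negative degree vanishes, here for the coordinates of weight zero.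
\<close>

lemma Q_zero:
  assumes "V \<in> D" "j \<in> idx (tot E)" "p \<in> P" "wt E j = 0" "fst p \<noteq> 0"
  shows "Q j p V = 0"
  using Q_homogeneous[of V j "fst p" "snd p" 0] assms by simp

text \<open>
  The terms with \<open>\<alpha> = 0\<close> carry the factor \<open>\<alpha>\<close>, and an entry with \<open>\<alpha> \<ge> 1\<close> has degree below the weight of \<open>j\<close>.
\<close>

lemma rhs_depends:
  assumes V: "V \<in> D" "V2 \<in> D" "proj E V = proj E V2" and j: "j \<in> idx (tot E)" "wt E j \<le> Suc n"
    and eq: "\<And>l. l \<in> idx (tot E) \<Longrightarrow> wt E l \<le> n \<Longrightarrow> \<psi>' V l = \<psi>' V2 l"
  shows "(\<Sum>p \<in> P. Q j p V * (real (fst p) * u (fst p - 1, snd p))) =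
    (\<Sum>p \<in> P. Q j p V2 * (real (fst p) * u (fst p - 1, snd p)))"
proof (rule sum.cong[OF refl])
  fix p assume p: "p \<in> P"
  show "Q j p V * (real (fst p) * u (fst p - 1, snd p)) = Q j p V2 * (real (fst p) * u (fst p - 1, snd p))"
  proof (cases "fst p = 0")
    case False
    have "Q j (fst p, snd p) V = Q j (fst p, snd p) V2"
      by (rule Q_depends[OF V j(1)]) (use p False j(2) in \<open>auto intro!: eq\<close>)
    then show ?thesis by simp
  qed simp
qed

lemma weight_zero_coord:
  assumes "V \<in> D" "V2 \<in> D" "proj E V = proj E V2" "j \<in> idx (tot E)" "wt E j = 0"
  shows "\<psi>' V j = \<psi>' V2 j"
  using assms cE.base_coord[of V j] cE.base_coord[of V2 j] cE.base_idx by (simp add: D_iff)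

lemma theta_eqn_unique:
  assumes V: "V \<in> D" "V2 \<in> D" "proj E V = proj E V2" and eqn: "theta_eqn u V" "theta_eqn u V2"
  shows "V = V2"
proof -
  have "\<forall>j \<in> idx (tot E). wt E j \<le> n \<longrightarrow> \<psi>' V j = \<psi>' V2 j" for n
  proof (induction n)
    case 0
    then show ?case using weight_zero_coord[OF V] by auto
  next
    case (Suc n)
    show ?case
    proof (intro ballI impI)
      fix j assume j: "j \<in> idx (tot E)" "wt E j \<le> Suc n"
      show "\<psi>' V j = \<psi>' V2 j"
      proof (cases "wt E j = 0")
        case True
        then show ?thesis using weight_zero_coord[OF V j(1)] by simp
      next
        case False
        have "real (wt E j) * \<psi>' V j = real (wt E j) * \<psi>' V2 j"
          using eqn j(1) rhs_depends[OF V j, of u] Suc unfolding theta_eqn_def by auto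
        then show ?thesis using False by simp
      qed
    qed
  qed
  then have "\<psi>' V j = \<psi>' V2 j" if "j \<in> idx (tot E)" for j using that by blast
  then show ?thesis using V by (intro cE.eqI) (auto simp: D_iff)
qed

lemma theta_eqn_gact:
  assumes V: "V \<in> D" and eqn: "theta_eqn u V"
  shows "theta_eqn (\<lambda>p. t ^ Suc (fst p) * u p) (gact E t V)"
  unfolding theta_eqn_def
proof
  fix j assume j: "j \<in> idx (tot E)"
  have VW: "V \<in> W'" using V by (simp add: D_iff)
  have "real (wt E j) * \<psi>' (gact E t V) j = t ^ wt E j * (real (wt E j) * \<psi>' V j)"
    using cE.gact(2)[OF VW j] by simp
  also have "\<dots> = (\<Sum>p \<in> P. t ^ wt E j * Q j p V * (real (fst p) * u (fst p - 1, snd p)))"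
    using eqn j unfolding theta_eqn_def by (simp add: sum_distrib_left mult.assoc)
  also have "\<dots> = (\<Sum>p \<in> P. Q j p (gact E t V) * (real (fst p) * (t ^ Suc (fst (fst p - 1, snd p)) * u (fst p - 1, snd p))))"
  proof (rule sum.cong[OF refl])
    fix p assume p: "p \<in> P"
    have "t ^ wt E j * Q j p V = t ^ fst p * Q j p (gact E t V)"
      using Q_homogeneous[OF V j, of "fst p" "snd p" t] p by simp
    then show "t ^ wt E j * Q j p V * (real (fst p) * u (fst p - 1, snd p)) =
        Q j p (gact E t V) * (real (fst p) * (t ^ Suc (fst (fst p - 1, snd p)) * u (fst p - 1, snd p)))"
      by (cases "fst p") (simp_all add: mult_ac)
  qed
  finally show "real (wt E j) * \<psi>' (gact E t V) j =
     (\<Sum>p \<in> P. Q j p (gact E t V) * (real (fst p) * (t ^ Suc (fst (fst p - 1, snd p)) * u (fst p - 1, snd p))))" .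
qed

text \<open>
  The curve \<open>t b(t)\<close>, which represents the lift of the jet of \<open>b\<close>.
\<close>

lemma times_curve:
  assumes b: "curve (tot A) b" "b 0 \<in> W"
  shows "curve (tot A) (\<lambda>t. gact A t (b t))" "gact A 0 (b 0) \<in> W"
    "jet M n (proj A \<circ> (\<lambda>t. gact A t (b t))) = jet M n (proj A \<circ> b)"
    "i \<in> fib_idx A \<Longrightarrow> (deriv ^^ \<alpha>) (\<lambda>t. \<psi> (gact A t (b t)) i) 0 = real \<alpha> * (deriv ^^ (\<alpha> - 1)) (\<lambda>t. \<psi> (b t) i) 0"
proof -
  show g: "curve (tot A) (\<lambda>t. gact A t (b t))" "gact A 0 (b 0) \<in> W"
    using graded_bundle_gact_curve[OF gbA b(1) smooth_real_on_ident[OF open_UNIV]] cA.gact(1)[OF b(2)] by auto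
  obtain S where S: "open S" "0 \<in> S" "\<And>t. t \<in> S \<Longrightarrow> b t \<in> W" "\<And>i. i \<in> idx (tot A) \<Longrightarrow> smooth_real_on S (\<lambda>t. \<psi> (b t) i)"
    using curve_near_chart[OF mfds(2) b(1) cA.smooth_chart b(2)] by blast
  show "jet M n (proj A \<circ> (\<lambda>t. gact A t (b t))) = jet M n (proj A \<circ> b)"
  proof (rule jet_local[OF _ _ S(1,2)])
    show "curve M (proj A \<circ> (\<lambda>t. gact A t (b t)))"
      using graded_bundle_proj_curve[OF gbA g(1)] unfolding base_A .
    show "curve M (proj A \<circ> b)" using graded_bundle_proj_curve[OF gbA b(1)] unfolding base_A .
    show "(proj A \<circ> (\<lambda>t. gact A t (b t))) t = (proj A \<circ> b) t" if "t \<in> S" for t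
      using cA.gact(3)[OF S(3)[OF that], of t] by (simp only: o_apply)
  qed
  assume i: "i \<in> fib_idx A"
  then have i': "i \<in> idx (tot A)" "wt A i = 1" using cA.wt_le[of i] by (auto simp: fib_idx_def)
  have "(deriv ^^ \<alpha>) (\<lambda>t. \<psi> (gact A t (b t)) i) 0 = (deriv ^^ \<alpha>) (\<lambda>t. t * \<psi> (b t) i) 0"
    by (rule derivs_cong[OF S(1,2)]) (use cA.gact(2)[OF S(3) i'(1)] i'(2) in simp)
  also have "\<dots> = real \<alpha> * (deriv ^^ (\<alpha> - 1)) (\<lambda>t. \<psi> (b t) i) 0"
    using derivs_times_ident[OF S(4)[OF i'(1)] S(1,2), of \<alpha>] by simp
  finally show "(deriv ^^ \<alpha>) (\<lambda>t. \<psi> (gact A t (b t)) i) 0 = real \<alpha> * (deriv ^^ (\<alpha> - 1)) (\<lambda>t. \<psi> (b t) i) 0" .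
qed

text \<open>For a curve \<open>b\<close> over the anchor of \<open>V\<close>, the coordinate equation is the equation for tangent vectors.\<close>

lemma theta_eqn_curve:
  assumes V: "V \<in> W'" and b: "curve (tot A) b" "b 0 \<in> W" "jet M k (proj A \<circ> b) = anc V"
    and u: "\<And>\<alpha> i. \<alpha> < k \<Longrightarrow> i \<in> fib_idx A \<Longrightarrow> u (\<alpha>, i) = (deriv ^^ \<alpha>) (\<lambda>t. \<psi> (b t) i) 0"
  shows "theta_eqn u V \<longleftrightarrow> kappa_at \<kappa> V (jet (tot A) k (\<lambda>t. gact A t (b t))) = weight_field (tot E) (wt E) V"
    and "theta_eqn u V \<longleftrightarrow> (jet (tot A) k (\<lambda>t. gact A t (b t)), weight_field (tot E) (wt E) V) \<in> \<kappa>"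
proof -
  note g = times_curve[OF b(1,2)]
  obtain Y where Y: "(jet (tot A) k (\<lambda>t. gact A t (b t)), Y) \<in> \<kappa>" "base_pt Y = V"
    "\<And>j. j \<in> idx (tot E) \<Longrightarrow> jet_coords 1 (idx (tot E)) \<psi>' Y (1, j) =
       (\<Sum>p \<in> P. Q j p V * (deriv ^^ fst p) (\<lambda>t. \<psi> (gact A t (b t)) (snd p)) 0)"
    by (rule kappa_curve[OF V g(1,2)]) (use g(3)[of k] b(3) in simp, blast)
  have Yj: "jet_coords 1 (idx (tot E)) \<psi>' Y (1, j) = (\<Sum>p \<in> P. Q j p V * (real (fst p) * u (fst p - 1, snd p)))"
    if "j \<in> idx (tot E)" for j
  proof -
    have "real (fst p) * u (fst p - 1, snd p) = (deriv ^^ fst p) (\<lambda>t. \<psi> (gact A t (b t)) (snd p)) 0" if "p \<in> P" for p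
    proof -
      have "fst p - 1 < k" "snd p \<in> fib_idx A" using that k by auto
      then show ?thesis using g(4)[of "snd p" "fst p"] u by simp
    qed
    then show ?thesis using Y(3)[OF that] by simp
  qed
  note wf = cE.weight_field[OF V]
  have wfj: "weight_field (tot E) (wt E) V \<in> jets (tot E) 1" "base_pt (weight_field (tot E) (wt E) V) = V"
    using jet_in_jets[OF wf(2)] base_pt_jet[OF wf(2)] wf(1,3) by auto
  have "theta_eqn u V \<longleftrightarrow> Y = weight_field (tot E) (wt E) V"
  proof
    assume "theta_eqn u V"
    then show "Y = weight_field (tot E) (wt E) V"
      using kappa(2)[OF Y(1)] wfj Y(2) V Yj wf(4) by (intro cE.tangent_eqI) (auto simp: theta_eqn_def)
  next
    assume "Y = weight_field (tot E) (wt E) V"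
    then show "theta_eqn u V" using Yj wf(4) by (auto simp: theta_eqn_def)
  qed
  moreover have ka: "kappa_at \<kappa> V (jet (tot A) k (\<lambda>t. gact A t (b t))) = Y" using kappa_atI[OF Y(1)] Y(2) by simp
  ultimately show 1: "theta_eqn u V \<longleftrightarrow> kappa_at \<kappa> V (jet (tot A) k (\<lambda>t. gact A t (b t))) = weight_field (tot E) (wt E) V" by simp
  have "(jet (tot A) k (\<lambda>t. gact A t (b t)), weight_field (tot E) (wt E) V) \<in> \<kappa> \<Longrightarrow> Y = weight_field (tot E) (wt E) V"
    using kappa_atI[of _ "weight_field (tot E) (wt E) V"] ka wfj(2) by metis
  then show "theta_eqn u V \<longleftrightarrow> (jet (tot A) k (\<lambda>t. gact A t (b t)), weight_field (tot E) (wt E) V) \<in> \<kappa>"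
    using 1 ka Y(1) by metis
qed

lemma jet_coords_fibre:
  assumes "curve (tot A) b" "b 0 \<in> W" "\<alpha> < k" "i \<in> fib_idx A"
  shows "jet_coords (k - 1) (idx (tot A)) \<psi> (jet (tot A) (k - 1) b) (\<alpha>, i) = (deriv ^^ \<alpha>) (\<lambda>t. \<psi> (b t) i) 0"
  by (rule jet_coords_jet[OF assms(1) cA.atlas assms(2)]) (use assms cA.idx_cases in auto)

lemma theta_rel_imp_eqn:
  assumes "(\<xi>, V) \<in> theta_rel" "base_pt \<xi> \<in> W" "V \<in> W'"
  shows "V \<in> D" "proj E V = proj A (base_pt \<xi>)" "theta_eqn (jet_coords (k - 1) (idx (tot A)) \<psi> \<xi>) V"
proof -
  obtain b where b: "curve (tot A) b" "jet (tot A) (k - 1) b = \<xi>" "jet M k (proj A \<circ> b) = anc V"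
     "kappa_at \<kappa> V (jet (tot A) k (\<lambda>t. gact A t (b t))) = weight_field (tot E) (wt E) V"
    using assms(1) unfolding theta_rel_def by auto
  have b0: "base_pt \<xi> = b 0" using base_pt_jet[OF b(1)] b(2) by metis
  then have bW: "b 0 \<in> W" using assms(2) by simp
  have "curve M (proj A \<circ> b)" using cA.proj_curve[OF b(1) bW] by (simp add: base_A)
  then have "base_pt (anc V) = proj A (b 0)" using base_pt_jet[of M "proj A \<circ> b" k] b(3) by simp
  then show p: "proj E V = proj A (base_pt \<xi>)" using anc_morphism(3) assms(3) cE.mem_iff b0 by simp
  show "V \<in> D" using p assms(2,3) cA.mem_iff by (simp add: D_iff)
  show "theta_eqn (jet_coords (k - 1) (idx (tot A)) \<psi> \<xi>) V"
    by (rule theta_eqn_curve(1)[THEN iffD2, OF assms(3) b(1) bW b(3) _ b(4)])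
      (rule jet_coords_fibre[OF b(1) bW, unfolded b(2)])
qed

text \<open>
  A solution \<open>V\<close> of the coordinate equation for the jet of an admissible curve \<open>a\<close>: first the equation is read along a
  curve \<open>b\<close> over the anchor of \<open>V\<close> with the fibre coordinates of \<open>a\<close>. The almost Lie condition shows that \<open>b\<close> is
  admissible to order \<open>k\<close>, hence its base has the same \<open>k\<close>-jet as that of \<open>a\<close>, and \<open>b\<close> may be replaced by \<open>a\<close>.
\<close>

lemma theta_eqn_imp_rel:
  assumes a: "admissible A sharp a" "a 0 \<in> W" and V: "V \<in> W'" "proj E V = proj A (a 0)"
    and eqn: "theta_eqn (jet_coords (k - 1) (idx (tot A)) \<psi> (jet (tot A) (k - 1) a)) V"
  shows "(jet (tot A) (k - 1) a, V) \<in> theta_rel" "anc V = jet M k (proj A \<circ> a)"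
proof -
  have ca: "curve (tot A) a" using a(1) by (simp add: admissible_def)
  have Vp: "V \<in> pts (tot E)" using V(1) cE.mem_iff by blast
  note r = anc_rep[OF Vp]
  have c0: "rep (anc V) 0 \<in> U" using r(2) V(2) a(2) cA.mem_iff by simp
  obtain S where S: "open S" "0 \<in> S" "\<And>t. t \<in> S \<Longrightarrow> a t \<in> W" "\<And>i. i \<in> idx (tot A) \<Longrightarrow> smooth_real_on S (\<lambda>t. \<psi> (a t) i)"
    using curve_near_chart[OF mfds(2) ca cA.smooth_chart a(2)] by blast
  define b where "b = (\<lambda>t. cA.point (rep (anc V) t) (\<psi> (a t)))"
  have sm: "smooth_real_on S (\<lambda>t. \<psi> (a t) i)" if "i \<in> fib_idx A" for i using S(4) that cA.idx_cases by blast
  note lft = lift[OF r(1) c0 S(1,2), where y = "\<lambda>t. \<psi> (a t)", OF sm]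
  have b: "curve (tot A) b" "b 0 \<in> W" "proj A (b 0) = rep (anc V) 0" "jet M k (proj A \<circ> b) = jet M k (rep (anc V))"
    and b4: "\<And>n l. l \<in> fib_idx A \<Longrightarrow> (deriv ^^ n) (\<lambda>t. \<psi> (b t) l) 0 = (deriv ^^ n) (\<lambda>t. \<psi> (a t) l) 0"
    unfolding b_def by (rule lft; assumption?)+
  have jb: "jet M k (proj A \<circ> b) = anc V" using b(4) r(4) by simp
  let ?u = "jet_coords (k - 1) (idx (tot A)) \<psi> (jet (tot A) (k - 1) a)"
  have u: "?u (\<alpha>, i) = (deriv ^^ \<alpha>) (\<lambda>t. \<psi> (b t) i) 0" if "\<alpha> < k" "i \<in> fib_idx A" for \<alpha> i
    using jet_coords_fibre[OF ca a(2) that] b4[OF that(2)] by simp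
  have "(jet (tot A) k (\<lambda>t. gact A t (b t)), weight_field (tot E) (wt E) V) \<in> \<kappa>"
    using theta_eqn_curve(2)[OF V(1) b(1,2) jb u] eqn by simp
  then have vb: "velocity_jet k b" by (rule weight_field_velocity_jet[OF Vp b(1) jb])
  have "proj A \<circ> a \<in> jet M k (proj A \<circ> b)"
  proof (rule velocity_jet_unique[OF cA.graded_bundle_chart_axioms ca a(2) admissible_velocity_jet[OF a(1)] b(1,2) vb])
    show "proj A (a 0) = proj A (b 0)" using b(3) r(2) V(2) by simp
  qed (use b4 in \<open>auto simp: eqjet_def\<close>)
  moreover have pa: "curve M (proj A \<circ> a)" using cA.proj_curve[OF ca a(2)] by (simp add: base_A)
  ultimately show anc_a: "anc V = jet M k (proj A \<circ> a)" using jb jet_eq_iff[OF pa] by metis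
  have 1: "kappa_at \<kappa> V (jet (tot A) k (\<lambda>t. gact A t (a t))) = weight_field (tot E) (wt E) V"
    using theta_eqn_curve(1)[OF V(1) ca a(2) anc_a[symmetric] jet_coords_fibre[OF ca a(2)]] eqn by simp
  have 2: "Tk_map M (k - 1) (proj A) (jet (tot A) (k - 1) a) = jet_trunc M (k - 1) (anc V)"
  proof -
    have "proj A \<circ> rep (jet (tot A) (k - 1) a) \<in> jet (base A) (k - 1) (proj A \<circ> a)"
      by (rule graded_bundle_proj_jet[OF gbA ca rep_jet[OF ca]])
    moreover have "curve (base A) (proj A \<circ> rep (jet (tot A) (k - 1) a))"
      by (rule graded_bundle_proj_curve[OF gbA rep_jet_curve[OF ca]])
    ultimately have "Tk_map M (k - 1) (proj A) (jet (tot A) (k - 1) a) = jet M (k - 1) (proj A \<circ> a)"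
      unfolding Tk_map_def base_A by (simp add: jet_eq_iff)
    moreover have "rep (anc V) \<in> jet M (k - 1) (proj A \<circ> a)"
      by (rule jet_mono[of _ _ k]) (use rep_jet[OF pa, of k] anc_a in auto)
    then have "jet_trunc M (k - 1) (anc V) = jet M (k - 1) (proj A \<circ> a)"
      unfolding jet_trunc_def using r(1) by (simp add: jet_eq_iff)
    ultimately show ?thesis by simp
  qed
  have "jet (tot A) (k - 1) a \<in> prolongation k A sharp" using a(1) by (auto simp: prolongation_def)
  then show "(jet (tot A) (k - 1) a, V) \<in> theta_rel"
    unfolding theta_rel_def using Vp 1 2 ca anc_a by auto
qed

text \<open>Solution of the triangular system by iteration; after \<open>n\<close> steps the coordinates of weight at most \<open>n\<close> are final.\<close>

abbreviation "J \<equiv> prolongation_idx k A"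

definition dom where "dom = {z \<in> extensional J. (\<lambda>i\<in>idx M. z (0, i)) \<in> \<phi> ` (U \<inter> U')}"

definition base_of where "base_of z = inv_into U \<phi> (\<lambda>i\<in>idx M. z (0, i))"

primrec approx :: "nat \<Rightarrow> (nat \<times> 'i \<Rightarrow> real) \<Rightarrow> 'e" where
  "approx 0 z = cE.point (base_of z) (\<lambda>_. 0)"
| "approx (Suc n) z = cE.point (base_of z) (\<lambda>j. inverse (real (wt E j)) *
     (\<Sum>p \<in> P. Q j p (approx n z) * (real (fst p) * z (fst p - 1, snd p))))"

lemma J_mem: "(0, i) \<in> J \<longleftrightarrow> i \<in> idx M \<or> i \<in> fib_idx A" "\<alpha> < k \<Longrightarrow> i \<in> fib_idx A \<Longrightarrow> (\<alpha>, i) \<in> J"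
  using k by (auto simp: prolongation_idx_def base_A)

lemma fin_J: "finite J"
  using cA.fin by (auto simp: prolongation_idx_def)

lemma open_dom: "openin (Rn J) dom"
  unfolding dom_def by (rule openin_restrict_preimage[OF fin_J cE.fin(2) _ base_transition(1)]) (use J_mem in auto)

lemma base_of:
  assumes "z \<in> dom"
  shows "base_of z \<in> U" "base_of z \<in> U'" "\<phi> (base_of z) = (\<lambda>i\<in>idx M. z (0, i))"
proof -
  obtain x where x: "x \<in> U" "x \<in> U'" "(\<lambda>i\<in>idx M. z (0, i)) = \<phi> x" using assms by (auto simp: dom_def)
  then have "base_of z = x" unfolding base_of_def using cA.base_inj by simp
  then show "base_of z \<in> U" "base_of z \<in> U'" "\<phi> (base_of z) = (\<lambda>i\<in>idx M. z (0, i))" using x by auto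
qed

lemma approx:
  assumes "z \<in> dom"
  shows "approx n z \<in> D" "proj E (approx n z) = base_of z"
  using cE.point(1,3)[OF base_of(2)[OF assms]] base_of(1)[OF assms] by (cases n; simp add: D_iff)+

lemma approx_coord:
  assumes z: "z \<in> dom"
  shows "j \<in> idx M \<Longrightarrow> \<psi>' (approx n z) j = \<phi>' (base_of z) j"
    "j \<in> fib_idx E \<Longrightarrow> \<psi>' (approx 0 z) j = 0"
    "j \<in> fib_idx E \<Longrightarrow> real (wt E j) * \<psi>' (approx (Suc n) z) j =
       (\<Sum>p \<in> P. Q j p (approx n z) * (real (fst p) * z (fst p - 1, snd p)))"
proof -
  note pt = cE.point(4,5)[OF base_of(2)[OF z]]
  show "j \<in> idx M \<Longrightarrow> \<psi>' (approx n z) j = \<phi>' (base_of z) j" by (cases n) (simp_all add: pt)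
  show "j \<in> fib_idx E \<Longrightarrow> \<psi>' (approx 0 z) j = 0" by (simp add: pt)
  assume j: "j \<in> fib_idx E"
  then have "real (wt E j) \<noteq> 0" by (simp add: fib_idx_def)
  then show "real (wt E j) * \<psi>' (approx (Suc n) z) j =
       (\<Sum>p \<in> P. Q j p (approx n z) * (real (fst p) * z (fst p - 1, snd p)))"
    by (simp add: pt(2)[OF j])
qed

lemma approx_smooth:
  assumes "j \<in> idx (tot E)"
  shows "smooth_on J dom (\<lambda>z. \<psi>' (approx n z) j)"
  using assms
proof (induction n arbitrary: j)
  have base: "smooth_on J dom (\<lambda>z. \<psi>' (approx n z) j)" if j: "j \<in> idx M" for n j
  proof -
    have "smooth_on J dom (\<lambda>z. \<phi>' (inv_into U \<phi> (\<lambda>i\<in>idx M. z (0, i))) j)"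
      by (rule smooth_on_compose[OF open_dom fin_J base_transition(1) cE.fin(2) base_transition(2)[OF j]])
        (simp_all add: smooth_on_coord[OF open_dom fin_J] J_mem(1), simp add: dom_def)
    then show ?thesis
      by (rule smooth_on_cong[OF open_dom fin_J]) (simp add: approx_coord(1)[OF _ j] base_of_def)
  qed
  {
    case 0
    show ?case
    proof (cases "j \<in> idx M")
      case False
      then have j: "j \<in> fib_idx E" using 0 cE.idx_cases by blast
      show ?thesis
        by (rule smooth_on_cong[OF open_dom fin_J smooth_on_const[OF open_dom fin_J, of 0]]) (rule approx_coord(2)[OF _ j])
    qed (rule base)
  next
    case (Suc n)
    show ?case
    proof (cases "j \<in> idx M")
      case False
      then have j: "j \<in> fib_idx E" using Suc.prems cE.idx_cases by blast
      have wj: "real (wt E j) \<noteq> 0" using j by (simp add: fib_idx_def)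
      have q: "smooth_on J dom (\<lambda>z. Q j p (approx n z))" if p: "p \<in> P" for p
      proof -
        have "smooth_on J dom (\<lambda>z. Q j p (inv_into W' \<psi>' (\<psi>' (approx n z))))"
          by (rule smooth_on_compose[OF open_dom fin_J open_psi_D cE.fin(1) Q_smooth[OF Suc.prems p] Suc.IH])
            (use approx(1) in auto)
        then show ?thesis
          by (rule smooth_on_cong[OF open_dom fin_J]) (use approx(1) cE.inj in \<open>auto simp: D_iff\<close>)
      qed
      have "smooth_on J dom (\<lambda>z. inverse (real (wt E j)) * (\<Sum>p \<in> P. Q j p (approx n z) * (real (fst p) * z (fst p - 1, snd p))))"
      proof (intro smooth_on_mult[OF open_dom fin_J] smooth_on_sum[OF open_dom fin_J] smooth_on_const[OF open_dom fin_J] q)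
        fix p assume "p \<in> P"
        then show "smooth_on J dom (\<lambda>z. z (fst p - 1, snd p))"
          using k by (intro smooth_on_coord[OF open_dom fin_J] J_mem(2)) auto
      qed
      then show ?thesis
      proof (rule smooth_on_cong[OF open_dom fin_J])
        fix z assume "z \<in> dom"
        from approx_coord(3)[OF this j, of n]
        show "\<psi>' (approx (Suc n) z) j = inverse (real (wt E j)) * (\<Sum>p \<in> P. Q j p (approx n z) * (real (fst p) * z (fst p - 1, snd p)))"
          using wj by (simp add: field_simps)
      qed
    qed (rule base)
  }
qed

lemma approx_stable:
  assumes z: "z \<in> dom"
  shows "j \<in> idx (tot E) \<Longrightarrow> wt E j \<le> n \<Longrightarrow> \<psi>' (approx (Suc n) z) j = \<psi>' (approx n z) j"
proof (induction n arbitrary: j)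
  have base: "\<psi>' (approx m z) j = \<psi>' (approx n z) j" if "j \<in> idx M" for m n j
    using approx_coord(1)[OF z that] by simp
  {
    case 0
    then show ?case using base cE.base_idx by blast
  next
    case (Suc n)
    show ?case
    proof (cases "j \<in> idx M")
      case False
      then have j: "j \<in> fib_idx E" using Suc.prems cE.idx_cases by blast
      have "real (wt E j) * \<psi>' (approx (Suc (Suc n)) z) j = real (wt E j) * \<psi>' (approx (Suc n) z) j"
        unfolding approx_coord(3)[OF z j]
        by (rule rhs_depends[OF approx(1)[OF z] approx(1)[OF z] _ Suc.prems Suc.IH]) (simp_all add: approx(2)[OF z] del: approx.simps)
      then show ?thesis using j by (simp add: fib_idx_def del: approx.simps)
    qed (rule base)
  }
qed

lemma approx_solution:
  assumes z: "z \<in> dom"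
  shows "theta_eqn z (approx k z)"
  unfolding theta_eqn_def
proof
  fix j assume j: "j \<in> idx (tot E)"
  show "real (wt E j) * \<psi>' (approx k z) j = (\<Sum>p \<in> P. Q j p (approx k z) * (real (fst p) * z (fst p - 1, snd p)))"
  proof (cases "j \<in> idx M")
    case True
    then have w: "wt E j = 0" using cE.wt_base by simp
    have "Q j p (approx k z) * (real (fst p) * z (fst p - 1, snd p)) = 0" if "p \<in> P" for p
      using Q_zero[OF approx(1)[OF z] j that w] by (cases "fst p = 0") auto
    then show ?thesis using w by (simp add: sum.neutral)
  next
    case False
    then have "j \<in> fib_idx E" using j cE.idx_cases by blast
    from approx_coord(3)[OF z this, of k] show ?thesis
      using approx_stable[OF z j cE.wt_le[OF j]] by (simp del: approx.simps)
  qed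
qed

end

section \<open>Existence of admissible curves with prescribed jets\<close>

context chart_pair
begin

text \<open>
  The differential equation for an admissible curve is made autonomous by taking all fibre coordinates
  \<open>y\<^sup>(\<^sup>\<alpha>\<^sup>)\<close>, \<open>\<alpha> < k\<close>, as unknowns, with \<open>y\<^sup>(\<^sup>\<alpha>\<^sup>)\<close> differentiating to \<open>y\<^sup>(\<^sup>\<alpha>\<^sup>+\<^sup>1\<^sup>)\<close> and the last one constant. The base coordinates
  are taken in a chart of the atlas of the base, in which the anchor is known to be smooth.
\<close>

lemma admissible_realization:
  assumes z: "z \<in> dom"
  obtains a where "admissible A sharp a" "a 0 \<in> W"
    "restrict (jet_coords (k - 1) (idx (tot A)) \<psi> (jet (tot A) (k - 1) a)) J = z"
proof -
  let ?x = "base_of z"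
  note x = base_of[OF z]
  have bc: "smooth_chart M (U, \<phi>)" using cA.base_chart by (simp add: base_A)
  have "?x \<in> pts M" using x(1) smooth_chartD(1)[OF bc] by auto
  then obtain U0 \<phi>0 where U0: "(U0, \<phi>0) \<in> atlas M" "?x \<in> U0" by (rule pts_chartE)
  note c0 = smooth_chart_atlas[OF mfds(1) U0(1)]
  note ch0 = is_chartD[OF smooth_chartD(2)[OF c0]]
  note tr = smooth_chart_transition[OF mfds(1) c0 bc]
  define T where "T = {y \<in> extensional J. (\<lambda>i\<in>idx M. y (0, i)) \<in> \<phi>0 ` (U0 \<inter> U)}"
  have T: "openin (Rn J) T"
    unfolding T_def by (rule openin_restrict_preimage[OF fin_J cE.fin(2) _ tr(1)]) (use J_mem(1) in auto)
  define q where "q y = inv_into U0 \<phi>0 (\<lambda>i\<in>idx M. y (0, i))" for y :: "nat \<times> 'i \<Rightarrow> real"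
  have q: "q y \<in> U0" "q y \<in> U" "\<phi>0 (q y) = (\<lambda>i\<in>idx M. y (0, i))" if "y \<in> T" for y
  proof -
    have "(\<lambda>i\<in>idx M. y (0, i)) \<in> \<phi>0 ` (U0 \<inter> U)" using that by (simp add: T_def)
    then obtain p where p: "p \<in> U0" "p \<in> U" "(\<lambda>i\<in>idx M. y (0, i)) = \<phi>0 p" by blast
    then have "q y = p" unfolding q_def using ch0(1) by simp
    then show "q y \<in> U0" "q y \<in> U" "\<phi>0 (q y) = (\<lambda>i\<in>idx M. y (0, i))" using p by auto
  qed
  define pt where "pt y = cA.point (q y) (\<lambda>i. y (0, i))" for y
  have pt: "pt y \<in> W" "proj A (pt y) = q y" "i \<in> idx M \<Longrightarrow> \<psi> (pt y) i = \<phi> (q y) i"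
    "i \<in> fib_idx A \<Longrightarrow> \<psi> (pt y) i = y (0, i)" if "y \<in> T" for y i
    unfolding pt_def using cA.point[OF q(2)[OF that]] base_A_idx by auto
  have pt_smooth: "smooth_on J T (\<lambda>y. \<psi> (pt y) i)" if i: "i \<in> idx (tot A)" for i
  proof (cases "i \<in> idx M")
    case True
    have "smooth_on J T (\<lambda>y. \<phi> (inv_into U0 \<phi>0 (\<lambda>i\<in>idx M. y (0, i))) i)"
      by (rule smooth_on_compose[OF T fin_J tr(1) cE.fin(2) tr(2)[OF True]])
        (simp_all add: smooth_on_coord[OF T fin_J] J_mem(1), simp add: T_def)
    then show ?thesis by (rule smooth_on_cong[OF T fin_J]) (simp add: pt(3)[OF _ True] q_def)
  next
    case False
    then have i': "i \<in> fib_idx A" using i cA.idx_cases base_A_idx by auto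
    then show ?thesis
      by (intro smooth_on_cong[OF T fin_J smooth_on_coord[OF T fin_J, of "(0, i)"]]) (auto simp: J_mem(1) pt(4))
  qed
  have vel_pt: "smooth_on J T (\<lambda>y. vel \<phi>0 l (pt y))" if l: "l \<in> idx M" for l
  proof -
    let ?P0 = "{a \<in> pts (tot A). proj A a \<in> U0}"
    note v = vel_smooth[OF cA.atlas U0(1) l]
    have mem: "pt y \<in> W \<inter> ?P0" if "y \<in> T" for y
      using pt(1,2)[OF that] q(1)[OF that] cA.mem_iff by auto
    have "smooth_on J T (\<lambda>y. vel \<phi>0 l (inv_into W \<psi> (\<psi> (pt y))))"
      by (rule smooth_on_compose[OF T fin_J v(1) cA.fin(1) v(2) pt_smooth]) (use mem in blast)+
    then show ?thesis by (rule smooth_on_cong[OF T fin_J]) (use pt(1) cA.inj in simp)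
  qed
  \<comment> \<open>The indices with \<open>snd p \<in> idx M\<close> occur in order zero only; they are the base coordinates.\<close>
  define F where "F p y = (if snd p \<in> idx M then vel \<phi>0 (snd p) (pt y)
      else if Suc (fst p) < k then y (Suc (fst p), snd p) else 0)" for p and y :: "nat \<times> 'i \<Rightarrow> real"
  have F: "smooth_on J T (F p)" if p: "p \<in> J" for p
  proof -
    consider "snd p \<in> idx M" | "snd p \<notin> idx M" "Suc (fst p) < k" | "snd p \<notin> idx M" "\<not> Suc (fst p) < k" by blast
    then show ?thesis
    proof cases
      case 1
      then have "F p = (\<lambda>y. vel \<phi>0 (snd p) (pt y))" by (auto simp: F_def)
      then show ?thesis using vel_pt[OF 1] by simp
    next
      case 2
      then have "snd p \<in> fib_idx A" using p base_A_idx by (simp add: prolongation_idx_def mem_Times_iff)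
      then have "(Suc (fst p), snd p) \<in> J" using 2 J_mem(2) by blast
      moreover have "F p = (\<lambda>y. y (Suc (fst p), snd p))" using 2 by (auto simp: F_def)
      ultimately show ?thesis using smooth_on_coord[OF T fin_J] by simp
    next
      case 3
      then have "F p = (\<lambda>_. 0)" by (auto simp: F_def)
      then show ?thesis using smooth_on_const[OF T fin_J] by simp
    qed
  qed
  define y0 where "y0 = (\<lambda>p\<in>J. if snd p \<in> idx M then \<phi>0 ?x (snd p) else z p)"
  have y0_base: "(\<lambda>i\<in>idx M. y0 (0, i)) = \<phi>0 ?x"
    by (rule extensionalityI[of _ "idx M"]) (use ch0(3)[OF U0(2)] J_mem(1) in \<open>auto simp: y0_def\<close>)
  have y0: "y0 \<in> T" unfolding T_def using y0_base U0(2) x(1) by (auto simp: y0_def)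
  obtain \<delta> y where \<delta>: "\<delta> > 0" "y 0 = y0" "\<And>t. y t \<in> extensional J" "\<And>t. t \<in> {-\<delta><..<\<delta>} \<Longrightarrow> y t \<in> T"
    "\<And>t j. t \<in> {-\<delta><..<\<delta>} \<Longrightarrow> j \<in> J \<Longrightarrow> ((\<lambda>t. y t j) has_real_derivative F j (y t)) (at t)"
    "\<And>j. j \<in> J \<Longrightarrow> smooth_real_on {-\<delta><..<\<delta>} (\<lambda>t. y t j)"
    using ode_local_solution[where F = F, OF fin_J T F y0] by blast
  let ?S = "{-\<delta><..<\<delta>}"
  have S: "open ?S" "0 \<in> ?S" using \<delta>(1) by auto
  define a where "a t = pt (y t)" for t
  have aW: "a t \<in> W" "proj A (a t) \<in> U0" "l \<in> idx M \<Longrightarrow> \<phi>0 (proj A (a t)) l = y t (0, l)" if "t \<in> ?S" for t l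
    using pt(1,2)[OF \<delta>(4)[OF that]] q(1,3)[OF \<delta>(4)[OF that]] by (auto simp: a_def)
  have ca: "curve_on (tot A) ?S a"
  proof (rule curve_onI[OF mfds(2) S(1) cA.smooth_chart aW(1)])
    show "smooth_real_on ?S (\<lambda>t. \<psi> (a t) i)" if "i \<in> idx (tot A)" for i
      unfolding a_def by (rule smooth_real_on_compose_Rn[OF S(1) T fin_J pt_smooth[OF that] \<delta>(6,4)])
  qed
  then have c: "curve (tot A) a" using S(2) unfolding curve_iff by blast
  have cp: "curve_on M ?S (proj A \<circ> a)"
  proof (rule curve_onI[OF mfds(1) S(1) c0])
    fix l assume l: "l \<in> idx M"
    show "smooth_real_on ?S (\<lambda>t. \<phi>0 ((proj A \<circ> a) t) l)"
      by (rule smooth_real_on_cong[OF S(1) \<delta>(6)[of "(0, l)"]]) (use aW(3) l J_mem(1) in auto)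
  qed (use aW in auto)
  have adm: "jet M 1 (\<lambda>s. proj A (a (t + s))) = sharp (a t)" if t: "t \<in> ?S" for t
  proof -
    have cs: "curve M (\<lambda>s. proj A (a (t + s)))" using curve_shift[OF cp t] by simp
    have at: "a t \<in> pts (tot A)" using aW(1)[OF t] cA.mem_iff by blast
    show ?thesis
    proof (rule jets1_eqI[OF mfds(1) U0(1) jet_in_jets[OF cs] sharp_morphism(3)[OF at]])
      show "base_pt (jet M 1 (\<lambda>s. proj A (a (t + s)))) \<in> U0" using base_pt_jet[OF cs] aW(2)[OF t] by simp
      show "base_pt (sharp (a t)) = base_pt (jet M 1 (\<lambda>s. proj A (a (t + s))))"
        using base_pt_jet[OF cs] sharp_base[OF at] by simp
      fix l assume l: "l \<in> idx M"
      have "jet_coords 1 (idx M) \<phi>0 (jet M 1 (\<lambda>s. proj A (a (t + s)))) (1, l) = (deriv ^^ 1) (\<lambda>s. \<phi>0 (proj A (a (t + s))) l) 0"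
        by (rule jet_coords_jet[OF cs U0(1)]) (use aW(2)[OF t] l in auto)
      also have "\<dots> = (deriv ^^ 1) (\<lambda>s. \<phi>0 (proj A (a s)) l) t"
        using deriv_shift_0[of "\<lambda>s. \<phi>0 (proj A (a s)) l" t] by (simp add: o_def)
      also have "\<dots> = (deriv ^^ 1) (\<lambda>s. y s (0, l)) t" by (rule derivs_cong[OF S(1) t aW(3)[OF _ l]])
      also have "\<dots> = F (0, l) (y t)" using DERIV_imp_deriv[OF \<delta>(5)[OF t, of "(0, l)"]] J_mem(1) l by simp
      also have "\<dots> = vel \<phi>0 l (a t)" using l by (simp add: F_def a_def)
      finally show "jet_coords 1 (idx M) \<phi>0 (jet M 1 (\<lambda>s. proj A (a (t + s)))) (1, l) = vel \<phi>0 l (a t)" .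
    qed
  qed
  have adm': "admissible A sharp a"
    unfolding admissible_def base_A by (intro conjI c eventually_mono[OF eventually_nhds_open[OF S]] adm)
  have fib: "(deriv ^^ \<alpha>) (\<lambda>t. y t (0, i)) t = y t (\<alpha>, i)" if "\<alpha> < k" "i \<in> fib_idx A" "t \<in> ?S" for \<alpha> i t
    using that(1,3)
  proof (induction \<alpha> arbitrary: t)
    case (Suc \<alpha>)
    have iM: "i \<notin> idx M" using cA.idx_disj[OF that(2)] base_A_idx by simp
    have "(deriv ^^ Suc \<alpha>) (\<lambda>t. y t (0, i)) t = (deriv ^^ 1) ((deriv ^^ \<alpha>) (\<lambda>t. y t (0, i))) t" by simp
    also have "\<dots> = (deriv ^^ 1) (\<lambda>t. y t (\<alpha>, i)) t"
      by (rule derivs_cong[OF S(1) Suc.prems(2)]) (use Suc in auto)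
    also have "\<dots> = F (\<alpha>, i) (y t)"
      using DERIV_imp_deriv[OF \<delta>(5)[OF Suc.prems(2), of "(\<alpha>, i)"]] J_mem(2)[of \<alpha> i] Suc.prems that(2) by simp
    also have "\<dots> = y t (Suc \<alpha>, i)" using iM Suc.prems by (simp add: F_def)
    finally show ?case .
  qed simp
  have z_ext: "z \<in> extensional J" using z by (simp add: dom_def)
  have "restrict (jet_coords (k - 1) (idx (tot A)) \<psi> (jet (tot A) (k - 1) a)) J = z"
  proof (rule extensionalityI[OF restrict_extensional z_ext])
    fix p assume p: "p \<in> J"
    have "jet_coords (k - 1) (idx (tot A)) \<psi> (jet (tot A) (k - 1) a) p = z p"
    proof (cases "snd p \<in> idx M")
      case True
      then have p0: "fst p = 0" using p cA.idx_disj base_A_idx by (auto simp: prolongation_idx_def)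
      have "jet_coords (k - 1) (idx (tot A)) \<psi> (jet (tot A) (k - 1) a) (0, snd p) = (deriv ^^ 0) (\<lambda>t. \<psi> (a t) (snd p)) 0"
        by (rule jet_coords_jet[OF c cA.atlas aW(1)[OF S(2)]]) (use True cA.idx_cases base_A_idx in auto)
      also have "\<dots> = \<phi> (q y0) (snd p)" using pt(3)[OF y0 True] \<delta>(2) by (simp add: a_def)
      also have "q y0 = ?x" unfolding q_def y0_base using ch0(1) U0(2) by simp
      also have "\<phi> ?x (snd p) = z (0, snd p)" using x(3) True by simp
      finally show ?thesis using p0 by (metis prod.collapse)
    next
      case False
      then have p': "fst p < k" "snd p \<in> fib_idx A"
        using p base_A_idx by (simp_all add: prolongation_idx_def mem_Times_iff)
      have "jet_coords (k - 1) (idx (tot A)) \<psi> (jet (tot A) (k - 1) a) (fst p, snd p) = (deriv ^^ fst p) (\<lambda>t. \<psi> (a t) (snd p)) 0"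
        by (rule jet_coords_fibre[OF c aW(1)[OF S(2)] p'])
      also have "\<dots> = (deriv ^^ fst p) (\<lambda>t. y t (0, snd p)) 0"
        by (rule derivs_cong[OF S]) (use pt(4)[OF \<delta>(4) p'(2)] in \<open>simp add: a_def\<close>)
      also have "\<dots> = z p" using fib[OF p' S(2)] \<delta>(2) p False by (simp add: y0_def)
      finally show ?thesis by simp
    qed
    then show "restrict (jet_coords (k - 1) (idx (tot A)) \<psi> (jet (tot A) (k - 1) a)) J p = z p" using p by simp
  qed
  then show thesis by (rule that[OF adm' aW(1)[OF S(2)]])
qed

definition pcoords where "pcoords \<xi> = restrict (jet_coords (k - 1) (idx (tot A)) \<psi> \<xi>) J"

lemma pcoords_base:
  assumes "curve (tot A) a" "a 0 \<in> W"
  shows "(\<lambda>i\<in>idx M. pcoords (jet (tot A) (k - 1) a) (0, i)) = \<phi> (proj A (a 0))"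
proof (rule extensionalityI[of _ "idx M"])
  show "\<phi> (proj A (a 0)) \<in> extensional (idx M)" using cA.base_ext assms(2) cA.mem_iff base_A_idx by auto
  fix i assume i: "i \<in> idx M"
  have "jet_coords (k - 1) (idx (tot A)) \<psi> (jet (tot A) (k - 1) a) (0, i) = (deriv ^^ 0) (\<lambda>t. \<psi> (a t) i) 0"
    by (rule jet_coords_jet[OF assms(1) cA.atlas assms(2)]) (use i cA.idx_cases base_A_idx in auto)
  then show "(\<lambda>i\<in>idx M. pcoords (jet (tot A) (k - 1) a) (0, i)) i = \<phi> (proj A (a 0)) i"
    using i J_mem(1) cA.base_coord[OF assms(2)] base_A_idx by (simp add: pcoords_def)
qed simp

lemma pcoords_dom:
  assumes "curve (tot A) a" "a 0 \<in> W"
  shows "pcoords (jet (tot A) (k - 1) a) \<in> dom \<longleftrightarrow> proj A (a 0) \<in> U'"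
    "proj A (a 0) \<in> U' \<Longrightarrow> base_of (pcoords (jet (tot A) (k - 1) a)) = proj A (a 0)"
proof -
  have x: "proj A (a 0) \<in> U" using assms(2) cA.mem_iff by blast
  have "\<phi> (proj A (a 0)) \<in> \<phi> ` (U \<inter> U') \<longleftrightarrow> proj A (a 0) \<in> U'"
    using inj_on_image_mem_iff[OF cA.base_inj x, of "U \<inter> U'"] x by auto
  then show "pcoords (jet (tot A) (k - 1) a) \<in> dom \<longleftrightarrow> proj A (a 0) \<in> U'"
    unfolding dom_def using pcoords_base[OF assms] by (simp add: pcoords_def)
  show "base_of (pcoords (jet (tot A) (k - 1) a)) = proj A (a 0)"
    unfolding base_of_def pcoords_base[OF assms] using cA.base_inj x by simp
qed

lemma theta_eqn_pcoords: "theta_eqn (pcoords \<xi>) V \<longleftrightarrow> theta_eqn (jet_coords (k - 1) (idx (tot A)) \<psi> \<xi>) V"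
  by (rule theta_eqn_cong) (simp add: pcoords_def J_mem(2))

text \<open>
  The derivatives of the base coordinates, which the coordinates of the prolongation omit, are recovered from admissibility.
\<close>

lemma pcoords_inj:
  assumes a: "admissible A sharp a" "a 0 \<in> W" and b: "admissible A sharp b" "b 0 \<in> W"
    and eq: "pcoords (jet (tot A) (k - 1) a) = pcoords (jet (tot A) (k - 1) b)"
  shows "jet (tot A) (k - 1) a = jet (tot A) (k - 1) b"
proof -
  have c: "curve (tot A) a" "curve (tot A) b" using a b by (auto simp: admissible_def)
  have "\<phi> (proj A (a 0)) = \<phi> (proj A (b 0))" using pcoords_base[OF c(1) a(2)] pcoords_base[OF c(2) b(2)] eq by simp
  then have p: "proj A (a 0) = proj A (b 0)" using cA.base_inj a(2) b(2) cA.mem_iff by (auto dest: inj_onD)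
  have f: "eqjet (k - 1) (\<lambda>t. \<psi> (a t) i) (\<lambda>t. \<psi> (b t) i)" if i: "i \<in> fib_idx A" for i
    unfolding eqjet_def
  proof (intro allI impI)
    fix \<alpha> assume "\<alpha> \<le> k - 1"
    then have \<alpha>: "\<alpha> < k" using k by simp
    have "pcoords (jet (tot A) (k - 1) a) (\<alpha>, i) = pcoords (jet (tot A) (k - 1) b) (\<alpha>, i)" using eq by simp
    then show "(deriv ^^ \<alpha>) (\<lambda>t. \<psi> (a t) i) 0 = (deriv ^^ \<alpha>) (\<lambda>t. \<psi> (b t) i) 0"
      using jet_coords_fibre[OF c(1) a(2) \<alpha> i] jet_coords_fibre[OF c(2) b(2) \<alpha> i] J_mem(2)[OF \<alpha> i] by (simp add: pcoords_def)
  qed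
  have "proj A \<circ> a \<in> jet M (k - 1) (proj A \<circ> b)"
    by (rule velocity_jet_unique[OF cA.graded_bundle_chart_axioms c(1) a(2) admissible_velocity_jet[OF a(1)]
        c(2) b(2) admissible_velocity_jet[OF b(1)] p f]) simp_all
  then have "a \<in> jet (tot A) (k - 1) b" using cA.jet_iff_coords[OF c(2) b(2)] c(1) a(2) f by (simp add: base_A)
  then show ?thesis using jet_eq_iff[OF c(1)] by blast
qed

lemma approx_theta_rel:
  assumes a: "admissible A sharp a" "a 0 \<in> W" and U': "proj A (a 0) \<in> U'"
  shows "(jet (tot A) (k - 1) a, approx k (pcoords (jet (tot A) (k - 1) a))) \<in> theta_rel"
proof -
  have c: "curve (tot A) a" using a(1) by (simp add: admissible_def)
  have z: "pcoords (jet (tot A) (k - 1) a) \<in> dom" using pcoords_dom(1)[OF c a(2)] U' by simp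
  show ?thesis
    by (rule theta_eqn_imp_rel(1)[OF a])
      (use approx[OF z, of k] pcoords_dom(2)[OF c a(2) U'] approx_solution[OF z] theta_eqn_pcoords in \<open>auto simp: D_iff\<close>)
qed

end


section \<open>The morphism\<close>

context anchored_comorphism
begin

lemma chart_pairI:
  assumes "graded_bundle_chart 1 A W \<psi> U \<phi>" "graded_bundle_chart k E W' \<psi>' U' \<phi>'"
  shows "chart_pair k A E \<kappa> anc sharp W \<psi> U \<phi> W' \<psi>' U' \<phi>'"
  using assms anchored_comorphism_axioms by (intro chart_pair.intro)

lemma prolongationE:
  assumes "\<xi> \<in> prolongation k A sharp"
  obtains a where "admissible A sharp a" "\<xi> = jet (tot A) (k - 1) a" "curve (tot A) a" "base_pt \<xi> = a 0" "a 0 \<in> pts (tot A)"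
proof -
  obtain a where a: "admissible A sharp a" "\<xi> = jet (tot A) (k - 1) a" using assms by (auto simp: prolongation_def)
  then have "curve (tot A) a" by (simp add: admissible_def)
  then show thesis using that a base_pt_jet curve_pts by metis
qed

lemma theta_rel_dom:
  assumes "(\<xi>, V) \<in> theta_rel"
  shows "\<xi> \<in> prolongation k A sharp" "V \<in> pts (tot E)" "proj E V = proj A (base_pt \<xi>)"
proof -
  show x: "\<xi> \<in> prolongation k A sharp" and V: "V \<in> pts (tot E)" using assms by (auto simp: theta_rel_def)
  obtain a where "admissible A sharp a" "\<xi> = jet (tot A) (k - 1) a" "curve (tot A) a"
    and a: "base_pt \<xi> = a 0" "a 0 \<in> pts (tot A)" using prolongationE[OF x] .
  obtain W \<psi> U \<phi> where cA: "graded_bundle_chart 1 A W \<psi> U \<phi>" "a 0 \<in> W" using graded_bundle_curveE[OF gbA a(2)] .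
  obtain W' \<psi>' U' \<phi>' where cE: "graded_bundle_chart k E W' \<psi>' U' \<phi>'" "V \<in> W'" using graded_bundle_curveE[OF gbE V] .
  interpret chart_pair k A E \<kappa> anc sharp W \<psi> U \<phi> W' \<psi>' U' \<phi>' by (rule chart_pairI[OF cA(1) cE(1)])
  show "proj E V = proj A (base_pt \<xi>)" using theta_rel_imp_eqn(2)[OF assms] cA(2) cE(2) a(1) by simp
qed

lemma theta_ex1:
  assumes "\<xi> \<in> prolongation k A sharp"
  shows "\<exists>!V. (\<xi>, V) \<in> theta_rel"
proof -
  obtain a where a: "admissible A sharp a" "\<xi> = jet (tot A) (k - 1) a" "curve (tot A) a" "base_pt \<xi> = a 0" "a 0 \<in> pts (tot A)"
    using prolongationE[OF assms] .
  obtain W \<psi> U \<phi> where cA: "graded_bundle_chart 1 A W \<psi> U \<phi>" "a 0 \<in> W" using graded_bundle_curveE[OF gbA a(5)] .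
  have "proj A (a 0) \<in> pts M" using graded_bundle_gact(3)[OF gbA a(5)] by (simp add: base_A)
  then obtain W' \<psi>' U' \<phi>' where g: "gchart E W' \<psi>' U' \<phi>'" and x: "proj A (a 0) \<in> U'" using gchart_over[OF gbE] by metis
  interpret chart_pair k A E \<kappa> anc sharp W \<psi> U \<phi> W' \<psi>' U' \<phi>'
    by (rule chart_pairI[OF cA(1)]) (use g gbE in \<open>simp add: graded_bundle_chart_def\<close>)
  show ?thesis
  proof (rule ex_ex1I)
    show "\<exists>V. (\<xi>, V) \<in> theta_rel" using approx_theta_rel[OF a(1) cA(2) x] a(2) by blast
    fix V V2 assume V: "(\<xi>, V) \<in> theta_rel" and V2: "(\<xi>, V2) \<in> theta_rel"
    have "V \<in> W'" "V2 \<in> W'" using theta_rel_dom[OF V] theta_rel_dom[OF V2] x a(4) cE.mem_iff by auto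
    then show "V = V2"
      using theta_rel_imp_eqn[OF V] theta_rel_imp_eqn[OF V2] a(4) cA(2) theta_eqn_unique by simp
  qed
qed

definition theta :: "(real \<Rightarrow> 'a) set \<Rightarrow> 'e" where
  "theta \<xi> = (THE V. (\<xi>, V) \<in> theta_rel)"

lemma theta: "\<xi> \<in> prolongation k A sharp \<Longrightarrow> (\<xi>, theta \<xi>) \<in> theta_rel"
  unfolding theta_def by (rule theI'[OF theta_ex1])

lemma theta_eqI: "(\<xi>, V) \<in> theta_rel \<Longrightarrow> theta \<xi> = V"
  using theta_ex1[OF theta_rel_dom(1)] theta[OF theta_rel_dom(1)] by blast

lemma theta_rel_graph: "theta_rel = {(\<xi>, theta \<xi>) | \<xi>. \<xi> \<in> prolongation k A sharp}"
  using theta theta_eqI theta_rel_dom(1) by auto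

lemma anc_theta:
  assumes x: "\<xi> \<in> prolongation k A sharp"
  shows "anc (theta \<xi>) = prolongation_anchor k A sharp \<xi>"
proof -
  let ?a = "SOME a. admissible A sharp a \<and> jet (tot A) (k - 1) a = \<xi>"
  have "\<exists>a. admissible A sharp a \<and> jet (tot A) (k - 1) a = \<xi>" using x by (auto simp: prolongation_def)
  from someI_ex[OF this] have a: "admissible A sharp ?a" "jet (tot A) (k - 1) ?a = \<xi>" by auto
  have c: "curve (tot A) ?a" using a(1) by (simp add: admissible_def)
  have a0: "base_pt \<xi> = ?a 0" using base_pt_jet[OF c, of "k - 1"] a(2) by simp
  note t = theta[OF x]
  obtain W \<psi> U \<phi> where cA: "graded_bundle_chart 1 A W \<psi> U \<phi>" "?a 0 \<in> W" using graded_bundle_curveE[OF gbA curve_pts[OF c]] .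
  obtain W' \<psi>' U' \<phi>' where cE: "graded_bundle_chart k E W' \<psi>' U' \<phi>'" "theta \<xi> \<in> W'"
    using graded_bundle_curveE[OF gbE theta_rel_dom(2)[OF t]] .
  interpret chart_pair k A E \<kappa> anc sharp W \<psi> U \<phi> W' \<psi>' U' \<phi>' by (rule chart_pairI[OF cA(1) cE(1)])
  have "base_pt \<xi> \<in> W" using a0 cA(2) by simp
  note e = theta_rel_imp_eqn[OF t this cE(2)]
  have "anc (theta \<xi>) = jet M k (proj A \<circ> ?a)"
    by (rule theta_eqn_imp_rel(2)[OF a(1) cA(2) cE(2)]) (use e a(2) a0 in auto)
  then show ?thesis by (simp add: prolongation_anchor_def base_A)
qed

lemma prolongation_mfd_simps:
  "idx (prolongation_mfd k A sharp) = prolongation_idx k A"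
  "atlas (prolongation_mfd k A sharp) = (\<lambda>(W, \<psi>). ({\<xi> \<in> prolongation k A sharp. base_pt \<xi> \<in> W},
       \<lambda>\<xi>. restrict (jet_coords (k - 1) (idx (tot A)) \<psi> \<xi>) (prolongation_idx k A))) ` atlas (tot A)"
  "pts (prolongation_mfd k A sharp) = prolongation k A sharp"
proof -
  show 1: "idx (prolongation_mfd k A sharp) = prolongation_idx k A"
    "atlas (prolongation_mfd k A sharp) = (\<lambda>(W, \<psi>). ({\<xi> \<in> prolongation k A sharp. base_pt \<xi> \<in> W},
       \<lambda>\<xi>. restrict (jet_coords (k - 1) (idx (tot A)) \<psi> \<xi>) (prolongation_idx k A))) ` atlas (tot A)"
    by (simp_all add: prolongation_mfd_def)
  have "base_pt \<xi> \<in> pts (tot A)" if "\<xi> \<in> prolongation k A sharp" for \<xi>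
    using prolongationE[OF that] by metis
  then have "\<exists>c \<in> atlas (tot A). base_pt \<xi> \<in> fst c" if "\<xi> \<in> prolongation k A sharp" for \<xi>
    using that by (auto simp: pts_def)
  moreover have "pts (prolongation_mfd k A sharp) = {\<xi> \<in> prolongation k A sharp. \<exists>c \<in> atlas (tot A). base_pt \<xi> \<in> fst c}"
    unfolding pts_def 1 by (auto simp: case_prod_beta)
  ultimately show "pts (prolongation_mfd k A sharp) = prolongation k A sharp" by auto
qed

text \<open>
  In a pair of charts the map is the last iterate \<open>approx k\<close>, and by realization the chart of the prolongation maps its
  part over \<open>U \<inter> U'\<close> onto the open set on which the iterates are defined.
\<close>

lemma theta_smooth: "smooth_map (prolongation_mfd k A sharp) (tot E) theta"
  unfolding smooth_map_def
proof (intro conjI)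
  show "theta ` pts (prolongation_mfd k A sharp) \<subseteq> pts (tot E)"
    unfolding prolongation_mfd_simps using theta theta_rel_dom(2) by auto
  have main: "openin (Rn (prolongation_idx k A)) (f ` (X \<inter> theta -` W')) \<and>
      (\<forall>j \<in> idx (tot E). smooth_on (prolongation_idx k A) (f ` (X \<inter> theta -` W')) (\<lambda>x. \<psi>' (theta (inv_into X f x)) j))"
    if W: "(W, \<psi>) \<in> atlas (tot A)" and W': "(W', \<psi>') \<in> atlas (tot E)"
      and X: "X = {\<xi> \<in> prolongation k A sharp. base_pt \<xi> \<in> W}"
      and f: "f = (\<lambda>\<xi>. restrict (jet_coords (k - 1) (idx (tot A)) \<psi> \<xi>) (prolongation_idx k A))" for W \<psi> W' \<psi>' X f
  proof -
    obtain U \<phi> where g: "gchart A W \<psi> U \<phi>" using gchart_exists[OF gbA W] .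
    obtain U' \<phi>' where g': "gchart E W' \<psi>' U' \<phi>'" using gchart_exists[OF gbE W'] .
    interpret chart_pair k A E \<kappa> anc sharp W \<psi> U \<phi> W' \<psi>' U' \<phi>'
      by (rule chart_pairI) (use g g' gbA gbE in \<open>simp_all add: graded_bundle_chart_def\<close>)
    have fz: "f = pcoords" unfolding f pcoords_def by (rule refl)
    have XE: "\<exists>a. admissible A sharp a \<and> \<xi> = jet (tot A) (k - 1) a \<and> curve (tot A) a \<and> a 0 \<in> W \<and>
        (theta \<xi> \<in> W' \<longleftrightarrow> proj A (a 0) \<in> U')" if "\<xi> \<in> X" for \<xi>
    proof -
      have x: "\<xi> \<in> prolongation k A sharp" "base_pt \<xi> \<in> W" using that X by auto
      obtain a where a: "admissible A sharp a" "\<xi> = jet (tot A) (k - 1) a" "curve (tot A) a" "base_pt \<xi> = a 0"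
        using prolongationE[OF x(1)] by metis
      have "theta \<xi> \<in> W' \<longleftrightarrow> proj A (a 0) \<in> U'"
        using theta_rel_dom(2,3)[OF theta[OF x(1)]] a(4) cE.mem_iff by simp
      then show ?thesis using a x(2) by auto
    qed
    have inj: "inj_on pcoords X"
    proof (rule inj_onI)
      fix \<xi> \<eta> assume *: "\<xi> \<in> X" "\<eta> \<in> X" "pcoords \<xi> = pcoords \<eta>"
      obtain a where "admissible A sharp a" "\<xi> = jet (tot A) (k - 1) a" "a 0 \<in> W" using XE[OF *(1)] by blast
      moreover obtain b where "admissible A sharp b" "\<eta> = jet (tot A) (k - 1) b" "b 0 \<in> W" using XE[OF *(2)] by blast
      ultimately show "\<xi> = \<eta>" using pcoords_inj *(3) by simp
    qed
    have val: "pcoords \<xi> \<in> dom" "theta \<xi> = approx k (pcoords \<xi>)" if mem: "\<xi> \<in> X" "theta \<xi> \<in> W'" for \<xi>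
    proof -
      obtain a where a: "admissible A sharp a" "\<xi> = jet (tot A) (k - 1) a" "curve (tot A) a" "a 0 \<in> W" "proj A (a 0) \<in> U'"
        using XE[of \<xi>] mem by blast
      show "pcoords \<xi> \<in> dom" using pcoords_dom(1)[OF a(3,4)] a(2,5) by simp
      show "theta \<xi> = approx k (pcoords \<xi>)" using approx_theta_rel[OF a(1,4,5)] a(2) theta_eqI by simp
    qed
    have im: "pcoords ` (X \<inter> theta -` W') = dom"
    proof (intro equalityI subsetI)
      fix z assume z: "z \<in> dom"
      obtain a where a: "admissible A sharp a" "a 0 \<in> W"
        "restrict (jet_coords (k - 1) (idx (tot A)) \<psi> (jet (tot A) (k - 1) a)) J = z"
        using admissible_realization[OF z] .
      have c: "curve (tot A) a" using a(1) by (simp add: admissible_def)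
      let ?\<xi> = "jet (tot A) (k - 1) a"
      have zx: "pcoords ?\<xi> = z" using a(3) by (simp add: pcoords_def)
      have "?\<xi> \<in> X" using a(1,2) base_pt_jet[OF c] unfolding X by (auto simp: prolongation_def)
      moreover have U': "proj A (a 0) \<in> U'" using pcoords_dom(1)[OF c a(2)] zx z by simp
      then have "theta ?\<xi> \<in> W'" using theta_eqI[OF approx_theta_rel[OF a(1,2) U']] approx(1)[OF z, of k] zx by (simp add: D_iff)
      ultimately show "z \<in> pcoords ` (X \<inter> theta -` W')" using zx by blast
    qed (use val(1) in auto)
    show ?thesis
      unfolding fz im
    proof (intro conjI ballI open_dom)
      fix j assume j: "j \<in> idx (tot E)"
      show "smooth_on J dom (\<lambda>x. \<psi>' (theta (inv_into X pcoords x)) j)"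
      proof (rule smooth_on_cong[OF open_dom fin_J approx_smooth[OF j, of k]])
        fix x assume "x \<in> dom"
        then obtain \<xi> where \<xi>: "\<xi> \<in> X \<inter> theta -` W'" "x = pcoords \<xi>" using im by blast
        then have "inv_into X pcoords x = \<xi>" using inj by simp
        then show "\<psi>' (theta (inv_into X pcoords x)) j = \<psi>' (approx k x) j" using val(2)[of \<xi>] \<xi> by simp
      qed
    qed
  qed
  show "\<forall>(X, f) \<in> atlas (prolongation_mfd k A sharp). \<forall>(W', \<psi>') \<in> atlas (tot E).
      openin (Rn (idx (prolongation_mfd k A sharp))) (f ` (X \<inter> theta -` W')) \<and>
      (\<forall>j \<in> idx (tot E). smooth_on (idx (prolongation_mfd k A sharp)) (f ` (X \<inter> theta -` W')) (\<lambda>x. \<psi>' (theta (inv_into X f x)) j))"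
  proof (intro ballI, clarify)
    fix X f W' \<psi>' assume X: "(X, f) \<in> atlas (prolongation_mfd k A sharp)" and W': "(W', \<psi>') \<in> atlas (tot E)"
    then obtain W \<psi> where W: "(W, \<psi>) \<in> atlas (tot A)" "X = {\<xi> \<in> prolongation k A sharp. base_pt \<xi> \<in> W}"
      "f = (\<lambda>\<xi>. restrict (jet_coords (k - 1) (idx (tot A)) \<psi> \<xi>) (prolongation_idx k A))"
      unfolding prolongation_mfd_simps by auto
    show "openin (Rn (idx (prolongation_mfd k A sharp))) (f ` (X \<inter> theta -` W')) \<and>
      (\<forall>j \<in> idx (tot E). smooth_on (idx (prolongation_mfd k A sharp)) (f ` (X \<inter> theta -` W')) (\<lambda>x. \<psi>' (theta (inv_into X f x)) j))"
      unfolding prolongation_mfd_simps(1) by (rule main[OF W(1) W' W(2,3)])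
  qed
qed

text \<open>The homotheties of the prolongation: \<open>a(s)\<close> is replaced by \<open>t a(ts)\<close>, which is again admissible.\<close>

lemma admissible_scale:
  assumes a: "admissible A sharp a"
  shows "admissible A sharp (\<lambda>s. gact A t (a (t * s)))"
proof -
  have ca: "curve (tot A) a" and ev: "\<forall>\<^sub>F s in nhds 0. jet M 1 (\<lambda>r. proj A (a (s + r))) = sharp (a s)"
    using a by (auto simp: admissible_def base_A)
  let ?a = "\<lambda>s. gact A t (a (t * s))"
  have c: "curve (tot A) ?a"
    by (rule graded_bundle_gact_curve[OF gbA curve_scale[OF ca] smooth_real_on_const]) simp
  obtain S0 where S0: "open S0" "0 \<in> S0" "\<And>s. s \<in> S0 \<Longrightarrow> jet M 1 (\<lambda>r. proj A (a (s + r))) = sharp (a s)"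
    using ev unfolding eventually_nhds by blast
  obtain S1 where S1: "0 \<in> S1" "curve_on (tot A) S1 a" using ca by (auto simp: curve_iff)
  obtain S2 where S2: "0 \<in> S2" "curve_on (tot A) S2 ?a" using c by (auto simp: curve_iff)
  let ?S = "((\<lambda>s. t * s) -` (S0 \<inter> S1)) \<inter> S2"
  have o: "open ?S"
    by (intro open_Int open_vimage S0(1) curve_on_open[OF S1(2)] curve_on_open[OF S2(2)] continuous_intros)
  have "jet M 1 (\<lambda>r. proj A (?a (s + r))) = sharp (?a s)" if s: "s \<in> ?S" for s
  proof -
    have pts: "a r \<in> pts (tot A)" if "r \<in> S1" for r using S1(2) that by (auto simp: curve_on_def)
    have as: "a (t * s) \<in> pts (tot A)" using pts s by auto
    have c1: "curve (tot A) (\<lambda>r. a (t * s + r))" by (rule curve_shift[OF S1(2)]) (use s in auto)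
    have c1': "curve M (\<lambda>r. proj A (a (t * s + r)))" using graded_bundle_proj_curve[OF gbA c1] by (simp add: base_A o_def)
    have c2: "curve (tot A) (\<lambda>r. ?a (s + r))" using curve_shift[OF S2(2)] s by auto
    have c2': "curve M (\<lambda>r. proj A (?a (s + r)))" using graded_bundle_proj_curve[OF gbA c2] by (simp add: base_A o_def)
    have "jet M 1 (\<lambda>r. proj A (?a (s + r))) = jet M 1 (\<lambda>r. proj A (a (t * s + t * r)))"
    proof (rule jet_local[OF c2' curve_scale[OF c1']])
      show "open ((\<lambda>r. t * (s + r)) -` S1)" by (rule open_vimage[OF curve_on_open[OF S1(2)]]) (intro continuous_intros)
      show "0 \<in> (\<lambda>r. t * (s + r)) -` S1" using s by auto
      show "proj A (?a (s + r)) = proj A (a (t * s + t * r))" if "r \<in> (\<lambda>r. t * (s + r)) -` S1" for r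
        using graded_bundle_gact(2)[OF gbA pts, of "t * (s + r)" t] that by (simp add: distrib_left)
    qed
    also have "\<dots> = jet_act M 1 t (jet M 1 (\<lambda>r. proj A (a (t * s + r))))"
      by (rule jet_act_jet[OF mfds(1) c1', symmetric])
    also have "\<dots> = sharp (?a s)" using S0(3)[of "t * s"] s sharp_morphism(2)[OF as] by simp
    finally show ?thesis .
  qed
  moreover have "0 \<in> ?S" using S0(2) S1(1) S2(1) by auto
  ultimately have "\<forall>\<^sub>F s in nhds 0. jet M 1 (\<lambda>r. proj A (?a (s + r))) = sharp (?a s)"
    by (intro eventually_mono[OF eventually_nhds_open[OF o]])
  then show ?thesis unfolding admissible_def base_A using c by (rule conjI[rotated])
qed

text \<open>
  The factor \<open>t\<^sup>\<alpha>\<close> from the parameter and the factor \<open>t\<close> from the fibre add up to the weight \<open>\<alpha> + 1\<close>.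
\<close>

lemma scale_coords:
  assumes ch: "graded_bundle_chart 1 A W \<psi> U \<phi>" and a: "curve (tot A) a" "a 0 \<in> W" and p: "p \<in> prolongation_idx k A"
  shows "jet_coords (k - 1) (idx (tot A)) \<psi> (jet (tot A) (k - 1) (\<lambda>s. gact A t (a (t * s)))) p =
    t ^ prolongation_wt A p * jet_coords (k - 1) (idx (tot A)) \<psi> (jet (tot A) (k - 1) a) p"
proof -
  interpret cA: graded_bundle_chart 1 A W \<psi> U \<phi> by (rule ch)
  obtain \<alpha> i where pi: "p = (\<alpha>, i)" by (cases p)
  have \<alpha>: "\<alpha> \<le> k - 1" and i: "i \<in> idx (tot A)" and w: "wt A i + \<alpha> = prolongation_wt A p"
  proof -
    have "(\<alpha> = 0 \<and> i \<in> idx (base A)) \<or> (\<alpha> < k \<and> i \<in> fib_idx A)" using p pi by (auto simp: prolongation_idx_def)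
    then show "\<alpha> \<le> k - 1" "i \<in> idx (tot A)" "wt A i + \<alpha> = prolongation_wt A p"
      using cA.base_idx cA.wt_le[of i] pi by (auto simp: prolongation_wt_def fib_idx_def)
  qed
  let ?a = "\<lambda>s. gact A t (a (t * s))"
  have c: "curve (tot A) ?a"
    by (rule graded_bundle_gact_curve[OF gbA curve_scale[OF a(1)] smooth_real_on_const]) simp
  have a0: "?a 0 \<in> W" using cA.gact(1)[OF a(2)] by simp
  obtain S where S: "open S" "0 \<in> S" "\<And>s. s \<in> S \<Longrightarrow> a s \<in> W" "\<And>i. i \<in> idx (tot A) \<Longrightarrow> smooth_real_on S (\<lambda>s. \<psi> (a s) i)"
    using curve_near_chart[OF mfds(2) a(1) cA.smooth_chart a(2)] by blast
  let ?T = "(\<lambda>s. t * s) -` S"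
  have T: "open ?T" "0 \<in> ?T" using S(2) by (auto intro!: open_vimage[OF S(1)] continuous_intros)
  have sm: "smooth_real_on ?T (\<lambda>s. \<psi> (a (t * s)) i)"
    by (rule smooth_real_on_compose[OF T(1) S(1) S(4)[OF i] smooth_real_on_affine(1)[OF T(1)]]) simp
  have "jet_coords (k - 1) (idx (tot A)) \<psi> (jet (tot A) (k - 1) ?a) (\<alpha>, i) = (deriv ^^ \<alpha>) (\<lambda>s. \<psi> (?a s) i) 0"
    by (rule jet_coords_jet[OF c cA.atlas a0 \<alpha> i])
  also have "\<dots> = (deriv ^^ \<alpha>) (\<lambda>s. t ^ wt A i * \<psi> (a (t * s)) i) 0"
    by (rule derivs_cong[OF T]) (use cA.gact(2)[OF S(3) i] in auto)
  also have "\<dots> = t ^ wt A i * (deriv ^^ \<alpha>) (\<lambda>s. \<psi> (a (t * s)) i) 0"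
    by (rule derivs_cmult[OF sm T])
  also have "\<dots> = t ^ wt A i * (t ^ \<alpha> * (deriv ^^ \<alpha>) (\<lambda>s. \<psi> (a s) i) 0)"
    using derivs_scale[OF S(4)[OF i] S(1), of t 0] S(2) by simp
  also have "(deriv ^^ \<alpha>) (\<lambda>s. \<psi> (a s) i) 0 = jet_coords (k - 1) (idx (tot A)) \<psi> (jet (tot A) (k - 1) a) (\<alpha>, i)"
    by (rule jet_coords_jet[OF a(1) cA.atlas a(2) \<alpha> i, symmetric])
  finally show ?thesis unfolding pi w[unfolded pi, symmetric] by (simp add: power_add)
qed

lemma prolongation_act:
  assumes a: "admissible A sharp a"
  shows "act (prolongation_mfd k A sharp) (prolongation_wt A) t (jet (tot A) (k - 1) a) =
    jet (tot A) (k - 1) (\<lambda>s. gact A t (a (t * s)))"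
proof -
  let ?P = "prolongation_mfd k A sharp" and ?\<xi> = "jet (tot A) (k - 1) a" and ?a = "\<lambda>s. gact A t (a (t * s))"
  let ?\<eta> = "jet (tot A) (k - 1) ?a"
  have c: "curve (tot A) a" and c': "curve (tot A) ?a" using a admissible_scale[OF a] by (auto simp: admissible_def)
  have chart: "?\<eta> \<in> X \<and> (\<forall>p \<in> prolongation_idx k A. f ?\<eta> p = t ^ prolongation_wt A p * f ?\<xi> p)"
    if X: "(X, f) \<in> atlas ?P" "?\<xi> \<in> X" for X f
  proof -
    obtain W \<psi> where W: "(W, \<psi>) \<in> atlas (tot A)" "X = {\<xi> \<in> prolongation k A sharp. base_pt \<xi> \<in> W}"
      "f = (\<lambda>\<xi>. restrict (jet_coords (k - 1) (idx (tot A)) \<psi> \<xi>) (prolongation_idx k A))"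
      using X(1) unfolding prolongation_mfd_simps by auto
    obtain U \<phi> where g: "gchart A W \<psi> U \<phi>" using gchart_exists[OF gbA W(1)] .
    then have ch: "graded_bundle_chart 1 A W \<psi> U \<phi>" using gbA by (simp add: graded_bundle_chart_def)
    interpret cA: graded_bundle_chart 1 A W \<psi> U \<phi> by (rule ch)
    have a0: "a 0 \<in> W" using X(2) W(2) base_pt_jet[OF c] by simp
    have "?\<eta> \<in> prolongation k A sharp" using admissible_scale[OF a] by (auto simp: prolongation_def)
    then have "?\<eta> \<in> X" using W(2) base_pt_jet[OF c'] cA.gact(1)[OF a0] by simp
    then show ?thesis using scale_coords[OF ch c a0] W(3) by simp
  qed
  have x: "?\<xi> \<in> prolongation k A sharp" "?\<eta> \<in> prolongation k A sharp"
    using a admissible_scale[OF a] by (auto simp: prolongation_def)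
  show ?thesis
    unfolding act_def[of ?P] prolongation_mfd_simps(1)
  proof (rule the_equality)
    show "?\<eta> \<in> pts ?P \<and> (\<forall>(X, f) \<in> atlas ?P. ?\<xi> \<in> X \<longrightarrow> ?\<eta> \<in> X \<and>
        (\<forall>p \<in> prolongation_idx k A. f ?\<eta> p = t ^ prolongation_wt A p * f ?\<xi> p))"
      using x(2) chart unfolding prolongation_mfd_simps(3) by blast
    fix \<zeta> assume *: "\<zeta> \<in> pts ?P \<and> (\<forall>(X, f) \<in> atlas ?P. ?\<xi> \<in> X \<longrightarrow> \<zeta> \<in> X \<and>
        (\<forall>p \<in> prolongation_idx k A. f \<zeta> p = t ^ prolongation_wt A p * f ?\<xi> p))"
    obtain b where b: "admissible A sharp b" "\<zeta> = jet (tot A) (k - 1) b" "base_pt \<zeta> = b 0"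
      using prolongationE * unfolding prolongation_mfd_simps(3) by metis
    obtain W \<psi> U \<phi> where cA: "graded_bundle_chart 1 A W \<psi> U \<phi>" "a 0 \<in> W" using graded_bundle_curveE[OF gbA curve_pts[OF c]] .
    have "proj A (a 0) \<in> pts M" using graded_bundle_gact(3)[OF gbA curve_pts[OF c]] by (simp add: base_A)
    then obtain W' \<psi>' U' \<phi>' where g: "gchart E W' \<psi>' U' \<phi>'" using gchart_over[OF gbE] by metis
    interpret chart_pair k A E \<kappa> anc sharp W \<psi> U \<phi> W' \<psi>' U' \<phi>'
      by (rule chart_pairI[OF cA(1)]) (use g gbE in \<open>simp add: graded_bundle_chart_def\<close>)
    let ?X = "{\<xi> \<in> prolongation k A sharp. base_pt \<xi> \<in> W}"
    have X: "(?X, pcoords) \<in> atlas ?P" unfolding prolongation_mfd_simps pcoords_def using cA.atlas by force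
    have xX: "?\<xi> \<in> ?X" using x(1) base_pt_jet[OF c] cA(2) by simp
    have z: "\<zeta> \<in> ?X" "\<forall>p \<in> J. pcoords \<zeta> p = t ^ prolongation_wt A p * pcoords ?\<xi> p" using bspec[OF conjunct2[OF *] X] xX by simp_all
    have e: "?\<eta> \<in> ?X" "\<forall>p \<in> J. pcoords ?\<eta> p = t ^ prolongation_wt A p * pcoords ?\<xi> p" using chart[OF X xX] by blast+
    have "pcoords \<zeta> = pcoords ?\<eta>"
      by (rule extensionalityI[of _ J]) (use z e in \<open>auto simp: pcoords_def\<close>)
    then show "\<zeta> = ?\<eta>"
      using pcoords_inj[OF b(1) _ admissible_scale[OF a]] b(2,3) z(1) e(1) base_pt_jet[OF c'] by simp
  qed
qed

lemma theta_equivariant: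
  assumes "\<xi> \<in> prolongation k A sharp"
  shows "theta (act (prolongation_mfd k A sharp) (prolongation_wt A) t \<xi>) = gact E t (theta \<xi>)"
proof -
  obtain a where a: "admissible A sharp a" "\<xi> = jet (tot A) (k - 1) a" "curve (tot A) a" "base_pt \<xi> = a 0" "a 0 \<in> pts (tot A)"
    using prolongationE[OF assms] .
  let ?a = "\<lambda>s. gact A t (a (t * s))"
  note t = theta[OF assms]
  obtain W \<psi> U \<phi> where cA: "graded_bundle_chart 1 A W \<psi> U \<phi>" "a 0 \<in> W" using graded_bundle_curveE[OF gbA a(5)] .
  obtain W' \<psi>' U' \<phi>' where cE: "graded_bundle_chart k E W' \<psi>' U' \<phi>'" "theta \<xi> \<in> W'"
    using graded_bundle_curveE[OF gbE theta_rel_dom(2)[OF t]] .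
  interpret chart_pair k A E \<kappa> anc sharp W \<psi> U \<phi> W' \<psi>' U' \<phi>' by (rule chart_pairI[OF cA(1) cE(1)])
  have "base_pt \<xi> \<in> W" using a(4) cA(2) by simp
  note e = theta_rel_imp_eqn[OF t this cE(2)]
  let ?u = "jet_coords (k - 1) (idx (tot A)) \<psi>"
  have "theta_eqn (\<lambda>p. t ^ Suc (fst p) * ?u \<xi> p) (gact E t (theta \<xi>))" by (rule theta_eqn_gact[OF e(1,3)])
  moreover have "?u (jet (tot A) (k - 1) ?a) (\<alpha>, i) = t ^ Suc (fst (\<alpha>, i)) * ?u \<xi> (\<alpha>, i)" if "\<alpha> < k" "i \<in> fib_idx A" for \<alpha> i
    using scale_coords[OF cA(1) a(3) cA(2) J_mem(2)[OF that], of t] that(2) a(2) by (simp add: prolongation_wt_def fib_idx_def)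
  ultimately have eqn: "theta_eqn (?u (jet (tot A) (k - 1) ?a)) (gact E t (theta \<xi>))"
    by (subst theta_eqn_cong[of _ "\<lambda>p. t ^ Suc (fst p) * ?u \<xi> p"]) auto
  have "(jet (tot A) (k - 1) ?a, gact E t (theta \<xi>)) \<in> theta_rel"
  proof (rule theta_eqn_imp_rel(1)[OF admissible_scale[OF a(1)] _ _ _ eqn])
    show "gact A t (a (t * 0)) \<in> W" using cA.gact(1)[OF cA(2)] by simp
    show "gact E t (theta \<xi>) \<in> W'" using cE.gact(1)[OF cE(2)] .
    show "proj E (gact E t (theta \<xi>)) = proj A (gact A t (a (t * 0)))"
      using cE.gact(3)[OF cE(2)] cA.gact(3)[OF cA(2)] e(2) a(4) by simp
  qed
  then show ?thesis using prolongation_act[OF a(1)] a(2) theta_eqI by simp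
qed

end

theorem theorem3p2:
  fixes k :: nat
    and E :: "('e, 'm, 'i) gbundle"
    and \<kappa> :: "((real \<Rightarrow> 'e set) set \<times> (real \<Rightarrow> 'e) set) set"
    and anc :: "'e \<Rightarrow> (real \<Rightarrow> 'm) set"
  assumes "almost_Lie_higher_algebroid k E \<kappa> anc"
  shows "\<exists>\<theta>.
      Theta k E \<kappa> anc
        = {(U, \<theta> U) | U. U \<in> prolongation k (reduction 1 E) (anchor1 E anc)} \<and>
      graded_morphism
        (prolongation_mfd k (reduction 1 E) (anchor1 E anc))
        (act (prolongation_mfd k (reduction 1 E) (anchor1 E anc))
             (prolongation_wt (reduction 1 E)))
        (tot E) (gact E) \<theta> \<and>
      (\<forall>U \<in> prolongation k (reduction 1 E) (anchor1 E anc).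
         anc (\<theta> U) = prolongation_anchor k (reduction 1 E) (anchor1 E anc) U)"
proof -
  have ha: "higher_algebroid k E \<kappa> anc"
    and al: "\<forall>(X, Y) \<in> \<kappa>. (Tk_map (Tk 1 (base E)) k (anchor1 E anc) X, Tk_map (Tk k (base E)) 1 anc Y) \<in> flip_graph k (base E)"
    using assms unfolding almost_Lie_higher_algebroid_def skew_higher_algebroid_def by blast+
  have base: "base (reduction 1 E) = base E" by (simp add: reduction_def)
  have gc1: "graded_comorphism 1 (reduction 1 E) (reduction 1 E) (kappa1 E \<kappa>) (anchor1 E anc)"
    using ha unfolding higher_algebroid_def algebroid_def by blast
  interpret anchored_comorphism k "reduction 1 E" E \<kappa> anc "anchor1 E anc"
  proof
    show "1 \<le> k" "graded_bundle 1 (reduction 1 E)" "graded_bundle k E" "graded_comorphism k (reduction 1 E) E \<kappa> anc"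
      using ha unfolding higher_algebroid_def algebroid_def by blast+
    show "graded_morphism (tot (reduction 1 E)) (gact (reduction 1 E)) (Tk 1 (base E)) (jet_act (base E) 1) (anchor1 E anc)"
      "\<And>a. a \<in> pts (tot (reduction 1 E)) \<Longrightarrow> base_pt (anchor1 E anc a) = proj (reduction 1 E) a"
      using gc1 unfolding graded_comorphism_def base by blast+
  qed (use al base in auto)
  have "Theta k E \<kappa> anc = theta_rel" unfolding Theta_def theta_rel_def by (rule refl)
  moreover have "graded_morphism
        (prolongation_mfd k (reduction 1 E) (anchor1 E anc))
        (act (prolongation_mfd k (reduction 1 E) (anchor1 E anc)) (prolongation_wt (reduction 1 E)))
        (tot E) (gact E) theta"
    unfolding graded_morphism_def prolongation_mfd_simps(3) using theta_smooth theta_equivariant by blast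
  ultimately show ?thesis using theta_rel_graph anc_theta by (intro exI[of _ theta]) simp
qed

end
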